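(* Let $H$ be a finite-dimensional Hopf algebra over a field $k$, $R\subseteq H$ a Hopf subalgebra and $Q=H/R^+H$ its right quotient $H$-module coalgebra. Then $$d(R,H) - d(R, Q^* \# R) \leq 2$$ (i.e. $d(R,H)\le d(R,Q^*\# R)+2$), and $$d_h(R,H) = d_{\mathrm{odd}}(H, Q^* \# H).$$
   Context: $R^+=\ker\varepsilon|_R$, $\varepsilon$ the counit of $H$. $Q=H/R^+H$ is a right $H$-module coalgebra (quotient of $H$), so its dual $Q^*=\mathrm{Hom}_k(Q,k)$ is an algebra under convolution and a left $H$-module algebra via $(h.f)(q)=f(qh)$; by restriction it is also a left $R$-module algebra. For a left $H$-module algebra $A$, the smash product $A\# H$ is $A\otimes_k H$ with multiplication $(a\# h)(b\# g)=a(h_{(1)}.b)\# h_{(2)}g$, and $H$ is identified with the subalgebra $1_A\# H$; similarly for $R$. Modules $X, Y$ are similar if each is isomorphic to a direct summand of a finite direct sum of copies of the other. For a unital subalgebra $B\subseteq C$ of finite-dimensional algebras let $C^{\otimes_B n}$ be the $n$-fold tensor product of $C$ over $B$, $C^{\otimes_B 0}=B$. Consider similarity of $C^{\otimes_B(n+1)}$ and $C^{\otimes_B n}$: the extension has depth $2n+1$ ($n\ge 0$) if they are similar as $B$-$B$-bimodules; depth $2n$ ($n\ge 1$) if they are similar as $B$-$C$-bimodules or as $C$-$B$-bimodules; h-depth $2n-1$ ($n\ge 1$) if they are similar as $C$-$C$-bimodules. $d(B,C)$ is the least $m\ge 1$ such that $B\subseteq C$ has depth $m$, $d_h(B,C)$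 is the least odd $m$ such that it has h-depth $m$, each being $\infty$ if there is no such $m$. $d_{\mathrm{odd}}(B,C)=2\lceil\frac{d(B,C)-1}{2}\rceil+1$ is the least odd integer greater than or equal to $d(B,C)$ ($\infty$ if $d(B,C)=\infty$). *)

theory Defs
  imports Complex_Main "HOL-Algebra.Module" "HOL-Algebra.AbelCoset" "HOL-Library.Extended_Nat"
begin

section \<open>Modules given by generators and relations\<close>

definition linear_maps ::
    "('k, 'm) ring_scheme \<Rightarrow> ('k, 'a, 'x) module_scheme \<Rightarrow> ('k, 'b, 'y) module_scheme \<Rightarrow> ('a \<Rightarrow> 'b) set"
  where "linear_maps K M N =
    {f \<in> carrier M \<rightarrow> carrier N.
      (\<forall>x\<in>carrier M. \<forall>y\<in>carrier M. f (x \<oplus>\<^bsub>M\<^esub> y) = f x \<oplus>\<^bsub>N\<^esub> f y) \<and>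
      (\<forall>c\<in>carrier K. \<forall>x\<in>carrier M. f (c \<odot>\<^bsub>M\<^esub> x) = c \<odot>\<^bsub>N\<^esub> f x)}"

definition regular_module :: "('k, 'm) ring_scheme \<Rightarrow> ('k, 'k) module"
  where "regular_module K =
    \<lparr>carrier = carrier K, mult = mult K, one = one K, zero = zero K, add = add K, smult = mult K\<rparr>"

definition module_span ::
    "('k, 'm) ring_scheme \<Rightarrow> ('k, 'a, 'x) module_scheme \<Rightarrow> 'a set \<Rightarrow> 'a set"
  where "module_span K M S = \<Inter>{N. submodule N K M \<and> S \<subseteq> N}"

definition finite_dimensional ::
    "('k, 'm) ring_scheme \<Rightarrow> ('k, 'a, 'x) module_scheme \<Rightarrow> bool"
  where "finite_dimensional K M \<longleftrightarrow>
    (\<exists>S. finite S \<and> S \<subseteq> carrier M \<and> module_span K M S = carrier M)"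

text \<open>In records that are only used as modules, the inherited ring fields \<^const>\<open>mult\<close> and
  \<^const>\<open>one\<close> carry no meaning and are undefined.\<close>

definition quot_module ::
    "('k, 'a, 'x) module_scheme \<Rightarrow> 'a set \<Rightarrow> ('k, 'a set) module"
  where "quot_module M N =
    \<lparr>carrier = a_rcosets\<^bsub>M\<^esub> N, mult = undefined, one = undefined, zero = N, add = set_add M,
     smult = (\<lambda>c X. \<Union>x\<in>X. N +>\<^bsub>M\<^esub> (c \<odot>\<^bsub>M\<^esub> x))\<rparr>"

definition free_module :: "('k, 'm) ring_scheme \<Rightarrow> 'x set \<Rightarrow> ('k, 'x \<Rightarrow> 'k) module"
  where "free_module K X =
    \<lparr>carrier = {\<phi>. (\<forall>x. \<phi> x \<in> carrier K) \<and> finite {x. \<phi> x \<noteq> \<zero>\<^bsub>K\<^esub>} \<and> {x. \<phi> x \<noteq> \<zero>\<^bsub>K\<^esub>} \<subseteq> X},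
     mult = undefined, one = undefined,
     zero = (\<lambda>x. \<zero>\<^bsub>K\<^esub>), add = (\<lambda>\<phi> \<psi> x. \<phi> x \<oplus>\<^bsub>K\<^esub> \<psi> x),
     smult = (\<lambda>c \<phi> x. c \<otimes>\<^bsub>K\<^esub> \<phi> x)\<rparr>"

definition free_gen :: "('k, 'm) ring_scheme \<Rightarrow> 'x \<Rightarrow> 'x \<Rightarrow> 'k"
  where "free_gen K x = (\<lambda>y. if y = x then \<one>\<^bsub>K\<^esub> else \<zero>\<^bsub>K\<^esub>)"

definition presented_module ::
    "('k, 'm) ring_scheme \<Rightarrow> 'x set \<Rightarrow> ('x \<Rightarrow> 'k) set \<Rightarrow> ('k, ('x \<Rightarrow> 'k) set) module"
  where "presented_module K X rels =
    quot_module (free_module K X) (module_span K (free_module K X) rels)"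

definition presented_gen ::
    "('k, 'm) ring_scheme \<Rightarrow> 'x set \<Rightarrow> ('x \<Rightarrow> 'k) set \<Rightarrow> 'x \<Rightarrow> ('x \<Rightarrow> 'k) set"
  where "presented_gen K X rels x =
    module_span K (free_module K X) rels +>\<^bsub>free_module K X\<^esub> free_gen K x"

text \<open>The value at a class \<open>P\<close> of the linear map into \<open>M\<close> that extends \<open>f\<close> from generators.
  It does not depend on the chosen representative of \<open>P\<close> when \<open>f\<close> respects the relations.\<close>

definition linear_lift ::
    "('k, 'm) ring_scheme \<Rightarrow> ('k, 'a, 'y) module_scheme \<Rightarrow> ('x \<Rightarrow> 'a) \<Rightarrow> ('x \<Rightarrow> 'k) set \<Rightarrow> 'a"
  where "linear_lift K M f P =
    (let \<phi> = (SOME \<phi>. \<phi> \<in> P) in \<Oplus>\<^bsub>M\<^esub>x\<in>{x. \<phi> x \<noteq> \<zero>\<^bsub>K\<^esub>}. \<phi> x \<odot>\<^bsub>M\<^esub> f x)"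


section \<open>Tensor products over the ground field\<close>

type_synonym ('k, 'a, 'b) tensor = "('a \<times> 'b \<Rightarrow> 'k) set"

definition tensor_rels ::
    "('k, 'm) ring_scheme \<Rightarrow> ('k, 'a, 'x) module_scheme \<Rightarrow> ('k, 'b, 'y) module_scheme
      \<Rightarrow> ('a \<times> 'b \<Rightarrow> 'k) set"
  where "tensor_rels K V W =
    (let F = free_module K (carrier V \<times> carrier W); g = free_gen K in
      {g (v \<oplus>\<^bsub>V\<^esub> v', w) \<ominus>\<^bsub>F\<^esub> (g (v, w) \<oplus>\<^bsub>F\<^esub> g (v', w)) | v v' w.
        v \<in> carrier V \<and> v' \<in> carrier V \<and> w \<in> carrier W} \<union>
      {g (v, w \<oplus>\<^bsub>W\<^esub> w') \<ominus>\<^bsub>F\<^esub> (g (v, w) \<oplus>\<^bsub>F\<^esub> g (v, w')) | v w w'.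
        v \<in> carrier V \<and> w \<in> carrier W \<and> w' \<in> carrier W} \<union>
      {g (c \<odot>\<^bsub>V\<^esub> v, w) \<ominus>\<^bsub>F\<^esub> c \<odot>\<^bsub>F\<^esub> g (v, w) | c v w.
        c \<in> carrier K \<and> v \<in> carrier V \<and> w \<in> carrier W} \<union>
      {g (v, c \<odot>\<^bsub>W\<^esub> w) \<ominus>\<^bsub>F\<^esub> c \<odot>\<^bsub>F\<^esub> g (v, w) | c v w.
        c \<in> carrier K \<and> v \<in> carrier V \<and> w \<in> carrier W})"

definition tensor ::
    "('k, 'm) ring_scheme \<Rightarrow> ('k, 'a, 'x) module_scheme \<Rightarrow> ('k, 'b, 'y) module_scheme
      \<Rightarrow> ('k, ('k, 'a, 'b) tensor) module"
  where "tensor K V W = presented_module K (carrier V \<times> carrier W) (tensor_rels K V W)"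

definition pure_tensor ::
    "('k, 'm) ring_scheme \<Rightarrow> ('k, 'a, 'x) module_scheme \<Rightarrow> ('k, 'b, 'y) module_scheme
      \<Rightarrow> 'a \<Rightarrow> 'b \<Rightarrow> ('k, 'a, 'b) tensor"
  where "pure_tensor K V W v w =
    presented_gen K (carrier V \<times> carrier W) (tensor_rels K V W) (v, w)"

text \<open>For bilinear \<open>f\<close> and \<open>P = \<Sum> v\<^sub>i \<otimes> w\<^sub>i\<close> this is \<open>\<Sum> f v\<^sub>i w\<^sub>i\<close>; applied to \<open>P = \<Delta>(h)\<close> it
  renders Sweedler notation, i.e. it is the sum of the \<open>f h\<^sub>(\<^sub>1\<^sub>) h\<^sub>(\<^sub>2\<^sub>)\<close>.\<close>

definition tensor_lift ::
    "('k, 'm) ring_scheme \<Rightarrow> ('k, 'c, 'z) module_scheme \<Rightarrow> ('a \<Rightarrow> 'b \<Rightarrow> 'c)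
      \<Rightarrow> ('k, 'a, 'b) tensor \<Rightarrow> 'c"
  where "tensor_lift K M f P = linear_lift K M (case_prod f) P"


section \<open>Algebras, coalgebras and Hopf algebras\<close>

locale algebra_over = Module.module K A + ring A for K (structure) and A (structure) +
  assumes smult_mult_left:
      "\<lbrakk>c \<in> carrier K; x \<in> carrier A; y \<in> carrier A\<rbrakk>
        \<Longrightarrow> (c \<odot>\<^bsub>A\<^esub> x) \<otimes>\<^bsub>A\<^esub> y = c \<odot>\<^bsub>A\<^esub> (x \<otimes>\<^bsub>A\<^esub> y)"
    and smult_mult_right:
      "\<lbrakk>c \<in> carrier K; x \<in> carrier A; y \<in> carrier A\<rbrakk>
        \<Longrightarrow> x \<otimes>\<^bsub>A\<^esub> (c \<odot>\<^bsub>A\<^esub> y) = c \<odot>\<^bsub>A\<^esub> (x \<otimes>\<^bsub>A\<^esub> y)"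

definition unital_subalgebra ::
    "('k, 'm) ring_scheme \<Rightarrow> 'a set \<Rightarrow> ('k, 'a, 'x) module_scheme \<Rightarrow> bool"
  where "unital_subalgebra K B A \<longleftrightarrow>
    submodule B K A \<and> \<one>\<^bsub>A\<^esub> \<in> B \<and> (\<forall>x\<in>B. \<forall>y\<in>B. x \<otimes>\<^bsub>A\<^esub> y \<in> B)"

record ('k, 'c) coalg = "('k, 'c) module" +
  comult :: "'c \<Rightarrow> ('k, 'c, 'c) tensor"
  counit :: "'c \<Rightarrow> 'k"

record ('k, 'h) hopf = "('k, 'h) coalg" +
  antipode :: "'h \<Rightarrow> 'h"

text \<open>Coassociativity is stated in \<open>(C \<otimes> C) \<otimes> C\<close>; the right-hand side is the image of
  \<open>(id \<otimes> \<Delta>) \<circ> \<Delta>\<close> under the associativity isomorphism.\<close>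

locale coalgebra = Module.module K C for K (structure) and C :: "('k, 'c, 'x) coalg_scheme" (structure) +
  assumes comult_linear: "comult C \<in> linear_maps K C (tensor K C C)"
    and counit_linear: "counit C \<in> linear_maps K C (regular_module K)"
    and coassoc: "c \<in> carrier C \<Longrightarrow>
      tensor_lift K (tensor K (tensor K C C) C)
        (\<lambda>x y. pure_tensor K (tensor K C C) C (comult C x) y) (comult C c) =
      tensor_lift K (tensor K (tensor K C C) C)
        (\<lambda>x y. tensor_lift K (tensor K (tensor K C C) C)
          (\<lambda>y\<^sub>1 y\<^sub>2. pure_tensor K (tensor K C C) C (pure_tensor K C C x y\<^sub>1) y\<^sub>2) (comult C y))
        (comult C c)"
    and counit_left: "c \<in> carrier C \<Longrightarrow>
      tensor_lift K C (\<lambda>x y. counit C x \<odot>\<^bsub>C\<^esub> y) (comult C c) = c"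
    and counit_right: "c \<in> carrier C \<Longrightarrow>
      tensor_lift K C (\<lambda>x y. counit C y \<odot>\<^bsub>C\<^esub> x) (comult C c) = c"

locale hopf_algebra = field K + algebra_over K H + coalgebra K H
  for K (structure) and H :: "('k, 'h, 'x) hopf_scheme" (structure) +
  assumes comult_mult: "\<lbrakk>x \<in> carrier H; y \<in> carrier H\<rbrakk> \<Longrightarrow>
      comult H (x \<otimes>\<^bsub>H\<^esub> y) =
      tensor_lift K (tensor K H H)
        (\<lambda>x\<^sub>1 x\<^sub>2. tensor_lift K (tensor K H H)
          (\<lambda>y\<^sub>1 y\<^sub>2. pure_tensor K H H (x\<^sub>1 \<otimes>\<^bsub>H\<^esub> y\<^sub>1) (x\<^sub>2 \<otimes>\<^bsub>H\<^esub> y\<^sub>2)) (comult H y))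
        (comult H x)"
    and comult_one: "comult H \<one>\<^bsub>H\<^esub> = pure_tensor K H H \<one>\<^bsub>H\<^esub> \<one>\<^bsub>H\<^esub>"
    and counit_ring_hom: "counit H \<in> ring_hom H K"
    and antipode_linear: "antipode H \<in> linear_maps K H H"
    and antipode_left: "h \<in> carrier H \<Longrightarrow>
      tensor_lift K H (\<lambda>x y. antipode H x \<otimes>\<^bsub>H\<^esub> y) (comult H h) = counit H h \<odot>\<^bsub>H\<^esub> \<one>\<^bsub>H\<^esub>"
    and antipode_right: "h \<in> carrier H \<Longrightarrow>
      tensor_lift K H (\<lambda>x y. x \<otimes>\<^bsub>H\<^esub> antipode H y) (comult H h) = counit H h \<odot>\<^bsub>H\<^esub> \<one>\<^bsub>H\<^esub>"


section \<open>Hopf subalgebras\<close>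

definition tensor_incl ::
    "('k, 'm) ring_scheme \<Rightarrow> ('k, 'a, 'x) module_scheme \<Rightarrow> ('k, 'a, 'a) tensor \<Rightarrow> ('k, 'a, 'a) tensor"
  where "tensor_incl K M = tensor_lift K (tensor K M M) (pure_tensor K M M)"

definition hopf_subalgebra ::
    "('k, 'm) ring_scheme \<Rightarrow> 'h set \<Rightarrow> ('k, 'h, 'x) hopf_scheme \<Rightarrow> bool"
  where "hopf_subalgebra K R H \<longleftrightarrow>
    unital_subalgebra K R H \<and>
    comult H ` R \<subseteq>
      tensor_incl K H ` carrier (tensor K (H\<lparr>carrier := R\<rparr>) (H\<lparr>carrier := R\<rparr>)) \<and>
    antipode H ` R \<subseteq> R"

text \<open>The comultiplication of \<open>R\<close> takes values in \<open>R \<otimes> R\<close> itself. Over a field the natural map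
  \<open>R \<otimes> R \<rightarrow> H \<otimes> H\<close> is injective, so the preimage of \<open>\<Delta>(r)\<close> is unique.\<close>

definition sub_hopf ::
    "('k, 'm) ring_scheme \<Rightarrow> 'h set \<Rightarrow> ('k, 'h, 'x) hopf_scheme \<Rightarrow> ('k, 'h, 'x) hopf_scheme"
  where "sub_hopf K R H = H\<lparr>carrier := R,
    comult := (\<lambda>r. THE P. P \<in> carrier (tensor K (H\<lparr>carrier := R\<rparr>) (H\<lparr>carrier := R\<rparr>)) \<and>
                 tensor_incl K H P = comult H r)\<rparr>"


section \<open>The quotient module coalgebra, its dual algebra, and smash products\<close>

definition augmentation_right_ideal ::
    "('k, 'm) ring_scheme \<Rightarrow> 'h set \<Rightarrow> ('k, 'h, 'x) hopf_scheme \<Rightarrow> 'h set"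
  where "augmentation_right_ideal K R H =
    module_span K H {r \<otimes>\<^bsub>H\<^esub> h | r h. r \<in> R \<and> counit H r = \<zero>\<^bsub>K\<^esub> \<and> h \<in> carrier H}"

definition quot_coalg ::
    "('k, 'm) ring_scheme \<Rightarrow> 'h set \<Rightarrow> ('k, 'h, 'x) hopf_scheme \<Rightarrow> ('k, 'h set) coalg"
  where "quot_coalg K R H =
    (let I = augmentation_right_ideal K R H; Q = quot_module H I in
     \<lparr>carrier = carrier Q, mult = mult Q, one = one Q, zero = zero Q, add = add Q, smult = smult Q,
       comult = (\<lambda>X. tensor_lift K (tensor K Q Q)
          (\<lambda>x y. pure_tensor K Q Q (I +>\<^bsub>H\<^esub> x) (I +>\<^bsub>H\<^esub> y)) (comult H (SOME h. h \<in> X))),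
       counit = (\<lambda>X. counit H (SOME h. h \<in> X))\<rparr>)"

definition quot_ract ::
    "('k, 'm) ring_scheme \<Rightarrow> 'h set \<Rightarrow> ('k, 'h, 'x) hopf_scheme \<Rightarrow> 'h set \<Rightarrow> 'h \<Rightarrow> 'h set"
  where "quot_ract K R H X g =
    (\<Union>x\<in>X. augmentation_right_ideal K R H +>\<^bsub>H\<^esub> (x \<otimes>\<^bsub>H\<^esub> g))"

text \<open>Functionals are made extensional, so that they are determined by their values on \<open>C\<close>.\<close>

definition dual_algebra ::
    "('k, 'm) ring_scheme \<Rightarrow> ('k, 'c, 'x) coalg_scheme \<Rightarrow> ('k, 'c \<Rightarrow> 'k) module"
  where "dual_algebra K C =
    \<lparr>carrier = linear_maps K C (regular_module K) \<inter> extensional (carrier C),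
     mult = (\<lambda>f g. \<lambda>c\<in>carrier C.
       tensor_lift K (regular_module K) (\<lambda>x y. f x \<otimes>\<^bsub>K\<^esub> g y) (comult C c)),
     one = (\<lambda>c\<in>carrier C. counit C c),
     zero = (\<lambda>c\<in>carrier C. \<zero>\<^bsub>K\<^esub>),
     add = (\<lambda>f g. \<lambda>c\<in>carrier C. f c \<oplus>\<^bsub>K\<^esub> g c),
     smult = (\<lambda>a f. \<lambda>c\<in>carrier C. a \<otimes>\<^bsub>K\<^esub> f c)\<rparr>"

definition quot_dual ::
    "('k, 'm) ring_scheme \<Rightarrow> 'h set \<Rightarrow> ('k, 'h, 'x) hopf_scheme \<Rightarrow> ('k, 'h set \<Rightarrow> 'k) module"
  where "quot_dual K R H = dual_algebra K (quot_coalg K R H)"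

definition quot_dual_lact ::
    "('k, 'm) ring_scheme \<Rightarrow> 'h set \<Rightarrow> ('k, 'h, 'x) hopf_scheme
      \<Rightarrow> 'h \<Rightarrow> ('h set \<Rightarrow> 'k) \<Rightarrow> 'h set \<Rightarrow> 'k"
  where "quot_dual_lact K R H h f =
    (\<lambda>q\<in>carrier (quot_coalg K R H). f (quot_ract K R H q h))"

definition smash ::
    "('k, 'm) ring_scheme \<Rightarrow> ('k, 'a, 'y) module_scheme \<Rightarrow> ('h \<Rightarrow> 'a \<Rightarrow> 'a)
      \<Rightarrow> ('k, 'h, 'x) hopf_scheme \<Rightarrow> ('k, ('k, 'a, 'h) tensor) module"
  where "smash K A act H =
    (let T = tensor K A H; t = pure_tensor K A H in
      T\<lparr>mult := (\<lambda>P P'.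
          tensor_lift K T (\<lambda>a h.
            tensor_lift K T (\<lambda>b g.
              tensor_lift K T (\<lambda>h\<^sub>1 h\<^sub>2. t (a \<otimes>\<^bsub>A\<^esub> act h\<^sub>1 b) (h\<^sub>2 \<otimes>\<^bsub>H\<^esub> g)) (comult H h)) P') P),
        one := t \<one>\<^bsub>A\<^esub> \<one>\<^bsub>H\<^esub>\<rparr>)"

definition smash_base ::
    "('k, 'm) ring_scheme \<Rightarrow> ('k, 'a, 'y) module_scheme \<Rightarrow> ('k, 'h, 'x) hopf_scheme
      \<Rightarrow> ('k, 'a, 'h) tensor set"
  where "smash_base K A H = pure_tensor K A H \<one>\<^bsub>A\<^esub> ` carrier H"


section \<open>Bimodules and similarity\<close>

text \<open>The algebras acting on the left and on the right are sets of elements of one ambient type;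
  they are passed as the arguments \<open>L\<close> and \<open>R\<close> below, so that actions can be restricted.
  In the intended uses both contain the scalars, so bimodule maps and sub-bimodules are
  automatically linear.\<close>

record ('k, 'c, 'b) bimodule = "('k, 'b) module" +
  lact :: "'c \<Rightarrow> 'b \<Rightarrow> 'b"
  ract :: "'b \<Rightarrow> 'c \<Rightarrow> 'b"

definition bimodule_iso ::
    "'c set \<Rightarrow> 'c set \<Rightarrow> ('k, 'c, 'a) bimodule \<Rightarrow> ('k, 'c, 'b) bimodule \<Rightarrow> bool"
  where "bimodule_iso L R M N \<longleftrightarrow>
    (\<exists>f. bij_betw f (carrier M) (carrier N) \<and>
      (\<forall>x\<in>carrier M. \<forall>y\<in>carrier M. f (x \<oplus>\<^bsub>M\<^esub> y) = f x \<oplus>\<^bsub>N\<^esub> f y) \<and>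
      (\<forall>c\<in>L. \<forall>x\<in>carrier M. f (lact M c x) = lact N c (f x)) \<and>
      (\<forall>c\<in>R. \<forall>x\<in>carrier M. f (ract M x c) = ract N (f x) c))"

definition sub_bimodule :: "'c set \<Rightarrow> 'c set \<Rightarrow> 'b set \<Rightarrow> ('k, 'c, 'b) bimodule \<Rightarrow> bool"
  where "sub_bimodule L R S M \<longleftrightarrow>
    additive_subgroup S M \<and>
    (\<forall>c\<in>L. \<forall>x\<in>S. lact M c x \<in> S) \<and> (\<forall>c\<in>R. \<forall>x\<in>S. ract M x c \<in> S)"

definition direct_summand ::
    "'c set \<Rightarrow> 'c set \<Rightarrow> ('k, 'c, 'a) bimodule \<Rightarrow> ('k, 'c, 'b) bimodule \<Rightarrow> bool"
  where "direct_summand L R M N \<longleftrightarrow>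
    (\<exists>S S'. sub_bimodule L R S N \<and> sub_bimodule L R S' N \<and>
      S \<inter> S' = {\<zero>\<^bsub>N\<^esub>} \<and> S <+>\<^bsub>N\<^esub> S' = carrier N \<and>
      bimodule_iso L R M (N\<lparr>carrier := S\<rparr>))"

definition direct_power ::
    "nat \<Rightarrow> ('k, 'c, 'b) bimodule \<Rightarrow> ('k, 'c, nat \<Rightarrow> 'b) bimodule"
  where "direct_power m N =
    \<lparr>carrier = {..<m} \<rightarrow>\<^sub>E carrier N, mult = undefined, one = undefined,
     zero = (\<lambda>i\<in>{..<m}. \<zero>\<^bsub>N\<^esub>),
     add = (\<lambda>f g. \<lambda>i\<in>{..<m}. f i \<oplus>\<^bsub>N\<^esub> g i),
     smult = (\<lambda>a f. \<lambda>i\<in>{..<m}. a \<odot>\<^bsub>N\<^esub> f i),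
     lact = (\<lambda>c f. \<lambda>i\<in>{..<m}. lact N c (f i)),
     ract = (\<lambda>f c. \<lambda>i\<in>{..<m}. ract N (f i) c)\<rparr>"

definition similar ::
    "'c set \<Rightarrow> 'c set \<Rightarrow> ('k, 'c, 'a) bimodule \<Rightarrow> ('k, 'c, 'b) bimodule \<Rightarrow> bool"
  where "similar L R M N \<longleftrightarrow>
    (\<exists>m. direct_summand L R M (direct_power m N)) \<and>
    (\<exists>m. direct_summand L R N (direct_power m M))"


section \<open>Tensor powers over a subalgebra and depth\<close>

definition power_gens :: "('k, 'c, 'x) module_scheme \<Rightarrow> nat \<Rightarrow> 'c list set"
  where "power_gens C n = {xs. length xs = n \<and> set xs \<subseteq> carrier C}"

definition power_rels ::
    "('k, 'm) ring_scheme \<Rightarrow> 'c set \<Rightarrow> ('k, 'c, 'x) module_scheme \<Rightarrow> nat \<Rightarrow> ('c list \<Rightarrow> 'k) set"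
  where "power_rels K B C n =
    (let F = free_module K (power_gens C n); g = free_gen K in
      {g (us @ [x \<oplus>\<^bsub>C\<^esub> y] @ vs) \<ominus>\<^bsub>F\<^esub> (g (us @ [x] @ vs) \<oplus>\<^bsub>F\<^esub> g (us @ [y] @ vs)) | us x y vs.
        us @ [x] @ vs \<in> power_gens C n \<and> y \<in> carrier C} \<union>
      {g (us @ [a \<odot>\<^bsub>C\<^esub> x] @ vs) \<ominus>\<^bsub>F\<^esub> a \<odot>\<^bsub>F\<^esub> g (us @ [x] @ vs) | us a x vs.
        us @ [x] @ vs \<in> power_gens C n \<and> a \<in> carrier K} \<union>
      {g (us @ [x \<otimes>\<^bsub>C\<^esub> b, y] @ vs) \<ominus>\<^bsub>F\<^esub> g (us @ [x, b \<otimes>\<^bsub>C\<^esub> y] @ vs) | us x b y vs.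
        us @ [x, y] @ vs \<in> power_gens C n \<and> b \<in> B})"

text \<open>The \<open>n\<close>-fold tensor product \<open>C \<otimes>\<^sub>B \<dots> \<otimes>\<^sub>B C\<close> with its \<open>C\<close>-\<open>C\<close>-bimodule structure, to be used
  only for \<open>n \<ge> 1\<close>. The zeroth power is \<open>B\<close>, which has another type and is given by
  \<open>base_bimodule\<close>.\<close>

definition tensor_power ::
    "('k, 'm) ring_scheme \<Rightarrow> 'c set \<Rightarrow> ('k, 'c, 'x) module_scheme \<Rightarrow> nat
      \<Rightarrow> ('k, 'c, ('c list \<Rightarrow> 'k) set) bimodule"
  where "tensor_power K B C n =
    (let P = presented_module K (power_gens C n) (power_rels K B C n);
         t = presented_gen K (power_gens C n) (power_rels K B C n) in
     \<lparr>carrier = carrier P, mult = mult P, one = one P, zero = zero P, add = add P, smult = smult P,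
       lact = (\<lambda>c. linear_lift K P (\<lambda>xs. t ((c \<otimes>\<^bsub>C\<^esub> hd xs) # tl xs))),
       ract = (\<lambda>p c. linear_lift K P (\<lambda>xs. t (butlast xs @ [last xs \<otimes>\<^bsub>C\<^esub> c])) p)\<rparr>)"

definition base_bimodule :: "'c set \<Rightarrow> ('k, 'c, 'x) module_scheme \<Rightarrow> ('k, 'c, 'c) bimodule"
  where "base_bimodule B C =
    \<lparr>carrier = B, mult = mult C, one = one C, zero = zero C, add = add C, smult = smult C,
     lact = mult C, ract = mult C\<rparr>"

definition has_depth ::
    "('k, 'm) ring_scheme \<Rightarrow> 'c set \<Rightarrow> ('k, 'c, 'x) module_scheme \<Rightarrow> nat \<Rightarrow> bool"
  where "has_depth K B C m \<longleftrightarrow>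
    (m = 1 \<and> similar B B (tensor_power K B C 1) (base_bimodule B C)) \<or>
    (\<exists>n\<ge>1. m = 2 * n + 1 \<and>
      similar B B (tensor_power K B C (n + 1)) (tensor_power K B C n)) \<or>
    (\<exists>n\<ge>1. m = 2 * n \<and>
      (similar B (carrier C) (tensor_power K B C (n + 1)) (tensor_power K B C n) \<or>
       similar (carrier C) B (tensor_power K B C (n + 1)) (tensor_power K B C n)))"

definition has_h_depth ::
    "('k, 'm) ring_scheme \<Rightarrow> 'c set \<Rightarrow> ('k, 'c, 'x) module_scheme \<Rightarrow> nat \<Rightarrow> bool"
  where "has_h_depth K B C m \<longleftrightarrow>
    (\<exists>n\<ge>1. m = 2 * n - 1 \<and>
      similar (carrier C) (carrier C) (tensor_power K B C (n + 1)) (tensor_power K B C n))"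

text \<open>The infimum of the empty set is \<open>\<infinity>\<close>.\<close>

definition min_depth ::
    "('k, 'm) ring_scheme \<Rightarrow> 'c set \<Rightarrow> ('k, 'c, 'x) module_scheme \<Rightarrow> enat"
  where "min_depth K B C = Inf {enat m | m. m \<ge> 1 \<and> has_depth K B C m}"

definition min_h_depth ::
    "('k, 'm) ring_scheme \<Rightarrow> 'c set \<Rightarrow> ('k, 'c, 'x) module_scheme \<Rightarrow> enat"
  where "min_h_depth K B C = Inf {enat m | m. odd m \<and> has_h_depth K B C m}"

definition min_odd_depth ::
    "('k, 'm) ring_scheme \<Rightarrow> 'c set \<Rightarrow> ('k, 'c, 'x) module_scheme \<Rightarrow> enat"
  where "min_odd_depth K B C =
    (case min_depth K B C of
       enat d \<Rightarrow> enat (2 * nat \<lceil>(real d - 1) / 2\<rceil> + 1)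
     | \<infinity> \<Rightarrow> \<infinity>)"

end

theory Submission
  imports Defs
begin

text \<open>Let \<open>p\<close> be the matrix of coefficients of the right \<open>H\<close>-module \<open>Q\<^sup>\<otimes>\<^sup>n\<close> in some basis. The tensor power of
  \<open>n + 1\<close> copies of \<open>H\<close> over \<open>R\<close> is free as a left \<open>H\<close>-module on \<open>(dim Q)\<^sup>n\<close> generators, and \<open>s\<close> acts from the
  right on coordinates by the matrix \<open>s\<^sub>1 p(s\<^sub>2)\<close>. For \<open>S = R\<close> and for \<open>S = H\<close>, the tensor power of \<open>n\<close> copies
  of \<open>Q\<^sup>* # S\<close> over \<open>S\<close> is free as a right \<open>S\<close>-module, and \<open>s\<close> acts from the left by \<open>p(s\<^sub>1) s\<^sub>2\<close>. Bimodule maps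
  between such modules are matrices; applying the counit to their entries yields scalar matrices that
  intertwine the \<open>p\<close>, and these in turn induce bimodule maps. So in both settings two consecutive tensor powers
  are similar if and only if the right \<open>S\<close>-modules \<open>Q\<^sup>\<otimes>\<^sup>n\<^sup>+\<^sup>1\<close> and \<open>Q\<^sup>\<otimes>\<^sup>n\<close> are: for \<open>H\<close>-\<open>S\<close>-bimodules in the first
  setting and \<open>S\<close>-\<open>S\<close>-bimodules in the second. Hence \<open>R \<subseteq> H\<close> has h-depth \<open>2n + 1\<close> iff \<open>H \<subseteq> Q\<^sup>* # H\<close> has depth
  \<open>2n + 1\<close>, and if \<open>R \<subseteq> Q\<^sup>* # R\<close> has depth \<open>2n\<close> or \<open>2n + 1\<close>, then \<open>R \<subseteq> H\<close> has depth \<open>2n + 2\<close>.\<close>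

section \<open>Linear maps and presented modules\<close>

text \<open>The towers are shifted: k+1 factors of H over R have rank (dim Q)^k over H, and so have
  k factors of Q* # S over S. Hence h-depth and depth match exactly in the equality, whereas
  similarity of powers of Q over R yields an H-R-bimodule statement, an even depth, and up to 2 is
  lost. The counit sends both s_(1) p(s_(2)) and p(s_(1)) s_(2) to p(s), and it is multiplicative;
  conversely scalar matrices commute with the H-part of both expressions. This drives the two
  directions of the matrix argument. Freeness of H over R tensored with t rests on x \<otimes> h ->
  x h_(1) \<otimes> [h_(2)], with inverse x \<otimes> [h] -> x S(h_(1)) \<otimes> h_(2); this is
  where the antipode enters. Sweedler sums become finite indexed sums through a fixed basis of H.
  That basis is unrelated to R: for r in R the second legs lie in R, but the first legs are basis
  vectors of H and have to be projected to R by a linear retraction. The smash product acts from the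
  left on a dual space, so its matrices are the transposes of those of Q; the comparison therefore
  includes a transposition.\<close>

lemma eq_of_diff_zero:
  assumes "abelian_group G" "x \<in> carrier G" "y \<in> carrier G" "x \<ominus>\<^bsub>G\<^esub> y = \<zero>\<^bsub>G\<^esub>"
  shows "x = y"
proof -
  interpret abelian_group G by fact
  show ?thesis using assms(2-4) minus_equality[of x "\<ominus>\<^bsub>G\<^esub> y"] by (simp add: a_minus_def)
qed

locale base_field = field K for K :: "('k, 'm) ring_scheme" (structure)
begin

lemma linear_mapsI:
  assumes "\<And>x. x \<in> carrier M \<Longrightarrow> f x \<in> carrier N"
    and "\<And>x y. \<lbrakk>x \<in> carrier M; y \<in> carrier M\<rbrakk> \<Longrightarrow> f (x \<oplus>\<^bsub>M\<^esub> y) = f x \<oplus>\<^bsub>N\<^esub> f y"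
    and "\<And>c x. \<lbrakk>c \<in> carrier K; x \<in> carrier M\<rbrakk> \<Longrightarrow> f (c \<odot>\<^bsub>M\<^esub> x) = c \<odot>\<^bsub>N\<^esub> f x"
  shows "f \<in> linear_maps K M N"
  using assms by (auto simp: linear_maps_def)

lemma linear_closed: "\<lbrakk>f \<in> linear_maps K M N; x \<in> carrier M\<rbrakk> \<Longrightarrow> f x \<in> carrier N"
  and linear_add: "\<lbrakk>f \<in> linear_maps K M N; x \<in> carrier M; y \<in> carrier M\<rbrakk>
    \<Longrightarrow> f (x \<oplus>\<^bsub>M\<^esub> y) = f x \<oplus>\<^bsub>N\<^esub> f y"
  and linear_smult: "\<lbrakk>f \<in> linear_maps K M N; c \<in> carrier K; x \<in> carrier M\<rbrakk>
    \<Longrightarrow> f (c \<odot>\<^bsub>M\<^esub> x) = c \<odot>\<^bsub>N\<^esub> f x"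
  by (auto simp: linear_maps_def)

lemma vs_abelian: "Module.module K M \<Longrightarrow> abelian_group M"
  by (simp add: Module.module_def)

lemma linear_zero:
  assumes M: "Module.module K M" and N: "Module.module K N" and f: "f \<in> linear_maps K M N"
  shows "f \<zero>\<^bsub>M\<^esub> = \<zero>\<^bsub>N\<^esub>"
proof -
  interpret M: Module.module K M by fact
  interpret N: Module.module K N by fact
  have "f (\<zero> \<odot>\<^bsub>M\<^esub> \<zero>\<^bsub>M\<^esub>) = \<zero> \<odot>\<^bsub>N\<^esub> f \<zero>\<^bsub>M\<^esub>"
    by (rule linear_smult[OF f]) auto
  then show ?thesis using linear_closed[OF f, of "\<zero>\<^bsub>M\<^esub>"] by simp
qed

lemma linear_minus:
  assumes M: "Module.module K M" and N: "Module.module K N" and f: "f \<in> linear_maps K M N"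
    and x: "x \<in> carrier M"
  shows "f (\<ominus>\<^bsub>M\<^esub> x) = \<ominus>\<^bsub>N\<^esub> f x"
proof -
  interpret M: Module.module K M by fact
  interpret N: Module.module K N by fact
  have "f (\<ominus>\<^bsub>M\<^esub> x) \<oplus>\<^bsub>N\<^esub> f x = f (\<ominus>\<^bsub>M\<^esub> x \<oplus>\<^bsub>M\<^esub> x)"
    using linear_add[OF f, of "\<ominus>\<^bsub>M\<^esub> x" x] x by simp
  also have "\<dots> = \<zero>\<^bsub>N\<^esub>" using x linear_zero[OF M N f] by (simp add: M.M.l_neg)
  finally show ?thesis using x linear_closed[OF f]
    by (simp add: N.M.minus_equality)
qed

lemma linear_diff:
  assumes M: "Module.module K M" and N: "Module.module K N" and f: "f \<in> linear_maps K M N"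
    and x: "x \<in> carrier M" "y \<in> carrier M"
  shows "f (x \<ominus>\<^bsub>M\<^esub> y) = f x \<ominus>\<^bsub>N\<^esub> f y"
proof -
  interpret M: Module.module K M by fact
  show ?thesis unfolding a_minus_def
    using x linear_add[OF f x(1), of "\<ominus>\<^bsub>M\<^esub> y"] linear_minus[OF M N f x(2)] by simp
qed

lemma linear_finsum:
  assumes M: "Module.module K M" and N: "Module.module K N" and f: "f \<in> linear_maps K M N"
    and g: "\<And>i. i \<in> A \<Longrightarrow> g i \<in> carrier M"
  shows "f (\<Oplus>\<^bsub>M\<^esub>i\<in>A. g i) = (\<Oplus>\<^bsub>N\<^esub>i\<in>A. f (g i))"
proof -
  interpret M: Module.module K M by fact
  interpret N: Module.module K N by fact
  show ?thesis
  proof (cases "finite A")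
    case True
    then show ?thesis using g
    proof (induction A)
      case empty
      then show ?case using linear_zero[OF M N f] by simp
    next
      case (insert a A)
      then have "g a \<in> carrier M" "g \<in> A \<rightarrow> carrier M" by auto
      moreover have "(\<lambda>i. f (g i)) \<in> A \<rightarrow> carrier N" using insert linear_closed[OF f] by auto
      ultimately show ?case using insert linear_closed[OF f]
        by (simp add: linear_add[OF f] M.M.finsum_closed)
    qed
  next
    case False
    then show ?thesis using linear_zero[OF M N f] by (simp add: M.M.finsum_infinite N.M.finsum_infinite)
  qed
qed

lemma linear_id: "(\<lambda>x. x) \<in> linear_maps K M M"
  by (auto simp: linear_maps_def)

lemma linear_comp:
  "\<lbrakk>f \<in> linear_maps K M N; g \<in> linear_maps K N L\<rbrakk> \<Longrightarrow> (\<lambda>x. g (f x)) \<in> linear_maps K M L"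
  by (auto simp: linear_maps_def Pi_def)

lemma linear_plus:
  assumes N: "Module.module K N" and f: "f \<in> linear_maps K M N" and g: "g \<in> linear_maps K M N"
  shows "(\<lambda>x. f x \<oplus>\<^bsub>N\<^esub> g x) \<in> linear_maps K M N"
proof -
  interpret N: Module.module K N by fact
  show ?thesis
    using f g by (intro linear_mapsI)
      (auto simp: linear_closed linear_add linear_smult N.smult_r_distr N.M.a_ac)
qed

lemma linear_scale:
  assumes N: "Module.module K N" and f: "f \<in> linear_maps K M N" and c: "c \<in> carrier K"
  shows "(\<lambda>x. c \<odot>\<^bsub>N\<^esub> f x) \<in> linear_maps K M N"
proof -
  interpret N: Module.module K N by fact
  show ?thesis
    using f c by (intro linear_mapsI)
      (auto simp: linear_closed linear_add linear_smult N.smult_r_distr N.smult_assoc1[symmetric] m_comm)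
qed

lemma linear_zero_map:
  assumes N: "Module.module K N"
  shows "(\<lambda>x. \<zero>\<^bsub>N\<^esub>) \<in> linear_maps K M N"
proof -
  interpret N: Module.module K N by fact
  show ?thesis by (intro linear_mapsI) auto
qed

lemma linear_sum:
  assumes N: "Module.module K N" and f: "\<And>i. i \<in> A \<Longrightarrow> f i \<in> linear_maps K M N"
  shows "(\<lambda>x. \<Oplus>\<^bsub>N\<^esub>i\<in>A. f i x) \<in> linear_maps K M N"
proof (cases "finite A")
  interpret N: Module.module K N by fact
  case True
  note cl = linear_closed[OF f]
  show ?thesis
  proof (rule linear_mapsI)
    fix x y assume "x \<in> carrier M" "y \<in> carrier M"
    then have "(\<Oplus>\<^bsub>N\<^esub>i\<in>A. f i (x \<oplus>\<^bsub>M\<^esub> y)) = (\<Oplus>\<^bsub>N\<^esub>i\<in>A. f i x \<oplus>\<^bsub>N\<^esub> f i y)"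
      by (intro N.M.finsum_cong') (auto simp: cl linear_add[OF f])
    also have "\<dots> = (\<Oplus>\<^bsub>N\<^esub>i\<in>A. f i x) \<oplus>\<^bsub>N\<^esub> (\<Oplus>\<^bsub>N\<^esub>i\<in>A. f i y)"
      using \<open>x \<in> carrier M\<close> \<open>y \<in> carrier M\<close> by (intro N.M.finsum_addf) (auto simp: cl)
    finally show "(\<Oplus>\<^bsub>N\<^esub>i\<in>A. f i (x \<oplus>\<^bsub>M\<^esub> y)) = (\<Oplus>\<^bsub>N\<^esub>i\<in>A. f i x) \<oplus>\<^bsub>N\<^esub> (\<Oplus>\<^bsub>N\<^esub>i\<in>A. f i y)" .
  next
    fix c x assume c: "c \<in> carrier K" and x: "x \<in> carrier M"
    then have "(\<Oplus>\<^bsub>N\<^esub>i\<in>A. f i (c \<odot>\<^bsub>M\<^esub> x)) = (\<Oplus>\<^bsub>N\<^esub>i\<in>A. c \<odot>\<^bsub>N\<^esub> f i x)"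
      by (intro N.M.finsum_cong') (auto simp: cl linear_smult[OF f])
    also have "\<dots> = c \<odot>\<^bsub>N\<^esub> (\<Oplus>\<^bsub>N\<^esub>i\<in>A. f i x)"
      using c x True by (intro N.finsum_smult_ldistr[symmetric]) (auto simp: cl)
    finally show "(\<Oplus>\<^bsub>N\<^esub>i\<in>A. f i (c \<odot>\<^bsub>M\<^esub> x)) = c \<odot>\<^bsub>N\<^esub> (\<Oplus>\<^bsub>N\<^esub>i\<in>A. f i x)" .
  qed (auto simp: cl)
next
  interpret N: Module.module K N by fact
  case False
  then show ?thesis using linear_zero_map[OF N] by (simp add: N.M.finsum_infinite)
qed

section \<open>Submodules and spans\<close>

lemma submodule_kernel:
  assumes M: "Module.module K M" and N: "Module.module K N" and f: "f \<in> linear_maps K M N"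
  shows "submodule {x \<in> carrier M. f x = \<zero>\<^bsub>N\<^esub>} K M"
proof -
  interpret M: Module.module K M by fact
  interpret N: Module.module K N by fact
  show ?thesis
    using f by (intro M.submoduleI)
      (auto simp: linear_zero[OF M N] linear_minus[OF M N] linear_add linear_smult)
qed

lemma submodule_equalizer:
  assumes M: "Module.module K M" and N: "Module.module K N" and f: "f \<in> linear_maps K M N"
    and g: "g \<in> linear_maps K M N"
  shows "submodule {x \<in> carrier M. f x = g x} K M"
proof -
  interpret M: Module.module K M by fact
  interpret N: Module.module K N by fact
  show ?thesis
    using f g by (intro M.submoduleI)
      (auto simp: linear_zero[OF M N] linear_minus[OF M N] linear_add linear_smult)
qed

lemma span_submodule:
  assumes M: "Module.module K M" and S: "S \<subseteq> carrier M"
  shows "submodule (module_span K M S) K M"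
proof -
  interpret M: Module.module K M by fact
  have c: "submodule (carrier M) K M" by (rule M.carrier_is_submodule)
  show ?thesis
  proof (rule M.submoduleI)
    show "module_span K M S \<subseteq> carrier M" using c S by (auto simp: module_span_def)
    show "\<zero>\<^bsub>M\<^esub> \<in> module_span K M S"
      by (auto simp: module_span_def intro: subgroup.one_closed[OF submodule.axioms(1), simplified])
  qed (auto simp: module_span_def dest: M.submoduleE)
qed

lemma span_superset: "S \<subseteq> module_span K M S"
  by (auto simp: module_span_def)

lemma span_least: "\<lbrakk>submodule N K M; S \<subseteq> N\<rbrakk> \<Longrightarrow> module_span K M S \<subseteq> N"
  by (auto simp: module_span_def)

lemma submodule_zero: "submodule N K M \<Longrightarrow> \<zero>\<^bsub>M\<^esub> \<in> N"
  using subgroup.one_closed[OF submodule.axioms(1)] by fastforce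

lemma submodule_finsum:
  assumes M: "Module.module K M" and N: "submodule N K M" and f: "\<And>i. i \<in> A \<Longrightarrow> f i \<in> N"
  shows "(\<Oplus>\<^bsub>M\<^esub>i\<in>A. f i) \<in> N"
proof -
  interpret M: Module.module K M by fact
  note sub = M.submoduleE[OF N]
  show ?thesis
  proof (cases "finite A")
    case True
    then show ?thesis using f
    proof (induction A)
      case empty
      then show ?case using submodule_zero[OF N] by simp
    next
      case (insert a A)
      then have "f \<in> A \<rightarrow> carrier M" "f a \<in> carrier M" using sub(1) by auto
      then show ?case using insert sub(5) by (simp add: M.M.finsum_insert)
    qed
  next
    case False
    then show ?thesis using submodule_zero[OF N] by (simp add: M.M.finsum_infinite)
  qed
qed

lemma linear_eq_on_span:
  assumes M: "Module.module K M" and N: "Module.module K N" and f: "f \<in> linear_maps K M N"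
    and g: "g \<in> linear_maps K M N" and S: "\<And>x. x \<in> S \<Longrightarrow> f x = g x" and SM: "S \<subseteq> carrier M"
    and x: "x \<in> module_span K M S"
  shows "f x = g x"
  using span_least[OF submodule_equalizer[OF M N f g], of S] S SM x by blast

section \<open>Free modules and linear extension from generators\<close>

lemma free_module_vs: "Module.module K (free_module K X)"
proof (rule moduleI)
  let ?F = "free_module K X"
  note fin = finite_subset[rotated, OF finite_UnI]
  show "cring K" by (rule is_cring)
  have add: "(\<lambda>x. \<phi> x \<oplus> \<psi> x) \<in> carrier ?F" if "\<phi> \<in> carrier ?F" "\<psi> \<in> carrier ?F" for \<phi> \<psi>
  proof -
    have sub: "{x. \<phi> x \<oplus> \<psi> x \<noteq> \<zero>} \<subseteq> {x. \<phi> x \<noteq> \<zero>} \<union> {x. \<psi> x \<noteq> \<zero>}" by auto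
    then have "finite {x. \<phi> x \<oplus> \<psi> x \<noteq> \<zero>}"
      using that by (auto simp: free_module_def intro: finite_subset)
    with sub show ?thesis using that unfolding free_module_def by auto
  qed
  have sm: "(\<lambda>x. c \<otimes> \<phi> x) \<in> carrier ?F" if "c \<in> carrier K" "\<phi> \<in> carrier ?F" for c \<phi>
  proof -
    have sub: "{x. c \<otimes> \<phi> x \<noteq> \<zero>} \<subseteq> {x. \<phi> x \<noteq> \<zero>}" using that by auto
    then have "finite {x. c \<otimes> \<phi> x \<noteq> \<zero>}"
      using that by (auto simp: free_module_def intro: finite_subset)
    with sub show ?thesis using that unfolding free_module_def by auto
  qed
  show "abelian_group ?F"
  proof (rule abelian_groupI)
    fix \<phi> assume "\<phi> \<in> carrier ?F"
    then show "\<exists>\<psi>\<in>carrier ?F. \<psi> \<oplus>\<^bsub>?F\<^esub> \<phi> = \<zero>\<^bsub>?F\<^esub>"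
      using sm[of "\<ominus> \<one>" \<phi>] by (intro bexI[of _ "\<lambda>x. \<ominus> \<one> \<otimes> \<phi> x"])
        (auto simp: free_module_def l_minus l_neg)
  qed (insert add, auto simp: free_module_def fun_eq_iff a_ac)
  show "\<And>c \<phi>. c \<in> carrier K \<Longrightarrow> \<phi> \<in> carrier ?F \<Longrightarrow> c \<odot>\<^bsub>?F\<^esub> \<phi> \<in> carrier ?F"
    using sm by (auto simp: free_module_def)
qed (auto simp: free_module_def l_distr r_distr m_assoc)

lemma free_gen_closed: "x \<in> X \<Longrightarrow> free_gen K x \<in> carrier (free_module K X)"
  by (auto simp: free_module_def free_gen_def)

text \<open>This is the sum inside \<open>linear_lift\<close>, freed from the choice of a
  representative, so that linearity and well-definedness on cosets can be treated
  separately.\<close>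

definition free_ext :: "('k, 'a, 'y) module_scheme \<Rightarrow> ('x \<Rightarrow> 'a) \<Rightarrow> ('x \<Rightarrow> 'k) \<Rightarrow> 'a"
  where "free_ext M f \<phi> = (\<Oplus>\<^bsub>M\<^esub>x\<in>{x. \<phi> x \<noteq> \<zero>}. \<phi> x \<odot>\<^bsub>M\<^esub> f x)"

text \<open>The sum in \<open>free_ext\<close> runs over the support, which changes under addition
  and scaling. Enlarging it to a common finite set only adds zero terms.\<close>

lemma free_ext_superset:
  assumes M: "Module.module K M" and F: "finite F" "{x. \<phi> x \<noteq> \<zero>} \<subseteq> F"
    and f: "\<And>x. x \<in> F \<Longrightarrow> f x \<in> carrier M" and \<phi>: "\<And>x. \<phi> x \<in> carrier K"
  shows "free_ext M f \<phi> = (\<Oplus>\<^bsub>M\<^esub>x\<in>F. \<phi> x \<odot>\<^bsub>M\<^esub> f x)"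
proof -
  interpret M: Module.module K M by fact
  show ?thesis unfolding free_ext_def
    using F f \<phi> by (intro M.M.add.finprod_mono_neutral_cong_left) auto
qed

lemma free_ext_linear:
  fixes M :: "('k, 'b, 'y) module_scheme"
  assumes M: "Module.module K M" and f: "f \<in> X \<rightarrow> carrier M"
  shows "free_ext M f \<in> linear_maps K (free_module K X) M"
proof -
  interpret M: Module.module K M by fact
  let ?F = "free_module K X"
  interpret F: Module.module K ?F by (rule free_module_vs)
  have fs: "finite {x. \<phi> x \<noteq> \<zero>}" "{x. \<phi> x \<noteq> \<zero>} \<subseteq> X" "\<phi> x \<in> carrier K" if "\<phi> \<in> carrier ?F" for \<phi> x
    using that unfolding free_module_def by simp_all
  have cl: "free_ext M f \<phi> \<in> carrier M" if "\<phi> \<in> carrier ?F" for \<phi>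
    unfolding free_ext_def using fs[OF that] funcset_mem[OF f] by (intro M.M.finsum_closed) blast
  show ?thesis
  proof (rule linear_mapsI)
    fix \<phi> \<psi> assume \<phi>: "\<phi> \<in> carrier ?F" and \<psi>: "\<psi> \<in> carrier ?F"
    let ?S = "{x. \<phi> x \<noteq> \<zero>} \<union> {x. \<psi> x \<noteq> \<zero>}"
    have S: "finite ?S" "?S \<subseteq> X" using fs[OF \<phi>] fs[OF \<psi>] by auto
    then have fS: "f x \<in> carrier M" if "x \<in> ?S" for x using f S(2) that by (blast dest: funcset_mem)
    have "free_ext M f (\<phi> \<oplus>\<^bsub>?F\<^esub> \<psi>) = (\<Oplus>\<^bsub>M\<^esub>x\<in>?S. (\<phi> \<oplus>\<^bsub>?F\<^esub> \<psi>) x \<odot>\<^bsub>M\<^esub> f x)"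
      using fs[OF F.a_closed[OF \<phi> \<psi>]] by (intro free_ext_superset M S fS) (auto simp: free_module_def)
    also have "\<dots> = (\<Oplus>\<^bsub>M\<^esub>x\<in>?S. \<phi> x \<odot>\<^bsub>M\<^esub> f x \<oplus>\<^bsub>M\<^esub> \<psi> x \<odot>\<^bsub>M\<^esub> f x)"
      using fs(3)[OF \<phi>] fs(3)[OF \<psi>] fS
      by (intro M.M.finsum_cong') (auto simp: free_module_def M.smult_l_distr)
    also have "\<dots> = (\<Oplus>\<^bsub>M\<^esub>x\<in>?S. \<phi> x \<odot>\<^bsub>M\<^esub> f x) \<oplus>\<^bsub>M\<^esub> (\<Oplus>\<^bsub>M\<^esub>x\<in>?S. \<psi> x \<odot>\<^bsub>M\<^esub> f x)"
      using fs(3)[OF \<phi>] fs(3)[OF \<psi>] fS by (intro M.M.finsum_addf) auto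
    also have "\<dots> = free_ext M f \<phi> \<oplus>\<^bsub>M\<^esub> free_ext M f \<psi>"
      using free_ext_superset[where f=f, OF M S(1) _ fS] fs(3)[OF \<phi>] free_ext_superset[where f=f, OF M S(1) _ fS] fs(3)[OF \<psi>]
      by auto
    finally show "free_ext M f (\<phi> \<oplus>\<^bsub>?F\<^esub> \<psi>) = free_ext M f \<phi> \<oplus>\<^bsub>M\<^esub> free_ext M f \<psi>" .
  next
    fix c \<phi> assume c: "c \<in> carrier K" and \<phi>: "\<phi> \<in> carrier ?F"
    let ?S = "{x. \<phi> x \<noteq> \<zero>}"
    have S: "finite ?S" "?S \<subseteq> X" using fs[OF \<phi>] by auto
    then have fS: "f x \<in> carrier M" if "x \<in> ?S" for x using f S(2) that by (blast dest: funcset_mem)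
    have "free_ext M f (c \<odot>\<^bsub>?F\<^esub> \<phi>) = (\<Oplus>\<^bsub>M\<^esub>x\<in>?S. (c \<odot>\<^bsub>?F\<^esub> \<phi>) x \<odot>\<^bsub>M\<^esub> f x)"
      using fs(3)[OF F.smult_closed[OF c \<phi>]] c
      by (intro free_ext_superset M S fS) (auto simp: free_module_def)
    also have "\<dots> = (\<Oplus>\<^bsub>M\<^esub>x\<in>?S. c \<odot>\<^bsub>M\<^esub> (\<phi> x \<odot>\<^bsub>M\<^esub> f x))"
      using fs(3)[OF \<phi>] fS c
      by (intro M.M.finsum_cong') (auto simp: free_module_def M.smult_assoc1)
    also have "\<dots> = c \<odot>\<^bsub>M\<^esub> free_ext M f \<phi>" unfolding free_ext_def
      using fs(3)[OF \<phi>] fS c S by (intro M.finsum_smult_ldistr[symmetric]) auto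
    finally show "free_ext M f (c \<odot>\<^bsub>?F\<^esub> \<phi>) = c \<odot>\<^bsub>M\<^esub> free_ext M f \<phi>" .
  qed (rule cl)
qed

lemma free_ext_gen:
  assumes M: "Module.module K M" and f: "f x \<in> carrier M"
  shows "free_ext M f (free_gen K x) = f x"
proof -
  interpret M: Module.module K M by fact
  have "free_ext M f (free_gen K x) = (\<Oplus>\<^bsub>M\<^esub>y\<in>{x}. free_gen K x y \<odot>\<^bsub>M\<^esub> f y)"
    using f by (intro free_ext_superset M) (auto simp: free_gen_def)
  also have "\<dots> = f x" using f by (simp add: free_gen_def)
  finally show ?thesis .
qed

lemma free_span: "module_span K (free_module K X) (free_gen K ` X) = carrier (free_module K X)"
proof
  let ?F = "free_module K X" and ?S = "module_span K (free_module K X) (free_gen K ` X)"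
  interpret F: Module.module K ?F by (rule free_module_vs)
  have sub: "submodule ?S K ?F"
    by (intro span_submodule free_module_vs) (auto intro: free_gen_closed)
  note subE = F.submoduleE[OF sub]
  show "?S \<subseteq> carrier ?F" by (rule subE(1))
  have *: "\<phi> \<in> ?S" if "finite A" "\<phi> \<in> carrier ?F" "{x. \<phi> x \<noteq> \<zero>} \<subseteq> A" for A \<phi>
    using that
  proof (induction A arbitrary: \<phi>)
    case empty
    then have "\<phi> = \<zero>\<^bsub>?F\<^esub>" by (auto simp: free_module_def)
    then show ?case using submodule_zero[OF sub] by simp
  next
    case (insert a A)
    \<comment> \<open>Clearing one coordinate of the support leaves a smaller support; what is
      removed is a multiple of the generator at \<open>a\<close>.\<close>
    let ?\<psi> = "\<phi>(a := \<zero>)"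
    have \<psi>: "?\<psi> \<in> ?S"
    proof (rule insert.IH)
      have "{x. ?\<psi> x \<noteq> \<zero>} \<subseteq> {x. \<phi> x \<noteq> \<zero>}" by auto
      from finite_subset[OF this] this show "?\<psi> \<in> carrier ?F"
        using insert.prems by (auto simp: free_module_def)
    qed (use insert in auto)
    show ?case
    proof (cases "\<phi> a = \<zero>")
      case True
      then have "?\<psi> = \<phi>" by auto
      with \<psi> show ?thesis by simp
    next
      case False
      then have "a \<in> X" "\<phi> a \<in> carrier K" using insert.prems by (auto simp: free_module_def)
      moreover from \<open>a \<in> X\<close> have "free_gen K a \<in> ?S" using span_superset[of "free_gen K ` X" ?F] by auto
      ultimately have "\<phi> a \<odot>\<^bsub>?F\<^esub> free_gen K a \<in> ?S" by (intro subE(4))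
      from subE(5)[OF \<psi> this] have "?\<psi> \<oplus>\<^bsub>?F\<^esub> \<phi> a \<odot>\<^bsub>?F\<^esub> free_gen K a \<in> ?S" .
      also have "?\<psi> \<oplus>\<^bsub>?F\<^esub> \<phi> a \<odot>\<^bsub>?F\<^esub> free_gen K a = \<phi>"
        using insert.prems by (auto simp: free_module_def free_gen_def fun_eq_iff)
      finally show ?thesis .
    qed
  qed
  show "carrier ?F \<subseteq> ?S"
  proof
    fix \<phi> assume \<phi>: "\<phi> \<in> carrier ?F"
    then have "finite {x. \<phi> x \<noteq> \<zero>}" by (simp add: free_module_def)
    from *[OF this \<phi> order_refl] show "\<phi> \<in> ?S" .
  qed
qed

section \<open>Quotient modules\<close>

context
  fixes M :: "('k, 'a, 'x) module_scheme" and N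
  assumes M: "Module.module K M" and N: "submodule N K M"
begin

interpretation M: Module.module K M by (fact M)

lemma subgroup_of_submodule: "additive_subgroup N M"
  using N by (simp add: additive_subgroup.intro submodule.axioms(1))

interpretation N: abelian_subgroup N M
  by (rule abelian_subgroupI3[OF subgroup_of_submodule vs_abelian[OF M]])

lemma coset_eq_iff:
  assumes "x \<in> carrier M" "y \<in> carrier M"
  shows "N +>\<^bsub>M\<^esub> x = N +>\<^bsub>M\<^esub> y \<longleftrightarrow> x \<ominus>\<^bsub>M\<^esub> y \<in> N"
proof -
  have "N +>\<^bsub>M\<^esub> x = N +>\<^bsub>M\<^esub> y \<longleftrightarrow> x \<in> N +>\<^bsub>M\<^esub> y"
    using assms N.a_repr_independence'[of x y] N.a_rcos_self[of x] by auto
  also have "\<dots> \<longleftrightarrow> x \<ominus>\<^bsub>M\<^esub> y \<in> N"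
    using assms N.a_rcos_module by (simp add: a_minus_def)
  finally show ?thesis .
qed

lemma coset_self: "x \<in> carrier M \<Longrightarrow> x \<in> N +>\<^bsub>M\<^esub> x"
  by (rule N.a_rcos_self)

lemma coset_closed: "\<lbrakk>x \<in> carrier M; y \<in> N +>\<^bsub>M\<^esub> x\<rbrakk> \<Longrightarrow> y \<in> carrier M"
  using N.a_elemrcos_carrier by blast

lemma coset_memD: "\<lbrakk>x \<in> carrier M; y \<in> N +>\<^bsub>M\<^esub> x\<rbrakk> \<Longrightarrow> N +>\<^bsub>M\<^esub> y = N +>\<^bsub>M\<^esub> x"
  using N.a_repr_independence'[of y x] by simp

lemma quot_carrier: "carrier (quot_module M N) = (\<lambda>x. N +>\<^bsub>M\<^esub> x) ` carrier M"
  by (auto simp: quot_module_def A_RCOSETS_def')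

lemma quot_add: "\<lbrakk>x \<in> carrier M; y \<in> carrier M\<rbrakk> \<Longrightarrow>
  (N +>\<^bsub>M\<^esub> x) \<oplus>\<^bsub>quot_module M N\<^esub> (N +>\<^bsub>M\<^esub> y) = N +>\<^bsub>M\<^esub> (x \<oplus>\<^bsub>M\<^esub> y)"
  by (simp add: quot_module_def N.a_rcos_sum)

text \<open>Operations on cosets, as in \<open>quot_module\<close> and \<open>quot_ract\<close>, are
  unions over all representatives. When \<open>g\<close> respects congruence modulo
  \<open>N\<close>, all members of the union are the same coset.\<close>

lemma quot_UN:
  assumes x: "x \<in> carrier M" and g: "\<And>y. y \<in> carrier M \<Longrightarrow> g y \<in> carrier M"
    and d: "\<And>y. \<lbrakk>y \<in> carrier M; y \<ominus>\<^bsub>M\<^esub> x \<in> N\<rbrakk> \<Longrightarrow> g y \<ominus>\<^bsub>M\<^esub> g x \<in> N"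
  shows "(\<Union>y\<in>N +>\<^bsub>M\<^esub> x. N +>\<^bsub>M\<^esub> g y) = N +>\<^bsub>M\<^esub> g x"
proof -
  have "N +>\<^bsub>M\<^esub> g y = N +>\<^bsub>M\<^esub> g x" if "y \<in> N +>\<^bsub>M\<^esub> x" for y
  proof -
    note y = coset_closed[OF x that]
    have "y \<ominus>\<^bsub>M\<^esub> x \<in> N" using coset_memD[OF x that] coset_eq_iff[OF y x] by blast
    then show ?thesis using coset_eq_iff[OF g[OF y] g[OF x]] d[OF y] by blast
  qed
  then show ?thesis using coset_self[OF x] by blast
qed

lemma quot_smult:
  assumes c: "c \<in> carrier K" and x: "x \<in> carrier M"
  shows "c \<odot>\<^bsub>quot_module M N\<^esub> (N +>\<^bsub>M\<^esub> x) = N +>\<^bsub>M\<^esub> (c \<odot>\<^bsub>M\<^esub> x)"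
proof -
  have "(\<Union>y\<in>N +>\<^bsub>M\<^esub> x. N +>\<^bsub>M\<^esub> (c \<odot>\<^bsub>M\<^esub> y)) = N +>\<^bsub>M\<^esub> (c \<odot>\<^bsub>M\<^esub> x)"
  proof (rule quot_UN[OF x])
    fix y assume y: "y \<in> carrier M" "y \<ominus>\<^bsub>M\<^esub> x \<in> N"
    have "c \<odot>\<^bsub>M\<^esub> y \<ominus>\<^bsub>M\<^esub> c \<odot>\<^bsub>M\<^esub> x = c \<odot>\<^bsub>M\<^esub> (y \<ominus>\<^bsub>M\<^esub> x)"
      using c x y by (simp add: a_minus_def M.smult_r_distr M.smult_r_minus)
    then show "c \<odot>\<^bsub>M\<^esub> y \<ominus>\<^bsub>M\<^esub> c \<odot>\<^bsub>M\<^esub> x \<in> N" using M.submoduleE(4)[OF N c y(2)] by simp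
  qed (use c in auto)
  then show ?thesis by (simp add: quot_module_def)
qed

lemma quot_zero: "\<zero>\<^bsub>quot_module M N\<^esub> = N +>\<^bsub>M\<^esub> \<zero>\<^bsub>M\<^esub>"
  using M.submoduleE(1)[OF N] by (simp add: quot_module_def M.M.a_coset_add_zero)

lemma quot_vs: "Module.module K (quot_module M N)"
proof (rule moduleI)
  let ?Q = "quot_module M N"
  show "cring K" by (rule is_cring)
  have mem: "x \<in> carrier M \<Longrightarrow> N +>\<^bsub>M\<^esub> x \<in> carrier ?Q" for x
    by (simp add: quot_carrier)
  show "abelian_group ?Q"
  proof (rule abelian_groupI)
    fix X assume "X \<in> carrier ?Q"
    then obtain x where "x \<in> carrier M" "X = N +>\<^bsub>M\<^esub> x" by (auto simp: quot_carrier)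
    then show "\<exists>Y\<in>carrier ?Q. Y \<oplus>\<^bsub>?Q\<^esub> X = \<zero>\<^bsub>?Q\<^esub>"
      by (intro bexI[of _ "N +>\<^bsub>M\<^esub> (\<ominus>\<^bsub>M\<^esub> x)"]) (auto simp: quot_add quot_zero mem M.M.l_neg)
  qed (auto simp: quot_carrier quot_add quot_zero M.M.a_ac)
qed (auto simp: quot_carrier quot_add quot_smult M.smult_l_distr M.smult_r_distr M.smult_assoc1)

lemma quot_proj_linear: "(\<lambda>x. N +>\<^bsub>M\<^esub> x) \<in> linear_maps K M (quot_module M N)"
  by (rule linear_mapsI) (auto simp: quot_carrier quot_add quot_smult)

end

section \<open>Modules given by generators and relations: the universal property\<close>

lemma presented_vs:
  assumes "rels \<subseteq> carrier (free_module K X)"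
  shows "Module.module K (presented_module K X rels)"
  unfolding presented_module_def by (intro quot_vs free_module_vs span_submodule assms)

lemma presented_gen_closed:
  assumes "rels \<subseteq> carrier (free_module K X)" "x \<in> X"
  shows "presented_gen K X rels x \<in> carrier (presented_module K X rels)"
  unfolding presented_module_def presented_gen_def
  using linear_closed[OF quot_proj_linear[OF free_module_vs span_submodule[OF free_module_vs assms(1)]]
    free_gen_closed[OF assms(2)]] .

text \<open>The representative picked by \<open>SOME\<close> differs from \<open>\<phi>\<close> by
  an element of the span of the relations, and this span lies in the kernel of
  \<open>free_ext\<close>, which is a submodule containing the relations.\<close>

lemma linear_lift_coset:
  assumes rels: "rels \<subseteq> carrier (free_module K X)" and M: "Module.module K M"
    and f: "f \<in> X \<rightarrow> carrier M" and z: "\<forall>\<rho>\<in>rels. free_ext M f \<rho> = \<zero>\<^bsub>M\<^esub>"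
    and \<phi>: "\<phi> \<in> carrier (free_module K X)"
  shows "linear_lift K M f (module_span K (free_module K X) rels +>\<^bsub>free_module K X\<^esub> \<phi>) = free_ext M f \<phi>"
proof -
  let ?F = "free_module K X" and ?N = "module_span K (free_module K X) rels"
  note F = free_module_vs[of X]
  interpret F: Module.module K ?F by (rule F)
  interpret M: Module.module K M by fact
  note N = span_submodule[OF F rels]
  note lin = free_ext_linear[OF M f]
  let ?\<psi> = "SOME \<psi>. \<psi> \<in> ?N +>\<^bsub>?F\<^esub> \<phi>"
  have \<psi>: "?\<psi> \<in> ?N +>\<^bsub>?F\<^esub> \<phi>" by (rule someI[of "\<lambda>\<psi>. \<psi> \<in> _"], rule coset_self[OF F N \<phi>])
  note \<psi>c = coset_closed[OF F N \<phi> \<psi>]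
  have "?\<psi> \<ominus>\<^bsub>?F\<^esub> \<phi> \<in> ?N" using coset_memD[OF F N \<phi> \<psi>] coset_eq_iff[OF F N \<psi>c \<phi>] by simp
  moreover have "?N \<subseteq> {x \<in> carrier ?F. free_ext M f x = \<zero>\<^bsub>M\<^esub>}"
  proof (intro span_least submodule_kernel F M lin subsetI CollectI conjI)
    fix \<rho> assume "\<rho> \<in> rels"
    then show "\<rho> \<in> carrier ?F" "free_ext M f \<rho> = \<zero>\<^bsub>M\<^esub>" using rels z by blast+
  qed
  ultimately have "free_ext M f (?\<psi> \<ominus>\<^bsub>?F\<^esub> \<phi>) = \<zero>\<^bsub>M\<^esub>" by blast
  then have "free_ext M f ?\<psi> \<ominus>\<^bsub>M\<^esub> free_ext M f \<phi> = \<zero>\<^bsub>M\<^esub>"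
    using linear_diff[OF F M lin \<psi>c \<phi>] by simp
  then have "free_ext M f ?\<psi> = free_ext M f \<phi>"
    using eq_of_diff_zero[OF M.M.abelian_group_axioms linear_closed[OF lin \<psi>c] linear_closed[OF lin \<phi>]]
    by simp
  then show ?thesis by (simp add: linear_lift_def free_ext_def Let_def)
qed

context
  fixes X :: "'x set" and rels
  assumes rels: "rels \<subseteq> carrier (free_module K X)"
begin

lemma linear_lift_linear:
  assumes M: "Module.module K M"
    and f: "f \<in> X \<rightarrow> carrier M" and z: "\<forall>\<rho>\<in>rels. free_ext M f \<rho> = \<zero>\<^bsub>M\<^esub>"
  shows "linear_lift K M f \<in> linear_maps K (presented_module K X rels) M"
proof -
  note F = free_module_vs[of X]
  note N = span_submodule[OF F rels]
  note lin = free_ext_linear[OF M f]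
  interpret F: Module.module K "free_module K X" by (rule F)
  note l = linear_lift_coset[OF rels M f z]
  show ?thesis unfolding presented_module_def
    by (rule linear_mapsI)
      (auto simp: quot_carrier[OF F N] quot_add[OF F N] quot_smult[OF F N] l linear_closed[OF lin]
        linear_add[OF lin] linear_smult[OF lin])
qed

lemma linear_lift_gen:
  assumes M: "Module.module K M"
    and f: "f \<in> X \<rightarrow> carrier M" and z: "\<forall>\<rho>\<in>rels. free_ext M f \<rho> = \<zero>\<^bsub>M\<^esub>" and x: "x \<in> X"
  shows "linear_lift K M f (presented_gen K X rels x) = f x"
  unfolding presented_gen_def
  using linear_lift_coset[OF rels M f z free_gen_closed[OF x]] free_ext_gen[where f=f and x=x, OF M funcset_mem[OF f x]] by simp

text \<open>Pull the span back along the projection: the preimage is a submodule containing the free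
  generators, hence everything.\<close>

lemma presented_span:
  "module_span K (presented_module K X rels) (presented_gen K X rels ` X) =
    carrier (presented_module K X rels)"
proof
  let ?P = "presented_module K X rels"
  note F = free_module_vs[of X]
  note N = span_submodule[OF F rels]
  let ?\<pi> = "\<lambda>\<phi>. module_span K (free_module K X) rels +>\<^bsub>free_module K X\<^esub> \<phi>"
  have \<pi>: "?\<pi> \<in> linear_maps K (free_module K X) ?P"
    unfolding presented_module_def by (rule quot_proj_linear[OF F N])
  note P = presented_vs[OF rels]
  interpret P: Module.module K ?P by (rule P)
  interpret F: Module.module K "free_module K X" by (rule F)
  let ?S = "module_span K ?P (presented_gen K X rels ` X)"
  have S: "submodule ?S K ?P"
    by (intro span_submodule P) (auto intro!: presented_gen_closed[OF rels])
  note SE = P.submoduleE[OF S]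
  show "?S \<subseteq> carrier ?P" by (rule SE)
  have "submodule {\<phi> \<in> carrier (free_module K X). ?\<pi> \<phi> \<in> ?S} K (free_module K X)"
    using SE by (intro F.submoduleI)
      (auto simp: linear_add[OF \<pi>] linear_smult[OF \<pi>] linear_minus[OF F P \<pi>] linear_zero[OF F P \<pi>]
        submodule_zero[OF S])
  moreover have "free_gen K ` X \<subseteq> {\<phi> \<in> carrier (free_module K X). ?\<pi> \<phi> \<in> ?S}"
    using span_superset[of "presented_gen K X rels ` X" ?P]
    by (auto simp: free_gen_closed presented_gen_def)
  ultimately have "carrier (free_module K X) \<subseteq> {\<phi> \<in> carrier (free_module K X). ?\<pi> \<phi> \<in> ?S}"
    using span_least unfolding free_span[symmetric] by blast
  then show "carrier ?P \<subseteq> ?S"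
    unfolding presented_module_def quot_carrier[OF F N] by blast
qed

lemma presented_linear_eq:
  assumes M: "Module.module K M" and f: "f \<in> linear_maps K (presented_module K X rels) M"
    and g: "g \<in> linear_maps K (presented_module K X rels) M"
    and eq: "\<And>x. x \<in> X \<Longrightarrow> f (presented_gen K X rels x) = g (presented_gen K X rels x)"
    and p: "p \<in> carrier (presented_module K X rels)"
  shows "f p = g p"
  using linear_eq_on_span[OF presented_vs[OF rels] M f g, of "presented_gen K X rels ` X"]
    eq p presented_gen_closed[OF rels] by (auto simp: presented_span)

lemma presented_gen_relation:
  assumes "\<rho> \<in> carrier (free_module K X)" "\<sigma> \<in> carrier (free_module K X)"
    and "\<rho> \<ominus>\<^bsub>free_module K X\<^esub> \<sigma> \<in> rels"
  shows "module_span K (free_module K X) rels +>\<^bsub>free_module K X\<^esub> \<rho> =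
    module_span K (free_module K X) rels +>\<^bsub>free_module K X\<^esub> \<sigma>"
  using coset_eq_iff[OF free_module_vs span_submodule[OF free_module_vs rels] assms(1,2)]
    subsetD[OF span_superset assms(3)] by simp

end

end

section \<open>Tensor products\<close>

text \<open>Being a module depends only on carrier, addition, zero and scalar multiplication, so it
  passes between records that differ in their ring or action fields.\<close>

lemma module_cong:
  assumes "Module.module K M" "carrier N = carrier M" "add N = add M" "zero N = zero M"
    "\<And>c x. smult N c x = smult M c x"
  shows "Module.module K N"
proof -
  interpret M: Module.module K M by fact
  have "abelian_group N"
    by (rule abelian_groupI) (auto simp: assms(2-4) M.M.a_ac intro: M.M.l_neg M.M.a_inv_closed)
  then show ?thesis using assms(2-5)
    by (intro moduleI M.R.is_cring)
      (simp_all add: M.smult_l_distr M.smult_r_distr M.smult_assoc1)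
qed

context base_field
begin

lemma regular_vs: "Module.module K (regular_module K)"
proof (rule moduleI)
  show "abelian_group (regular_module K)"
    by (rule abelian_groupI) (auto simp: regular_module_def a_ac intro: l_neg a_inv_closed)
qed (auto simp: regular_module_def l_distr r_distr m_assoc is_cring)

text \<open>A sum reads only carrier, addition and zero, on which the field and its regular module
  agree. Linearity of functionals can thus be used with sums in the field.\<close>

lemma finsum_regular: "finsum (regular_module K) f A = finsum K f A"
  by (simp add: finsum_def finprod_def regular_module_def)

lemma regular_simps [simp]:
  "carrier (regular_module K) = carrier K" "add (regular_module K) = add K"
  "zero (regular_module K) = zero K" "smult (regular_module K) = mult K"
  by (simp_all add: regular_module_def)

lemma presented_proj_linear:
  assumes "rels \<subseteq> carrier (free_module K X)"
  shows "(\<lambda>\<phi>. module_span K (free_module K X) rels +>\<^bsub>free_module K X\<^esub> \<phi>)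
    \<in> linear_maps K (free_module K X) (presented_module K X rels)"
  unfolding presented_module_def
  by (rule quot_proj_linear[OF free_module_vs span_submodule[OF free_module_vs assms]])

definition bilinear ::
    "('k, 'a, 'x) module_scheme \<Rightarrow> ('k, 'b, 'y) module_scheme \<Rightarrow> ('k, 'c, 'z) module_scheme
      \<Rightarrow> ('a \<Rightarrow> 'b \<Rightarrow> 'c) \<Rightarrow> bool"
  where "bilinear V W M f \<longleftrightarrow>
    (\<forall>v\<in>carrier V. f v \<in> linear_maps K W M) \<and> (\<forall>w\<in>carrier W. (\<lambda>v. f v w) \<in> linear_maps K V M)"

lemma bilinearI:
  assumes "\<And>v. v \<in> carrier V \<Longrightarrow> f v \<in> linear_maps K W M"
    and "\<And>w. w \<in> carrier W \<Longrightarrow> (\<lambda>v. f v w) \<in> linear_maps K V M"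
  shows "bilinear V W M f"
  using assms by (auto simp: bilinear_def)

lemma bilinear_left: "\<lbrakk>bilinear V W M f; w \<in> carrier W\<rbrakk> \<Longrightarrow> (\<lambda>v. f v w) \<in> linear_maps K V M"
  and bilinear_right: "\<lbrakk>bilinear V W M f; v \<in> carrier V\<rbrakk> \<Longrightarrow> f v \<in> linear_maps K W M"
  by (auto simp: bilinear_def)

lemma bilinear_closed: "\<lbrakk>bilinear V W M f; v \<in> carrier V; w \<in> carrier W\<rbrakk> \<Longrightarrow> f v w \<in> carrier M"
  by (auto simp: bilinear_def dest: linear_closed)

lemma bilinear_comp2:
  assumes f: "bilinear V W M f" and g: "g \<in> linear_maps K V' V" and h: "h \<in> linear_maps K W' W"
  shows "bilinear V' W' M (\<lambda>v w. f (g v) (h w))"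
proof (rule bilinearI)
  show "(\<lambda>w. f (g v) (h w)) \<in> linear_maps K W' M" if "v \<in> carrier V'" for v
    by (rule linear_comp[OF h bilinear_right[OF f linear_closed[OF g that]]])
  show "(\<lambda>v. f (g v) (h w)) \<in> linear_maps K V' M" if "w \<in> carrier W'" for w
    by (rule linear_comp[OF g bilinear_left[OF f linear_closed[OF h that]]])
qed

context
  fixes V :: "('k, 'a, 'x) module_scheme" and W :: "('k, 'b, 'y) module_scheme"
  assumes V: "Module.module K V" and W: "Module.module K W"
begin

interpretation V: Module.module K V by (fact V)
interpretation W: Module.module K W by (fact W)
interpretation F: Module.module K "free_module K (carrier V \<times> carrier W)" by (rule free_module_vs)

lemma tensor_gen_closed [simp, intro]:
  "\<lbrakk>v \<in> carrier V; w \<in> carrier W\<rbrakk>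
    \<Longrightarrow> free_gen K (v, w) \<in> carrier (free_module K (carrier V \<times> carrier W))"
  by (simp add: free_gen_closed)

lemma tensor_rels_subset: "tensor_rels K V W \<subseteq> carrier (free_module K (carrier V \<times> carrier W))"
  unfolding tensor_rels_def Let_def by (auto intro!: F.M.minus_closed)

lemma tensor_vs: "Module.module K (tensor K V W)"
  unfolding tensor_def by (rule presented_vs[OF tensor_rels_subset])

lemma pure_closed [simp, intro]:
  "\<lbrakk>v \<in> carrier V; w \<in> carrier W\<rbrakk> \<Longrightarrow> pure_tensor K V W v w \<in> carrier (tensor K V W)"
  unfolding tensor_def pure_tensor_def by (rule presented_gen_closed[OF tensor_rels_subset]) simp

lemma pure_bilinear: "bilinear V W (tensor K V W) (pure_tensor K V W)"
proof -
  note \<pi> = presented_proj_linear[OF tensor_rels_subset]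
  note r = presented_gen_relation[OF tensor_rels_subset]
  note d = pure_tensor_def presented_gen_def tensor_def
  show ?thesis
  proof (intro bilinearI linear_mapsI)
    fix v w w' assume 1: "v \<in> carrier V" "w \<in> carrier W" "w' \<in> carrier W"
    show "pure_tensor K V W v (w \<oplus>\<^bsub>W\<^esub> w') =
      pure_tensor K V W v w \<oplus>\<^bsub>tensor K V W\<^esub> pure_tensor K V W v w'"
      unfolding d using 1
      by (subst linear_add[OF \<pi>, symmetric], simp, simp, intro r) (auto simp: tensor_rels_def Let_def)
  next
    fix v v' w assume 1: "v \<in> carrier V" "v' \<in> carrier V" "w \<in> carrier W"
    show "pure_tensor K V W (v \<oplus>\<^bsub>V\<^esub> v') w =
      pure_tensor K V W v w \<oplus>\<^bsub>tensor K V W\<^esub> pure_tensor K V W v' w"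
      unfolding d using 1
      by (subst linear_add[OF \<pi>, symmetric], simp, simp, intro r) (auto simp: tensor_rels_def Let_def)
  next
    fix c v w assume 1: "v \<in> carrier V" "c \<in> carrier K" "w \<in> carrier W"
    show "pure_tensor K V W v (c \<odot>\<^bsub>W\<^esub> w) = c \<odot>\<^bsub>tensor K V W\<^esub> pure_tensor K V W v w"
      unfolding d using 1
      by (subst linear_smult[OF \<pi>, symmetric], simp, simp, intro r) (auto simp: tensor_rels_def Let_def)
    show "pure_tensor K V W (c \<odot>\<^bsub>V\<^esub> v) w = c \<odot>\<^bsub>tensor K V W\<^esub> pure_tensor K V W v w"
      unfolding d using 1
      by (subst linear_smult[OF \<pi>, symmetric], simp, simp, intro r) (auto simp: tensor_rels_def Let_def)
  qed auto
qed

lemma free_ext_tensor_rels: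
  assumes M: "Module.module K M" and f: "bilinear V W M f"
  shows "\<forall>\<rho>\<in>tensor_rels K V W. free_ext M (case_prod f) \<rho> = \<zero>\<^bsub>M\<^esub>"
proof -
  interpret M: Module.module K M by fact
  let ?F = "free_module K (carrier V \<times> carrier W)"
  have fc: "case_prod f \<in> carrier V \<times> carrier W \<rightarrow> carrier M"
    using bilinear_closed[OF f] by auto
  note e = free_ext_linear[OF M fc]
  note e1 = linear_diff[OF F.module_axioms M e] linear_add[OF e] linear_smult[OF e]
  have g: "free_ext M (case_prod f) (free_gen K (v, w)) = f v w" if "v \<in> carrier V" "w \<in> carrier W" for v w
    using free_ext_gen[where f="case_prod f" and x="(v, w)", OF M] bilinear_closed[OF f that] by simp
  note bl = linear_add[OF bilinear_left[OF f]] linear_smult[OF bilinear_left[OF f]]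
    linear_add[OF bilinear_right[OF f]] linear_smult[OF bilinear_right[OF f]]
  have neg: "p \<ominus>\<^bsub>M\<^esub> p = \<zero>\<^bsub>M\<^esub>" if "p \<in> carrier M" for p
    using that by (simp add: a_minus_def M.M.r_neg)
  show ?thesis
    unfolding tensor_rels_def Let_def ball_Un
    by (intro conjI ballI; clarsimp simp: e1 g bl bilinear_closed[OF f] neg)
qed

lemma tensor_lift_linear:
  assumes M: "Module.module K M" and f: "bilinear V W M f"
  shows "tensor_lift K M f \<in> linear_maps K (tensor K V W) M"
  unfolding tensor_def tensor_lift_def
  using bilinear_closed[OF f]
  by (intro linear_lift_linear[OF tensor_rels_subset M] free_ext_tensor_rels M f) auto

lemma tensor_lift_pure:
  assumes M: "Module.module K M" and f: "bilinear V W M f" and "v \<in> carrier V" "w \<in> carrier W"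
  shows "tensor_lift K M f (pure_tensor K V W v w) = f v w"
proof -
  have "case_prod f \<in> carrier V \<times> carrier W \<rightarrow> carrier M"
    using bilinear_closed[OF f] by auto
  from linear_lift_gen[OF tensor_rels_subset M this free_ext_tensor_rels[OF M f], of "(v, w)"]
  show ?thesis
    unfolding tensor_lift_def pure_tensor_def using assms by simp
qed

lemma tensor_linear_eq:
  assumes M: "Module.module K M" and f: "f \<in> linear_maps K (tensor K V W) M"
    and g: "g \<in> linear_maps K (tensor K V W) M"
    and eq: "\<And>v w. \<lbrakk>v \<in> carrier V; w \<in> carrier W\<rbrakk> \<Longrightarrow> f (pure_tensor K V W v w) = g (pure_tensor K V W v w)"
    and p: "p \<in> carrier (tensor K V W)"
  shows "f p = g p"
proof (rule presented_linear_eq[OF tensor_rels_subset M f[unfolded tensor_def] g[unfolded tensor_def]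
      _ p[unfolded tensor_def]])
  fix x assume "x \<in> carrier V \<times> carrier W"
  then show "f (presented_gen K (carrier V \<times> carrier W) (tensor_rels K V W) x) =
      g (presented_gen K (carrier V \<times> carrier W) (tensor_rels K V W) x)"
    using eq[unfolded pure_tensor_def] by (cases x) simp
qed

end

end

section \<open>Tensor powers over a subalgebra\<close>

text \<open>Only elements of \<open>L\<close> need to act on the left and only elements of \<open>N\<close> on the right, so full
  associativity of the multiplication is not required.\<close>

locale tensor_tower = base_field K for K :: "('k, 'm) ring_scheme" (structure) +
  fixes C :: "('k, 'c, 'x) module_scheme" and B L N :: "'c set"
  assumes C_vs: "Module.module K C"
    and C_mult: "bilinear C C C (mult C)"
    and B_subset: "B \<subseteq> carrier C" and B_L: "B \<subseteq> L" and B_N: "B \<subseteq> N"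
    and L_subset: "L \<subseteq> carrier C" and N_subset: "N \<subseteq> carrier C"
    and L_assoc: "\<lbrakk>c \<in> L; x \<in> carrier C; b \<in> B\<rbrakk> \<Longrightarrow> c \<otimes>\<^bsub>C\<^esub> (x \<otimes>\<^bsub>C\<^esub> b) = (c \<otimes>\<^bsub>C\<^esub> x) \<otimes>\<^bsub>C\<^esub> b"
    and N_assoc: "\<lbrakk>c \<in> N; x \<in> carrier C; b \<in> B\<rbrakk> \<Longrightarrow> b \<otimes>\<^bsub>C\<^esub> (x \<otimes>\<^bsub>C\<^esub> c) = (b \<otimes>\<^bsub>C\<^esub> x) \<otimes>\<^bsub>C\<^esub> c"
begin

sublocale C: Module.module K C by (rule C_vs)

abbreviation T where "T n \<equiv> tensor_power K B C n"
abbreviation gens where "gens n \<equiv> power_gens C n"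
definition gen where "gen n = presented_gen K (power_gens C n) (power_rels K B C n)"
abbreviation P where "P n \<equiv> presented_module K (power_gens C n) (power_rels K B C n)"

lemma C_closed [simp, intro]: "\<lbrakk>x \<in> carrier C; y \<in> carrier C\<rbrakk> \<Longrightarrow> x \<otimes>\<^bsub>C\<^esub> y \<in> carrier C"
  by (rule bilinear_closed[OF C_mult])

lemma B_closed: "b \<in> B \<Longrightarrow> b \<in> carrier C"
  and L_closed: "b \<in> L \<Longrightarrow> b \<in> carrier C"
  and N_closed: "b \<in> N \<Longrightarrow> b \<in> carrier C"
  using B_subset L_subset N_subset by auto

lemma mem_gens: "xs \<in> gens n \<longleftrightarrow> length xs = n \<and> set xs \<subseteq> carrier C"
  by (simp add: power_gens_def)

lemma T_simps [simp]:
  "carrier (T n) = carrier (P n)" "add (T n) = add (P n)" "zero (T n) = zero (P n)"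
  "smult (T n) = smult (P n)"
  by (simp_all add: tensor_power_def Let_def)

lemma linear_maps_T: "linear_maps K (T n) M = linear_maps K (P n) M"
  "linear_maps K M (T n) = linear_maps K M (P n)"
  by (simp_all add: linear_maps_def)

lemma power_rels_subset: "power_rels K B C n \<subseteq> carrier (free_module K (gens n))"
proof -
  interpret F: Module.module K "free_module K (gens n)" by (rule free_module_vs)
  have g: "xs \<in> gens n \<Longrightarrow> free_gen K xs \<in> carrier (free_module K (gens n))" for xs
    by (rule free_gen_closed)
  show ?thesis
    unfolding power_rels_def Let_def Un_subset_iff
    using B_closed
    by (intro conjI subsetI; clarify; intro F.M.minus_closed F.M.a_closed F.smult_closed g;
        auto simp: mem_gens)
qed

lemma P_vs: "Module.module K (P n)"
  by (rule presented_vs[OF power_rels_subset])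

lemma T_vs: "Module.module K (T n)"
  by (rule module_cong[OF P_vs]) simp_all

lemma gen_closed: "xs \<in> gens n \<Longrightarrow> gen n xs \<in> carrier (T n)"
  unfolding gen_def T_simps by (rule presented_gen_closed[OF power_rels_subset])

lemma gen_add:
  assumes "us @ [x] @ vs \<in> gens n" "y \<in> carrier C"
  shows "gen n (us @ [x \<oplus>\<^bsub>C\<^esub> y] @ vs) = gen n (us @ [x] @ vs) \<oplus>\<^bsub>T n\<^esub> gen n (us @ [y] @ vs)"
proof -
  note \<pi> = presented_proj_linear[OF power_rels_subset]
  note r = presented_gen_relation[OF power_rels_subset]
  interpret F: Module.module K "free_module K (gens n)" by (rule free_module_vs)
  have g: "us @ [x] @ vs \<in> gens n" "us @ [y] @ vs \<in> gens n" "us @ [x \<oplus>\<^bsub>C\<^esub> y] @ vs \<in> gens n"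
    using assms by (auto simp: mem_gens)
  note g' = g[THEN free_gen_closed]
  show ?thesis
    unfolding gen_def presented_gen_def T_simps linear_add[OF \<pi> g'(1,2), symmetric]
    by (rule r) (use assms g' in \<open>auto simp: power_rels_def Let_def\<close>)
qed

lemma gen_smult:
  assumes "us @ [x] @ vs \<in> gens n" "a \<in> carrier K"
  shows "gen n (us @ [a \<odot>\<^bsub>C\<^esub> x] @ vs) = a \<odot>\<^bsub>T n\<^esub> gen n (us @ [x] @ vs)"
proof -
  note \<pi> = presented_proj_linear[OF power_rels_subset]
  note r = presented_gen_relation[OF power_rels_subset]
  interpret F: Module.module K "free_module K (gens n)" by (rule free_module_vs)
  have g: "us @ [x] @ vs \<in> gens n" "us @ [a \<odot>\<^bsub>C\<^esub> x] @ vs \<in> gens n"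
    using assms by (auto simp: mem_gens)
  note g' = g[THEN free_gen_closed]
  show ?thesis
    unfolding gen_def presented_gen_def T_simps linear_smult[OF \<pi> assms(2) g'(1), symmetric]
    by (rule r) (use assms g' in \<open>auto simp: power_rels_def Let_def\<close>)
qed

lemma gen_balanced:
  assumes "us @ [x, y] @ vs \<in> gens n" "b \<in> B"
  shows "gen n (us @ [x \<otimes>\<^bsub>C\<^esub> b, y] @ vs) = gen n (us @ [x, b \<otimes>\<^bsub>C\<^esub> y] @ vs)"
proof -
  note r = presented_gen_relation[OF power_rels_subset]
  have g: "us @ [x \<otimes>\<^bsub>C\<^esub> b, y] @ vs \<in> gens n" "us @ [x, b \<otimes>\<^bsub>C\<^esub> y] @ vs \<in> gens n"
    using assms by (auto simp: mem_gens B_closed)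
  note g' = g[THEN free_gen_closed]
  show ?thesis
    unfolding gen_def presented_gen_def
    by (rule r) (use assms g' in \<open>auto simp: power_rels_def Let_def\<close>)
qed

text \<open>Multilinear maps balanced over \<open>B\<close>. Positions in a list are encoded as in
  \<open>power_rels\<close>, so that each clause kills one family of relations.\<close>

definition multi :: "nat \<Rightarrow> ('k, 'd, 'y) module_scheme \<Rightarrow> ('c list \<Rightarrow> 'd) \<Rightarrow> bool"
  where "multi n M F \<longleftrightarrow> (\<forall>xs\<in>gens n. F xs \<in> carrier M) \<and>
    (\<forall>us x vs y. us @ [x] @ vs \<in> gens n \<longrightarrow> y \<in> carrier C \<longrightarrow>
      F (us @ [x \<oplus>\<^bsub>C\<^esub> y] @ vs) = F (us @ [x] @ vs) \<oplus>\<^bsub>M\<^esub> F (us @ [y] @ vs)) \<and>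
    (\<forall>us x vs a. us @ [x] @ vs \<in> gens n \<longrightarrow> a \<in> carrier K \<longrightarrow>
      F (us @ [a \<odot>\<^bsub>C\<^esub> x] @ vs) = a \<odot>\<^bsub>M\<^esub> F (us @ [x] @ vs)) \<and>
    (\<forall>us x y vs b. us @ [x, y] @ vs \<in> gens n \<longrightarrow> b \<in> B \<longrightarrow>
      F (us @ [x \<otimes>\<^bsub>C\<^esub> b, y] @ vs) = F (us @ [x, b \<otimes>\<^bsub>C\<^esub> y] @ vs))"

lemma multiI:
  assumes "\<And>xs. xs \<in> gens n \<Longrightarrow> F xs \<in> carrier M"
    and "\<And>us x vs y. \<lbrakk>us @ [x] @ vs \<in> gens n; y \<in> carrier C\<rbrakk> \<Longrightarrow>
      F (us @ [x \<oplus>\<^bsub>C\<^esub> y] @ vs) = F (us @ [x] @ vs) \<oplus>\<^bsub>M\<^esub> F (us @ [y] @ vs)"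
    and "\<And>us x vs a. \<lbrakk>us @ [x] @ vs \<in> gens n; a \<in> carrier K\<rbrakk> \<Longrightarrow>
      F (us @ [a \<odot>\<^bsub>C\<^esub> x] @ vs) = a \<odot>\<^bsub>M\<^esub> F (us @ [x] @ vs)"
    and "\<And>us x y vs b. \<lbrakk>us @ [x, y] @ vs \<in> gens n; b \<in> B\<rbrakk> \<Longrightarrow>
      F (us @ [x \<otimes>\<^bsub>C\<^esub> b, y] @ vs) = F (us @ [x, b \<otimes>\<^bsub>C\<^esub> y] @ vs)"
  shows "multi n M F"
  using assms unfolding multi_def by blast

lemma multi_rels:
  assumes M: "Module.module K M" and F: "multi n M F"
  shows "\<forall>\<rho>\<in>power_rels K B C n. free_ext M F \<rho> = \<zero>\<^bsub>M\<^esub>"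
proof -
  interpret M: Module.module K M by fact
  interpret F: Module.module K "free_module K (gens n)" by (rule free_module_vs)
  have fc: "F \<in> gens n \<rightarrow> carrier M" using F by (auto simp: multi_def)
  note e = free_ext_linear[OF M fc]
  have g: "free_ext M F (free_gen K xs) = F xs" "F xs \<in> carrier M"
    "free_gen K xs \<in> carrier (free_module K (gens n))" if "xs \<in> gens n" for xs
    using free_ext_gen[where f=F and x=xs, OF M funcset_mem[OF fc that]] funcset_mem[OF fc that]
      free_gen_closed[OF that] by auto
  have neg: "p \<ominus>\<^bsub>M\<^esub> p = \<zero>\<^bsub>M\<^esub>" if "p \<in> carrier M" for p
    using that by (simp add: a_minus_def M.M.r_neg)
  have 1: "free_ext M F (free_gen K (us @ [x \<oplus>\<^bsub>C\<^esub> y] @ vs) \<ominus>\<^bsub>free_module K (gens n)\<^esub>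
    (free_gen K (us @ [x] @ vs) \<oplus>\<^bsub>free_module K (gens n)\<^esub> free_gen K (us @ [y] @ vs))) = \<zero>\<^bsub>M\<^esub>"
    if a: "us @ [x] @ vs \<in> gens n" "y \<in> carrier C" for us x y vs
  proof -
    have m: "us @ [y] @ vs \<in> gens n" "us @ [x \<oplus>\<^bsub>C\<^esub> y] @ vs \<in> gens n" using a by (auto simp: mem_gens)
    have "F (us @ [x \<oplus>\<^bsub>C\<^esub> y] @ vs) = F (us @ [x] @ vs) \<oplus>\<^bsub>M\<^esub> F (us @ [y] @ vs)"
      using F a unfolding multi_def by blast
    then show ?thesis using g[OF a(1)] g[OF m(1)] g[OF m(2)]
      by (simp only: linear_diff[OF F.module_axioms M e] linear_add[OF e] F.M.a_closed neg M.M.a_closed)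
  qed
  have 2: "free_ext M F (free_gen K (us @ [a \<odot>\<^bsub>C\<^esub> x] @ vs) \<ominus>\<^bsub>free_module K (gens n)\<^esub>
    a \<odot>\<^bsub>free_module K (gens n)\<^esub> free_gen K (us @ [x] @ vs)) = \<zero>\<^bsub>M\<^esub>"
    if a: "us @ [x] @ vs \<in> gens n" "a \<in> carrier K" for us x a vs
  proof -
    have m: "us @ [a \<odot>\<^bsub>C\<^esub> x] @ vs \<in> gens n" using a by (auto simp: mem_gens)
    have "F (us @ [a \<odot>\<^bsub>C\<^esub> x] @ vs) = a \<odot>\<^bsub>M\<^esub> F (us @ [x] @ vs)"
      using F a unfolding multi_def by blast
    then show ?thesis using g[OF a(1)] g[OF m(1)] a
      by (simp only: linear_diff[OF F.module_axioms M e] linear_smult[OF e] F.smult_closed neg M.smult_closed)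
  qed
  have 3: "free_ext M F (free_gen K (us @ [x \<otimes>\<^bsub>C\<^esub> b, y] @ vs) \<ominus>\<^bsub>free_module K (gens n)\<^esub>
    free_gen K (us @ [x, b \<otimes>\<^bsub>C\<^esub> y] @ vs)) = \<zero>\<^bsub>M\<^esub>"
    if a: "us @ [x, y] @ vs \<in> gens n" "b \<in> B" for us x y b vs
  proof -
    have m: "us @ [x \<otimes>\<^bsub>C\<^esub> b, y] @ vs \<in> gens n" "us @ [x, b \<otimes>\<^bsub>C\<^esub> y] @ vs \<in> gens n"
      using a by (auto simp: mem_gens B_closed)
    have "F (us @ [x \<otimes>\<^bsub>C\<^esub> b, y] @ vs) = F (us @ [x, b \<otimes>\<^bsub>C\<^esub> y] @ vs)"
      using F a unfolding multi_def by blast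
    then show ?thesis using g[OF m(1)] g[OF m(2)]
      by (simp only: linear_diff[OF F.module_axioms M e] neg)
  qed
  show ?thesis
    unfolding power_rels_def Let_def ball_Un
    by (intro conjI ballI; elim CollectE exE conjE; hypsubst; intro 1 2 3)
qed

lemma multi_lift:
  assumes M: "Module.module K M" and F: "multi n M F"
  shows "linear_lift K M F \<in> linear_maps K (T n) M"
    and "\<And>xs. xs \<in> gens n \<Longrightarrow> linear_lift K M F (gen n xs) = F xs"
proof -
  have fc: "F \<in> gens n \<rightarrow> carrier M" using F by (auto simp: multi_def)
  note a = power_rels_subset M fc multi_rels[OF M F]
  show "linear_lift K M F \<in> linear_maps K (T n) M"
    unfolding linear_maps_T by (rule linear_lift_linear[OF a])
  show "linear_lift K M F (gen n xs) = F xs" if "xs \<in> gens n" for xs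
    unfolding gen_def by (rule linear_lift_gen[OF a that])
qed

text \<open>The actions in \<open>tensor_power\<close> are defined by lifting into the underlying
  presented module, while the bimodule itself is the target used everywhere else; both have the same
  module operations.\<close>

lemma linear_lift_P: "linear_lift K (P n) F = linear_lift K (T n) F"
  by (simp add: linear_lift_def Let_def finsum_def finprod_def fun_eq_iff)

lemma power_linear_eq:
  assumes M: "Module.module K M" and f: "f \<in> linear_maps K (T n) M" and g: "g \<in> linear_maps K (T n) M"
    and eq: "\<And>xs. xs \<in> gens n \<Longrightarrow> f (gen n xs) = g (gen n xs)" and p: "p \<in> carrier (T n)"
  shows "f p = g p"
  by (rule presented_linear_eq[OF power_rels_subset M f[unfolded linear_maps_T] g[unfolded linear_maps_T]
      eq[unfolded gen_def] p[unfolded T_simps]])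

lemma multi_linear:
  assumes M: "Module.module K M" and f: "f \<in> linear_maps K (T n) M"
  shows "multi n M (\<lambda>xs. f (gen n xs))"
proof (rule multiI)
  fix us x vs y assume a: "us @ [x] @ vs \<in> gens n" "y \<in> carrier C"
  then have "us @ [y] @ vs \<in> gens n" by (auto simp: mem_gens)
  then show "f (gen n (us @ [x \<oplus>\<^bsub>C\<^esub> y] @ vs)) = f (gen n (us @ [x] @ vs)) \<oplus>\<^bsub>M\<^esub> f (gen n (us @ [y] @ vs))"
    using a by (simp only: gen_add linear_add[OF f] gen_closed)
next
  fix us x vs a assume a: "us @ [x] @ vs \<in> gens n" "a \<in> carrier K"
  then show "f (gen n (us @ [a \<odot>\<^bsub>C\<^esub> x] @ vs)) = a \<odot>\<^bsub>M\<^esub> f (gen n (us @ [x] @ vs))"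
    by (simp only: gen_smult linear_smult[OF f] gen_closed)
qed (simp_all only: gen_balanced linear_closed[OF f] gen_closed)

subsection \<open>Left and right actions\<close>

text \<open>A relation is disturbed only if it involves the first factor, the case of empty
  \<open>us\<close>. There linearity of multiplication by \<open>c\<close> handles the first two
  kinds of relation, and \<open>L_assoc\<close> turns c(xb) into (cx)b for the balancing
  relation.\<close>

lemma multi_lact:
  assumes c: "c \<in> L"
  shows "multi (Suc n) (T (Suc n)) (\<lambda>xs. gen (Suc n) ((c \<otimes>\<^bsub>C\<^esub> hd xs) # tl xs))"
proof (rule multiI)
  note cC = L_closed[OF c]
  note cr = bilinear_right[OF C_mult cC]
  show "gen (Suc n) ((c \<otimes>\<^bsub>C\<^esub> hd xs) # tl xs) \<in> carrier (T (Suc n))" if "xs \<in> gens (Suc n)" for xs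
    using that cC by (intro gen_closed) (cases xs; auto simp: mem_gens)
  fix us vs :: "'c list" and x y a b
  show "gen (Suc n) ((c \<otimes>\<^bsub>C\<^esub> hd (us @ [x \<oplus>\<^bsub>C\<^esub> y] @ vs)) # tl (us @ [x \<oplus>\<^bsub>C\<^esub> y] @ vs)) =
    gen (Suc n) ((c \<otimes>\<^bsub>C\<^esub> hd (us @ [x] @ vs)) # tl (us @ [x] @ vs)) \<oplus>\<^bsub>T (Suc n)\<^esub>
    gen (Suc n) ((c \<otimes>\<^bsub>C\<^esub> hd (us @ [y] @ vs)) # tl (us @ [y] @ vs))"
    if "us @ [x] @ vs \<in> gens (Suc n)" "y \<in> carrier C"
    using that cC linear_add[OF cr, of x y]
      gen_add[of "[]" "c \<otimes>\<^bsub>C\<^esub> x" vs "Suc n" "c \<otimes>\<^bsub>C\<^esub> y"] gen_add[of "c \<otimes>\<^bsub>C\<^esub> hd us # tl us" x vs "Suc n" y]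
    by (cases us) (auto simp: mem_gens)
  show "gen (Suc n) ((c \<otimes>\<^bsub>C\<^esub> hd (us @ [a \<odot>\<^bsub>C\<^esub> x] @ vs)) # tl (us @ [a \<odot>\<^bsub>C\<^esub> x] @ vs)) =
    a \<odot>\<^bsub>T (Suc n)\<^esub> gen (Suc n) ((c \<otimes>\<^bsub>C\<^esub> hd (us @ [x] @ vs)) # tl (us @ [x] @ vs))"
    if "us @ [x] @ vs \<in> gens (Suc n)" "a \<in> carrier K"
    using that cC linear_smult[OF cr, of a x]
      gen_smult[of "[]" "c \<otimes>\<^bsub>C\<^esub> x" vs "Suc n" a] gen_smult[of "c \<otimes>\<^bsub>C\<^esub> hd us # tl us" x vs "Suc n" a]
    by (cases us) (auto simp: mem_gens)
  show "gen (Suc n) ((c \<otimes>\<^bsub>C\<^esub> hd (us @ [x \<otimes>\<^bsub>C\<^esub> b, y] @ vs)) # tl (us @ [x \<otimes>\<^bsub>C\<^esub> b, y] @ vs)) =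
    gen (Suc n) ((c \<otimes>\<^bsub>C\<^esub> hd (us @ [x, b \<otimes>\<^bsub>C\<^esub> y] @ vs)) # tl (us @ [x, b \<otimes>\<^bsub>C\<^esub> y] @ vs))"
    if "us @ [x, y] @ vs \<in> gens (Suc n)" "b \<in> B"
    using that cC L_assoc[OF c, of x b]
      gen_balanced[of "[]" "c \<otimes>\<^bsub>C\<^esub> x" y vs "Suc n" b] gen_balanced[of "c \<otimes>\<^bsub>C\<^esub> hd us # tl us" x y vs "Suc n" b]
    by (cases us) (auto simp: mem_gens)
qed

lemma multi_ract:
  assumes c: "c \<in> N"
  shows "multi (Suc n) (T (Suc n)) (\<lambda>xs. gen (Suc n) (butlast xs @ [last xs \<otimes>\<^bsub>C\<^esub> c]))"
proof (rule multiI)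
  note cC = N_closed[OF c]
  note cl = bilinear_left[OF C_mult cC]
  show "gen (Suc n) (butlast xs @ [last xs \<otimes>\<^bsub>C\<^esub> c]) \<in> carrier (T (Suc n))" if "xs \<in> gens (Suc n)" for xs
    using that cC by (intro gen_closed) (cases xs rule: rev_cases; auto simp: mem_gens)
  fix us vs :: "'c list" and x y a b
  show "gen (Suc n) (butlast (us @ [x \<oplus>\<^bsub>C\<^esub> y] @ vs) @ [last (us @ [x \<oplus>\<^bsub>C\<^esub> y] @ vs) \<otimes>\<^bsub>C\<^esub> c]) =
    gen (Suc n) (butlast (us @ [x] @ vs) @ [last (us @ [x] @ vs) \<otimes>\<^bsub>C\<^esub> c]) \<oplus>\<^bsub>T (Suc n)\<^esub>
    gen (Suc n) (butlast (us @ [y] @ vs) @ [last (us @ [y] @ vs) \<otimes>\<^bsub>C\<^esub> c])"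
    if "us @ [x] @ vs \<in> gens (Suc n)" "y \<in> carrier C"
    using that cC linear_add[OF cl, of x y]
      gen_add[of us "x \<otimes>\<^bsub>C\<^esub> c" "[]" "Suc n" "y \<otimes>\<^bsub>C\<^esub> c"]
      gen_add[of us x "butlast vs @ [last vs \<otimes>\<^bsub>C\<^esub> c]" "Suc n" y]
    by (cases vs rule: rev_cases) (auto simp: mem_gens butlast_append)
  show "gen (Suc n) (butlast (us @ [a \<odot>\<^bsub>C\<^esub> x] @ vs) @ [last (us @ [a \<odot>\<^bsub>C\<^esub> x] @ vs) \<otimes>\<^bsub>C\<^esub> c]) =
    a \<odot>\<^bsub>T (Suc n)\<^esub> gen (Suc n) (butlast (us @ [x] @ vs) @ [last (us @ [x] @ vs) \<otimes>\<^bsub>C\<^esub> c])"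
    if "us @ [x] @ vs \<in> gens (Suc n)" "a \<in> carrier K"
    using that cC linear_smult[OF cl, of a x]
      gen_smult[of us "x \<otimes>\<^bsub>C\<^esub> c" "[]" "Suc n" a]
      gen_smult[of us x "butlast vs @ [last vs \<otimes>\<^bsub>C\<^esub> c]" "Suc n" a]
    by (cases vs rule: rev_cases) (auto simp: mem_gens butlast_append)
  show "gen (Suc n) (butlast (us @ [x \<otimes>\<^bsub>C\<^esub> b, y] @ vs) @ [last (us @ [x \<otimes>\<^bsub>C\<^esub> b, y] @ vs) \<otimes>\<^bsub>C\<^esub> c]) =
    gen (Suc n) (butlast (us @ [x, b \<otimes>\<^bsub>C\<^esub> y] @ vs) @ [last (us @ [x, b \<otimes>\<^bsub>C\<^esub> y] @ vs) \<otimes>\<^bsub>C\<^esub> c])"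
    if "us @ [x, y] @ vs \<in> gens (Suc n)" "b \<in> B"
    using that cC N_assoc[OF c, of y b]
      gen_balanced[of us x "y \<otimes>\<^bsub>C\<^esub> c" "[]" "Suc n" b]
      gen_balanced[of us x y "butlast vs @ [last vs \<otimes>\<^bsub>C\<^esub> c]" "Suc n" b]
    by (cases vs rule: rev_cases) (auto simp: mem_gens butlast_append)
qed

lemma lact_T: "lact (T n) c = linear_lift K (T n) (\<lambda>xs. gen n ((c \<otimes>\<^bsub>C\<^esub> hd xs) # tl xs))"
  unfolding linear_lift_P[symmetric] by (simp add: tensor_power_def Let_def gen_def)

lemma ract_T: "ract (T n) p c = linear_lift K (T n) (\<lambda>xs. gen n (butlast xs @ [last xs \<otimes>\<^bsub>C\<^esub> c])) p"
  unfolding linear_lift_P[symmetric] by (simp add: tensor_power_def Let_def gen_def)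

lemma lact_linear: "c \<in> L \<Longrightarrow> lact (T (Suc n)) c \<in> linear_maps K (T (Suc n)) (T (Suc n))"
  unfolding lact_T by (rule multi_lift[OF T_vs multi_lact])

lemma ract_linear: "c \<in> N \<Longrightarrow> (\<lambda>p. ract (T (Suc n)) p c) \<in> linear_maps K (T (Suc n)) (T (Suc n))"
  unfolding ract_T by (rule multi_lift[OF T_vs multi_ract])

lemma lact_gen: "\<lbrakk>c \<in> L; xs \<in> gens (Suc n)\<rbrakk> \<Longrightarrow>
  lact (T (Suc n)) c (gen (Suc n) xs) = gen (Suc n) ((c \<otimes>\<^bsub>C\<^esub> hd xs) # tl xs)"
  unfolding lact_T by (rule multi_lift(2)[OF T_vs multi_lact])

lemma ract_gen: "\<lbrakk>c \<in> N; xs \<in> gens (Suc n)\<rbrakk> \<Longrightarrow>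
  ract (T (Suc n)) (gen (Suc n) xs) c = gen (Suc n) (butlast xs @ [last xs \<otimes>\<^bsub>C\<^esub> c])"
  unfolding ract_T by (rule multi_lift(2)[OF T_vs multi_ract])

subsection \<open>The first power\<close>

definition gen1 where "gen1 x = gen (Suc 0) [x]"

lemma gens1: "xs \<in> gens (Suc 0) \<longleftrightarrow> (\<exists>x\<in>carrier C. xs = [x])"
  by (cases xs) (auto simp: mem_gens)

lemma gen1_linear: "gen1 \<in> linear_maps K C (T (Suc 0))"
  unfolding gen1_def
  using gen_add[of "[]" _ "[]" "Suc 0"] gen_smult[of "[]" _ "[]" "Suc 0"]
  by (intro linear_mapsI gen_closed) (auto simp: gens1)

lemma lact_gen1: "\<lbrakk>c \<in> L; x \<in> carrier C\<rbrakk> \<Longrightarrow> lact (T (Suc 0)) c (gen1 x) = gen1 (c \<otimes>\<^bsub>C\<^esub> x)"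
  unfolding gen1_def by (simp add: lact_gen gens1)

lemma ract_gen1: "\<lbrakk>c \<in> N; x \<in> carrier C\<rbrakk> \<Longrightarrow> ract (T (Suc 0)) (gen1 x) c = gen1 (x \<otimes>\<^bsub>C\<^esub> c)"
  unfolding gen1_def by (simp add: ract_gen gens1)

lemma gen1_lift:
  assumes M: "Module.module K M" and f: "f \<in> linear_maps K C M"
  obtains g where "g \<in> linear_maps K (T (Suc 0)) M" "\<And>x. x \<in> carrier C \<Longrightarrow> g (gen1 x) = f x"
proof
  have m: "multi (Suc 0) M (\<lambda>xs. f (hd xs))"
    by (rule multiI)
      (auto simp: gens1 linear_closed[OF f] linear_add[OF f] linear_smult[OF f] append_eq_Cons_conv)
  show "linear_lift K M (\<lambda>xs. f (hd xs)) \<in> linear_maps K (T (Suc 0)) M"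
    by (rule multi_lift[OF M m])
  show "x \<in> carrier C \<Longrightarrow> linear_lift K M (\<lambda>xs. f (hd xs)) (gen1 x) = f x" for x
    unfolding gen1_def using multi_lift(2)[OF M m, of "[x]"] by (simp add: gens1)
qed

lemma gen1_linear_eq:
  assumes M: "Module.module K M" and f: "f \<in> linear_maps K (T (Suc 0)) M"
    and g: "g \<in> linear_maps K (T (Suc 0)) M"
    and eq: "\<And>x. x \<in> carrier C \<Longrightarrow> f (gen1 x) = g (gen1 x)" and p: "p \<in> carrier (T (Suc 0))"
  shows "f p = g p"
  by (rule power_linear_eq[OF M f g _ p]) (use eq in \<open>auto simp: gens1 gen1_def\<close>)

subsection \<open>Higher powers as iterated tensor products\<close>

text \<open>Tensoring with \<open>x\<close> from the left. It recovers from the flat list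
  presentation the recursive one, C tensored over \<open>B\<close> with the n-th power, along which
  the inductions on the number of factors run.\<close>

definition cons where "cons n x = linear_lift K (T (Suc n)) (\<lambda>xs. gen (Suc n) (x # xs))"

lemma cons_multi: "x \<in> carrier C \<Longrightarrow> multi n (T (Suc n)) (\<lambda>xs. gen (Suc n) (x # xs))"
proof (rule multiI)
  fix us vs :: "'c list" and z y a b
  assume x: "x \<in> carrier C"
  show "gen (Suc n) (x # xs) \<in> carrier (T (Suc n))" if "xs \<in> gens n" for xs
    using that x by (intro gen_closed) (auto simp: mem_gens)
  show "gen (Suc n) (x # us @ [z \<oplus>\<^bsub>C\<^esub> y] @ vs) =
    gen (Suc n) (x # us @ [z] @ vs) \<oplus>\<^bsub>T (Suc n)\<^esub> gen (Suc n) (x # us @ [y] @ vs)"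
    if "us @ [z] @ vs \<in> gens n" "y \<in> carrier C"
    using that x gen_add[of "x # us" z vs "Suc n" y] by (auto simp: mem_gens)
  show "gen (Suc n) (x # us @ [a \<odot>\<^bsub>C\<^esub> z] @ vs) = a \<odot>\<^bsub>T (Suc n)\<^esub> gen (Suc n) (x # us @ [z] @ vs)"
    if "us @ [z] @ vs \<in> gens n" "a \<in> carrier K"
    using that x gen_smult[of "x # us" z vs "Suc n" a] by (auto simp: mem_gens)
  show "gen (Suc n) (x # us @ [z \<otimes>\<^bsub>C\<^esub> b, y] @ vs) = gen (Suc n) (x # us @ [z, b \<otimes>\<^bsub>C\<^esub> y] @ vs)"
    if "us @ [z, y] @ vs \<in> gens n" "b \<in> B"
    using that x gen_balanced[of "x # us" z y vs "Suc n" b] by (auto simp: mem_gens)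
qed

lemma cons_linear: "x \<in> carrier C \<Longrightarrow> cons n x \<in> linear_maps K (T n) (T (Suc n))"
  unfolding cons_def by (rule multi_lift[OF T_vs cons_multi])

lemma cons_gen: "\<lbrakk>x \<in> carrier C; xs \<in> gens n\<rbrakk> \<Longrightarrow> cons n x (gen n xs) = gen (Suc n) (x # xs)"
  unfolding cons_def by (rule multi_lift(2)[OF T_vs cons_multi])

lemma cons_bilinear: "bilinear C (T n) (T (Suc n)) (cons n)"
proof (intro bilinearI cons_linear linear_mapsI)
  interpret S: Module.module K "T (Suc n)" by (rule T_vs)
  fix w x y assume w: "w \<in> carrier (T n)" and x: "x \<in> carrier C" and y: "y \<in> carrier C"
  show "cons n x w \<in> carrier (T (Suc n))" by (rule linear_closed[OF cons_linear[OF x] w])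
  show "cons n (x \<oplus>\<^bsub>C\<^esub> y) w = cons n x w \<oplus>\<^bsub>T (Suc n)\<^esub> cons n y w"
  proof (rule power_linear_eq[OF T_vs cons_linear[OF C.a_closed[OF x y]]
        linear_plus[OF T_vs cons_linear[OF x] cons_linear[OF y]] _ w])
    fix xs assume xs: "xs \<in> gens n"
    then show "cons n (x \<oplus>\<^bsub>C\<^esub> y) (gen n xs) = cons n x (gen n xs) \<oplus>\<^bsub>T (Suc n)\<^esub> cons n y (gen n xs)"
      using x y gen_add[of "[]" x xs "Suc n" y] by (simp add: cons_gen mem_gens)
  qed
next
  fix w x a assume w: "w \<in> carrier (T n)" and a: "a \<in> carrier K" and x: "x \<in> carrier C"
  show "cons n (a \<odot>\<^bsub>C\<^esub> x) w = a \<odot>\<^bsub>T (Suc n)\<^esub> cons n x w"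
  proof (rule power_linear_eq[OF T_vs cons_linear[OF C.smult_closed[OF a x]]
        linear_scale[OF T_vs cons_linear[OF x] a] _ w])
    fix xs assume xs: "xs \<in> gens n"
    then show "cons n (a \<odot>\<^bsub>C\<^esub> x) (gen n xs) = a \<odot>\<^bsub>T (Suc n)\<^esub> cons n x (gen n xs)"
      using x a gen_smult[of "[]" x xs "Suc n" a] by (simp add: cons_gen mem_gens)
  qed
qed

lemma cons_balanced:
  assumes x: "x \<in> carrier C" and b: "b \<in> B" and t: "t \<in> carrier (T (Suc n))"
  shows "cons (Suc n) (x \<otimes>\<^bsub>C\<^esub> b) t = cons (Suc n) x (lact (T (Suc n)) b t)"
proof (rule power_linear_eq[OF T_vs cons_linear linear_comp[OF lact_linear cons_linear] _ t])
  fix xs assume xs: "xs \<in> gens (Suc n)"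
  then obtain y ys where ys: "xs = y # ys" "y \<in> carrier C" "set ys \<subseteq> carrier C" "length ys = n"
    by (cases xs) (auto simp: mem_gens)
  have bL: "b \<in> L" "b \<in> carrier C" using b B_L B_closed by auto
  have g: "(b \<otimes>\<^bsub>C\<^esub> y) # ys \<in> gens (Suc n)" using ys bL by (auto simp: mem_gens)
  have "cons (Suc n) (x \<otimes>\<^bsub>C\<^esub> b) (gen (Suc n) xs) = gen (Suc (Suc n)) ([] @ [x \<otimes>\<^bsub>C\<^esub> b, y] @ ys)"
    using xs ys x bL by (simp add: cons_gen)
  also have "\<dots> = gen (Suc (Suc n)) ([] @ [x, b \<otimes>\<^bsub>C\<^esub> y] @ ys)"
    using x ys b by (intro gen_balanced) (auto simp: mem_gens)
  also have "\<dots> = cons (Suc n) x (lact (T (Suc n)) b (gen (Suc n) xs))"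
    using x ys xs g by (simp add: lact_gen bL cons_gen)
  finally show "cons (Suc n) (x \<otimes>\<^bsub>C\<^esub> b) (gen (Suc n) xs) = cons (Suc n) x (lact (T (Suc n)) b (gen (Suc n) xs))" .
qed (use x b B_L B_closed in auto)

lemma lact_cons:
  assumes x: "x \<in> carrier C" and c: "c \<in> L" and t: "t \<in> carrier (T n)"
  shows "lact (T (Suc n)) c (cons n x t) = cons n (c \<otimes>\<^bsub>C\<^esub> x) t"
  by (rule power_linear_eq[OF T_vs linear_comp[OF cons_linear lact_linear] cons_linear _ t])
    (use x c L_closed[OF c] in \<open>auto simp: cons_gen lact_gen mem_gens\<close>)

lemma ract_cons:
  assumes x: "x \<in> carrier C" and c: "c \<in> N" and t: "t \<in> carrier (T (Suc n))"
  shows "ract (T (Suc (Suc n))) (cons (Suc n) x t) c = cons (Suc n) x (ract (T (Suc n)) t c)"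
proof (rule power_linear_eq[OF T_vs linear_comp[OF cons_linear[OF x] ract_linear[OF c]]
      linear_comp[OF ract_linear[OF c] cons_linear[OF x]] _ t])
  fix xs assume xs: "xs \<in> gens (Suc n)"
  then obtain y ys where ys: "xs = ys @ [y]" "y \<in> carrier C" "set ys \<subseteq> carrier C" "length ys = n"
    by (cases xs rule: rev_cases) (auto simp: mem_gens)
  have g: "x # ys @ [y] \<in> gens (Suc (Suc n))" "ys @ [y \<otimes>\<^bsub>C\<^esub> c] \<in> gens (Suc n)"
    using ys x N_closed[OF c] by (auto simp: mem_gens)
  show "ract (T (Suc (Suc n))) (cons (Suc n) x (gen (Suc n) xs)) c =
    cons (Suc n) x (ract (T (Suc n)) (gen (Suc n) xs) c)"
    using xs g x c by (simp add: ys(1) cons_gen ract_gen)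
qed

text \<open>Universal property of C tensored over \<open>B\<close> with a power: split a list into
  head and tail. Relations at the head are bilinearity or \<open>bal\<close>; relations further
  inside follow from \<open>multi_linear\<close> for the fixed head. The second factor is a power
  with at least one factor because \<open>bal\<close> speaks of its left action.\<close>

lemma cons_lift:
  assumes M: "Module.module K M" and f: "bilinear C (T (Suc n)) M f"
    and bal: "\<And>x b t. \<lbrakk>x \<in> carrier C; b \<in> B; t \<in> carrier (T (Suc n))\<rbrakk>
      \<Longrightarrow> f (x \<otimes>\<^bsub>C\<^esub> b) t = f x (lact (T (Suc n)) b t)"
  obtains g where "g \<in> linear_maps K (T (Suc (Suc n))) M"
    "\<And>x t. \<lbrakk>x \<in> carrier C; t \<in> carrier (T (Suc n))\<rbrakk> \<Longrightarrow> g (cons (Suc n) x t) = f x t"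
proof
  let ?F = "\<lambda>xs. f (hd xs) (gen (Suc n) (tl xs))"
  have m: "multi (Suc (Suc n)) M ?F"
  proof (rule multiI)
    fix xs assume "xs \<in> gens (Suc (Suc n))"
    then show "?F xs \<in> carrier M"
      by (intro bilinear_closed[OF f] gen_closed) (cases xs; auto simp: mem_gens)+
  next
    fix us x vs y assume a: "us @ [x] @ vs \<in> gens (Suc (Suc n))" "y \<in> carrier C"
    show "?F (us @ [x \<oplus>\<^bsub>C\<^esub> y] @ vs) = ?F (us @ [x] @ vs) \<oplus>\<^bsub>M\<^esub> ?F (us @ [y] @ vs)"
    proof (cases us)
      case Nil
      then have "vs \<in> gens (Suc n)" "x \<in> carrier C" using a by (auto simp: mem_gens)
      then show ?thesis using Nil linear_add[OF bilinear_left[OF f gen_closed], of vs x y] a by simp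
    next
      case (Cons u us')
      then have u: "u \<in> carrier C" "us' @ [x] @ vs \<in> gens (Suc n)" using a by (auto simp: mem_gens)
      have "multi (Suc n) M (\<lambda>xs. f u (gen (Suc n) xs))"
        by (rule multi_linear[OF M bilinear_right[OF f u(1)]])
      then show ?thesis using u(2) a(2) unfolding multi_def Cons by simp
    qed
  next
    fix us x vs a assume a: "us @ [x] @ vs \<in> gens (Suc (Suc n))" "a \<in> carrier K"
    show "?F (us @ [a \<odot>\<^bsub>C\<^esub> x] @ vs) = a \<odot>\<^bsub>M\<^esub> ?F (us @ [x] @ vs)"
    proof (cases us)
      case Nil
      then have "vs \<in> gens (Suc n)" "x \<in> carrier C" using a by (auto simp: mem_gens)
      then show ?thesis using Nil linear_smult[OF bilinear_left[OF f gen_closed], of vs a x] a by simp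
    next
      case (Cons u us')
      then have u: "u \<in> carrier C" "us' @ [x] @ vs \<in> gens (Suc n)" using a by (auto simp: mem_gens)
      have "multi (Suc n) M (\<lambda>xs. f u (gen (Suc n) xs))"
        by (rule multi_linear[OF M bilinear_right[OF f u(1)]])
      then show ?thesis using u(2) a(2) unfolding multi_def Cons by simp
    qed
  next
    fix us x y vs b assume a: "us @ [x, y] @ vs \<in> gens (Suc (Suc n))" "b \<in> B"
    show "?F (us @ [x \<otimes>\<^bsub>C\<^esub> b, y] @ vs) = ?F (us @ [x, b \<otimes>\<^bsub>C\<^esub> y] @ vs)"
    proof (cases us)
      case Nil
      then have g: "y # vs \<in> gens (Suc n)" "x \<in> carrier C" using a by (auto simp: mem_gens)
      have "b \<in> L" using a B_L by auto
      then show ?thesis using Nil bal[OF g(2) a(2) gen_closed[OF g(1)]] g by (simp add: lact_gen)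
    next
      case (Cons u us')
      then have u: "u \<in> carrier C" "us' @ [x, y] @ vs \<in> gens (Suc n)" using a by (auto simp: mem_gens)
      have "multi (Suc n) M (\<lambda>xs. f u (gen (Suc n) xs))"
        by (rule multi_linear[OF M bilinear_right[OF f u(1)]])
      then show ?thesis using u(2) a(2) unfolding multi_def Cons by simp
    qed
  qed
  let ?g = "linear_lift K M ?F"
  show g: "?g \<in> linear_maps K (T (Suc (Suc n))) M"
    by (rule multi_lift[OF M m])
  fix x t assume x: "x \<in> carrier C" and t: "t \<in> carrier (T (Suc n))"
  show "?g (cons (Suc n) x t) = f x t"
  proof (rule power_linear_eq[OF M linear_comp[OF cons_linear[OF x] g] bilinear_right[OF f x] _ t])
    fix xs assume xs: "xs \<in> gens (Suc n)"
    then have "x # xs \<in> gens (Suc (Suc n))" using x by (auto simp: mem_gens)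
    then show "?g (cons (Suc n) x (gen (Suc n) xs)) = f x (gen (Suc n) xs)"
      using x xs by (simp add: cons_gen multi_lift(2)[OF M m])
  qed
qed

lemma cons_linear_eq:
  assumes M: "Module.module K M" and f: "f \<in> linear_maps K (T (Suc n)) M"
    and g: "g \<in> linear_maps K (T (Suc n)) M"
    and eq: "\<And>x t. \<lbrakk>x \<in> carrier C; t \<in> carrier (T n)\<rbrakk> \<Longrightarrow> f (cons n x t) = g (cons n x t)"
    and p: "p \<in> carrier (T (Suc n))"
  shows "f p = g p"
proof (rule power_linear_eq[OF M f g _ p])
  fix xs assume xs: "xs \<in> gens (Suc n)"
  then obtain y ys where ys: "xs = y # ys" "y \<in> carrier C" "ys \<in> gens n"
    by (cases xs) (auto simp: mem_gens)
  then show "f (gen (Suc n) xs) = g (gen (Suc n) xs)"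
    using eq[OF ys(2) gen_closed[OF ys(3)]] by (simp add: cons_gen)
qed

end

section \<open>Relative bases\<close>

lemma group_minus_zero: "abelian_group G \<Longrightarrow> \<ominus>\<^bsub>G\<^esub> \<zero>\<^bsub>G\<^esub> = \<zero>\<^bsub>G\<^esub>"
  using abelian_group.minus_equality[of G "\<zero>\<^bsub>G\<^esub>" "\<zero>\<^bsub>G\<^esub>"]
  by (simp add: abelian_group_def abelian_monoid.zero_closed abelian_monoid.l_zero)

context base_field
begin

lemma form_closed: "\<lbrakk>f \<in> linear_maps K M (regular_module K); x \<in> carrier M\<rbrakk> \<Longrightarrow> f x \<in> carrier K"
  and form_add: "\<lbrakk>f \<in> linear_maps K M (regular_module K); x \<in> carrier M; y \<in> carrier M\<rbrakk>
    \<Longrightarrow> f (x \<oplus>\<^bsub>M\<^esub> y) = f x \<oplus> f y"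
  and form_smult: "\<lbrakk>f \<in> linear_maps K M (regular_module K); c \<in> carrier K; x \<in> carrier M\<rbrakk>
    \<Longrightarrow> f (c \<odot>\<^bsub>M\<^esub> x) = c \<otimes> f x"
  by (auto simp: linear_maps_def)

text \<open>The classes of the \<open>q i\<close> form a basis of \<open>M / N\<close>, with dual basis \<open>\<phi> i\<close>.\<close>

definition rel_basis ::
    "('k, 'a, 'x) module_scheme \<Rightarrow> 'a set \<Rightarrow> nat \<Rightarrow> (nat \<Rightarrow> 'a) \<Rightarrow> (nat \<Rightarrow> 'a \<Rightarrow> 'k) \<Rightarrow> bool"
  where "rel_basis M N n q \<phi> \<longleftrightarrow>
    (\<forall>i<n. q i \<in> carrier M) \<and> (\<forall>i<n. \<phi> i \<in> linear_maps K M (regular_module K)) \<and>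
    (\<forall>i<n. \<forall>x\<in>N. \<phi> i x = \<zero>) \<and> (\<forall>i<n. \<forall>j<n. \<phi> i (q j) = (if i = j then \<one> else \<zero>)) \<and>
    (\<forall>x\<in>carrier M. x \<ominus>\<^bsub>M\<^esub> (\<Oplus>\<^bsub>M\<^esub>i\<in>{..<n}. \<phi> i x \<odot>\<^bsub>M\<^esub> q i) \<in> N)"

text \<open>A basis of M modulo N + K s becomes one of M modulo N by adding \<open>s\<close>. The
  map \<open>r\<close> subtracts the components along the old vectors and lands in N + K s; the new
  dual vector \<open>d\<close> reads off the coefficient of \<open>s\<close> there.\<close>

lemma rel_basis_insert:
  assumes M: "Module.module K M" and N: "submodule N K M" and s: "s \<in> carrier M" "s \<notin> N"
    and b: "rel_basis M {x \<in> carrier M. \<exists>c\<in>carrier K. x \<ominus>\<^bsub>M\<^esub> c \<odot>\<^bsub>M\<^esub> s \<in> N} n q \<phi>"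
  shows "\<exists>q \<phi>. rel_basis M N (Suc n) q \<phi>"
proof -
  interpret M: Module.module K M by fact
  note SN = M.submoduleE[OF N]
  let ?N = "{x \<in> carrier M. \<exists>c\<in>carrier K. x \<ominus>\<^bsub>M\<^esub> c \<odot>\<^bsub>M\<^esub> s \<in> N}"
  have q: "q i \<in> carrier M" and \<phi>: "\<phi> i \<in> linear_maps K M (regular_module K)"
    and \<phi>N: "x \<in> ?N \<Longrightarrow> \<phi> i x = \<zero>" and \<phi>q: "j < n \<Longrightarrow> \<phi> i (q j) = (if i = j then \<one> else \<zero>)"
    if "i < n" for i x j using b that unfolding rel_basis_def by blast+
  define r where "r x = x \<ominus>\<^bsub>M\<^esub> (\<Oplus>\<^bsub>M\<^esub>i\<in>{..<n}. \<phi> i x \<odot>\<^bsub>M\<^esub> q i)" for x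
  have sl: "(\<lambda>x. \<Oplus>\<^bsub>M\<^esub>i\<in>{..<n}. \<phi> i x \<odot>\<^bsub>M\<^esub> q i) \<in> linear_maps K M M"
  proof (rule linear_sum[OF M])
    fix i assume "i \<in> {..<n}"
    then show "(\<lambda>x. \<phi> i x \<odot>\<^bsub>M\<^esub> q i) \<in> linear_maps K M M"
      using q[of i] form_closed[OF \<phi>] form_add[OF \<phi>] form_smult[OF \<phi>]
      by (intro linear_mapsI) (auto simp: M.smult_l_distr M.smult_assoc1)
  qed
  note sc = linear_closed[OF sl]
  have rl: "r \<in> linear_maps K M M"
  proof (rule linear_mapsI)
    fix x y assume "x \<in> carrier M" "y \<in> carrier M"
    then show "r (x \<oplus>\<^bsub>M\<^esub> y) = r x \<oplus>\<^bsub>M\<^esub> r y"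
      using sc[of x] sc[of y]
      by (simp add: r_def linear_add[OF sl] a_minus_def M.M.minus_add M.M.a_ac)
  qed (auto simp: r_def linear_smult[OF sl] sc a_minus_def M.smult_r_distr M.smult_r_minus)
  have rN: "\<exists>c\<in>carrier K. r x \<ominus>\<^bsub>M\<^esub> c \<odot>\<^bsub>M\<^esub> s \<in> N" if "x \<in> carrier M" for x
    using b that unfolding rel_basis_def r_def by blast
  \<comment> \<open>The coefficient is chosen, but it is unique because \<open>s\<close> is not in
    \<open>N\<close> and nonzero scalars are invertible (\<open>uniq\<close>). Uniqueness is what
    makes \<open>d\<close> linear.\<close>
  define d where "d x = (SOME c. c \<in> carrier K \<and> r x \<ominus>\<^bsub>M\<^esub> c \<odot>\<^bsub>M\<^esub> s \<in> N)" for x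
  have d: "d x \<in> carrier K" "r x \<ominus>\<^bsub>M\<^esub> d x \<odot>\<^bsub>M\<^esub> s \<in> N" if "x \<in> carrier M" for x
    using someI_ex[OF rN[OF that, unfolded Bex_def]] unfolding d_def by blast+
  have diff: "(y \<ominus>\<^bsub>M\<^esub> c \<odot>\<^bsub>M\<^esub> s) \<ominus>\<^bsub>M\<^esub> (y \<ominus>\<^bsub>M\<^esub> c' \<odot>\<^bsub>M\<^esub> s) = (c' \<ominus> c) \<odot>\<^bsub>M\<^esub> s"
    if "y \<in> carrier M" "c \<in> carrier K" "c' \<in> carrier K" for y c c'
  proof -
    have "(y \<ominus>\<^bsub>M\<^esub> c \<odot>\<^bsub>M\<^esub> s) \<ominus>\<^bsub>M\<^esub> (y \<ominus>\<^bsub>M\<^esub> c' \<odot>\<^bsub>M\<^esub> s)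
        = (y \<oplus>\<^bsub>M\<^esub> \<ominus>\<^bsub>M\<^esub> y) \<oplus>\<^bsub>M\<^esub> (c' \<odot>\<^bsub>M\<^esub> s \<oplus>\<^bsub>M\<^esub> \<ominus>\<^bsub>M\<^esub> (c \<odot>\<^bsub>M\<^esub> s))"
      using that s by (simp add: a_minus_def M.M.minus_add M.M.a_ac)
    then show ?thesis
      using that s by (simp add: M.M.r_neg a_minus_def M.smult_l_distr M.smult_l_minus)
  qed
  have uniq: "c = c'"
    if "y \<in> carrier M" "c \<in> carrier K" "c' \<in> carrier K"
      "y \<ominus>\<^bsub>M\<^esub> c \<odot>\<^bsub>M\<^esub> s \<in> N" "y \<ominus>\<^bsub>M\<^esub> c' \<odot>\<^bsub>M\<^esub> s \<in> N" for y c c'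
  proof (rule ccontr)
    assume ne: "c \<noteq> c'"
    have "(c' \<ominus> c) \<odot>\<^bsub>M\<^esub> s \<in> N"
      using SN(5)[OF that(4) SN(3)[OF that(5)]] diff[OF that(1-3)] by (simp add: a_minus_def)
    moreover have u: "c' \<ominus> c \<in> Units K"
      using ne that(2,3) eq_of_diff_zero[OF abelian_group_axioms, of c' c]
      by (auto simp: field_Units)
    ultimately have "inv (c' \<ominus> c) \<odot>\<^bsub>M\<^esub> ((c' \<ominus> c) \<odot>\<^bsub>M\<^esub> s) \<in> N"
      using Units_inv_closed by (blast intro: SN(4))
    then show False using u s that(2,3) by (simp add: M.smult_assoc1[symmetric])
  qed
  have dl: "d \<in> linear_maps K M (regular_module K)"
  proof (rule linear_mapsI)
    fix x y assume x: "x \<in> carrier M" and y: "y \<in> carrier M"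
    note rx = linear_closed[OF rl x] linear_closed[OF rl y]
    have "(r x \<ominus>\<^bsub>M\<^esub> d x \<odot>\<^bsub>M\<^esub> s) \<oplus>\<^bsub>M\<^esub> (r y \<ominus>\<^bsub>M\<^esub> d y \<odot>\<^bsub>M\<^esub> s) = r (x \<oplus>\<^bsub>M\<^esub> y) \<ominus>\<^bsub>M\<^esub> (d x \<oplus> d y) \<odot>\<^bsub>M\<^esub> s"
      using x y rx d(1)[OF x] d(1)[OF y] s
      by (simp add: linear_add[OF rl] a_minus_def M.smult_l_distr M.M.minus_add M.M.a_ac)
    with SN(5)[OF d(2)[OF x] d(2)[OF y]]
    have "r (x \<oplus>\<^bsub>M\<^esub> y) \<ominus>\<^bsub>M\<^esub> (d x \<oplus> d y) \<odot>\<^bsub>M\<^esub> s \<in> N" by simp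
    from uniq[OF _ d(1) _ d(2) this] x y d(1)[OF x] d(1)[OF y] linear_closed[OF rl]
    show "d (x \<oplus>\<^bsub>M\<^esub> y) = d x \<oplus>\<^bsub>regular_module K\<^esub> d y" by simp
  next
    fix c x assume c: "c \<in> carrier K" and x: "x \<in> carrier M"
    note rx = linear_closed[OF rl x]
    have "c \<odot>\<^bsub>M\<^esub> (r x \<ominus>\<^bsub>M\<^esub> d x \<odot>\<^bsub>M\<^esub> s) = r (c \<odot>\<^bsub>M\<^esub> x) \<ominus>\<^bsub>M\<^esub> (c \<otimes> d x) \<odot>\<^bsub>M\<^esub> s"
      using x c rx d(1)[OF x] s
      by (simp add: linear_smult[OF rl] a_minus_def M.smult_r_distr M.smult_r_minus M.smult_assoc1)
    with SN(4)[OF c d(2)[OF x]]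
    have "r (c \<odot>\<^bsub>M\<^esub> x) \<ominus>\<^bsub>M\<^esub> (c \<otimes> d x) \<odot>\<^bsub>M\<^esub> s \<in> N" by simp
    from uniq[OF _ d(1) _ d(2) this] x c d(1)[OF x] linear_closed[OF rl]
    show "d (c \<odot>\<^bsub>M\<^esub> x) = c \<odot>\<^bsub>regular_module K\<^esub> d x" by simp
  qed (simp add: d)
  have sN: "s \<in> ?N" using s submodule_zero[OF N] by (auto intro!: bexI[of _ \<one>] simp: a_minus_def M.M.r_neg)
  have NN: "x \<in> ?N" if "x \<in> N" for x
    using that subsetD[OF SN(1) that] by (auto intro!: bexI[of _ \<zero>] simp: a_minus_def s group_minus_zero[OF M.M.abelian_group_axioms])
  have rid: "r x = x" if "x \<in> ?N" for x
  proof -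
    have "(\<Oplus>\<^bsub>M\<^esub>i\<in>{..<n}. \<phi> i x \<odot>\<^bsub>M\<^esub> q i) = (\<Oplus>\<^bsub>M\<^esub>i\<in>{..<n}. \<zero>\<^bsub>M\<^esub>)"
      using \<phi>N[OF _ that] q by (intro M.M.finsum_cong') auto
    then show ?thesis using that by (simp add: r_def a_minus_def group_minus_zero[OF M.M.abelian_group_axioms])
  qed
  have rq: "r (q j) = \<zero>\<^bsub>M\<^esub>" if j: "j < n" for j
  proof -
    have "(\<Oplus>\<^bsub>M\<^esub>i\<in>{..<n}. \<phi> i (q j) \<odot>\<^bsub>M\<^esub> q i) = (\<Oplus>\<^bsub>M\<^esub>i\<in>{..<n}. if j = i then q i else \<zero>\<^bsub>M\<^esub>)"
      using \<phi>q j q by (intro M.M.finsum_cong') auto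
    also have "\<dots> = q j" using j q by (subst M.M.finsum_singleton) auto
    finally show ?thesis using q[OF j] by (simp add: r_def a_minus_def M.M.r_neg)
  qed
  have dz: "d x = \<zero>" if "x \<in> carrier M" "r x \<in> N" for x
    using uniq[OF linear_closed[OF rl that(1)] d(1)[OF that(1)] zero_closed d(2)[OF that(1)]]
      that linear_closed[OF rl that(1)] by (simp add: a_minus_def s group_minus_zero[OF M.M.abelian_group_axioms])
  have ds: "d s = \<one>"
    using uniq[OF linear_closed[OF rl s(1)] d(1)[OF s(1)] one_closed d(2)[OF s(1)]]
      submodule_zero[OF N] s rid[OF sN] by (simp add: a_minus_def M.M.r_neg group_minus_zero[OF M.M.abelian_group_axioms])
  have "rel_basis M N (Suc n) (q(n := s)) (\<phi>(n := d))"
    unfolding rel_basis_def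
  proof (intro conjI allI impI ballI)
    fix i x assume i: "i < Suc n" and x: "x \<in> N"
    have "x \<in> carrier M" "r x \<in> N" using x SN(1) rid[OF NN[OF x]] by auto
    then show "(\<phi>(n := d)) i x = \<zero>" using i \<phi>N[OF _ NN[OF x]] dz by auto
  next
    fix i j assume ij: "i < Suc n" "j < Suc n"
    have "r (q j) \<in> N" if "j < n" using rq[OF that] submodule_zero[OF N] by simp
    then show "(\<phi>(n := d)) i ((q(n := s)) j) = (if i = j then \<one> else \<zero>)"
      using ij \<phi>q \<phi>N[OF _ sN] ds dz q by auto
  next
    fix x assume x: "x \<in> carrier M"
    have "(\<Oplus>\<^bsub>M\<^esub>i\<in>{..<Suc n}. (\<phi>(n := d)) i x \<odot>\<^bsub>M\<^esub> (q(n := s)) i)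
        = d x \<odot>\<^bsub>M\<^esub> s \<oplus>\<^bsub>M\<^esub> (\<Oplus>\<^bsub>M\<^esub>i\<in>{..<n}. (\<phi>(n := d)) i x \<odot>\<^bsub>M\<^esub> (q(n := s)) i)"
      using q d(1)[OF x] s form_closed[OF \<phi> x]
      by (simp add: lessThan_Suc)
    also have "(\<Oplus>\<^bsub>M\<^esub>i\<in>{..<n}. (\<phi>(n := d)) i x \<odot>\<^bsub>M\<^esub> (q(n := s)) i) = (\<Oplus>\<^bsub>M\<^esub>i\<in>{..<n}. \<phi> i x \<odot>\<^bsub>M\<^esub> q i)"
      using q form_closed[OF \<phi> x] by (intro M.M.finsum_cong') auto
    finally have "x \<ominus>\<^bsub>M\<^esub> (\<Oplus>\<^bsub>M\<^esub>i\<in>{..<Suc n}. (\<phi>(n := d)) i x \<odot>\<^bsub>M\<^esub> (q(n := s)) i) = r x \<ominus>\<^bsub>M\<^esub> d x \<odot>\<^bsub>M\<^esub> s"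
      using x d(1)[OF x] s sc[OF x] by (simp add: r_def a_minus_def M.M.minus_add M.M.a_ac)
    then show "x \<ominus>\<^bsub>M\<^esub> (\<Oplus>\<^bsub>M\<^esub>i\<in>{..<Suc n}. (\<phi>(n := d)) i x \<odot>\<^bsub>M\<^esub> (q(n := s)) i) \<in> N"
      using d(2)[OF x] by simp
  qed (use q \<phi> dl s in \<open>auto simp: less_Suc_eq\<close>)
  then show ?thesis by blast
qed

text \<open>Induction over a finite spanning set with varying \<open>N\<close>: a vector already in
  \<open>N\<close> is discarded, any other first enlarges \<open>N\<close> and is then put back by
  \<open>rel_basis_insert\<close>. The relative form serves three purposes later: a basis of H, a
  basis of Q, and a complement of R.\<close>

lemma rel_basis_exists:
  assumes M: "Module.module K M" and fd: "finite_dimensional K M" and N: "submodule N K M"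
  obtains n q \<phi> where "rel_basis M N n q \<phi>"
proof -
  interpret M: Module.module K M by fact
  obtain S where S: "finite S" "S \<subseteq> carrier M" "module_span K M S = carrier M"
    using fd unfolding finite_dimensional_def by blast
  \<comment> \<open>That \<open>N\<close> and \<open>S\<close> together generate \<open>M\<close> is
    expressed by submodules \<open>U\<close> containing both; this form survives moving a vector
    from \<open>S\<close> into \<open>N\<close>.\<close>
  have "\<exists>n q \<phi>. rel_basis M N n q \<phi>"
    if "finite S" "S \<subseteq> carrier M" "submodule N K M"
      "\<forall>U. submodule U K M \<longrightarrow> N \<subseteq> U \<longrightarrow> S \<subseteq> U \<longrightarrow> carrier M \<subseteq> U" for S N
    using that
  proof (induction S arbitrary: N)
    case empty
    then have "carrier M \<subseteq> N" by blast
    then have "rel_basis M N 0 q \<phi>" for q \<phi> by (auto simp: rel_basis_def)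
    then show ?case by blast
  next
    case (insert s S N)
    have s: "s \<in> carrier M" using insert.prems by simp
    note SN = M.submoduleE[OF insert.prems(2)]
    show ?case
    proof (cases "s \<in> N")
      case True
      have 1: "S \<subseteq> carrier M" using insert.prems(1) by simp
      have 2: "\<forall>U. submodule U K M \<longrightarrow> N \<subseteq> U \<longrightarrow> S \<subseteq> U \<longrightarrow> carrier M \<subseteq> U"
      proof (intro allI impI)
        fix U assume U: "submodule U K M" "N \<subseteq> U" "S \<subseteq> U"
        then have "insert s S \<subseteq> U" using True by blast
        with insert.prems(3) U(1,2) show "carrier M \<subseteq> U" by simp
      qed
      show ?thesis by (rule insert.IH[OF 1 insert.prems(2) 2])
    next
      case False
      let ?N = "{x \<in> carrier M. \<exists>c\<in>carrier K. x \<ominus>\<^bsub>M\<^esub> c \<odot>\<^bsub>M\<^esub> s \<in> N}"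
      have sub: "submodule ?N K M"
      proof (rule M.submoduleI)
        show "\<zero>\<^bsub>M\<^esub> \<in> ?N" using submodule_zero[OF insert.prems(2)] s
          by (auto intro!: bexI[of _ \<zero>] simp: a_minus_def group_minus_zero[OF M.M.abelian_group_axioms])
      next
        fix a assume "a \<in> ?N"
        then obtain c where c: "a \<in> carrier M" "c \<in> carrier K" "a \<ominus>\<^bsub>M\<^esub> c \<odot>\<^bsub>M\<^esub> s \<in> N" by blast
        have "\<ominus>\<^bsub>M\<^esub> (a \<ominus>\<^bsub>M\<^esub> c \<odot>\<^bsub>M\<^esub> s) = \<ominus>\<^bsub>M\<^esub> a \<ominus>\<^bsub>M\<^esub> (\<ominus> c) \<odot>\<^bsub>M\<^esub> s"
          using c s by (simp add: a_minus_def M.M.minus_add M.smult_l_minus)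
        with SN(3)[OF c(3)] c show "\<ominus>\<^bsub>M\<^esub> a \<in> ?N" by (auto intro!: bexI[of _ "\<ominus> c"])
      next
        fix a a' assume "a \<in> ?N" "a' \<in> ?N"
        then obtain c c' where c: "a \<in> carrier M" "c \<in> carrier K" "a \<ominus>\<^bsub>M\<^esub> c \<odot>\<^bsub>M\<^esub> s \<in> N"
          and c': "a' \<in> carrier M" "c' \<in> carrier K" "a' \<ominus>\<^bsub>M\<^esub> c' \<odot>\<^bsub>M\<^esub> s \<in> N" by blast
        have "(a \<ominus>\<^bsub>M\<^esub> c \<odot>\<^bsub>M\<^esub> s) \<oplus>\<^bsub>M\<^esub> (a' \<ominus>\<^bsub>M\<^esub> c' \<odot>\<^bsub>M\<^esub> s) = (a \<oplus>\<^bsub>M\<^esub> a') \<ominus>\<^bsub>M\<^esub> (c \<oplus> c') \<odot>\<^bsub>M\<^esub> s"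
          using c c' s by (simp add: a_minus_def M.M.minus_add M.smult_l_distr M.M.a_ac)
        with SN(5)[OF c(3) c'(3)] c c' show "a \<oplus>\<^bsub>M\<^esub> a' \<in> ?N" by (auto intro!: bexI[of _ "c \<oplus> c'"])
      next
        fix e a assume e: "e \<in> carrier K" and "a \<in> ?N"
        then obtain c where c: "a \<in> carrier M" "c \<in> carrier K" "a \<ominus>\<^bsub>M\<^esub> c \<odot>\<^bsub>M\<^esub> s \<in> N" by blast
        have "e \<odot>\<^bsub>M\<^esub> (a \<ominus>\<^bsub>M\<^esub> c \<odot>\<^bsub>M\<^esub> s) = e \<odot>\<^bsub>M\<^esub> a \<ominus>\<^bsub>M\<^esub> (e \<otimes> c) \<odot>\<^bsub>M\<^esub> s"
          using c s e by (simp add: a_minus_def M.smult_r_distr M.smult_r_minus M.smult_assoc1)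
        with SN(4)[OF e c(3)] c e show "e \<odot>\<^bsub>M\<^esub> a \<in> ?N" by (auto intro!: bexI[of _ "e \<otimes> c"])
      qed auto
      have NN: "N \<subseteq> ?N"
      proof
        fix x assume "x \<in> N"
        with subsetD[OF SN(1) this] show "x \<in> ?N" using s by (auto intro!: bexI[of _ \<zero>] simp: a_minus_def group_minus_zero[OF M.M.abelian_group_axioms])
      qed
      have sN: "s \<in> ?N" using s submodule_zero[OF insert.prems(2)]
        by (auto intro!: bexI[of _ \<one>] simp: a_minus_def M.M.r_neg)
      have 1: "S \<subseteq> carrier M" using insert.prems(1) by simp
      have 2: "\<forall>U. submodule U K M \<longrightarrow> ?N \<subseteq> U \<longrightarrow> S \<subseteq> U \<longrightarrow> carrier M \<subseteq> U"
      proof (intro allI impI)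
        fix U assume U: "submodule U K M" "?N \<subseteq> U" "S \<subseteq> U"
        then have "N \<subseteq> U" "insert s S \<subseteq> U" using NN sN by auto
        with insert.prems(3) U(1) show "carrier M \<subseteq> U" by simp
      qed
      obtain n q \<phi> where "rel_basis M ?N n q \<phi>" using insert.IH[OF 1 sub 2] by blast
      from rel_basis_insert[OF M insert.prems(2) s False this] show ?thesis by blast
    qed
  qed
  moreover have "\<forall>U. submodule U K M \<longrightarrow> N \<subseteq> U \<longrightarrow> S \<subseteq> U \<longrightarrow> carrier M \<subseteq> U"
    using span_least[of _ M S] S(3) by auto
  ultimately show ?thesis using that S N by blast
qed

end

section \<open>Direct summands and systems of bimodule maps\<close>

definition bihom ::
    "'l set \<Rightarrow> 'r set \<Rightarrow> ('k, 'a, 'x) module_scheme \<Rightarrow> ('l \<Rightarrow> 'a \<Rightarrow> 'a) \<Rightarrow> ('r \<Rightarrow> 'a \<Rightarrow> 'a) \<Rightarrow>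
      ('k, 'b, 'y) module_scheme \<Rightarrow> ('l \<Rightarrow> 'b \<Rightarrow> 'b) \<Rightarrow> ('r \<Rightarrow> 'b \<Rightarrow> 'b) \<Rightarrow> ('a \<Rightarrow> 'b) set"
  where "bihom L R M l r N l' r' = {f. (\<forall>x\<in>carrier M. f x \<in> carrier N) \<and>
    (\<forall>x\<in>carrier M. \<forall>y\<in>carrier M. f (x \<oplus>\<^bsub>M\<^esub> y) = f x \<oplus>\<^bsub>N\<^esub> f y) \<and>
    (\<forall>c\<in>L. \<forall>x\<in>carrier M. f (l c x) = l' c (f x)) \<and>
    (\<forall>c\<in>R. \<forall>x\<in>carrier M. f (r c x) = r' c (f x))}"

text \<open>The property of being a summand of a finite power, written with component maps so that
  the power does not appear. The two acting sets may have different types and the actions are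
  arbitrary functions, which permits exchanging left and right later.\<close>

definition retract_of_power ::
    "'l set \<Rightarrow> 'r set \<Rightarrow> ('k, 'a, 'x) module_scheme \<Rightarrow> ('l \<Rightarrow> 'a \<Rightarrow> 'a) \<Rightarrow> ('r \<Rightarrow> 'a \<Rightarrow> 'a) \<Rightarrow>
      ('k, 'b, 'y) module_scheme \<Rightarrow> ('l \<Rightarrow> 'b \<Rightarrow> 'b) \<Rightarrow> ('r \<Rightarrow> 'b \<Rightarrow> 'b) \<Rightarrow> bool"
  where "retract_of_power L R M l r N l' r' \<longleftrightarrow>
    (\<exists>m f g. (\<forall>i<m. f i \<in> bihom L R M l r N l' r' \<and> g i \<in> bihom L R N l' r' M l r) \<and>
      (\<forall>x\<in>carrier M. (\<Oplus>\<^bsub>M\<^esub>i\<in>{..<m::nat}. g i (f i x)) = x))"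

definition acts_on :: "'l set \<Rightarrow> ('l \<Rightarrow> 'a \<Rightarrow> 'a) \<Rightarrow> ('k, 'a, 'x) module_scheme \<Rightarrow> bool"
  where "acts_on L l M \<longleftrightarrow> (\<forall>c\<in>L. \<forall>x\<in>carrier M. l c x \<in> carrier M) \<and>
    (\<forall>c\<in>L. \<forall>x\<in>carrier M. \<forall>y\<in>carrier M. l c (x \<oplus>\<^bsub>M\<^esub> y) = l c x \<oplus>\<^bsub>M\<^esub> l c y)"

lemma bihomD:
  assumes "f \<in> bihom L R M l r N l' r'"
  shows "\<And>x. x \<in> carrier M \<Longrightarrow> f x \<in> carrier N"
    and "\<And>x y. \<lbrakk>x \<in> carrier M; y \<in> carrier M\<rbrakk> \<Longrightarrow> f (x \<oplus>\<^bsub>M\<^esub> y) = f x \<oplus>\<^bsub>N\<^esub> f y"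
    and "\<And>c x. \<lbrakk>c \<in> L; x \<in> carrier M\<rbrakk> \<Longrightarrow> f (l c x) = l' c (f x)"
    and "\<And>c x. \<lbrakk>c \<in> R; x \<in> carrier M\<rbrakk> \<Longrightarrow> f (r c x) = r' c (f x)"
  using assms unfolding bihom_def by blast+

lemma acts_onD:
  assumes "acts_on L l M"
  shows "\<And>c x. \<lbrakk>c \<in> L; x \<in> carrier M\<rbrakk> \<Longrightarrow> l c x \<in> carrier M"
    and "\<And>c x y. \<lbrakk>c \<in> L; x \<in> carrier M; y \<in> carrier M\<rbrakk> \<Longrightarrow> l c (x \<oplus>\<^bsub>M\<^esub> y) = l c x \<oplus>\<^bsub>M\<^esub> l c y"
  using assms unfolding acts_on_def by blast+

lemma additive_zero:
  assumes "abelian_group G" "abelian_group H" "\<And>x. x \<in> carrier G \<Longrightarrow> f x \<in> carrier H"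
    "\<And>x y. \<lbrakk>x \<in> carrier G; y \<in> carrier G\<rbrakk> \<Longrightarrow> f (x \<oplus>\<^bsub>G\<^esub> y) = f x \<oplus>\<^bsub>H\<^esub> f y"
  shows "f \<zero>\<^bsub>G\<^esub> = \<zero>\<^bsub>H\<^esub>"
proof -
  interpret G: abelian_group G by fact
  interpret H: abelian_group H by fact
  have "f \<zero>\<^bsub>G\<^esub> \<oplus>\<^bsub>H\<^esub> f \<zero>\<^bsub>G\<^esub> = f \<zero>\<^bsub>G\<^esub>" using assms(4)[of "\<zero>\<^bsub>G\<^esub>" "\<zero>\<^bsub>G\<^esub>"] by simp
  then show ?thesis using assms(3)[of "\<zero>\<^bsub>G\<^esub>"] by simp
qed

lemma additive_minus:
  assumes "abelian_group G" "abelian_group H" "\<And>x. x \<in> carrier G \<Longrightarrow> f x \<in> carrier H"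
    "\<And>x y. \<lbrakk>x \<in> carrier G; y \<in> carrier G\<rbrakk> \<Longrightarrow> f (x \<oplus>\<^bsub>G\<^esub> y) = f x \<oplus>\<^bsub>H\<^esub> f y" and "x \<in> carrier G"
  shows "f (\<ominus>\<^bsub>G\<^esub> x) = \<ominus>\<^bsub>H\<^esub> f x"
proof -
  interpret G: abelian_group G by fact
  interpret H: abelian_group H by fact
  have "f (\<ominus>\<^bsub>G\<^esub> x) \<oplus>\<^bsub>H\<^esub> f x = \<zero>\<^bsub>H\<^esub>"
    using assms(4)[of "\<ominus>\<^bsub>G\<^esub> x" x] assms(5) additive_zero[OF assms(1,2), of f] assms(3,4) by (simp add: G.l_neg)
  then show ?thesis using assms(3)[of x] assms(3)[of "\<ominus>\<^bsub>G\<^esub> x"] assms(5) by (simp add: H.minus_equality)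
qed

lemma additive_finsum:
  assumes "abelian_group G" "abelian_group H" "\<And>x. x \<in> carrier G \<Longrightarrow> f x \<in> carrier H"
    "\<And>x y. \<lbrakk>x \<in> carrier G; y \<in> carrier G\<rbrakk> \<Longrightarrow> f (x \<oplus>\<^bsub>G\<^esub> y) = f x \<oplus>\<^bsub>H\<^esub> f y"
    and g: "\<And>i. i \<in> A \<Longrightarrow> g i \<in> carrier G" and "finite A"
  shows "f (\<Oplus>\<^bsub>G\<^esub>i\<in>A. g i) = (\<Oplus>\<^bsub>H\<^esub>i\<in>A. f (g i))"
proof -
  interpret G: abelian_group G by fact
  interpret H: abelian_group H by fact
  show ?thesis using \<open>finite A\<close> g
  proof (induction A)
    case empty
    then show ?case using additive_zero[OF assms(1,2), of f] assms(3,4) by simp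
  next
    case (insert a A)
    then have "g a \<in> carrier G" "g \<in> A \<rightarrow> carrier G" "(\<lambda>i. f (g i)) \<in> A \<rightarrow> carrier H"
      using assms(3) by auto
    then show ?case using insert assms(3) by (simp add: assms(4) G.finsum_closed)
  qed
qed

lemma direct_power_group:
  assumes "abelian_group N"
  shows "abelian_group (direct_power m N)"
proof -
  interpret N: abelian_group N by fact
  show ?thesis
  proof (rule abelian_groupI)
    fix f assume "f \<in> carrier (direct_power m N)"
    then show "\<exists>g\<in>carrier (direct_power m N). g \<oplus>\<^bsub>direct_power m N\<^esub> f = \<zero>\<^bsub>direct_power m N\<^esub>"
      by (intro bexI[of _ "\<lambda>i\<in>{..<m}. \<ominus>\<^bsub>N\<^esub> f i"])
        (auto simp: direct_power_def PiE_def Pi_def N.l_neg fun_eq_iff)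
  qed (auto simp: direct_power_def PiE_def Pi_def extensional_def fun_eq_iff N.a_ac)
qed

lemma direct_power_acts:
  fixes N :: "('k, 'c, 'b) bimodule"
  shows "acts_on L (lact N) N \<Longrightarrow> acts_on L (lact (direct_power m N)) (direct_power m N)"
    and "acts_on R (\<lambda>c x. ract N x c) N \<Longrightarrow> acts_on R (\<lambda>c x. ract (direct_power m N) x c) (direct_power m N)"
  unfolding acts_on_def by (auto simp: direct_power_def fun_eq_iff PiE_iff)

text \<open>The tuple \<open>F\<close> of the \<open>f i\<close> and the sum \<open>G\<close> of the
  \<open>g i\<close> satisfy G F = id, so the power splits into the image of \<open>F\<close> and
  the kernel of \<open>G\<close>.\<close>

lemma retract_imp_summand:
  fixes M :: "('k, 'c, 'a) bimodule" and N :: "('k, 'c, 'b) bimodule"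
  assumes M: "abelian_group M" and N: "abelian_group N"
    and lM: "acts_on L (lact M) M" and rM: "acts_on R (\<lambda>c x. ract M x c) M"
    and lN: "acts_on L (lact N) N" and rN: "acts_on R (\<lambda>c x. ract N x c) N"
    and fg: "\<And>i. i < m \<Longrightarrow> f i \<in> bihom L R M (lact M) (\<lambda>c x. ract M x c) N (lact N) (\<lambda>c x. ract N x c)"
      "\<And>i. i < m \<Longrightarrow> g i \<in> bihom L R N (lact N) (\<lambda>c x. ract N x c) M (lact M) (\<lambda>c x. ract M x c)"
    and id: "\<And>x. x \<in> carrier M \<Longrightarrow> (\<Oplus>\<^bsub>M\<^esub>i\<in>{..<m}. g i (f i x)) = x"
  shows "direct_summand L R M (direct_power m N)"
proof -
  interpret M: abelian_group M by fact
  interpret N: abelian_group N by fact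
  let ?D = "direct_power m N"
  interpret D: abelian_group ?D by (rule direct_power_group[OF N])
  define F where "F x = (\<lambda>i\<in>{..<m}. f i x)" for x
  define G where "G y = (\<Oplus>\<^bsub>M\<^esub>i\<in>{..<m}. g i (y i))" for y
  note fc = bihomD(1)[OF fg(1)] and fa = bihomD(2)[OF fg(1)] and fl = bihomD(3)[OF fg(1)] and fr = bihomD(4)[OF fg(1)]
  note gc = bihomD(1)[OF fg(2)] and ga = bihomD(2)[OF fg(2)] and gl = bihomD(3)[OF fg(2)] and gr = bihomD(4)[OF fg(2)]
  have Dc: "y \<in> carrier ?D \<Longrightarrow> i < m \<Longrightarrow> y i \<in> carrier N" for y i
    by (auto simp: direct_power_def)
  have Da: "i < m \<Longrightarrow> (y \<oplus>\<^bsub>?D\<^esub> z) i = y i \<oplus>\<^bsub>N\<^esub> z i" for y z i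
    by (simp add: direct_power_def)
  have Dl: "i < m \<Longrightarrow> lact ?D c y i = lact N c (y i)" and Dr: "i < m \<Longrightarrow> ract ?D y c i = ract N (y i) c" for y c i
    by (simp_all add: direct_power_def)
  have Fc: "F x \<in> carrier ?D" if "x \<in> carrier M" for x
    using that by (auto simp: F_def direct_power_def fc)
  have Fa: "F (x \<oplus>\<^bsub>M\<^esub> y) = F x \<oplus>\<^bsub>?D\<^esub> F y" if "x \<in> carrier M" "y \<in> carrier M" for x y
    using that by (auto simp: F_def direct_power_def fa)
  have Fl: "F (lact M c x) = lact ?D c (F x)" if "c \<in> L" "x \<in> carrier M" for x c
    using that by (auto simp: F_def direct_power_def fl)
  have Fr: "F (ract M x c) = ract ?D (F x) c" if "c \<in> R" "x \<in> carrier M" for x c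
    using that by (auto simp: F_def direct_power_def fr)
  have Gc: "G y \<in> carrier M" if "y \<in> carrier ?D" for y
    unfolding G_def using that by (intro M.finsum_closed) (auto intro!: gc Dc)
  have Ga: "G (y \<oplus>\<^bsub>?D\<^esub> z) = G y \<oplus>\<^bsub>M\<^esub> G z" if "y \<in> carrier ?D" "z \<in> carrier ?D" for y z
  proof -
    have "G (y \<oplus>\<^bsub>?D\<^esub> z) = (\<Oplus>\<^bsub>M\<^esub>i\<in>{..<m}. g i (y i) \<oplus>\<^bsub>M\<^esub> g i (z i))"
      unfolding G_def using that by (intro M.finsum_cong') (auto simp: Da ga gc Dc)
    also have "\<dots> = G y \<oplus>\<^bsub>M\<^esub> G z" unfolding G_def
      using that by (intro M.finsum_addf) (auto simp: gc Dc)
    finally show ?thesis .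
  qed
  note lMc = acts_onD(1)[OF lM] and lMa = acts_onD(2)[OF lM] and rMc = acts_onD(1)[OF rM] and rMa = acts_onD(2)[OF rM]
  note lDc = acts_onD(1)[OF direct_power_acts(1)[OF lN]] and rDc = acts_onD(1)[OF direct_power_acts(2)[OF rN]]
  have Gl: "G (lact ?D c y) = lact M c (G y)" if c: "c \<in> L" and y: "y \<in> carrier ?D" for c y
  proof -
    have "G (lact ?D c y) = (\<Oplus>\<^bsub>M\<^esub>i\<in>{..<m}. lact M c (g i (y i)))"
      unfolding G_def using c y
      by (intro M.finsum_cong') (auto simp: Dl gl gc lMc Dc)
    also have "\<dots> = lact M c (G y)" unfolding G_def
      using c y by (intro additive_finsum[OF M M, symmetric] lMc lMa) (auto simp: gc Dc)
    finally show ?thesis .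
  qed
  have Gr: "G (ract ?D y c) = ract M (G y) c" if c: "c \<in> R" and y: "y \<in> carrier ?D" for c y
  proof -
    have "G (ract ?D y c) = (\<Oplus>\<^bsub>M\<^esub>i\<in>{..<m}. ract M (g i (y i)) c)"
      unfolding G_def using c y
      by (intro M.finsum_cong') (auto simp: Dr gr gc rMc Dc)
    also have "\<dots> = ract M (G y) c" unfolding G_def
      using c y by (intro additive_finsum[OF M M, where f="\<lambda>x. ract M x c", symmetric] rMc rMa) (auto simp: gc Dc)
    finally show ?thesis .
  qed
  have GF: "G (F x) = x" if "x \<in> carrier M" for x
  proof -
    have "G (F x) = (\<Oplus>\<^bsub>M\<^esub>i\<in>{..<m}. g i (f i x))"
      unfolding G_def F_def using that by (intro M.finsum_cong') (auto simp: gc fc)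
    then show ?thesis using id that by simp
  qed
  note F0 = additive_zero[OF M D.abelian_group_axioms, of F, OF Fc Fa]
  note G0 = additive_zero[OF D.abelian_group_axioms M, of G, OF Gc Ga]
  note Fm = additive_minus[OF M D.abelian_group_axioms, of F, OF Fc Fa]
  note Gm = additive_minus[OF D.abelian_group_axioms M, of G, OF Gc Ga]
  let ?S = "F ` carrier M" and ?S' = "{y \<in> carrier ?D. G y = \<zero>\<^bsub>M\<^esub>}"
  have 1: "sub_bimodule L R ?S ?D"
    unfolding sub_bimodule_def
  proof (intro conjI ballI)
    show "additive_subgroup ?S ?D"
      using M.zero_closed
      by (intro additive_subgroup.intro D.add.subgroupI) (auto simp: Fc Fa[symmetric] Fm[symmetric])
    show "\<And>c x. c \<in> L \<Longrightarrow> x \<in> ?S \<Longrightarrow> lact ?D c x \<in> ?S" using Fl lMc by (force simp: Fl[symmetric])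
    show "\<And>c x. c \<in> R \<Longrightarrow> x \<in> ?S \<Longrightarrow> ract ?D x c \<in> ?S" using Fr rMc by (force simp: Fr[symmetric])
  qed
  have L0: "lact M c \<zero>\<^bsub>M\<^esub> = \<zero>\<^bsub>M\<^esub>" if "c \<in> L" for c
    using additive_zero[OF M M, of "lact M c"] lMc lMa that by blast
  have R0: "ract M \<zero>\<^bsub>M\<^esub> c = \<zero>\<^bsub>M\<^esub>" if "c \<in> R" for c
    using additive_zero[OF M M, of "\<lambda>x. ract M x c"] rMc rMa that by blast
  have 2: "sub_bimodule L R ?S' ?D"
    unfolding sub_bimodule_def
  proof (intro conjI ballI)
    show "additive_subgroup ?S' ?D"
      using D.zero_closed by (intro additive_subgroup.intro D.add.subgroupI) (auto simp: Ga Gm G0)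
  qed (auto simp: lDc rDc Gl Gr L0 R0)
  have 3: "?S \<inter> ?S' = {\<zero>\<^bsub>?D\<^esub>}"
  proof (intro equalityI subsetI)
    fix y assume "y \<in> ?S \<inter> ?S'"
    then obtain x where "x \<in> carrier M" "y = F x" "G (F x) = \<zero>\<^bsub>M\<^esub>" by auto
    then show "y \<in> {\<zero>\<^bsub>?D\<^esub>}" using GF[of x] F0 by simp
  next
    fix y assume "y \<in> {\<zero>\<^bsub>?D\<^esub>}"
    then have "y = F \<zero>\<^bsub>M\<^esub>" "y \<in> carrier ?D" "G y = \<zero>\<^bsub>M\<^esub>" using F0 G0 by simp_all
    then show "y \<in> ?S \<inter> ?S'" by blast
  qed
  have "y \<in> ?S <+>\<^bsub>?D\<^esub> ?S'" if y: "y \<in> carrier ?D" for y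
  proof -
    have z: "F (G y) \<in> carrier ?D" by (intro Fc Gc y)
    then have "y = F (G y) \<oplus>\<^bsub>?D\<^esub> (y \<ominus>\<^bsub>?D\<^esub> F (G y))"
      using y by (simp add: a_minus_def D.a_lcomm D.r_neg)
    moreover have "G (y \<ominus>\<^bsub>?D\<^esub> F (G y)) = \<zero>\<^bsub>M\<^esub>"
      using y z Gc[OF y] by (simp add: a_minus_def Ga Gm GF M.r_neg)
    ultimately show ?thesis unfolding set_add_def' using y z Gc[OF y]
      by (blast intro: D.minus_closed)
  qed
  then have 4: "?S <+>\<^bsub>?D\<^esub> ?S' = carrier ?D"
    using Fc by (auto simp: set_add_def')
  have 5: "bimodule_iso L R M (?D\<lparr>carrier := ?S\<rparr>)"
    unfolding bimodule_iso_def
  proof (intro exI[of _ F] conjI ballI)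
    show "bij_betw F (carrier M) (carrier (?D\<lparr>carrier := ?S\<rparr>))"
      using GF by (auto simp: bij_betw_def intro!: inj_on_inverseI[of _ G])
  qed (auto simp: Fa Fl Fr)
  show ?thesis unfolding direct_summand_def using 1 2 3 4 5 by blast
qed

lemma direct_power_finsum:
  assumes N: "abelian_group N" and y: "\<And>i. i \<in> A \<Longrightarrow> y i \<in> carrier (direct_power m N)"
    and "finite A" and j: "j < m"
  shows "(\<Oplus>\<^bsub>direct_power m N\<^esub>i\<in>A. y i) j = (\<Oplus>\<^bsub>N\<^esub>i\<in>A. y i j)"
  by (rule additive_finsum[OF direct_power_group[OF N] N, where f="\<lambda>z. z j" and g=y])
    (use assms in \<open>auto simp: direct_power_def\<close>)

text \<open>With \<open>k\<close> the projection onto \<open>S\<close> along \<open>S'\<close>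
  followed by the inverse of \<open>h\<close>, and \<open>e i\<close> the coordinate inclusions of
  the power, the maps are the i-th coordinate of \<open>h\<close> and \<open>k\<close> after
  \<open>e i\<close>.\<close>

lemma summand_imp_retract:
  fixes M :: "('k, 'c, 'a) bimodule" and N :: "('k, 'c, 'b) bimodule"
  assumes M: "abelian_group M" and N: "abelian_group N"
    and lM: "acts_on L (lact M) M" and rM: "acts_on R (\<lambda>c x. ract M x c) M"
    and lN: "acts_on L (lact N) N" and rN: "acts_on R (\<lambda>c x. ract N x c) N"
    and ds: "direct_summand L R M (direct_power m N)"
  shows "retract_of_power L R M (lact M) (\<lambda>c x. ract M x c) N (lact N) (\<lambda>c x. ract N x c)"
proof -
  interpret M: abelian_group M by fact
  interpret N: abelian_group N by fact
  let ?D = "direct_power m N"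
  interpret D: abelian_group ?D by (rule direct_power_group[OF N])
  obtain S S' h where S: "sub_bimodule L R S ?D" and S': "sub_bimodule L R S' ?D"
    and SS: "S \<inter> S' = {\<zero>\<^bsub>?D\<^esub>}" and D: "S <+>\<^bsub>?D\<^esub> S' = carrier ?D"
    and h: "bij_betw h (carrier M) S" and ha: "\<And>x y. \<lbrakk>x \<in> carrier M; y \<in> carrier M\<rbrakk> \<Longrightarrow> h (x \<oplus>\<^bsub>M\<^esub> y) = h x \<oplus>\<^bsub>?D\<^esub> h y"
    and hl: "\<And>c x. \<lbrakk>c \<in> L; x \<in> carrier M\<rbrakk> \<Longrightarrow> h (lact M c x) = lact ?D c (h x)"
    and hr: "\<And>c x. \<lbrakk>c \<in> R; x \<in> carrier M\<rbrakk> \<Longrightarrow> h (ract M x c) = ract ?D (h x) c"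
    using ds unfolding direct_summand_def bimodule_iso_def by auto
  interpret S: additive_subgroup S ?D using S by (simp add: sub_bimodule_def)
  interpret S': additive_subgroup S' ?D using S' by (simp add: sub_bimodule_def)
  have hS: "h x \<in> S" "h x \<in> carrier ?D" if "x \<in> carrier M" for x
    using that h S.a_subset by (auto simp: bij_betw_def)
  have ex: "\<exists>x. x \<in> carrier M \<and> (\<exists>s\<in>S'. y = h x \<oplus>\<^bsub>?D\<^esub> s)" if "y \<in> carrier ?D" for y
  proof -
    have "y \<in> S <+>\<^bsub>?D\<^esub> S'" using that D by simp
    then obtain t s where "t \<in> S" "s \<in> S'" "y = t \<oplus>\<^bsub>?D\<^esub> s" by (auto simp: set_add_def')
    moreover then obtain x where "x \<in> carrier M" "t = h x" using h by (auto simp: bij_betw_def)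
    ultimately show ?thesis by blast
  qed
  \<comment> \<open>The choice is unique by \<open>ku\<close>, because \<open>S\<close> and
    \<open>S'\<close> meet in zero and \<open>h\<close> is injective.\<close>
  define k where "k y = (SOME x. x \<in> carrier M \<and> (\<exists>s\<in>S'. y = h x \<oplus>\<^bsub>?D\<^esub> s))" for y
  have k: "k y \<in> carrier M" "\<exists>s\<in>S'. y = h (k y) \<oplus>\<^bsub>?D\<^esub> s" if "y \<in> carrier ?D" for y
    using someI_ex[OF ex[OF that]] unfolding k_def by blast+
  have ku: "k y = x" if y: "y \<in> carrier ?D" and x: "x \<in> carrier M" and s: "s \<in> S'" and e: "y = h x \<oplus>\<^bsub>?D\<^esub> s" for y x s
  proof -
    obtain s' where s': "s' \<in> S'" "y = h (k y) \<oplus>\<^bsub>?D\<^esub> s'" using k(2)[OF y] by blast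
    note c = hS[OF x] hS[OF k(1)[OF y]] S'.a_Hcarr[OF s] S'.a_Hcarr[OF s'(1)]
    have eq: "h x \<oplus>\<^bsub>?D\<^esub> s = h (k y) \<oplus>\<^bsub>?D\<^esub> s'" using e s' by simp
    have "h x \<ominus>\<^bsub>?D\<^esub> h (k y) = (h x \<oplus>\<^bsub>?D\<^esub> s) \<oplus>\<^bsub>?D\<^esub> \<ominus>\<^bsub>?D\<^esub> s \<oplus>\<^bsub>?D\<^esub> \<ominus>\<^bsub>?D\<^esub> h (k y)"
      using c by (simp add: a_minus_def D.a_assoc D.r_neg)
    also have "\<dots> = (h (k y) \<oplus>\<^bsub>?D\<^esub> \<ominus>\<^bsub>?D\<^esub> h (k y)) \<oplus>\<^bsub>?D\<^esub> (s' \<oplus>\<^bsub>?D\<^esub> \<ominus>\<^bsub>?D\<^esub> s)"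
      unfolding eq using c by (simp add: D.a_ac)
    also have "\<dots> = s' \<oplus>\<^bsub>?D\<^esub> \<ominus>\<^bsub>?D\<^esub> s" using c by (simp add: D.r_neg)
    finally have "h x \<ominus>\<^bsub>?D\<^esub> h (k y) \<in> S'" using s s' by (simp add: S'.a_closed S'.a_inv_closed)
    moreover have "h x \<ominus>\<^bsub>?D\<^esub> h (k y) \<in> S"
      using c by (simp add: a_minus_def S.a_closed S.a_inv_closed)
    ultimately have "h x \<ominus>\<^bsub>?D\<^esub> h (k y) = \<zero>\<^bsub>?D\<^esub>" using SS by blast
    then have "h x = h (k y)" using eq_of_diff_zero[OF D.abelian_group_axioms] c by blast
    then show ?thesis using h x k(1)[OF y] by (auto simp: bij_betw_def inj_on_def)
  qed
  have kh: "k (h x) = x" if "x \<in> carrier M" for x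
    using that hS[OF that] by (intro ku[of _ _ "\<zero>\<^bsub>?D\<^esub>"]) auto
  have ka: "k (y \<oplus>\<^bsub>?D\<^esub> z) = k y \<oplus>\<^bsub>M\<^esub> k z" if y: "y \<in> carrier ?D" and z: "z \<in> carrier ?D" for y z
  proof -
    obtain s t where s: "s \<in> S'" "y = h (k y) \<oplus>\<^bsub>?D\<^esub> s" and t: "t \<in> S'" "z = h (k z) \<oplus>\<^bsub>?D\<^esub> t"
      using k(2)[OF y] k(2)[OF z] by blast
    note c = hS[OF k(1)[OF y]] hS[OF k(1)[OF z]] S'.a_Hcarr[OF s(1)] S'.a_Hcarr[OF t(1)]
    have "y \<oplus>\<^bsub>?D\<^esub> z = (h (k y) \<oplus>\<^bsub>?D\<^esub> s) \<oplus>\<^bsub>?D\<^esub> (h (k z) \<oplus>\<^bsub>?D\<^esub> t)" using s(2) t(2) by simp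
    also have "\<dots> = h (k y \<oplus>\<^bsub>M\<^esub> k z) \<oplus>\<^bsub>?D\<^esub> (s \<oplus>\<^bsub>?D\<^esub> t)"
      using c k(1)[OF y] k(1)[OF z] by (simp add: ha D.a_ac)
    finally show ?thesis
      by (rule ku[OF D.a_closed[OF y z] M.a_closed[OF k(1)[OF y] k(1)[OF z]] S'.a_closed[OF s(1) t(1)]])
  qed
  \<comment> \<open>An operator on the power that preserves \<open>S'\<close> and corresponds under
    \<open>h\<close> to an operator on \<open>M\<close> commutes with \<open>k\<close>. Both actions
    are instances.\<close>
  have kop: "k (u y) = v (k y)"
    if v: "\<And>x. x \<in> carrier M \<Longrightarrow> v x \<in> carrier M" "\<And>x. x \<in> carrier M \<Longrightarrow> h (v x) = u (h x)"
      and u: "\<And>x. x \<in> carrier ?D \<Longrightarrow> u x \<in> carrier ?D"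
        "\<And>x z. \<lbrakk>x \<in> carrier ?D; z \<in> carrier ?D\<rbrakk> \<Longrightarrow> u (x \<oplus>\<^bsub>?D\<^esub> z) = u x \<oplus>\<^bsub>?D\<^esub> u z"
        "\<And>x. x \<in> S' \<Longrightarrow> u x \<in> S'"
      and y: "y \<in> carrier ?D" for u v y
  proof -
    obtain s where s: "s \<in> S'" "y = h (k y) \<oplus>\<^bsub>?D\<^esub> s" using k(2)[OF y] by blast
    have "u y = u (h (k y) \<oplus>\<^bsub>?D\<^esub> s)" using s by simp
    also have "\<dots> = h (v (k y)) \<oplus>\<^bsub>?D\<^esub> u s"
      using hS[OF k(1)[OF y]] S'.a_Hcarr[OF s(1)] k(1)[OF y] by (simp add: u v)
    finally show ?thesis by (rule ku[OF u(1)[OF y] v(1)[OF k(1)[OF y]] u(3)[OF s(1)]])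
  qed
  note lD = direct_power_acts(1)[OF lN, of m] and rD = direct_power_acts(2)[OF rN, of m]
  have kl: "k (lact ?D c y) = lact M c (k y)" if "c \<in> L" "y \<in> carrier ?D" for c y
    using S' that acts_onD[OF lM] acts_onD[OF lD] hl
    by (intro kop[where v="lact M c" and u="lact ?D c"]) (auto simp: sub_bimodule_def)
  have kr: "k (ract ?D y c) = ract M (k y) c" if "c \<in> R" "y \<in> carrier ?D" for c y
    using S' that acts_onD[OF rM] acts_onD[OF rD] hr
    by (intro kop[where v="\<lambda>x. ract M x c" and u="\<lambda>y. ract ?D y c"]) (auto simp: sub_bimodule_def)
  define e where "e i z = (\<lambda>j\<in>{..<m}. if i = j then z else \<zero>\<^bsub>N\<^esub>)" for i :: nat and z
  have ec: "z \<in> carrier N \<Longrightarrow> e i z \<in> carrier ?D" for i z by (auto simp: e_def direct_power_def)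
  have ea: "e i (x \<oplus>\<^bsub>N\<^esub> z) = e i x \<oplus>\<^bsub>?D\<^esub> e i z" if "x \<in> carrier N" "z \<in> carrier N" for i x z
    using that by (auto simp: e_def direct_power_def fun_eq_iff)
  have l0: "lact N c \<zero>\<^bsub>N\<^esub> = \<zero>\<^bsub>N\<^esub>" if "c \<in> L" for c
    using additive_zero[OF N N, of "lact N c"] acts_onD[OF lN] that by blast
  have r0: "ract N \<zero>\<^bsub>N\<^esub> c = \<zero>\<^bsub>N\<^esub>" if "c \<in> R" for c
    using additive_zero[OF N N, of "\<lambda>x. ract N x c"] rN that unfolding acts_on_def by blast
  have el: "e i (lact N c z) = lact ?D c (e i z)" if "c \<in> L" for i c z
    using that by (auto simp: e_def direct_power_def fun_eq_iff l0)
  have er: "e i (ract N z c) = ract ?D (e i z) c" if "c \<in> R" for i c z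
    using that by (auto simp: e_def direct_power_def fun_eq_iff r0)
  have dec: "(\<Oplus>\<^bsub>?D\<^esub>i\<in>{..<m}. e i (y i)) = y" if y: "y \<in> carrier ?D" for y
  proof -
    have yc: "y i \<in> carrier N" if "i < m" for i using y that by (auto simp: direct_power_def)
    then have ey: "e i (y i) \<in> carrier ?D" if "i \<in> {..<m}" for i using that ec by auto
    have sc: "(\<Oplus>\<^bsub>?D\<^esub>i\<in>{..<m}. e i (y i)) \<in> carrier ?D" using ey by (intro D.finsum_closed) auto
    have "(\<Oplus>\<^bsub>?D\<^esub>i\<in>{..<m}. e i (y i)) j = y j" if j: "j < m" for j
    proof -
      have "(\<Oplus>\<^bsub>?D\<^esub>i\<in>{..<m}. e i (y i)) j = (\<Oplus>\<^bsub>N\<^esub>i\<in>{..<m}. e i (y i) j)"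
        by (rule direct_power_finsum[OF N ey _ j]) auto
      also have "\<dots> = (\<Oplus>\<^bsub>N\<^esub>i\<in>{..<m}. if j = i then y i else \<zero>\<^bsub>N\<^esub>)"
        using j yc by (intro N.finsum_cong') (auto simp: e_def)
      also have "\<dots> = y j" using j yc by (subst N.finsum_singleton) auto
      finally show ?thesis .
    qed
    then show ?thesis using y sc
      by (intro extensionalityI[of _ "{..<m}"]) (auto simp: direct_power_def PiE_def)
  qed
  have "(\<Oplus>\<^bsub>M\<^esub>i\<in>{..<m}. k (e i (h x i))) = x" if x: "x \<in> carrier M" for x
  proof -
    have yc: "h x i \<in> carrier N" if "i < m" for i using hS[OF x] that by (auto simp: direct_power_def)
    have "(\<Oplus>\<^bsub>M\<^esub>i\<in>{..<m}. k (e i (h x i))) = k (\<Oplus>\<^bsub>?D\<^esub>i\<in>{..<m}. e i (h x i))"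
      by (rule additive_finsum[OF D.abelian_group_axioms M, symmetric]) (auto simp: k ka ec yc)
    then show ?thesis using dec[OF hS(2)[OF x]] kh[OF x] by simp
  qed
  moreover have "(\<lambda>x. h x i) \<in> bihom L R M (lact M) (\<lambda>c x. ract M x c) N (lact N) (\<lambda>c x. ract N x c)"
    if "i < m" for i
    using that hS(2) unfolding bihom_def by (auto simp: ha hl hr) (auto simp: direct_power_def)
  moreover have "(\<lambda>z. k (e i z)) \<in> bihom L R N (lact N) (\<lambda>c x. ract N x c) M (lact M) (\<lambda>c x. ract M x c)"
    if "i < m" for i
    unfolding bihom_def by (auto simp: k ka kl kr ec ea el er)
  ultimately show ?thesis unfolding retract_of_power_def
    by (intro exI[of _ m] exI[of _ "\<lambda>i x. h x i"] exI[of _ "\<lambda>i z. k (e i z)"]) auto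
qed

lemma summand_iff_retract:
  fixes M :: "('k, 'c, 'a) bimodule" and N :: "('k, 'c, 'b) bimodule"
  assumes "abelian_group M" "abelian_group N"
    "acts_on L (lact M) M" "acts_on R (\<lambda>c x. ract M x c) M"
    "acts_on L (lact N) N" "acts_on R (\<lambda>c x. ract N x c) N"
  shows "(\<exists>m. direct_summand L R M (direct_power m N)) \<longleftrightarrow>
    retract_of_power L R M (lact M) (\<lambda>c x. ract M x c) N (lact N) (\<lambda>c x. ract N x c)"
proof
  assume "\<exists>m. direct_summand L R M (direct_power m N)"
  then show "retract_of_power L R M (lact M) (\<lambda>c x. ract M x c) N (lact N) (\<lambda>c x. ract N x c)"
    using summand_imp_retract[OF assms] by blast
next
  assume "retract_of_power L R M (lact M) (\<lambda>c x. ract M x c) N (lact N) (\<lambda>c x. ract N x c)"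
  then obtain m f g where
    "\<forall>i<m. f i \<in> bihom L R M (lact M) (\<lambda>c x. ract M x c) N (lact N) (\<lambda>c x. ract N x c) \<and>
      g i \<in> bihom L R N (lact N) (\<lambda>c x. ract N x c) M (lact M) (\<lambda>c x. ract M x c)"
    "\<forall>x\<in>carrier M. (\<Oplus>\<^bsub>M\<^esub>i\<in>{..<m::nat}. g i (f i x)) = x"
    unfolding retract_of_power_def by blast
  then show "\<exists>m. direct_summand L R M (direct_power m N)"
    using retract_imp_summand[OF assms, of m f g] by blast
qed

section \<open>Bimodules that are free on one side\<close>

lemma (in abelian_monoid) finsum_swap:
  assumes "finite A" "finite B" "\<And>i j. \<lbrakk>i \<in> A; j \<in> B\<rbrakk> \<Longrightarrow> f i j \<in> carrier G"
  shows "(\<Oplus>i\<in>A. \<Oplus>j\<in>B. f i j) = (\<Oplus>j\<in>B. \<Oplus>i\<in>A. f i j)"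
  using assms(1,3)
proof (induction A)
  case empty
  then show ?case by (simp add: finsum_zero)
next
  case (insert a A)
  have "(\<Oplus>j\<in>B. \<Oplus>i\<in>insert a A. f i j) = (\<Oplus>j\<in>B. f a j \<oplus> (\<Oplus>i\<in>A. f i j))"
    using insert by (intro finsum_cong') (auto intro!: finsum_insert)
  also have "\<dots> = (\<Oplus>j\<in>B. f a j) \<oplus> (\<Oplus>j\<in>B. \<Oplus>i\<in>A. f i j)"
    using insert.prems by (intro finsum_addf) auto
  also have "\<dots> = (\<Oplus>i\<in>insert a A. \<Oplus>j\<in>B. f i j)"
    using insert by (subst finsum_insert) auto
  finally show ?case by simp
qed

lemma (in ring) finsum_mat_assoc:
  assumes fin: "finite I" "finite J"
    and u: "\<And>i. i \<in> I \<Longrightarrow> u i \<in> carrier R" and X: "\<And>i j. \<lbrakk>i \<in> I; j \<in> J\<rbrakk> \<Longrightarrow> X i j \<in> carrier R"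
    and Y: "\<And>j. j \<in> J \<Longrightarrow> Y j \<in> carrier R"
  shows "(\<Oplus>j\<in>J. (\<Oplus>i\<in>I. u i \<otimes> X i j) \<otimes> Y j) = (\<Oplus>i\<in>I. u i \<otimes> (\<Oplus>j\<in>J. X i j \<otimes> Y j))"
proof -
  have "(\<Oplus>j\<in>J. (\<Oplus>i\<in>I. u i \<otimes> X i j) \<otimes> Y j) = (\<Oplus>j\<in>J. \<Oplus>i\<in>I. u i \<otimes> (X i j \<otimes> Y j))"
    using assms by (intro finsum_cong') (auto simp: finsum_ldistr m_assoc intro!: finsum_cong')
  also have "\<dots> = (\<Oplus>i\<in>I. \<Oplus>j\<in>J. u i \<otimes> (X i j \<otimes> Y j))"
    using assms by (intro finsum_swap) auto
  also have "\<dots> = (\<Oplus>i\<in>I. u i \<otimes> (\<Oplus>j\<in>J. X i j \<otimes> Y j))"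
    using assms by (intro finsum_cong') (auto simp: finsum_rdistr intro!: finsum_cong')
  finally show ?thesis .
qed

lemma (in ring) finsum_delta_right:
  assumes "finite I" "k \<in> I" "\<And>i. i \<in> I \<Longrightarrow> u i \<in> carrier R"
  shows "(\<Oplus>i\<in>I. u i \<otimes> (if i = k then \<one> else \<zero>)) = u k"
proof -
  have "(\<Oplus>i\<in>I. u i \<otimes> (if i = k then \<one> else \<zero>)) = (\<Oplus>i\<in>I. if k = i then u i else \<zero>)"
    using assms by (intro finsum_cong') auto
  also have "\<dots> = u k" using assms by (intro finsum_singleton) auto
  finally show ?thesis .
qed

lemma (in ring) finsum_delta_left:
  assumes "finite I" "k \<in> I" "\<And>i. i \<in> I \<Longrightarrow> u i \<in> carrier R"
  shows "(\<Oplus>i\<in>I. (if i = k then \<one> else \<zero>) \<otimes> u i) = u k"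
proof -
  have "(\<Oplus>i\<in>I. (if i = k then \<one> else \<zero>) \<otimes> u i) = (\<Oplus>i\<in>I. if k = i then u i else \<zero>)"
    using assms by (intro finsum_cong') auto
  also have "\<dots> = u k" using assms by (intro finsum_singleton) auto
  finally show ?thesis .
qed

text \<open>Row vectors over \<open>W\<close> with s acting by the matrix p(s), and likewise over
  \<open>V\<close> with q: the condition p(s) a = a q(s) says that multiplication by
  \<open>a\<close> is a map of right modules.\<close>

definition intertwines ::
    "('k, 'm) ring_scheme \<Rightarrow> 's set \<Rightarrow> 'w set \<Rightarrow> ('w \<Rightarrow> 'w \<Rightarrow> 's \<Rightarrow> 'k) \<Rightarrow> 'v set \<Rightarrow> ('v \<Rightarrow> 'v \<Rightarrow> 's \<Rightarrow> 'k) \<Rightarrow>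
      ('w \<Rightarrow> 'v \<Rightarrow> 'k) \<Rightarrow> bool"
  where "intertwines K S W p V q a \<longleftrightarrow> (\<forall>i\<in>W. \<forall>k\<in>V. a i k \<in> carrier K) \<and>
    (\<forall>s\<in>S. \<forall>i\<in>W. \<forall>k\<in>V. (\<Oplus>\<^bsub>K\<^esub>j\<in>W. p i j s \<otimes>\<^bsub>K\<^esub> a j k) = (\<Oplus>\<^bsub>K\<^esub>j\<in>V. a i j \<otimes>\<^bsub>K\<^esub> q j k s))"

text \<open>The matrix form of being a direct summand of a finite power: the products of the pairs
  of intertwining matrices add up to the identity matrix.\<close>

definition mat_retract ::
    "('k, 'm) ring_scheme \<Rightarrow> 's set \<Rightarrow> 'w set \<Rightarrow> ('w \<Rightarrow> 'w \<Rightarrow> 's \<Rightarrow> 'k) \<Rightarrow> 'v set \<Rightarrow> ('v \<Rightarrow> 'v \<Rightarrow> 's \<Rightarrow> 'k) \<Rightarrow> bool"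
  where "mat_retract K S W p V q \<longleftrightarrow> (\<exists>m a b.
    (\<forall>t<m. intertwines K S W p V q (a t) \<and> intertwines K S V q W p (b t)) \<and>
    (\<forall>i\<in>W. \<forall>k\<in>W. (\<Oplus>\<^bsub>K\<^esub>t\<in>{..<m::nat}. \<Oplus>\<^bsub>K\<^esub>j\<in>V. a t i j \<otimes>\<^bsub>K\<^esub> b t j k) =
      (if i = k then \<one>\<^bsub>K\<^esub> else \<zero>\<^bsub>K\<^esub>)))"

text \<open>The operators \<open>lam a\<close> make \<open>M\<close> a free \<open>A\<close>-module with coordinate functions \<open>\<theta> w\<close>, and \<open>rho s\<close>
  acts on coordinates by the matrix \<open>P\<close>.\<close>

definition free_over ::
    "('a, 'r) ring_scheme \<Rightarrow> 's set \<Rightarrow> ('k, 'b, 'x) module_scheme \<Rightarrow> ('a \<Rightarrow> 'b \<Rightarrow> 'b) \<Rightarrow> ('s \<Rightarrow> 'b \<Rightarrow> 'b) \<Rightarrow>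
      'w set \<Rightarrow> ('w \<Rightarrow> 'b \<Rightarrow> 'a) \<Rightarrow> ('w \<Rightarrow> 'w \<Rightarrow> 's \<Rightarrow> 'a) \<Rightarrow> bool"
  where "free_over A S M lam rho W \<theta> P \<longleftrightarrow> abelian_group M \<and> finite W \<and>
    (\<forall>w\<in>W. \<forall>x\<in>carrier M. \<theta> w x \<in> carrier A) \<and>
    (\<forall>w\<in>W. \<forall>x\<in>carrier M. \<forall>y\<in>carrier M. \<theta> w (x \<oplus>\<^bsub>M\<^esub> y) = \<theta> w x \<oplus>\<^bsub>A\<^esub> \<theta> w y) \<and>
    (\<forall>b\<in>W \<rightarrow> carrier A. \<exists>x\<in>carrier M. \<forall>w\<in>W. \<theta> w x = b w) \<and>
    (\<forall>x\<in>carrier M. \<forall>y\<in>carrier M. (\<forall>w\<in>W. \<theta> w x = \<theta> w y) \<longrightarrow> x = y) \<and>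
    (\<forall>a\<in>carrier A. \<forall>x\<in>carrier M. lam a x \<in> carrier M \<and> (\<forall>w\<in>W. \<theta> w (lam a x) = a \<otimes>\<^bsub>A\<^esub> \<theta> w x)) \<and>
    (\<forall>s\<in>S. \<forall>x\<in>carrier M. rho s x \<in> carrier M \<and>
      (\<forall>w\<in>W. \<theta> w (rho s x) = (\<Oplus>\<^bsub>A\<^esub>i\<in>W. \<theta> i x \<otimes>\<^bsub>A\<^esub> P i w s))) \<and>
    (\<forall>s\<in>S. \<forall>i\<in>W. \<forall>j\<in>W. P i j s \<in> carrier A)"

text \<open>Instantiated with H and with the opposite algebra of S, both augmented by the counit, so
  that the two towers share one matrix argument.\<close>

locale augmented_algebra = base_field K for K :: "('k, 'm) ring_scheme" (structure) +
  fixes A :: "('k, 'c, 'z) module_scheme" and eps :: "'c \<Rightarrow> 'k"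
  assumes alg: "algebra_over K A"
    and eps_hom: "eps \<in> ring_hom A K"
    and eps_smult: "\<lbrakk>c \<in> carrier K; x \<in> carrier A\<rbrakk> \<Longrightarrow> eps (c \<odot>\<^bsub>A\<^esub> x) = c \<otimes> eps x"
begin

sublocale A: algebra_over K A by (rule alg)

abbreviation scal where "scal c \<equiv> c \<odot>\<^bsub>A\<^esub> \<one>\<^bsub>A\<^esub>"

lemma A_vs: "Module.module K A"
  by (rule A.module_axioms)

lemma scal_mult: "\<lbrakk>c \<in> carrier K; d \<in> carrier K; x \<in> carrier A\<rbrakk> \<Longrightarrow> (c \<odot>\<^bsub>A\<^esub> x) \<otimes>\<^bsub>A\<^esub> scal d = (c \<otimes> d) \<odot>\<^bsub>A\<^esub> x"
  and mult_scal: "\<lbrakk>c \<in> carrier K; d \<in> carrier K; x \<in> carrier A\<rbrakk> \<Longrightarrow> scal d \<otimes>\<^bsub>A\<^esub> (c \<odot>\<^bsub>A\<^esub> x) = (d \<otimes> c) \<odot>\<^bsub>A\<^esub> x"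
  by (simp_all add: A.smult_mult_left A.smult_mult_right A.smult_assoc1[symmetric] m_comm)

lemma eps_closed: "x \<in> carrier A \<Longrightarrow> eps x \<in> carrier K"
  and eps_mult: "\<lbrakk>x \<in> carrier A; y \<in> carrier A\<rbrakk> \<Longrightarrow> eps (x \<otimes>\<^bsub>A\<^esub> y) = eps x \<otimes> eps y"
  and eps_add: "\<lbrakk>x \<in> carrier A; y \<in> carrier A\<rbrakk> \<Longrightarrow> eps (x \<oplus>\<^bsub>A\<^esub> y) = eps x \<oplus> eps y"
  and eps_one: "eps \<one>\<^bsub>A\<^esub> = \<one>"
  using eps_hom by (auto simp: ring_hom_def)

lemma A_group: "abelian_group A"
  by (rule A.M.abelian_group_axioms)

lemma eps_finsum:
  assumes "finite I" "\<And>i. i \<in> I \<Longrightarrow> f i \<in> carrier A"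
  shows "eps (\<Oplus>\<^bsub>A\<^esub>i\<in>I. f i) = (\<Oplus>i\<in>I. eps (f i))"
  by (rule additive_finsum[OF A_group is_abelian_group eps_closed eps_add assms(2,1)])

lemma eps_zero: "eps \<zero>\<^bsub>A\<^esub> = \<zero>"
  using eps_finsum[of "{}"] by simp

lemma smult_sum_left:
  assumes "finite I" "\<And>i. i \<in> I \<Longrightarrow> f i \<in> carrier K" "x \<in> carrier A"
  shows "(\<Oplus>i\<in>I. f i) \<odot>\<^bsub>A\<^esub> x = (\<Oplus>\<^bsub>A\<^esub>i\<in>I. f i \<odot>\<^bsub>A\<^esub> x)"
  using assms by (intro additive_finsum[OF is_abelian_group A_group, where f="\<lambda>c. c \<odot>\<^bsub>A\<^esub> x"])
    (auto simp: A.smult_l_distr)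

end

lemma free_overD:
  assumes "free_over A S M lam rho W \<theta> P"
  shows "abelian_group M" "finite W"
    and "\<And>w x. \<lbrakk>w \<in> W; x \<in> carrier M\<rbrakk> \<Longrightarrow> \<theta> w x \<in> carrier A"
    and "\<And>w x y. \<lbrakk>w \<in> W; x \<in> carrier M; y \<in> carrier M\<rbrakk> \<Longrightarrow> \<theta> w (x \<oplus>\<^bsub>M\<^esub> y) = \<theta> w x \<oplus>\<^bsub>A\<^esub> \<theta> w y"
    and "\<And>b. b \<in> W \<rightarrow> carrier A \<Longrightarrow> \<exists>x\<in>carrier M. \<forall>w\<in>W. \<theta> w x = b w"
    and "\<And>x y. \<lbrakk>x \<in> carrier M; y \<in> carrier M; \<And>w. w \<in> W \<Longrightarrow> \<theta> w x = \<theta> w y\<rbrakk> \<Longrightarrow> x = y"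
    and "\<And>a x. \<lbrakk>a \<in> carrier A; x \<in> carrier M\<rbrakk> \<Longrightarrow> lam a x \<in> carrier M"
    and "\<And>a x w. \<lbrakk>a \<in> carrier A; x \<in> carrier M; w \<in> W\<rbrakk> \<Longrightarrow> \<theta> w (lam a x) = a \<otimes>\<^bsub>A\<^esub> \<theta> w x"
    and "\<And>s x. \<lbrakk>s \<in> S; x \<in> carrier M\<rbrakk> \<Longrightarrow> rho s x \<in> carrier M"
    and "\<And>s x w. \<lbrakk>s \<in> S; x \<in> carrier M; w \<in> W\<rbrakk> \<Longrightarrow> \<theta> w (rho s x) = (\<Oplus>\<^bsub>A\<^esub>i\<in>W. \<theta> i x \<otimes>\<^bsub>A\<^esub> P i w s)"
    and "\<And>s i j. \<lbrakk>s \<in> S; i \<in> W; j \<in> W\<rbrakk> \<Longrightarrow> P i j s \<in> carrier A"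
  using assms unfolding free_over_def by blast+

context augmented_algebra
begin

lemma unit_vectors:
  assumes "free_over A S M lam rho W \<theta> P"
  obtains c where "\<And>i. c i \<in> carrier M" "\<And>i w. w \<in> W \<Longrightarrow> \<theta> w (c i) = (if w = i then \<one>\<^bsub>A\<^esub> else \<zero>\<^bsub>A\<^esub>)"
proof -
  have "\<exists>x. x \<in> carrier M \<and> (\<forall>w\<in>W. \<theta> w x = (if w = i then \<one>\<^bsub>A\<^esub> else \<zero>\<^bsub>A\<^esub>))" for i
    using free_overD(5)[OF assms, of "\<lambda>w. if w = i then \<one>\<^bsub>A\<^esub> else \<zero>\<^bsub>A\<^esub>"] by auto
  then show thesis using that by metis
qed

lemma coordinates_expand:
  assumes F: "free_over A S M lam rho W \<theta> P"
    and c: "\<And>i. c i \<in> carrier M" "\<And>i w. w \<in> W \<Longrightarrow> \<theta> w (c i) = (if w = i then \<one>\<^bsub>A\<^esub> else \<zero>\<^bsub>A\<^esub>)"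
    and x: "x \<in> carrier M"
  shows "x = (\<Oplus>\<^bsub>M\<^esub>i\<in>W. lam (\<theta> i x) (c i))"
proof (rule free_overD(6)[OF F x])
  note F = free_overD[OF F]
  interpret M: abelian_group M by (rule F)
  have lc: "lam (\<theta> i x) (c i) \<in> carrier M" if "i \<in> W" for i
    using that by (intro F c x)
  show "(\<Oplus>\<^bsub>M\<^esub>i\<in>W. lam (\<theta> i x) (c i)) \<in> carrier M"
    using lc by (intro M.finsum_closed) auto
  fix w assume w: "w \<in> W"
  have "\<theta> w (\<Oplus>\<^bsub>M\<^esub>i\<in>W. lam (\<theta> i x) (c i)) = (\<Oplus>\<^bsub>A\<^esub>i\<in>W. \<theta> w (lam (\<theta> i x) (c i)))"
    using w by (intro additive_finsum[OF F(1) A_group] F(2,3,4) lc)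
  also have "\<dots> = (\<Oplus>\<^bsub>A\<^esub>i\<in>W. \<theta> i x \<otimes>\<^bsub>A\<^esub> (if i = w then \<one>\<^bsub>A\<^esub> else \<zero>\<^bsub>A\<^esub>))"
    using w x by (intro A.finsum_cong') (auto simp: F(3) F(8) c)
  also have "\<dots> = \<theta> w x" using w x F(2,3) by (intro A.finsum_delta_right) auto
  finally show "\<theta> w x = \<theta> w (\<Oplus>\<^bsub>M\<^esub>i\<in>W. lam (\<theta> i x) (c i))" by simp
qed

lemma eps_finsum_prod:
  assumes "finite J" "\<And>j. j \<in> J \<Longrightarrow> u j \<in> carrier A" "\<And>j. j \<in> J \<Longrightarrow> v j \<in> carrier A"
  shows "eps (\<Oplus>\<^bsub>A\<^esub>j\<in>J. u j \<otimes>\<^bsub>A\<^esub> v j) = (\<Oplus>j\<in>J. eps (u j) \<otimes> eps (v j))"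
proof -
  have "eps (\<Oplus>\<^bsub>A\<^esub>j\<in>J. u j \<otimes>\<^bsub>A\<^esub> v j) = (\<Oplus>j\<in>J. eps (u j \<otimes>\<^bsub>A\<^esub> v j))"
    using assms by (intro eps_finsum) auto
  also have "\<dots> = (\<Oplus>j\<in>J. eps (u j) \<otimes> eps (v j))"
    using assms by (intro finsum_cong') (auto simp: eps_mult eps_closed)
  finally show ?thesis .
qed

context
  fixes M :: "('l, 'b, 'x) module_scheme" and M' :: "('l, 'b2, 'x2) module_scheme"
    and S :: "'s set" and lam rho lam' rho' and W :: "'w set" and W' :: "'w2 set" and \<theta> P \<theta>' P'
  assumes F: "free_over A S M lam rho W \<theta> P" and F': "free_over A S M' lam' rho' W' \<theta>' P'"
begin

lemma hom_matrix:
  assumes f: "f \<in> bihom (carrier A) S M lam rho M' lam' rho'"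
    and c: "\<And>i. c i \<in> carrier M" "\<And>i w. w \<in> W \<Longrightarrow> \<theta> w (c i) = (if w = i then \<one>\<^bsub>A\<^esub> else \<zero>\<^bsub>A\<^esub>)"
    and x: "x \<in> carrier M" and j: "j \<in> W'"
  shows "\<theta>' j (f x) = (\<Oplus>\<^bsub>A\<^esub>i\<in>W. \<theta> i x \<otimes>\<^bsub>A\<^esub> \<theta>' j (f (c i)))"
proof -
  note D = free_overD[OF F] and D' = free_overD[OF F'] and f = bihomD[OF f]
  have lc: "lam (\<theta> i x) (c i) \<in> carrier M" if "i \<in> W" for i
    using that by (intro D c x)
  have "\<theta>' j (f x) = \<theta>' j (f (\<Oplus>\<^bsub>M\<^esub>i\<in>W. lam (\<theta> i x) (c i)))" using coordinates_expand[OF F c x] by simp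
  also have "\<dots> = (\<Oplus>\<^bsub>A\<^esub>i\<in>W. \<theta>' j (f (lam (\<theta> i x) (c i))))"
    using j by (intro additive_finsum[OF D(1) A_group, where f="\<lambda>z. \<theta>' j (f z)"] D(2) lc)
      (auto simp: f D')
  also have "\<dots> = (\<Oplus>\<^bsub>A\<^esub>i\<in>W. \<theta> i x \<otimes>\<^bsub>A\<^esub> \<theta>' j (f (c i)))"
    using j x by (intro A.finsum_cong') (auto simp: D(3) f c D'(3,8))
  finally show ?thesis .
qed

text \<open>Compute the coordinates of f(rho s (c i)) twice: once by \<open>hom_matrix\<close>, once
  by moving rho past \<open>f\<close>. This gives P X = X P' over \<open>A\<close>, and
  \<open>eps\<close> carries it to scalars because it is a ring homomorphism.\<close>

lemma hom_intertwines:
  assumes f: "f \<in> bihom (carrier A) S M lam rho M' lam' rho'"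
    and c: "\<And>i. c i \<in> carrier M" "\<And>i w. w \<in> W \<Longrightarrow> \<theta> w (c i) = (if w = i then \<one>\<^bsub>A\<^esub> else \<zero>\<^bsub>A\<^esub>)"
    and p: "\<And>s i j. \<lbrakk>s \<in> S; i \<in> W; j \<in> W\<rbrakk> \<Longrightarrow> eps (P i j s) = p i j s"
    and p': "\<And>s i j. \<lbrakk>s \<in> S; i \<in> W'; j \<in> W'\<rbrakk> \<Longrightarrow> eps (P' i j s) = p' i j s"
  shows "intertwines K S W p W' p' (\<lambda>i j. eps (\<theta>' j (f (c i))))"
  unfolding intertwines_def
proof (intro conjI ballI)
  note D = free_overD[OF F] and D' = free_overD[OF F'] and fD = bihomD[OF f]
  show "eps (\<theta>' k (f (c i))) \<in> carrier K" if "k \<in> W'" for i k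
    using that by (intro eps_closed D' fD c)
  fix s i k assume s: "s \<in> S" and i: "i \<in> W" and k: "k \<in> W'"
  have P: "\<theta> j (rho s (c i)) = P i j s" if j: "j \<in> W" for j
  proof -
    have "\<theta> j (rho s (c i)) = (\<Oplus>\<^bsub>A\<^esub>l\<in>W. (if l = i then \<one>\<^bsub>A\<^esub> else \<zero>\<^bsub>A\<^esub>) \<otimes>\<^bsub>A\<^esub> P l j s)"
      unfolding D(10)[OF s c(1) j] using j s by (intro A.finsum_cong') (auto simp: c D(11))
    also have "\<dots> = P i j s" using i j s D by (intro A.finsum_delta_left) auto
    finally show ?thesis .
  qed
  have "(\<Oplus>j\<in>W. p i j s \<otimes> eps (\<theta>' k (f (c j)))) = (\<Oplus>j\<in>W. eps (\<theta> j (rho s (c i))) \<otimes> eps (\<theta>' k (f (c j))))"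
    using s i k by (intro finsum_cong') (auto simp: P p[symmetric] D(11) D'(3) fD(1) c(1) eps_closed)
  also have "\<dots> = eps (\<Oplus>\<^bsub>A\<^esub>j\<in>W. \<theta> j (rho s (c i)) \<otimes>\<^bsub>A\<^esub> \<theta>' k (f (c j)))"
    using k by (intro eps_finsum_prod[symmetric] D(2,3) D'(3) D(9)[OF s] fD(1) c(1))
  also have "(\<Oplus>\<^bsub>A\<^esub>j\<in>W. \<theta> j (rho s (c i)) \<otimes>\<^bsub>A\<^esub> \<theta>' k (f (c j))) = \<theta>' k (f (rho s (c i)))"
    by (rule hom_matrix[OF f c D(9)[OF s c(1)] k, symmetric])
  also have "\<dots> = (\<Oplus>\<^bsub>A\<^esub>j\<in>W'. \<theta>' j (f (c i)) \<otimes>\<^bsub>A\<^esub> P' j k s)"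
    unfolding fD(4)[OF s c(1)] by (rule D'(10)[OF s fD(1)[OF c(1)] k])
  also have "eps \<dots> = (\<Oplus>j\<in>W'. eps (\<theta>' j (f (c i))) \<otimes> eps (P' j k s))"
    using k s by (intro eps_finsum_prod D'(2,3,11) fD(1) c(1))
  also have "\<dots> = (\<Oplus>j\<in>W'. eps (\<theta>' j (f (c i))) \<otimes> p' j k s)"
    using s k by (intro finsum_cong') (auto simp: p'[symmetric] D'(3,11) fD(1) c(1) eps_closed)
  finally show "(\<Oplus>j\<in>W. p i j s \<otimes> eps (\<theta>' k (f (c j)))) = (\<Oplus>j\<in>W'. eps (\<theta>' j (f (c i))) \<otimes> p' j k s)" .
qed

text \<open>Multiplying the coordinate row on the right by a matrix commutes with the action of
  \<open>A\<close> on the left, and \<open>comm\<close> makes it commute with rho.\<close>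

lemma matrix_hom:
  assumes a: "\<And>i j. \<lbrakk>i \<in> W; j \<in> W'\<rbrakk> \<Longrightarrow> a i j \<in> carrier K"
    and comm: "\<And>s i k. \<lbrakk>s \<in> S; i \<in> W; k \<in> W'\<rbrakk> \<Longrightarrow>
      (\<Oplus>\<^bsub>A\<^esub>j\<in>W. P i j s \<otimes>\<^bsub>A\<^esub> scal (a j k)) = (\<Oplus>\<^bsub>A\<^esub>j\<in>W'. scal (a i j) \<otimes>\<^bsub>A\<^esub> P' j k s)"
  obtains f where "f \<in> bihom (carrier A) S M lam rho M' lam' rho'"
    and "\<And>x k. \<lbrakk>x \<in> carrier M; k \<in> W'\<rbrakk> \<Longrightarrow> \<theta>' k (f x) = (\<Oplus>\<^bsub>A\<^esub>i\<in>W. \<theta> i x \<otimes>\<^bsub>A\<^esub> scal (a i k))"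
proof -
  note F = free_overD[OF F] and F' = free_overD[OF F']
  have ac: "scal (a i j) \<in> carrier A" if "i \<in> W" "j \<in> W'" for i j using a that by auto
  have "\<exists>z. z \<in> carrier M' \<and> (\<forall>k\<in>W'. \<theta>' k z = (\<Oplus>\<^bsub>A\<^esub>i\<in>W. \<theta> i x \<otimes>\<^bsub>A\<^esub> scal (a i k)))" if "x \<in> carrier M" for x
    using F'(5)[of "\<lambda>k. \<Oplus>\<^bsub>A\<^esub>i\<in>W. \<theta> i x \<otimes>\<^bsub>A\<^esub> scal (a i k)"] F(3)[OF _ that] ac by fastforce
  then obtain f where f: "f x \<in> carrier M'" "k \<in> W' \<Longrightarrow> \<theta>' k (f x) = (\<Oplus>\<^bsub>A\<^esub>i\<in>W. \<theta> i x \<otimes>\<^bsub>A\<^esub> scal (a i k))"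
    if "x \<in> carrier M" for x k by metis
  interpret M: abelian_group M by (rule F)
  interpret M': abelian_group M' by (rule F')
  have "f \<in> bihom (carrier A) S M lam rho M' lam' rho'"
    unfolding bihom_def mem_Collect_eq
  proof (intro conjI ballI)
    fix x y assume x: "x \<in> carrier M" and y: "y \<in> carrier M"
    show "f (x \<oplus>\<^bsub>M\<^esub> y) = f x \<oplus>\<^bsub>M'\<^esub> f y"
    proof (rule F'(6))
      fix k assume k: "k \<in> W'"
      have "\<theta>' k (f (x \<oplus>\<^bsub>M\<^esub> y)) = (\<Oplus>\<^bsub>A\<^esub>i\<in>W. \<theta> i x \<otimes>\<^bsub>A\<^esub> scal (a i k) \<oplus>\<^bsub>A\<^esub> \<theta> i y \<otimes>\<^bsub>A\<^esub> scal (a i k))"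
        unfolding f(2)[OF M.a_closed[OF x y] k]
        using x y k by (intro A.finsum_cong') (auto simp: F ac A.l_distr)
      also have "\<dots> = \<theta>' k (f x) \<oplus>\<^bsub>A\<^esub> \<theta>' k (f y)"
        unfolding f(2)[OF x k] f(2)[OF y k] using x y k by (intro A.finsum_addf) (auto simp: F ac)
      finally show "\<theta>' k (f (x \<oplus>\<^bsub>M\<^esub> y)) = \<theta>' k (f x \<oplus>\<^bsub>M'\<^esub> f y)" using x y k by (simp add: F' f(1))
    qed (use x y f in auto)
  next
    fix c x assume c: "c \<in> carrier A" and x: "x \<in> carrier M"
    show "f (lam c x) = lam' c (f x)"
    proof (rule F'(6))
      fix k assume k: "k \<in> W'"
      have "\<theta>' k (f (lam c x)) = (\<Oplus>\<^bsub>A\<^esub>i\<in>W. c \<otimes>\<^bsub>A\<^esub> (\<theta> i x \<otimes>\<^bsub>A\<^esub> scal (a i k)))"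
        unfolding f(2)[OF F(7)[OF c x] k]
        using x c k by (intro A.finsum_cong') (auto simp: F ac A.m_assoc)
      also have "\<dots> = \<theta>' k (lam' c (f x))"
        using x c k by (simp add: F'(8) f) (intro A.finsum_rdistr[symmetric], auto simp: F ac)
      finally show "\<theta>' k (f (lam c x)) = \<theta>' k (lam' c (f x))" .
    qed (use x c f F F' in auto)
  next
    fix s x assume s: "s \<in> S" and x: "x \<in> carrier M"
    show "f (rho s x) = rho' s (f x)"
    proof (rule F'(6))
      fix k assume k: "k \<in> W'"
      have "\<theta>' k (f (rho s x)) = (\<Oplus>\<^bsub>A\<^esub>j\<in>W. (\<Oplus>\<^bsub>A\<^esub>i\<in>W. \<theta> i x \<otimes>\<^bsub>A\<^esub> P i j s) \<otimes>\<^bsub>A\<^esub> scal (a j k))"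
        unfolding f(2)[OF F(9)[OF s x] k]
        using x s k by (intro A.finsum_cong') (auto simp: F(3,10,11) ac intro!: A.finsum_closed)
      also have "\<dots> = (\<Oplus>\<^bsub>A\<^esub>i\<in>W. \<theta> i x \<otimes>\<^bsub>A\<^esub> (\<Oplus>\<^bsub>A\<^esub>j\<in>W. P i j s \<otimes>\<^bsub>A\<^esub> scal (a j k)))"
        using s x k by (intro A.finsum_mat_assoc F ac)
      also have "\<dots> = (\<Oplus>\<^bsub>A\<^esub>i\<in>W. \<theta> i x \<otimes>\<^bsub>A\<^esub> (\<Oplus>\<^bsub>A\<^esub>j\<in>W'. scal (a i j) \<otimes>\<^bsub>A\<^esub> P' j k s))"
        using s x k by (intro A.finsum_cong') (auto simp: comm F(3) F'(11) ac intro!: A.finsum_closed A.m_closed)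
      also have "\<dots> = (\<Oplus>\<^bsub>A\<^esub>j\<in>W'. (\<Oplus>\<^bsub>A\<^esub>i\<in>W. \<theta> i x \<otimes>\<^bsub>A\<^esub> scal (a i j)) \<otimes>\<^bsub>A\<^esub> P' j k s)"
        using s x k by (intro A.finsum_mat_assoc[symmetric] F F' ac)
      also have "\<dots> = (\<Oplus>\<^bsub>A\<^esub>j\<in>W'. \<theta>' j (f x) \<otimes>\<^bsub>A\<^esub> P' j k s)"
        using s x k by (intro A.finsum_cong') (auto simp: f F(3) F'(3,11) ac intro!: A.finsum_closed)
      also have "\<dots> = \<theta>' k (rho' s (f x))" using s x k by (simp add: F'(10) f(1))
      finally show "\<theta>' k (f (rho s x)) = \<theta>' k (rho' s (f x))" .
    qed (use x s f F F' in auto)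
  qed (use f in auto)
  then show thesis using that f(2) by blast
qed

end

text \<open>Evaluating the sum of the composites at unit vectors turns the identity map into a
  matrix identity over \<open>A\<close>; the augmentation then gives it for the scalar matrices of
  \<open>hom_intertwines\<close>.\<close>

lemma retract_imp_mat:
  assumes F: "free_over A S M lam rho W \<theta> P" and F': "free_over A S M' lam' rho' W' \<theta>' P'"
    and p: "\<And>s i j. \<lbrakk>s \<in> S; i \<in> W; j \<in> W\<rbrakk> \<Longrightarrow> eps (P i j s) = p i j s"
    and p': "\<And>s i j. \<lbrakk>s \<in> S; i \<in> W'; j \<in> W'\<rbrakk> \<Longrightarrow> eps (P' i j s) = p' i j s"
    and r: "retract_of_power (carrier A) S M lam rho M' lam' rho'"
  shows "mat_retract K S W p W' p'"
proof -
  note FD = free_overD[OF F] and FD' = free_overD[OF F']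
  obtain m f g where f: "\<And>t. t < m \<Longrightarrow> f t \<in> bihom (carrier A) S M lam rho M' lam' rho'"
    and g: "\<And>t. t < m \<Longrightarrow> g t \<in> bihom (carrier A) S M' lam' rho' M lam rho"
    and id: "\<And>x. x \<in> carrier M \<Longrightarrow> (\<Oplus>\<^bsub>M\<^esub>t\<in>{..<m::nat}. g t (f t x)) = x"
    using r unfolding retract_of_power_def by blast
  obtain c where c: "\<And>i. c i \<in> carrier M" "\<And>i w. w \<in> W \<Longrightarrow> \<theta> w (c i) = (if w = i then \<one>\<^bsub>A\<^esub> else \<zero>\<^bsub>A\<^esub>)"
    using unit_vectors[OF F] by blast
  obtain c' where c': "\<And>i. c' i \<in> carrier M'" "\<And>i w. w \<in> W' \<Longrightarrow> \<theta>' w (c' i) = (if w = i then \<one>\<^bsub>A\<^esub> else \<zero>\<^bsub>A\<^esub>)"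
    using unit_vectors[OF F'] by blast
  define X where "X t i j = \<theta>' j (f t (c i))" for t i j
  define Y where "Y t i j = \<theta> j (g t (c' i))" for t i j
  have X: "X t i j \<in> carrier A" if "t < m" "j \<in> W'" for t i j
    unfolding X_def using that by (intro FD'(3) bihomD(1)[OF f] c)
  have Y: "Y t i j \<in> carrier A" if "t < m" "j \<in> W" for t i j
    unfolding Y_def using that by (intro FD(3) bihomD(1)[OF g] c')
  have prod: "(\<Oplus>t\<in>{..<m}. \<Oplus>j\<in>W'. eps (X t i j) \<otimes> eps (Y t j k)) = (if i = k then \<one> else \<zero>)"
    if i: "i \<in> W" and k: "k \<in> W" for i k
  proof -
    have gfc: "g t (f t (c i)) \<in> carrier M" "f t (c i) \<in> carrier M'" if "t < m" for t
      using bihomD(1)[OF f[OF that] c(1)] bihomD(1)[OF g[OF that]] by blast+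
    have "(if k = i then \<one>\<^bsub>A\<^esub> else \<zero>\<^bsub>A\<^esub>) = \<theta> k (\<Oplus>\<^bsub>M\<^esub>t\<in>{..<m}. g t (f t (c i)))"
      using id[OF c(1)] c(2)[OF k] by simp
    also have "\<dots> = (\<Oplus>\<^bsub>A\<^esub>t\<in>{..<m}. \<theta> k (g t (f t (c i))))"
      using k gfc by (intro additive_finsum[OF FD(1) A_group] FD) auto
    also have "\<dots> = (\<Oplus>\<^bsub>A\<^esub>t\<in>{..<m}. \<Oplus>\<^bsub>A\<^esub>j\<in>W'. X t i j \<otimes>\<^bsub>A\<^esub> Y t j k)"
      using k gfc X Y
      by (intro A.finsum_cong') (auto simp: hom_matrix[OF F' F g c'] X_def[symmetric] Y_def[symmetric] intro!: A.finsum_closed)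
    finally have "eps (if k = i then \<one>\<^bsub>A\<^esub> else \<zero>\<^bsub>A\<^esub>) = eps (\<Oplus>\<^bsub>A\<^esub>t\<in>{..<m}. \<Oplus>\<^bsub>A\<^esub>j\<in>W'. X t i j \<otimes>\<^bsub>A\<^esub> Y t j k)"
      by simp
    also have "\<dots> = (\<Oplus>t\<in>{..<m}. eps (\<Oplus>\<^bsub>A\<^esub>j\<in>W'. X t i j \<otimes>\<^bsub>A\<^esub> Y t j k))"
      using k by (intro eps_finsum A.finsum_closed) (auto simp: X Y)
    also have "\<dots> = (\<Oplus>t\<in>{..<m}. \<Oplus>j\<in>W'. eps (X t i j) \<otimes> eps (Y t j k))"
      using k FD'(2) by (intro finsum_cong') (auto simp: X Y eps_finsum_prod eps_closed intro!: finsum_closed)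
    finally show ?thesis by (auto simp: eps_one eps_zero)
  qed
  have "intertwines K S W p W' p' (\<lambda>i j. eps (X t i j))" "intertwines K S W' p' W p (\<lambda>i j. eps (Y t i j))" if "t < m" for t
    unfolding X_def Y_def using p p'
    by (intro hom_intertwines[OF F F' f[OF that] c] hom_intertwines[OF F' F g[OF that] c']; blast)+
  then show ?thesis unfolding mat_retract_def
    by (intro exI[of _ m] exI[of _ "\<lambda>t i j. eps (X t i j)"] exI[of _ "\<lambda>t i j. eps (Y t i j)"]) (simp add: prod)
qed

text \<open>The hypotheses on \<open>P\<close> and \<open>P'\<close> cover both \<open>P(s) = s\<^sub>1 p(s\<^sub>2)\<close> and \<open>P(s) = p(s\<^sub>1) s\<^sub>2\<close>.\<close>

lemma mat_imp_retract:
  assumes F: "free_over A S M lam rho W \<theta> P" and F': "free_over A S M' lam' rho' W' \<theta>' P'"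
    and fin: "finite \<Lambda>" and xS: "\<And>l s. \<lbrakk>l \<in> \<Lambda>; s \<in> S\<rbrakk> \<Longrightarrow> x l s \<in> S"
    and yA: "\<And>l s. \<lbrakk>l \<in> \<Lambda>; s \<in> S\<rbrakk> \<Longrightarrow> y l s \<in> carrier A"
    and pc: "\<And>s i j. \<lbrakk>s \<in> S; i \<in> W; j \<in> W\<rbrakk> \<Longrightarrow> p i j s \<in> carrier K"
    and pc': "\<And>s i j. \<lbrakk>s \<in> S; i \<in> W'; j \<in> W'\<rbrakk> \<Longrightarrow> p' i j s \<in> carrier K"
    and P: "\<And>s i j. \<lbrakk>s \<in> S; i \<in> W; j \<in> W\<rbrakk> \<Longrightarrow> P i j s = (\<Oplus>\<^bsub>A\<^esub>l\<in>\<Lambda>. p i j (x l s) \<odot>\<^bsub>A\<^esub> y l s)"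
    and P': "\<And>s i j. \<lbrakk>s \<in> S; i \<in> W'; j \<in> W'\<rbrakk> \<Longrightarrow> P' i j s = (\<Oplus>\<^bsub>A\<^esub>l\<in>\<Lambda>. p' i j (x l s) \<odot>\<^bsub>A\<^esub> y l s)"
    and r: "mat_retract K S W p W' p'"
  shows "retract_of_power (carrier A) S M lam rho M' lam' rho'"
proof -
  note FD = free_overD[OF F] and FD' = free_overD[OF F']
  from r obtain m a b where I: "t < m \<Longrightarrow> intertwines K S W p W' p' (a t)" "t < m \<Longrightarrow> intertwines K S W' p' W p (b t)"
    and ab: "\<lbrakk>i \<in> W; k \<in> W\<rbrakk> \<Longrightarrow> (\<Oplus>t\<in>{..<m::nat}. \<Oplus>j\<in>W'. a t i j \<otimes> b t j k) = (if i = k then \<one> else \<zero>)" for t i k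
    unfolding mat_retract_def by blast
  have a: "a t i j \<in> carrier K" and b: "b t j i \<in> carrier K" if "t < m" "i \<in> W" "j \<in> W'" for t i j
    using I that unfolding intertwines_def by simp_all
  \<comment> \<open>The scalar identity holds at each point \<open>x l s\<close> of
    \<open>S\<close>. Weight it by \<open>y l s\<close>, which commutes with scalars, and sum over
    \<open>l\<close>. The statement is general because both directions of the retraction use
    it.\<close>
  have tr: "(\<Oplus>\<^bsub>A\<^esub>j\<in>V. Q i j s \<otimes>\<^bsub>A\<^esub> scal (d j k)) = (\<Oplus>\<^bsub>A\<^esub>j\<in>V'. scal (d i j) \<otimes>\<^bsub>A\<^esub> Q' j k s)"
    if V: "finite V" "finite V'" and i: "i \<in> V" and k: "k \<in> V'" and s: "s \<in> S"
      and qc: "\<And>s i j. \<lbrakk>s \<in> S; i \<in> V; j \<in> V\<rbrakk> \<Longrightarrow> q i j s \<in> carrier K"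
      and qc': "\<And>s i j. \<lbrakk>s \<in> S; i \<in> V'; j \<in> V'\<rbrakk> \<Longrightarrow> q' i j s \<in> carrier K"
      and Q: "\<And>s i j. \<lbrakk>s \<in> S; i \<in> V; j \<in> V\<rbrakk> \<Longrightarrow> Q i j s = (\<Oplus>\<^bsub>A\<^esub>l\<in>\<Lambda>. q i j (x l s) \<odot>\<^bsub>A\<^esub> y l s)"
      and Q': "\<And>s i j. \<lbrakk>s \<in> S; i \<in> V'; j \<in> V'\<rbrakk> \<Longrightarrow> Q' i j s = (\<Oplus>\<^bsub>A\<^esub>l\<in>\<Lambda>. q' i j (x l s) \<odot>\<^bsub>A\<^esub> y l s)"
      and I: "intertwines K S V q V' q' d"
    for i k s and V :: "'v set" and V' :: "'v' set" and q q' Q Q' d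
  proof -
    have d: "\<lbrakk>i \<in> V; j \<in> V'\<rbrakk> \<Longrightarrow> d i j \<in> carrier K"
      and dc: "\<lbrakk>s \<in> S; i \<in> V; k \<in> V'\<rbrakk> \<Longrightarrow> (\<Oplus>j\<in>V. q i j s \<otimes> d j k) = (\<Oplus>j\<in>V'. d i j \<otimes> q' j k s)" for s i j k
      using I unfolding intertwines_def by simp_all
    have "(\<Oplus>\<^bsub>A\<^esub>j\<in>V. Q i j s \<otimes>\<^bsub>A\<^esub> scal (d j k)) =
        (\<Oplus>\<^bsub>A\<^esub>j\<in>V. \<Oplus>\<^bsub>A\<^esub>l\<in>\<Lambda>. (q i j (x l s) \<otimes> d j k) \<odot>\<^bsub>A\<^esub> y l s)"
      using i k s fin V
      by (intro A.finsum_cong')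
        (auto simp: Q qc d A.finsum_ldistr scal_mult xS yA intro!: A.finsum_cong' A.finsum_closed)
    also have "\<dots> = (\<Oplus>\<^bsub>A\<^esub>l\<in>\<Lambda>. \<Oplus>\<^bsub>A\<^esub>j\<in>V. (q i j (x l s) \<otimes> d j k) \<odot>\<^bsub>A\<^esub> y l s)"
      using i k s fin V by (intro A.finsum_swap) (auto simp: qc d xS yA)
    also have "\<dots> = (\<Oplus>\<^bsub>A\<^esub>l\<in>\<Lambda>. (\<Oplus>j\<in>V. q i j (x l s) \<otimes> d j k) \<odot>\<^bsub>A\<^esub> y l s)"
      using i k s fin V by (intro A.finsum_cong') (auto simp: qc d xS yA smult_sum_left intro!: finsum_closed)
    also have "\<dots> = (\<Oplus>\<^bsub>A\<^esub>l\<in>\<Lambda>. (\<Oplus>j\<in>V'. d i j \<otimes> q' j k (x l s)) \<odot>\<^bsub>A\<^esub> y l s)"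
      using i k s fin V by (intro A.finsum_cong') (auto simp: dc qc' d xS yA intro!: finsum_closed)
    also have "\<dots> = (\<Oplus>\<^bsub>A\<^esub>l\<in>\<Lambda>. \<Oplus>\<^bsub>A\<^esub>j\<in>V'. (d i j \<otimes> q' j k (x l s)) \<odot>\<^bsub>A\<^esub> y l s)"
      using i k s fin V by (intro A.finsum_cong') (auto simp: qc' d xS yA smult_sum_left intro!: A.finsum_closed)
    also have "\<dots> = (\<Oplus>\<^bsub>A\<^esub>j\<in>V'. \<Oplus>\<^bsub>A\<^esub>l\<in>\<Lambda>. (d i j \<otimes> q' j k (x l s)) \<odot>\<^bsub>A\<^esub> y l s)"
      using i k s fin V by (intro A.finsum_swap) (auto simp: qc' d xS yA)
    also have "\<dots> = (\<Oplus>\<^bsub>A\<^esub>j\<in>V'. scal (d i j) \<otimes>\<^bsub>A\<^esub> Q' j k s)"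
      using i k s fin V
      by (intro A.finsum_cong')
        (auto simp: Q' qc' d A.finsum_rdistr mult_scal xS yA intro!: A.finsum_cong' A.finsum_closed)
    finally show ?thesis .
  qed
  have "\<forall>t. \<exists>f. t < m \<longrightarrow> f \<in> bihom (carrier A) S M lam rho M' lam' rho' \<and>
    (\<forall>x\<in>carrier M. \<forall>k\<in>W'. \<theta>' k (f x) = (\<Oplus>\<^bsub>A\<^esub>i\<in>W. \<theta> i x \<otimes>\<^bsub>A\<^esub> scal (a t i k)))" (is "\<forall>t. \<exists>f. ?F t f")
  proof
    show "\<exists>f. ?F t f" for t
      by (cases "t < m", rule matrix_hom[OF F F', of "a t"])
        (auto intro: a intro!: tr[OF FD(2) FD'(2) _ _ _ pc pc' P P' I(1)])
  qed
  from choice[OF this] obtain f where f0: "\<forall>t. ?F t (f t)" ..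
  then have f: "\<And>t. t < m \<Longrightarrow> f t \<in> bihom (carrier A) S M lam rho M' lam' rho'"
    "\<And>t x k. \<lbrakk>t < m; x \<in> carrier M; k \<in> W'\<rbrakk> \<Longrightarrow> \<theta>' k (f t x) = (\<Oplus>\<^bsub>A\<^esub>i\<in>W. \<theta> i x \<otimes>\<^bsub>A\<^esub> scal (a t i k))"
    by blast+
  have "\<forall>t. \<exists>g. t < m \<longrightarrow> g \<in> bihom (carrier A) S M' lam' rho' M lam rho \<and>
    (\<forall>x\<in>carrier M'. \<forall>k\<in>W. \<theta> k (g x) = (\<Oplus>\<^bsub>A\<^esub>i\<in>W'. \<theta>' i x \<otimes>\<^bsub>A\<^esub> scal (b t i k)))" (is "\<forall>t. \<exists>g. ?G t g")
  proof
    show "\<exists>g. ?G t g" for t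
      by (cases "t < m", rule matrix_hom[OF F' F, of "b t"])
        (auto intro: b intro!: tr[OF FD'(2) FD(2) _ _ _ pc' pc P' P I(2)])
  qed
  from choice[OF this] obtain g where g0: "\<forall>t. ?G t (g t)" ..
  then have g: "\<And>t. t < m \<Longrightarrow> g t \<in> bihom (carrier A) S M' lam' rho' M lam rho"
    "\<And>t x k. \<lbrakk>t < m; x \<in> carrier M'; k \<in> W\<rbrakk> \<Longrightarrow> \<theta> k (g t x) = (\<Oplus>\<^bsub>A\<^esub>i\<in>W'. \<theta>' i x \<otimes>\<^bsub>A\<^esub> scal (b t i k))"
    by blast+
  interpret M: abelian_group M by (rule FD)
  have "(\<Oplus>\<^bsub>M\<^esub>t\<in>{..<m}. g t (f t z)) = z" if z: "z \<in> carrier M" for z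
  proof (rule FD(6)[OF _ z])
    have fz: "f t z \<in> carrier M'" and gf: "g t (f t z) \<in> carrier M" if "t < m" for t
      using bihomD(1)[OF f(1)[OF that] z] bihomD(1)[OF g(1)[OF that]] by blast+
    show "(\<Oplus>\<^bsub>M\<^esub>t\<in>{..<m}. g t (f t z)) \<in> carrier M" using gf by (intro M.finsum_closed) auto
    fix k assume k: "k \<in> W"
    have \<theta>: "\<theta> i z \<in> carrier A" if "i \<in> W" for i using FD(3)[OF that z] .
    have abc: "(\<Oplus>j\<in>W'. a t i j \<otimes> b t j k) \<in> carrier K" if "t < m" "i \<in> W" for t i
      using that k by (intro finsum_closed) (auto simp: a b)
    have "\<theta> k (\<Oplus>\<^bsub>M\<^esub>t\<in>{..<m}. g t (f t z)) = (\<Oplus>\<^bsub>A\<^esub>t\<in>{..<m}. \<theta> k (g t (f t z)))"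
      using k gf by (intro additive_finsum[OF FD(1) A_group] FD) auto
    \<comment> \<open>Coordinates of a composite are the row times \<open>a t\<close> times
      \<open>b t\<close>; collecting the scalars prepares the sum over \<open>t\<close>, which is
      the identity matrix by \<open>ab\<close>.\<close>
    also have "\<dots> = (\<Oplus>\<^bsub>A\<^esub>t\<in>{..<m}. \<Oplus>\<^bsub>A\<^esub>i\<in>W. (\<Oplus>j\<in>W'. a t i j \<otimes> b t j k) \<odot>\<^bsub>A\<^esub> \<theta> i z)"
    proof (intro A.finsum_cong' refl)
      fix t assume "t \<in> {..<m}"
      then have t: "t < m" by simp
      have "\<theta> k (g t (f t z)) = (\<Oplus>\<^bsub>A\<^esub>j\<in>W'. (\<Oplus>\<^bsub>A\<^esub>i\<in>W. \<theta> i z \<otimes>\<^bsub>A\<^esub> scal (a t i j)) \<otimes>\<^bsub>A\<^esub> scal (b t j k))"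
        unfolding g(2)[OF t fz[OF t] k] using t k z
        by (intro A.finsum_cong') (auto simp: f(2) a b \<theta> intro!: A.finsum_closed)
      also have "\<dots> = (\<Oplus>\<^bsub>A\<^esub>i\<in>W. \<theta> i z \<otimes>\<^bsub>A\<^esub> (\<Oplus>\<^bsub>A\<^esub>j\<in>W'. scal (a t i j) \<otimes>\<^bsub>A\<^esub> scal (b t j k)))"
        using t k by (intro A.finsum_mat_assoc FD(2) FD'(2)) (auto simp: a b \<theta>)
      also have "\<dots> = (\<Oplus>\<^bsub>A\<^esub>i\<in>W. (\<Oplus>j\<in>W'. a t i j \<otimes> b t j k) \<odot>\<^bsub>A\<^esub> \<theta> i z)"
      proof (intro A.finsum_cong' refl)
        fix i assume i: "i \<in> W"
        have "(\<Oplus>\<^bsub>A\<^esub>j\<in>W'. scal (a t i j) \<otimes>\<^bsub>A\<^esub> scal (b t j k)) = (\<Oplus>\<^bsub>A\<^esub>j\<in>W'. scal (a t i j \<otimes> b t j k))"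
          using t i k by (intro A.finsum_cong') (auto simp: a b scal_mult)
        also have "\<dots> = scal (\<Oplus>j\<in>W'. a t i j \<otimes> b t j k)"
          using t i k FD'(2) by (intro smult_sum_left[symmetric]) (auto simp: a b)
        finally show "\<theta> i z \<otimes>\<^bsub>A\<^esub> (\<Oplus>\<^bsub>A\<^esub>j\<in>W'. scal (a t i j) \<otimes>\<^bsub>A\<^esub> scal (b t j k)) =
            (\<Oplus>j\<in>W'. a t i j \<otimes> b t j k) \<odot>\<^bsub>A\<^esub> \<theta> i z"
          using i t abc by (simp add: \<theta> A.smult_mult_right)
      qed (use t abc \<theta> in auto)
      finally show "\<theta> k (g t (f t z)) = (\<Oplus>\<^bsub>A\<^esub>i\<in>W. (\<Oplus>j\<in>W'. a t i j \<otimes> b t j k) \<odot>\<^bsub>A\<^esub> \<theta> i z)" .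
    qed (use abc \<theta> in \<open>auto intro!: A.finsum_closed\<close>)
    also have "\<dots> = (\<Oplus>\<^bsub>A\<^esub>i\<in>W. \<Oplus>\<^bsub>A\<^esub>t\<in>{..<m}. (\<Oplus>j\<in>W'. a t i j \<otimes> b t j k) \<odot>\<^bsub>A\<^esub> \<theta> i z)"
      using abc \<theta> FD(2) by (intro A.finsum_swap) auto
    also have "\<dots> = (\<Oplus>\<^bsub>A\<^esub>i\<in>W. (\<Oplus>t\<in>{..<m}. \<Oplus>j\<in>W'. a t i j \<otimes> b t j k) \<odot>\<^bsub>A\<^esub> \<theta> i z)"
      using abc \<theta> by (intro A.finsum_cong' refl smult_sum_left[symmetric]) (auto intro!: finsum_closed)
    also have "\<dots> = (\<Oplus>\<^bsub>A\<^esub>i\<in>W. \<theta> i z \<otimes>\<^bsub>A\<^esub> (if i = k then \<one>\<^bsub>A\<^esub> else \<zero>\<^bsub>A\<^esub>))"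
      using k \<theta> by (intro A.finsum_cong') (auto simp: ab)
    also have "\<dots> = \<theta> k z" using k \<theta> FD by (intro A.finsum_delta_right) auto
    finally show "\<theta> k (\<Oplus>\<^bsub>M\<^esub>t\<in>{..<m}. g t (f t z)) = \<theta> k z" .
  qed
  then show ?thesis unfolding retract_of_power_def using f(1) g(1) by blast
qed

end

section \<open>Sweedler calculus in finite-dimensional Hopf algebras\<close>

context base_field
begin

definition trilinear ::
    "('k, 'a, 'x) module_scheme \<Rightarrow> ('k, 'b, 'y) module_scheme \<Rightarrow> ('k, 'c, 'z) module_scheme \<Rightarrow>
      ('k, 'd, 'u) module_scheme \<Rightarrow> ('a \<Rightarrow> 'b \<Rightarrow> 'c \<Rightarrow> 'd) \<Rightarrow> bool"
  where "trilinear U V W M f \<longleftrightarrow> (\<forall>x\<in>carrier U. bilinear V W M (f x)) \<and>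
    (\<forall>y\<in>carrier V. \<forall>z\<in>carrier W. (\<lambda>x. f x y z) \<in> linear_maps K U M)"

lemma bilinearI':
  assumes "\<And>x y. \<lbrakk>x \<in> carrier V; y \<in> carrier W\<rbrakk> \<Longrightarrow> f x y \<in> carrier M"
    and "\<And>x y z. \<lbrakk>x \<in> carrier V; y \<in> carrier V; z \<in> carrier W\<rbrakk> \<Longrightarrow> f (x \<oplus>\<^bsub>V\<^esub> y) z = f x z \<oplus>\<^bsub>M\<^esub> f y z"
    and "\<And>c x y. \<lbrakk>c \<in> carrier K; x \<in> carrier V; y \<in> carrier W\<rbrakk> \<Longrightarrow> f (c \<odot>\<^bsub>V\<^esub> x) y = c \<odot>\<^bsub>M\<^esub> f x y"
    and "\<And>x y z. \<lbrakk>x \<in> carrier V; y \<in> carrier W; z \<in> carrier W\<rbrakk> \<Longrightarrow> f x (y \<oplus>\<^bsub>W\<^esub> z) = f x y \<oplus>\<^bsub>M\<^esub> f x z"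
    and "\<And>c x y. \<lbrakk>c \<in> carrier K; x \<in> carrier V; y \<in> carrier W\<rbrakk> \<Longrightarrow> f x (c \<odot>\<^bsub>W\<^esub> y) = c \<odot>\<^bsub>M\<^esub> f x y"
  shows "bilinear V W M f"
  using assms by (intro bilinearI linear_mapsI) auto

lemma trilinearI:
  assumes "\<And>x. x \<in> carrier U \<Longrightarrow> bilinear V W M (f x)"
    and "\<And>y z. \<lbrakk>y \<in> carrier V; z \<in> carrier W\<rbrakk> \<Longrightarrow> (\<lambda>x. f x y z) \<in> linear_maps K U M"
  shows "trilinear U V W M f"
  using assms by (auto simp: trilinear_def)

lemma trilinearD:
  assumes "trilinear U V W M f"
  shows "x \<in> carrier U \<Longrightarrow> bilinear V W M (f x)"
    and "\<lbrakk>y \<in> carrier V; z \<in> carrier W\<rbrakk> \<Longrightarrow> (\<lambda>x. f x y z) \<in> linear_maps K U M"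
    and "z \<in> carrier W \<Longrightarrow> bilinear U V M (\<lambda>x y. f x y z)"
    and "y \<in> carrier V \<Longrightarrow> bilinear U W M (\<lambda>x z. f x y z)"
  using assms by (auto simp: trilinear_def bilinear_def)

lemma bilinear_add:
  assumes "bilinear V W M f"
  shows "\<And>x y z. \<lbrakk>x \<in> carrier V; y \<in> carrier V; z \<in> carrier W\<rbrakk> \<Longrightarrow> f (x \<oplus>\<^bsub>V\<^esub> y) z = f x z \<oplus>\<^bsub>M\<^esub> f y z"
    and "\<And>c x y. \<lbrakk>c \<in> carrier K; x \<in> carrier V; y \<in> carrier W\<rbrakk> \<Longrightarrow> f (c \<odot>\<^bsub>V\<^esub> x) y = c \<odot>\<^bsub>M\<^esub> f x y"
    and "\<And>x y z. \<lbrakk>x \<in> carrier V; y \<in> carrier W; z \<in> carrier W\<rbrakk> \<Longrightarrow> f x (y \<oplus>\<^bsub>W\<^esub> z) = f x y \<oplus>\<^bsub>M\<^esub> f x z"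
    and "\<And>c x y. \<lbrakk>c \<in> carrier K; x \<in> carrier V; y \<in> carrier W\<rbrakk> \<Longrightarrow> f x (c \<odot>\<^bsub>W\<^esub> y) = c \<odot>\<^bsub>M\<^esub> f x y"
  using linear_add[OF bilinear_left[OF assms]] linear_smult[OF bilinear_left[OF assms]]
    linear_add[OF bilinear_right[OF assms]] linear_smult[OF bilinear_right[OF assms]] by blast+

lemma bilinear_sum:
  assumes M: "Module.module K M" and f: "\<And>i. i \<in> I \<Longrightarrow> bilinear V W M (f i)"
  shows "bilinear V W M (\<lambda>v w. \<Oplus>\<^bsub>M\<^esub>i\<in>I. f i v w)"
  by (intro bilinearI linear_sum M bilinear_left[OF f] bilinear_right[OF f])

lemma bilinear_finsum_right:
  assumes "Module.module K W" "Module.module K M" "bilinear V W M f" "v \<in> carrier V" "\<And>i. i \<in> I \<Longrightarrow> g i \<in> carrier W"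
  shows "f v (\<Oplus>\<^bsub>W\<^esub>i\<in>I. g i) = (\<Oplus>\<^bsub>M\<^esub>i\<in>I. f v (g i))"
  by (rule linear_finsum[OF assms(1,2) bilinear_right[OF assms(3,4)] assms(5)])

lemma bilinear_finsum_left:
  assumes "Module.module K V" "Module.module K M" "bilinear V W M f" "w \<in> carrier W" "\<And>i. i \<in> I \<Longrightarrow> g i \<in> carrier V"
  shows "f (\<Oplus>\<^bsub>V\<^esub>i\<in>I. g i) w = (\<Oplus>\<^bsub>M\<^esub>i\<in>I. f (g i) w)"
  by (rule linear_finsum[OF assms(1,2) bilinear_left[OF assms(3,4)] assms(5)])

text \<open>In nested Sweedler sums the outer integrand is itself a lift. Its linearity in the
  parameters is checked on pure tensors in the inner argument.\<close>

lemma lift_bilinear: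
  assumes X: "Module.module K X" and Y: "Module.module K Y" and V: "Module.module K V" and W: "Module.module K W"
    and M: "Module.module K M"
    and F: "\<And>v w. \<lbrakk>v \<in> carrier V; w \<in> carrier W\<rbrakk> \<Longrightarrow> bilinear X Y M (F v w)"
    and F': "\<And>x y. \<lbrakk>x \<in> carrier X; y \<in> carrier Y\<rbrakk> \<Longrightarrow> bilinear V W M (\<lambda>v w. F v w x y)"
    and P': "P' \<in> carrier (tensor K X Y)"
  shows "bilinear V W M (\<lambda>v w. tensor_lift K M (F v w) P')"
proof -
  interpret V: Module.module K V by fact
  interpret W: Module.module K W by fact
  note l = tensor_lift_linear[OF X Y M F]
  note p = tensor_lift_pure[OF X Y M F]
  show ?thesis
  proof (rule bilinearI')
    fix v w v' assume 1: "v \<in> carrier V" "w \<in> carrier V" "v' \<in> carrier W"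
    show "tensor_lift K M (F (v \<oplus>\<^bsub>V\<^esub> w) v') P' = tensor_lift K M (F v v') P' \<oplus>\<^bsub>M\<^esub> tensor_lift K M (F w v') P'"
      using 1 by (intro tensor_linear_eq[OF X Y M l linear_plus[OF M l l] _ P'])
        (simp_all add: p bilinear_add[OF F'])
  next
    fix v w v' assume 1: "v \<in> carrier V" "w \<in> carrier W" "v' \<in> carrier W"
    show "tensor_lift K M (F v (w \<oplus>\<^bsub>W\<^esub> v')) P' = tensor_lift K M (F v w) P' \<oplus>\<^bsub>M\<^esub> tensor_lift K M (F v v') P'"
      using 1 by (intro tensor_linear_eq[OF X Y M l linear_plus[OF M l l] _ P'])
        (simp_all add: p bilinear_add[OF F'])
  next
    fix c v w assume 1: "c \<in> carrier K" "v \<in> carrier V" "w \<in> carrier W"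
    show "tensor_lift K M (F (c \<odot>\<^bsub>V\<^esub> v) w) P' = c \<odot>\<^bsub>M\<^esub> tensor_lift K M (F v w) P'"
      using 1 by (intro tensor_linear_eq[OF X Y M l linear_scale[OF M l] _ P'])
        (simp_all add: p bilinear_add[OF F'])
    show "tensor_lift K M (F v (c \<odot>\<^bsub>W\<^esub> w)) P' = c \<odot>\<^bsub>M\<^esub> tensor_lift K M (F v w) P'"
      using 1 by (intro tensor_linear_eq[OF X Y M l linear_scale[OF M l] _ P'])
        (simp_all add: p bilinear_add[OF F'])
  qed (rule linear_closed[OF l P'])
qed

end

locale hopf_basis = base_field K for K :: "('k, 'm) ring_scheme" (structure) +
  fixes H :: "('k, 'h, 'x) hopf_scheme" and n :: nat and b :: "nat \<Rightarrow> 'h" and \<phi> :: "nat \<Rightarrow> 'h \<Rightarrow> 'k"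
  assumes hopf: "hopf_algebra K H"
    and basis: "rel_basis H {\<zero>\<^bsub>H\<^esub>} n b \<phi>"
begin

sublocale H: algebra_over K H
  using hopf by (rule hopf_algebra.axioms(2))

abbreviation eps where "eps \<equiv> counit H"
abbreviation HH where "HH \<equiv> tensor K H H"

lemma H_vs: "Module.module K H"
  by (rule H.module_axioms)

lemma HH_vs: "Module.module K HH"
  by (rule tensor_vs[OF H_vs H_vs])

lemma H_coalg: "coalgebra K H"
  using hopf by (rule hopf_algebra.axioms(3))

lemma b_closed [simp, intro]: "i < n \<Longrightarrow> b i \<in> carrier H"
  and \<phi>_linear: "i < n \<Longrightarrow> \<phi> i \<in> linear_maps K H (regular_module K)"
  using basis by (auto simp: rel_basis_def)

lemma basis_expand: "x \<in> carrier H \<Longrightarrow> (\<Oplus>\<^bsub>H\<^esub>i\<in>{..<n}. \<phi> i x \<odot>\<^bsub>H\<^esub> b i) = x"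
proof -
  assume x: "x \<in> carrier H"
  have "x \<ominus>\<^bsub>H\<^esub> (\<Oplus>\<^bsub>H\<^esub>i\<in>{..<n}. \<phi> i x \<odot>\<^bsub>H\<^esub> b i) = \<zero>\<^bsub>H\<^esub>"
    using basis x by (auto simp: rel_basis_def)
  moreover have "(\<Oplus>\<^bsub>H\<^esub>i\<in>{..<n}. \<phi> i x \<odot>\<^bsub>H\<^esub> b i) \<in> carrier H"
    using x form_closed[OF \<phi>_linear] by (intro H.M.finsum_closed) auto
  ultimately show ?thesis using eq_of_diff_zero[OF H.M.abelian_group_axioms x] by metis
qed

text \<open>\<open>dd i h\<close> is the contraction of the first leg of \<Delta>(h) with
  \<open>\<phi> i\<close>. Hence \<Delta>(h) is the sum of \<open>b i\<close> \<otimes>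
  \<open>dd i h\<close>, an indexed Sweedler notation in which \<open>b i\<close> plays h_(1) and
  \<open>dd i h\<close> plays h_(2).\<close>

definition coef where "coef i = tensor_lift K H (\<lambda>x y. \<phi> i x \<odot>\<^bsub>H\<^esub> y)"
definition dd where "dd i h = coef i (comult H h)"

lemma coef_bilinear: "i < n \<Longrightarrow> bilinear H H H (\<lambda>x y. \<phi> i x \<odot>\<^bsub>H\<^esub> y)"
  using form_closed[OF \<phi>_linear] form_add[OF \<phi>_linear] form_smult[OF \<phi>_linear]
  by (intro bilinearI') (auto simp: H.smult_l_distr H.smult_r_distr H.smult_assoc1[symmetric] m_comm)

lemma coef_linear: "i < n \<Longrightarrow> coef i \<in> linear_maps K HH H"
  unfolding coef_def by (intro tensor_lift_linear H_vs coef_bilinear)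

lemma coef_pure: "\<lbrakk>i < n; x \<in> carrier H; y \<in> carrier H\<rbrakk> \<Longrightarrow> coef i (pure_tensor K H H x y) = \<phi> i x \<odot>\<^bsub>H\<^esub> y"
  unfolding coef_def by (intro tensor_lift_pure H_vs coef_bilinear)

lemma comult_linear: "comult H \<in> linear_maps K H HH"
  by (rule coalgebra.comult_linear[OF H_coalg])

lemma dd_linear: "i < n \<Longrightarrow> dd i \<in> linear_maps K H H"
  using linear_comp[OF comult_linear coef_linear] by (simp add: dd_def[abs_def])

lemma dd_closed [simp, intro]: "\<lbrakk>i < n; h \<in> carrier H\<rbrakk> \<Longrightarrow> dd i h \<in> carrier H"
  by (rule linear_closed[OF dd_linear])

text \<open>Expand the first factor of a pure tensor in the basis and move the coefficients to the
  second factor.\<close>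

lemma tensor_expand:
  assumes "P \<in> carrier HH"
  shows "P = (\<Oplus>\<^bsub>HH\<^esub>i\<in>{..<n}. pure_tensor K H H (b i) (coef i P))"
proof (rule tensor_linear_eq[OF H_vs H_vs HH_vs linear_id _ _ assms])
  interpret HH: Module.module K HH by (rule HH_vs)
  note pb = pure_bilinear[OF H_vs H_vs]
  show "(\<lambda>P. \<Oplus>\<^bsub>HH\<^esub>i\<in>{..<n}. pure_tensor K H H (b i) (coef i P)) \<in> linear_maps K HH HH"
    by (intro linear_sum HH_vs linear_comp[OF coef_linear bilinear_right[OF pb]]) auto
  fix x y assume x: "x \<in> carrier H" and y: "y \<in> carrier H"
  note \<phi>c = form_closed[OF \<phi>_linear x]
  have "pure_tensor K H H x y = pure_tensor K H H (\<Oplus>\<^bsub>H\<^esub>i\<in>{..<n}. \<phi> i x \<odot>\<^bsub>H\<^esub> b i) y"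
    by (simp add: basis_expand[OF x])
  also have "\<dots> = (\<Oplus>\<^bsub>HH\<^esub>i\<in>{..<n}. pure_tensor K H H (\<phi> i x \<odot>\<^bsub>H\<^esub> b i) y)"
    using \<phi>c by (intro bilinear_finsum_left[OF H_vs HH_vs pb y]) auto
  also have "\<dots> = (\<Oplus>\<^bsub>HH\<^esub>i\<in>{..<n}. pure_tensor K H H (b i) (coef i (pure_tensor K H H x y)))"
    using \<phi>c x y
    by (intro HH.M.finsum_cong') (auto simp: coef_pure bilinear_add[OF pb] intro!: pure_closed H_vs)
  finally show "pure_tensor K H H x y = \<dots>" .
qed

lemma comult_closed: "h \<in> carrier H \<Longrightarrow> comult H h \<in> carrier HH"
  by (rule linear_closed[OF comult_linear])

lemma comult_expand:
  "h \<in> carrier H \<Longrightarrow> comult H h = (\<Oplus>\<^bsub>HH\<^esub>i\<in>{..<n}. pure_tensor K H H (b i) (dd i h))"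
  unfolding dd_def by (rule tensor_expand[OF comult_closed])

lemma lift_pure_sum:
  assumes M: "Module.module K M" and f: "bilinear H H M f"
    and "\<And>i. i \<in> I \<Longrightarrow> x i \<in> carrier H" "\<And>i. i \<in> I \<Longrightarrow> y i \<in> carrier H"
  shows "tensor_lift K M f (\<Oplus>\<^bsub>HH\<^esub>i\<in>I. pure_tensor K H H (x i) (y i)) = (\<Oplus>\<^bsub>M\<^esub>i\<in>I. f (x i) (y i))"
proof -
  interpret M: Module.module K M by fact
  have "tensor_lift K M f (\<Oplus>\<^bsub>HH\<^esub>i\<in>I. pure_tensor K H H (x i) (y i)) =
      (\<Oplus>\<^bsub>M\<^esub>i\<in>I. tensor_lift K M f (pure_tensor K H H (x i) (y i)))"
    using assms by (intro linear_finsum[OF HH_vs M tensor_lift_linear[OF H_vs H_vs M f]] pure_closed H_vs) auto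
  also have "\<dots> = (\<Oplus>\<^bsub>M\<^esub>i\<in>I. f (x i) (y i))"
    using assms by (intro M.M.finsum_cong') (auto simp: tensor_lift_pure[OF H_vs H_vs M f] bilinear_closed[OF f])
  finally show ?thesis .
qed

lemma sweedler:
  assumes "Module.module K M" "bilinear H H M f" "h \<in> carrier H"
  shows "tensor_lift K M f (comult H h) = (\<Oplus>\<^bsub>M\<^esub>i\<in>{..<n}. f (b i) (dd i h))"
  unfolding comult_expand[OF assms(3)] using assms by (intro lift_pure_sum) auto

text \<open>Both sides are the sum of f(h_(1), h_(2), h_(3)): the left one arises by splitting the
  first leg of h, the right one by splitting the second.\<close>

lemma sweedler_coassoc:
  assumes M: "Module.module K M" and f: "trilinear H H H M f" and h: "h \<in> carrier H"
  shows "(\<Oplus>\<^bsub>M\<^esub>i\<in>{..<n}. \<Oplus>\<^bsub>M\<^esub>j\<in>{..<n}. f (b j) (dd j (b i)) (dd i h)) =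
    (\<Oplus>\<^bsub>M\<^esub>i\<in>{..<n}. \<Oplus>\<^bsub>M\<^esub>j\<in>{..<n}. f (b i) (b j) (dd j (dd i h)))"
proof -
  interpret M: Module.module K M by fact
  let ?T3 = "tensor K HH H"
  have T3: "Module.module K ?T3" by (intro tensor_vs HH_vs H_vs)
  interpret T3: Module.module K ?T3 by (rule T3)
  note pb = pure_bilinear[OF H_vs H_vs] and pb3 = pure_bilinear[OF HH_vs H_vs]
  \<comment> \<open>Coassociativity is stated in (H \<otimes> H) \<otimes> H, so \<open>f\<close> is
    lifted in two stages: \<open>g\<close> absorbs the first two arguments and \<open>G\<close> the
    third.\<close>
  define g where "g P z = tensor_lift K M (\<lambda>x y. f x y z) P" for P z
  have gl: "z \<in> carrier H \<Longrightarrow> (\<lambda>P. g P z) \<in> linear_maps K HH M" for z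
    unfolding g_def by (intro tensor_lift_linear H_vs M trilinearD[OF f])
  have gp: "g (pure_tensor K H H x y) z = f x y z" if "x \<in> carrier H" "y \<in> carrier H" "z \<in> carrier H" for x y z
    unfolding g_def using that by (intro tensor_lift_pure H_vs M trilinearD[OF f])
  have gb: "bilinear HH H M g"
  proof (rule bilinearI[OF linear_mapsI gl])
    fix P z z' c assume P: "P \<in> carrier HH" and z: "z \<in> carrier H" and z': "z' \<in> carrier H"
    show "g P z \<in> carrier M" by (rule linear_closed[OF gl[OF z] P])
    show "g P (z \<oplus>\<^bsub>H\<^esub> z') = g P z \<oplus>\<^bsub>M\<^esub> g P z'"
      using z z'
      by (intro tensor_linear_eq[OF H_vs H_vs M gl linear_plus[OF M gl gl] _ P])
        (auto simp: gp bilinear_add[OF trilinearD(1)[OF f]])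
    show "g P (c \<odot>\<^bsub>H\<^esub> z) = c \<odot>\<^bsub>M\<^esub> g P z" if c: "c \<in> carrier K"
      using z c
      by (intro tensor_linear_eq[OF H_vs H_vs M gl linear_scale[OF M gl] _ P])
        (auto simp: gp bilinear_add[OF trilinearD(1)[OF f]])
  qed
  define G where "G = tensor_lift K M g"
  have Gl: "G \<in> linear_maps K ?T3 M" unfolding G_def by (intro tensor_lift_linear HH_vs H_vs M gb)
  have Gp: "G (pure_tensor K HH H P z) = g P z" if "P \<in> carrier HH" "z \<in> carrier H" for P z
    unfolding G_def using that by (intro tensor_lift_pure HH_vs H_vs M gb)
  have bl1: "bilinear H H ?T3 (\<lambda>x y. pure_tensor K HH H (comult H x) y)"
    by (rule bilinear_comp2[OF pb3 comult_linear linear_id])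
  have bl2: "bilinear H H ?T3 (\<lambda>y z. pure_tensor K HH H (pure_tensor K H H x y) z)" if "x \<in> carrier H" for x
    by (rule bilinear_comp2[OF pb3 bilinear_right[OF pb that] linear_id])
  have in3: "pure_tensor K HH H P z \<in> carrier ?T3" if "P \<in> carrier HH" "z \<in> carrier H" for P z
    using that by (intro pure_closed HH_vs H_vs)
  have inHH: "pure_tensor K H H x y \<in> carrier HH" if "x \<in> carrier H" "y \<in> carrier H" for x y
    using that by (intro pure_closed H_vs)
  let ?L = "\<lambda>x y. tensor_lift K ?T3 (\<lambda>y1 y2. pure_tensor K HH H (pure_tensor K H H x y1) y2) (comult H y)"
  have bl3: "bilinear H H ?T3 ?L"
  proof (rule bilinearI)
    fix x assume x: "x \<in> carrier H"
    show "?L x \<in> linear_maps K H ?T3"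
      by (rule linear_comp[OF comult_linear tensor_lift_linear[OF H_vs H_vs T3 bl2[OF x]]])
  next
    fix y assume y: "y \<in> carrier H"
    show "(\<lambda>x. ?L x y) \<in> linear_maps K H ?T3"
    proof (rule linear_mapsI)
      fix x x' c assume x: "x \<in> carrier H" and x': "x' \<in> carrier H"
      note tl = tensor_lift_linear[OF H_vs H_vs T3 bl2] and tp = tensor_lift_pure[OF H_vs H_vs T3 bl2]
      show "?L x y \<in> carrier ?T3"
        by (rule linear_closed[OF tl[OF x] comult_closed[OF y]])
      show "?L (x \<oplus>\<^bsub>H\<^esub> x') y = ?L x y \<oplus>\<^bsub>?T3\<^esub> ?L x' y"
        using x x'
        by (intro tensor_linear_eq[OF H_vs H_vs T3 tl linear_plus[OF T3 tl tl] _ comult_closed[OF y]])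
          (auto simp: tp bilinear_add[OF pb] bilinear_add[OF pb3] inHH)
      show "?L (c \<odot>\<^bsub>H\<^esub> x) y = c \<odot>\<^bsub>?T3\<^esub> ?L x y" if c: "c \<in> carrier K"
        using x c
        by (intro tensor_linear_eq[OF H_vs H_vs T3 tl linear_scale[OF T3 tl] _ comult_closed[OF y]])
          (auto simp: tp bilinear_add[OF pb] bilinear_add[OF pb3] inHH)
    qed
  qed
  have "(\<Oplus>\<^bsub>M\<^esub>i\<in>{..<n}. \<Oplus>\<^bsub>M\<^esub>j\<in>{..<n}. f (b j) (dd j (b i)) (dd i h)) =
      (\<Oplus>\<^bsub>M\<^esub>i\<in>{..<n}. G (pure_tensor K HH H (comult H (b i)) (dd i h)))"
  proof (intro M.M.finsum_cong' refl)
    fix i assume i: "i \<in> {..<n}"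
    have "G (pure_tensor K HH H (comult H (b i)) (dd i h)) = tensor_lift K M (\<lambda>x y. f x y (dd i h)) (comult H (b i))"
      using i h by (simp add: Gp comult_closed g_def)
    also have "\<dots> = (\<Oplus>\<^bsub>M\<^esub>j\<in>{..<n}. f (b j) (dd j (b i)) (dd i h))"
      using i h by (intro sweedler M trilinearD[OF f]) auto
    finally show "(\<Oplus>\<^bsub>M\<^esub>j\<in>{..<n}. f (b j) (dd j (b i)) (dd i h)) = G (pure_tensor K HH H (comult H (b i)) (dd i h))"
      by simp
  qed (use h linear_closed[OF Gl] in3 comult_closed in auto)
  also have "\<dots> = G (\<Oplus>\<^bsub>?T3\<^esub>i\<in>{..<n}. pure_tensor K HH H (comult H (b i)) (dd i h))"
    using h by (intro linear_finsum[OF T3 M Gl, symmetric] in3 comult_closed) auto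
  also have "\<dots> = G (tensor_lift K ?T3 (\<lambda>x y. pure_tensor K HH H (comult H x) y) (comult H h))"
    by (simp only: sweedler[OF T3 bl1 h])
  also have "\<dots> = G (tensor_lift K ?T3 ?L (comult H h))"
    by (simp only: coalgebra.coassoc[OF H_coalg h])
  also have "\<dots> = G (\<Oplus>\<^bsub>?T3\<^esub>i\<in>{..<n}. ?L (b i) (dd i h))"
    by (simp only: sweedler[OF T3 bl3 h])
  also have "\<dots> = (\<Oplus>\<^bsub>M\<^esub>i\<in>{..<n}. G (?L (b i) (dd i h)))"
    using h by (intro linear_finsum[OF T3 M Gl] bilinear_closed[OF bl3]) auto
  also have "\<dots> = (\<Oplus>\<^bsub>M\<^esub>i\<in>{..<n}. \<Oplus>\<^bsub>M\<^esub>j\<in>{..<n}. f (b i) (b j) (dd j (dd i h)))"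
  proof (intro M.M.finsum_cong' refl)
    fix i assume i: "i \<in> {..<n}"
    then have bi: "b i \<in> carrier H" and di: "dd i h \<in> carrier H" using h by auto
    have "G (?L (b i) (dd i h)) =
        G (\<Oplus>\<^bsub>?T3\<^esub>j\<in>{..<n}. pure_tensor K HH H (pure_tensor K H H (b i) (b j)) (dd j (dd i h)))"
      by (simp only: sweedler[OF T3 bl2[OF bi] di])
    also have "\<dots> = (\<Oplus>\<^bsub>M\<^esub>j\<in>{..<n}. G (pure_tensor K HH H (pure_tensor K H H (b i) (b j)) (dd j (dd i h))))"
      using bi di by (intro linear_finsum[OF T3 M Gl] in3 inHH) auto
    also have "\<dots> = (\<Oplus>\<^bsub>M\<^esub>j\<in>{..<n}. f (b i) (b j) (dd j (dd i h)))"
      using bi di bilinear_closed[OF trilinearD(1)[OF f]]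
      by (intro M.M.finsum_cong') (auto simp: Gp inHH gp)
    finally show "G (?L (b i) (dd i h)) = (\<Oplus>\<^bsub>M\<^esub>j\<in>{..<n}. f (b i) (b j) (dd j (dd i h)))" .
  qed (use h bilinear_closed[OF trilinearD(1)[OF f]] in \<open>auto intro!: M.M.finsum_closed\<close>)
  finally show ?thesis .
qed

lemma eps_linear: "eps \<in> linear_maps K H (regular_module K)"
  by (rule coalgebra.counit_linear[OF H_coalg])

lemma eps_closed [simp, intro]: "x \<in> carrier H \<Longrightarrow> eps x \<in> carrier K"
  by (rule form_closed[OF eps_linear])

lemma eps_mult: "\<lbrakk>x \<in> carrier H; y \<in> carrier H\<rbrakk> \<Longrightarrow> eps (x \<otimes>\<^bsub>H\<^esub> y) = eps x \<otimes> eps y"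
  and eps_one [simp]: "eps \<one>\<^bsub>H\<^esub> = \<one>"
  using hopf_algebra.counit_ring_hom[OF hopf] by (auto simp: ring_hom_def)

lemma eps_smult_bilinear: "bilinear H H H (\<lambda>x y. eps x \<odot>\<^bsub>H\<^esub> y)"
  using form_add[OF eps_linear] form_smult[OF eps_linear]
  by (intro bilinearI') (auto simp: H.smult_l_distr H.smult_r_distr H.smult_assoc1[symmetric] m_comm)

lemma sweedler_counit_left:
  "h \<in> carrier H \<Longrightarrow> (\<Oplus>\<^bsub>H\<^esub>i\<in>{..<n}. eps (b i) \<odot>\<^bsub>H\<^esub> dd i h) = h"
  using sweedler[OF H_vs eps_smult_bilinear] coalgebra.counit_left[OF H_coalg] by simp

lemma sweedler_counit_right:
  assumes h: "h \<in> carrier H"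
  shows "(\<Oplus>\<^bsub>H\<^esub>i\<in>{..<n}. eps (dd i h) \<odot>\<^bsub>H\<^esub> b i) = h"
proof -
  have "bilinear H H H (\<lambda>x y. eps y \<odot>\<^bsub>H\<^esub> x)"
    using form_add[OF eps_linear] form_smult[OF eps_linear]
    by (intro bilinearI') (auto simp: H.smult_l_distr H.smult_r_distr H.smult_assoc1[symmetric] m_comm)
  from sweedler[OF H_vs this h] show ?thesis using coalgebra.counit_right[OF H_coalg h] by simp
qed

lemma mult_bilinear: "bilinear H H H (mult H)"
  by (intro bilinearI') (auto simp: H.l_distr H.r_distr H.smult_mult_left H.smult_mult_right)

lemma sweedler_mult:
  assumes M: "Module.module K M" and f: "bilinear H H M f" and x: "x \<in> carrier H" and y: "y \<in> carrier H"
  shows "(\<Oplus>\<^bsub>M\<^esub>i\<in>{..<n}. f (b i) (dd i (x \<otimes>\<^bsub>H\<^esub> y))) =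
    (\<Oplus>\<^bsub>M\<^esub>i\<in>{..<n}. \<Oplus>\<^bsub>M\<^esub>j\<in>{..<n}. f (b i \<otimes>\<^bsub>H\<^esub> b j) (dd i x \<otimes>\<^bsub>H\<^esub> dd j y))"
proof -
  interpret M: Module.module K M by fact
  note pb = pure_bilinear[OF H_vs H_vs]
  let ?q = "\<lambda>x1 x2 y1 y2. pure_tensor K H H (x1 \<otimes>\<^bsub>H\<^esub> y1) (x2 \<otimes>\<^bsub>H\<^esub> y2)"
  have b1: "bilinear H H HH (?q x1 x2)" if "x1 \<in> carrier H" "x2 \<in> carrier H" for x1 x2
    by (rule bilinear_comp2[OF pb bilinear_right[OF mult_bilinear that(1)] bilinear_right[OF mult_bilinear that(2)]])
  let ?L = "\<lambda>x1 x2. tensor_lift K HH (?q x1 x2) (comult H y)"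
  have b2: "bilinear H H HH ?L"
    by (rule lift_bilinear[OF H_vs H_vs H_vs H_vs HH_vs b1 _ comult_closed[OF y]], assumption+)
      (rule bilinear_comp2[OF pb bilinear_left[OF mult_bilinear] bilinear_left[OF mult_bilinear]])
  note fl = tensor_lift_linear[OF H_vs H_vs M f]
  have "(\<Oplus>\<^bsub>M\<^esub>i\<in>{..<n}. f (b i) (dd i (x \<otimes>\<^bsub>H\<^esub> y))) = tensor_lift K M f (comult H (x \<otimes>\<^bsub>H\<^esub> y))"
    using x y by (intro sweedler[symmetric] M f) auto
  also have "\<dots> = tensor_lift K M f (tensor_lift K HH ?L (comult H x))"
    by (simp only: hopf_algebra.comult_mult[OF hopf x y])
  also have "\<dots> = tensor_lift K M f (\<Oplus>\<^bsub>HH\<^esub>i\<in>{..<n}. ?L (b i) (dd i x))"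
    by (simp only: sweedler[OF HH_vs b2 x])
  also have "\<dots> = (\<Oplus>\<^bsub>M\<^esub>i\<in>{..<n}. tensor_lift K M f (?L (b i) (dd i x)))"
    using x by (intro linear_finsum[OF HH_vs M fl] bilinear_closed[OF b2]) auto
  also have "\<dots> = (\<Oplus>\<^bsub>M\<^esub>i\<in>{..<n}. \<Oplus>\<^bsub>M\<^esub>j\<in>{..<n}. f (b i \<otimes>\<^bsub>H\<^esub> b j) (dd i x \<otimes>\<^bsub>H\<^esub> dd j y))"
  proof (intro M.M.finsum_cong' refl)
    fix i assume i: "i \<in> {..<n}"
    then have bi: "b i \<in> carrier H" and di: "dd i x \<in> carrier H" using x by auto
    have "tensor_lift K M f (?L (b i) (dd i x)) =
        tensor_lift K M f (\<Oplus>\<^bsub>HH\<^esub>j\<in>{..<n}. ?q (b i) (dd i x) (b j) (dd j y))"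
      by (simp only: sweedler[OF HH_vs b1[OF bi di] y])
    also have "\<dots> = (\<Oplus>\<^bsub>M\<^esub>j\<in>{..<n}. f (b i \<otimes>\<^bsub>H\<^esub> b j) (dd i x \<otimes>\<^bsub>H\<^esub> dd j y))"
      using bi di y by (intro lift_pure_sum M f) auto
    finally show "tensor_lift K M f (?L (b i) (dd i x)) = \<dots>" .
  qed (use x y bilinear_closed[OF f] in \<open>auto intro!: M.M.finsum_closed\<close>)
  finally show ?thesis .
qed

lemma sweedler_one:
  assumes M: "Module.module K M" and f: "bilinear H H M f"
  shows "(\<Oplus>\<^bsub>M\<^esub>i\<in>{..<n}. f (b i) (dd i \<one>\<^bsub>H\<^esub>)) = f \<one>\<^bsub>H\<^esub> \<one>\<^bsub>H\<^esub>"
  using sweedler[OF M f H.one_closed] hopf_algebra.comult_one[OF hopf]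
    tensor_lift_pure[OF H_vs H_vs M f H.one_closed H.one_closed] by simp

abbreviation antip where "antip \<equiv> antipode H"

lemma antip_linear: "antip \<in> linear_maps K H H"
  by (rule hopf_algebra.antipode_linear[OF hopf])

lemma antip_closed [simp, intro]: "x \<in> carrier H \<Longrightarrow> antip x \<in> carrier H"
  by (rule linear_closed[OF antip_linear])

lemma sweedler_antip_left:
  assumes h: "h \<in> carrier H"
  shows "(\<Oplus>\<^bsub>H\<^esub>i\<in>{..<n}. antip (b i) \<otimes>\<^bsub>H\<^esub> dd i h) = eps h \<odot>\<^bsub>H\<^esub> \<one>\<^bsub>H\<^esub>"
  using sweedler[OF H_vs bilinear_comp2[OF mult_bilinear antip_linear linear_id] h]
    hopf_algebra.antipode_left[OF hopf h] by simp

lemma sweedler_antip_right: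
  assumes h: "h \<in> carrier H"
  shows "(\<Oplus>\<^bsub>H\<^esub>i\<in>{..<n}. b i \<otimes>\<^bsub>H\<^esub> antip (dd i h)) = eps h \<odot>\<^bsub>H\<^esub> \<one>\<^bsub>H\<^esub>"
  using sweedler[OF H_vs bilinear_comp2[OF mult_bilinear linear_id antip_linear] h]
    hopf_algebra.antipode_right[OF hopf h] by simp

lemma eps_augmented: "augmented_algebra K H eps"
  using hopf_algebra.counit_ring_hom[OF hopf] form_smult[OF eps_linear]
  by unfold_locales (auto)

end

section \<open>Freeness of the tensor powers of a Hopf algebra over a Hopf subalgebra\<close>

context base_field
begin

lemma zero_submodule:
  assumes "Module.module K M"
  shows "submodule {\<zero>\<^bsub>M\<^esub>} K M"
proof -
  interpret M: Module.module K M by fact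
  show ?thesis
    using M.submoduleI[of "{\<zero>\<^bsub>M\<^esub>}"] group_minus_zero[OF M.M.abelian_group_axioms] by simp
qed

lemma form_finsum:
  assumes "Module.module K M" "f \<in> linear_maps K M (regular_module K)" "\<And>i. i \<in> I \<Longrightarrow> g i \<in> carrier M"
  shows "f (\<Oplus>\<^bsub>M\<^esub>i\<in>I. g i) = (\<Oplus>i\<in>I. f (g i))"
  using linear_finsum[OF assms(1) regular_vs assms(2,3)] by (simp add: finsum_regular)

lemma form_diff_eq:
  assumes M: "Module.module K M" and f: "f \<in> linear_maps K M (regular_module K)"
    and x: "x \<in> carrier M" "y \<in> carrier M" and z: "f (x \<ominus>\<^bsub>M\<^esub> y) = \<zero>"
  shows "f x = f y"
proof -
  interpret M: Module.module K M by fact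
  have "f x = f ((x \<ominus>\<^bsub>M\<^esub> y) \<oplus>\<^bsub>M\<^esub> y)"
    using x by (simp add: a_minus_def M.M.a_assoc M.M.l_neg)
  also have "\<dots> = f (x \<ominus>\<^bsub>M\<^esub> y) \<oplus> f y" using x by (intro form_add[OF f]) auto
  finally show ?thesis using z form_closed[OF f x(2)] by simp
qed

lemma finsum_times:
  assumes M: "abelian_monoid M" and fin: "finite A" "finite B"
    and f: "\<And>i j. \<lbrakk>i \<in> A; j \<in> B\<rbrakk> \<Longrightarrow> f (i, j) \<in> carrier M"
  shows "(\<Oplus>\<^bsub>M\<^esub>p\<in>A \<times> B. f p) = (\<Oplus>\<^bsub>M\<^esub>i\<in>A. \<Oplus>\<^bsub>M\<^esub>j\<in>B. f (i, j))"
proof -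
  interpret M: abelian_monoid M by fact
  show ?thesis using fin(1) f
  proof (induction A)
    case empty
    then show ?case by simp
  next
    case (insert a A)
    have "(\<Oplus>\<^bsub>M\<^esub>p\<in>insert a A \<times> B. f p) = (\<Oplus>\<^bsub>M\<^esub>p\<in>(Pair a ` B) \<union> A \<times> B. f p)"
      by (rule arg_cong[where f="finsum M f"]) auto
    also have "\<dots> = (\<Oplus>\<^bsub>M\<^esub>p\<in>Pair a ` B. f p) \<oplus>\<^bsub>M\<^esub> (\<Oplus>\<^bsub>M\<^esub>p\<in>A \<times> B. f p)"
      using insert fin by (intro M.finsum_Un_disjoint) auto
    also have "(\<Oplus>\<^bsub>M\<^esub>p\<in>Pair a ` B. f p) = (\<Oplus>\<^bsub>M\<^esub>j\<in>B. f (a, j))"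
      using insert.prems by (intro M.finsum_reindex) (auto simp: inj_on_def)
    finally show ?case using insert by (subst M.finsum_insert) (auto intro!: M.finsum_closed)
  qed
qed

end

context tensor_tower
begin

lemma lact_closed: "\<lbrakk>c \<in> L; t \<in> carrier (T (Suc m))\<rbrakk> \<Longrightarrow> lact (T (Suc m)) c t \<in> carrier (T (Suc m))"
  by (rule linear_closed[OF lact_linear])

lemma ract_closed: "\<lbrakk>c \<in> N; t \<in> carrier (T (Suc m))\<rbrakk> \<Longrightarrow> ract (T (Suc m)) t c \<in> carrier (T (Suc m))"
  using linear_closed[OF ract_linear] .

lemma cons_closed: "\<lbrakk>x \<in> carrier C; t \<in> carrier (T m)\<rbrakk> \<Longrightarrow> cons m x t \<in> carrier (T (Suc m))"
  by (rule bilinear_closed[OF cons_bilinear])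

lemma lact_add_left:
  assumes c: "c \<in> L" "c' \<in> L" "c \<oplus>\<^bsub>C\<^esub> c' \<in> L" and t: "t \<in> carrier (T (Suc m))"
  shows "lact (T (Suc m)) (c \<oplus>\<^bsub>C\<^esub> c') t = lact (T (Suc m)) c t \<oplus>\<^bsub>T (Suc m)\<^esub> lact (T (Suc m)) c' t"
proof (rule cons_linear_eq[OF T_vs lact_linear[OF c(3)] linear_plus[OF T_vs lact_linear[OF c(1)] lact_linear[OF c(2)]] _ t])
  fix x t assume x: "x \<in> carrier C" and t: "t \<in> carrier (T m)"
  note cC = L_closed[OF c(1)] L_closed[OF c(2)]
  show "lact (T (Suc m)) (c \<oplus>\<^bsub>C\<^esub> c') (cons m x t) =
      lact (T (Suc m)) c (cons m x t) \<oplus>\<^bsub>T (Suc m)\<^esub> lact (T (Suc m)) c' (cons m x t)"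
    using x t c cC
    by (simp only: lact_cons bilinear_add[OF C_mult] bilinear_add[OF cons_bilinear] C_closed)
qed

lemma lact_smult_left:
  assumes c: "c \<in> L" "a \<odot>\<^bsub>C\<^esub> c \<in> L" and a: "a \<in> carrier K" and t: "t \<in> carrier (T (Suc m))"
  shows "lact (T (Suc m)) (a \<odot>\<^bsub>C\<^esub> c) t = a \<odot>\<^bsub>T (Suc m)\<^esub> lact (T (Suc m)) c t"
proof (rule cons_linear_eq[OF T_vs lact_linear[OF c(2)] linear_scale[OF T_vs lact_linear[OF c(1)] a] _ t])
  fix x t assume x: "x \<in> carrier C" and t: "t \<in> carrier (T m)"
  note cC = L_closed[OF c(1)]
  show "lact (T (Suc m)) (a \<odot>\<^bsub>C\<^esub> c) (cons m x t) = a \<odot>\<^bsub>T (Suc m)\<^esub> lact (T (Suc m)) c (cons m x t)"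
    using x t c cC a
    by (simp only: lact_cons bilinear_add[OF C_mult] bilinear_add[OF cons_bilinear] C_closed)
qed

lemma lact_lact:
  assumes c: "c \<in> L" "c' \<in> L" "c \<otimes>\<^bsub>C\<^esub> c' \<in> L" and t: "t \<in> carrier (T (Suc m))"
    and assoc: "\<And>x. x \<in> carrier C \<Longrightarrow> c \<otimes>\<^bsub>C\<^esub> (c' \<otimes>\<^bsub>C\<^esub> x) = (c \<otimes>\<^bsub>C\<^esub> c') \<otimes>\<^bsub>C\<^esub> x"
  shows "lact (T (Suc m)) c (lact (T (Suc m)) c' t) = lact (T (Suc m)) (c \<otimes>\<^bsub>C\<^esub> c') t"
proof (rule cons_linear_eq[OF T_vs linear_comp[OF lact_linear[OF c(2)] lact_linear[OF c(1)]] lact_linear[OF c(3)] _ t])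
  fix x t assume x: "x \<in> carrier C" and t: "t \<in> carrier (T m)"
  note cC = L_closed[OF c(1)] L_closed[OF c(2)]
  show "lact (T (Suc m)) c (lact (T (Suc m)) c' (cons m x t)) = lact (T (Suc m)) (c \<otimes>\<^bsub>C\<^esub> c') (cons m x t)"
    using x t c cC by (simp only: lact_cons assoc C_closed)
qed

lemma lact_id:
  assumes c: "c \<in> L" and t: "t \<in> carrier (T (Suc m))" and id: "\<And>x. x \<in> carrier C \<Longrightarrow> c \<otimes>\<^bsub>C\<^esub> x = x"
  shows "lact (T (Suc m)) c t = t"
  by (rule cons_linear_eq[OF T_vs lact_linear[OF c] linear_id _ t]) (simp only: lact_cons c id)

end

text \<open>The quotient Q enters through representatives \<open>q i\<close> in H and functionals
  \<open>\<psi> i\<close> on H that vanish on R^+ H. Computations in Q and its tensor powers thus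
  take place in H with scalar coefficients.\<close>

locale hopf_quot = hopf_basis K H n b \<phi> for K :: "('k, 'm) ring_scheme" (structure)
    and H :: "('k, 'h, 'x) hopf_scheme" and n b \<phi> +
  fixes R :: "'h set" and r :: nat and q :: "nat \<Rightarrow> 'h" and \<psi> :: "nat \<Rightarrow> 'h \<Rightarrow> 'k"
  assumes R_sub: "hopf_subalgebra K R H"
    and qb: "rel_basis H (augmentation_right_ideal K R H) r q \<psi>"
begin

abbreviation I where "I \<equiv> augmentation_right_ideal K R H"

lemma R_submodule: "submodule R K H"
  and R_one: "\<one>\<^bsub>H\<^esub> \<in> R"
  using R_sub by (auto simp: hopf_subalgebra_def unital_subalgebra_def)

lemmas R_subE = H.submoduleE[OF R_submodule]

lemma R_closed: "x \<in> R \<Longrightarrow> x \<in> carrier H"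
  using R_subE(1) by blast

abbreviation HR where "HR \<equiv> H\<lparr>carrier := R\<rparr>"

lemma HR_vs: "Module.module K HR"
  by (rule submodule.submodule_is_module[OF R_submodule H_vs])

lemma bilinear_HR: "bilinear H H M f \<Longrightarrow> bilinear HR HR M f"
  by (rule bilinearI') (simp_all add: R_closed bilinear_closed bilinear_add)

text \<open>After composing with the projection modulo \<open>N\<close>, the map agrees with the
  zero map on pure tensors.\<close>

lemma tensor_linear_range:
  assumes V: "Module.module K V" and W: "Module.module K W" and M: "Module.module K M"
    and f: "f \<in> linear_maps K (tensor K V W) M" and N: "submodule N K M"
    and p: "\<And>v w. \<lbrakk>v \<in> carrier V; w \<in> carrier W\<rbrakk> \<Longrightarrow> f (pure_tensor K V W v w) \<in> N"
    and P: "P \<in> carrier (tensor K V W)"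
  shows "f P \<in> N"
proof -
  let ?Q = "quot_module M N"
  note pr = quot_proj_linear[OF M N]
  have Q: "Module.module K ?Q" by (rule quot_vs[OF M N])
  interpret M: Module.module K M by fact
  have z: "N +>\<^bsub>M\<^esub> y = \<zero>\<^bsub>?Q\<^esub> \<longleftrightarrow> y \<in> N" if "y \<in> carrier M" for y
    using coset_eq_iff[OF M N that M.M.zero_closed] that
    by (simp add: quot_zero[OF M N] a_minus_def group_minus_zero[OF M.M.abelian_group_axioms])
  have "N +>\<^bsub>M\<^esub> f P = \<zero>\<^bsub>?Q\<^esub>"
    by (rule tensor_linear_eq[OF V W Q linear_comp[OF f pr] linear_zero_map[OF Q] _ P])
      (simp add: z[OF linear_closed[OF f pure_closed[OF V W]]] p)
  then show ?thesis using z[OF linear_closed[OF f P]] by simp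
qed

lemma incl_linear: "tensor_incl K H \<in> linear_maps K (tensor K HR HR) HH"
  unfolding tensor_incl_def
  by (intro tensor_lift_linear HR_vs HH_vs bilinear_HR pure_bilinear H_vs)

lemma incl_pure: "\<lbrakk>x \<in> R; y \<in> R\<rbrakk> \<Longrightarrow> tensor_incl K H (pure_tensor K HR HR x y) = pure_tensor K H H x y"
  unfolding tensor_incl_def
  using tensor_lift_pure[OF HR_vs HR_vs HH_vs bilinear_HR[OF pure_bilinear[OF H_vs H_vs]]] by simp

lemma R_comult: "x \<in> R \<Longrightarrow> \<exists>P\<in>carrier (tensor K HR HR). comult H x = tensor_incl K H P"
  using R_sub unfolding hopf_subalgebra_def by blast

text \<open>\<Delta>(x) comes from R \<otimes> R, and contracting its first leg leaves an element of
  R. The first legs \<open>b i\<close> in the expansion are in general outside R.\<close>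

lemma dd_R: "\<lbrakk>i < n; x \<in> R\<rbrakk> \<Longrightarrow> dd i x \<in> R"
proof -
  assume i: "i < n" and x: "x \<in> R"
  obtain P where P: "P \<in> carrier (tensor K HR HR)" "comult H x = tensor_incl K H P"
    using R_comult[OF x] by blast
  have "coef i (tensor_incl K H P) \<in> R"
  proof (rule tensor_linear_range[OF HR_vs HR_vs H_vs linear_comp[OF incl_linear coef_linear[OF i]] R_submodule _ P(1)])
    fix v w assume "v \<in> carrier HR" "w \<in> carrier HR"
    then show "coef i (tensor_incl K H (pure_tensor K HR HR v w)) \<in> R"
      using i form_closed[OF \<phi>_linear[OF i]] by (simp add: incl_pure coef_pure R_closed R_subE(4))
  qed
  then show "dd i x \<in> R" by (simp add: dd_def P)
qed

lemma q_closed [simp, intro]: "i < r \<Longrightarrow> q i \<in> carrier H"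
  and \<psi>_linear: "i < r \<Longrightarrow> \<psi> i \<in> linear_maps K H (regular_module K)"
  and \<psi>_I: "\<lbrakk>i < r; x \<in> I\<rbrakk> \<Longrightarrow> \<psi> i x = \<zero>"
  and \<psi>_q: "\<lbrakk>i < r; j < r\<rbrakk> \<Longrightarrow> \<psi> i (q j) = (if i = j then \<one> else \<zero>)"
  and q_expand: "x \<in> carrier H \<Longrightarrow> x \<ominus>\<^bsub>H\<^esub> (\<Oplus>\<^bsub>H\<^esub>i\<in>{..<r}. \<psi> i x \<odot>\<^bsub>H\<^esub> q i) \<in> I"
  using qb by (auto simp: rel_basis_def)

lemma \<psi>_closed [simp, intro]: "\<lbrakk>i < r; x \<in> carrier H\<rbrakk> \<Longrightarrow> \<psi> i x \<in> carrier K"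
  by (rule form_closed[OF \<psi>_linear])

lemmas \<psi>_add = form_add[OF \<psi>_linear]
lemmas \<psi>_smult = form_smult[OF \<psi>_linear]
lemmas eps_add = form_add[OF eps_linear]
lemmas eps_smult = form_smult[OF eps_linear]

lemma I_gens_subset: "{x \<otimes>\<^bsub>H\<^esub> h |x h. x \<in> R \<and> eps x = \<zero> \<and> h \<in> carrier H} \<subseteq> carrier H"
  using R_closed by auto

lemma I_submodule: "submodule I K H"
  unfolding augmentation_right_ideal_def by (rule span_submodule[OF H_vs I_gens_subset])

lemma I_gen: "\<lbrakk>x \<in> R; eps x = \<zero>; h \<in> carrier H\<rbrakk> \<Longrightarrow> x \<otimes>\<^bsub>H\<^esub> h \<in> I"
  unfolding augmentation_right_ideal_def by (rule subsetD[OF span_superset]) blast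

lemma I_linear:
  assumes M: "Module.module K M" and f: "f \<in> linear_maps K H M" and N: "submodule N K M"
    and g: "\<And>x h. \<lbrakk>x \<in> R; eps x = \<zero>; h \<in> carrier H\<rbrakk> \<Longrightarrow> f (x \<otimes>\<^bsub>H\<^esub> h) \<in> N" and y: "y \<in> I"
  shows "f y \<in> N"
proof -
  interpret M: Module.module K M by fact
  note NE = M.submoduleE[OF N]
  have "submodule {x \<in> carrier H. f x \<in> N} K H"
    using NE submodule_zero[OF N]
    by (intro H.submoduleI) (auto simp: linear_add[OF f] linear_smult[OF f] linear_minus[OF H_vs M f] linear_zero[OF H_vs M f])
  then have "I \<subseteq> {x \<in> carrier H. f x \<in> N}"
    unfolding augmentation_right_ideal_def by (rule span_least) (use g R_closed in auto)
  then show ?thesis using y by blast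
qed

lemma I_right_ideal:
  assumes y: "y \<in> I" and h: "h \<in> carrier H"
  shows "y \<otimes>\<^bsub>H\<^esub> h \<in> I"
proof (rule I_linear[OF H_vs bilinear_left[OF mult_bilinear h] I_submodule _ y])
  fix x g assume "x \<in> R" "eps x = \<zero>" "g \<in> carrier H"
  then show "(x \<otimes>\<^bsub>H\<^esub> g) \<otimes>\<^bsub>H\<^esub> h \<in> I" using h by (simp add: H.m_assoc R_closed I_gen)
qed

lemma I_closed: "x \<in> I \<Longrightarrow> x \<in> carrier H"
  using H.submoduleE(1)[OF I_submodule] by blast

text \<open>The element x - eps(x) 1 lies in R^+, so its product with \<open>h\<close> is killed by
  \<open>f\<close>.\<close>

lemma form_R:
  assumes f: "f \<in> linear_maps K H (regular_module K)" "\<And>y. y \<in> I \<Longrightarrow> f y = \<zero>"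
    and x: "x \<in> R" and h: "h \<in> carrier H"
  shows "f (x \<otimes>\<^bsub>H\<^esub> h) = eps x \<otimes> f h"
proof -
  have xc: "x \<in> carrier H" by (rule R_closed[OF x])
  let ?y = "x \<oplus>\<^bsub>H\<^esub> (\<ominus> eps x) \<odot>\<^bsub>H\<^esub> \<one>\<^bsub>H\<^esub>"
  have y: "?y \<in> R" "eps ?y = \<zero>"
    using x xc R_one by (auto intro!: R_subE simp: eps_add eps_smult r_neg)
  have "f (?y \<otimes>\<^bsub>H\<^esub> h) = \<zero>" by (rule f(2)[OF I_gen[OF y h]])
  moreover have "f (?y \<otimes>\<^bsub>H\<^esub> h) = f (x \<otimes>\<^bsub>H\<^esub> h) \<oplus> \<ominus> (eps x \<otimes> f h)"
    using form_closed[OF f(1)] xc h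
    by (simp add: H.l_distr H.smult_mult_left form_add[OF f(1)] form_smult[OF f(1)] l_minus)
  ultimately show ?thesis
    using form_closed[OF f(1)] xc h eq_of_diff_zero[OF abelian_group_axioms, of "f (x \<otimes>\<^bsub>H\<^esub> h)" "eps x \<otimes> f h"]
    by (simp add: a_minus_def)
qed

lemmas \<psi>_R = form_R[OF \<psi>_linear \<psi>_I]

text \<open>Such a map factors through Q, where the class of \<open>x\<close> is the combination of
  the classes of the \<open>q i\<close> with coefficients \<open>\<psi> i x\<close>.\<close>

lemma kills_I_expand:
  assumes M: "Module.module K M" and f: "f \<in> linear_maps K H M"
    and z: "\<And>y. y \<in> I \<Longrightarrow> f y = \<zero>\<^bsub>M\<^esub>" and x: "x \<in> carrier H"
  shows "f x = (\<Oplus>\<^bsub>M\<^esub>i\<in>{..<r}. \<psi> i x \<odot>\<^bsub>M\<^esub> f (q i))"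
proof -
  interpret M: Module.module K M by fact
  let ?s = "\<Oplus>\<^bsub>H\<^esub>i\<in>{..<r}. \<psi> i x \<odot>\<^bsub>H\<^esub> q i"
  have s: "?s \<in> carrier H" using x by (intro H.M.finsum_closed) auto
  have "f x \<ominus>\<^bsub>M\<^esub> f ?s = \<zero>\<^bsub>M\<^esub>"
    using z[OF q_expand[OF x]] linear_diff[OF H_vs M f x s] by simp
  then have "f x = f ?s"
    by (rule eq_of_diff_zero[OF M.M.abelian_group_axioms linear_closed[OF f x] linear_closed[OF f s]])
  also have "\<dots> = (\<Oplus>\<^bsub>M\<^esub>i\<in>{..<r}. f (\<psi> i x \<odot>\<^bsub>H\<^esub> q i))"
    using x by (intro linear_finsum[OF H_vs M f]) auto
  also have "\<dots> = (\<Oplus>\<^bsub>M\<^esub>i\<in>{..<r}. \<psi> i x \<odot>\<^bsub>M\<^esub> f (q i))"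
    using x linear_closed[OF f] by (intro M.M.finsum_cong') (auto simp: linear_smult[OF f])
  finally show ?thesis .
qed

text \<open>Matrix coefficients of the right \<open>H\<close>-module \<open>Q = H / R\<^sup>+ H\<close> in the basis of the classes of the \<open>q i\<close>,
  and of its tensor powers with the diagonal action.\<close>

definition pq where "pq i j s = \<psi> j (q i \<otimes>\<^bsub>H\<^esub> s)"

lemma pq_linear: "\<lbrakk>i < r; j < r\<rbrakk> \<Longrightarrow> pq i j \<in> linear_maps K H (regular_module K)"
  using linear_comp[OF bilinear_right[OF mult_bilinear q_closed] \<psi>_linear] by (simp add: pq_def[abs_def])

lemma pq_closed [simp, intro]: "\<lbrakk>i < r; j < r; s \<in> carrier H\<rbrakk> \<Longrightarrow> pq i j s \<in> carrier K"
  by (rule form_closed[OF pq_linear])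

text \<open>For fixed \<open>s\<close> the functional h -> \<open>\<psi> i\<close> (h s) kills the
  right ideal \<open>I\<close>, so it can be expanded in the \<open>\<psi> j\<close>.\<close>

lemma \<psi>_mult:
  assumes i: "i < r" and h: "h \<in> carrier H" and s: "s \<in> carrier H"
  shows "\<psi> i (h \<otimes>\<^bsub>H\<^esub> s) = (\<Oplus>j\<in>{..<r}. \<psi> j h \<otimes> pq j i s)"
proof -
  have "\<psi> i (h \<otimes>\<^bsub>H\<^esub> s) = (\<Oplus>\<^bsub>regular_module K\<^esub>j\<in>{..<r}. \<psi> j h \<odot>\<^bsub>regular_module K\<^esub> \<psi> i (q j \<otimes>\<^bsub>H\<^esub> s))"
    by (rule kills_I_expand[OF regular_vs linear_comp[OF bilinear_left[OF mult_bilinear s] \<psi>_linear[OF i]] _ h])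
      (simp add: \<psi>_I i I_right_ideal s)
  then show ?thesis by (simp add: finsum_regular pq_def)
qed

primrec pw :: "nat list \<Rightarrow> nat list \<Rightarrow> 'h \<Rightarrow> 'k"
  where "pw [] w' s = (if w' = [] then eps s else \<zero>)"
  | "pw (i # w) w' s = (case w' of [] \<Rightarrow> \<zero> | j # w'' \<Rightarrow> \<Oplus>k\<in>{..<n}. pq i j (b k) \<otimes> pw w w'' (dd k s))"

text \<open>Index set of the basis of the m-th tensor power of Q. The empty word stands for the
  ground field, on which H acts through the counit, as in the first clause of
  \<open>pw\<close>.\<close>

definition words where "words m = {w. length w = m \<and> set w \<subseteq> {..<r}}"

lemma finite_words [simp]: "finite (words m)"
  using finite_lists_length_eq[of "{..<r}" m] by (simp add: words_def conj_commute)

lemma words_0 [simp]: "words 0 = {[]}"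
  by (auto simp: words_def)

lemma words_Suc: "words (Suc m) = (\<lambda>(i, w). i # w) ` ({..<r} \<times> words m)"
  by (auto simp: words_def length_Suc_conv)

lemma Cons_words [simp]: "i # w \<in> words (Suc m) \<longleftrightarrow> i < r \<and> w \<in> words m"
  by (auto simp: words_def)

lemma words_SucE:
  assumes "v \<in> words (Suc m)" obtains i w where "v = i # w" "i < r" "w \<in> words m"
  using assms by (auto simp: words_Suc)

lemma finsum_words_Suc:
  assumes "abelian_monoid M" "\<And>i w. \<lbrakk>i < r; w \<in> words m\<rbrakk> \<Longrightarrow> f (i # w) \<in> carrier M"
  shows "(\<Oplus>\<^bsub>M\<^esub>v\<in>words (Suc m). f v) = (\<Oplus>\<^bsub>M\<^esub>i\<in>{..<r}. \<Oplus>\<^bsub>M\<^esub>w\<in>words m. f (i # w))"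
proof -
  interpret M: abelian_monoid M by fact
  have "(\<Oplus>\<^bsub>M\<^esub>v\<in>words (Suc m). f v) = (\<Oplus>\<^bsub>M\<^esub>p\<in>{..<r} \<times> words m. f (case p of (i, w) \<Rightarrow> i # w))"
    unfolding words_Suc by (intro M.finsum_reindex) (use assms(2) in \<open>auto simp: inj_on_def\<close>)
  also have "\<dots> = (\<Oplus>\<^bsub>M\<^esub>i\<in>{..<r}. \<Oplus>\<^bsub>M\<^esub>w\<in>words m. f (i # w))"
    using assms(2) by (subst finsum_times[OF assms(1)]) auto
  finally show ?thesis .
qed

lemma pw_linear:
  "\<lbrakk>w \<in> words m; w' \<in> words m\<rbrakk> \<Longrightarrow> pw w w' \<in> linear_maps K H (regular_module K)"
proof (induction m arbitrary: w w')
  case 0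
  then have "pw w w' = eps" by (auto simp: fun_eq_iff)
  then show ?case using eps_linear by simp
next
  case (Suc m)
  obtain i v where v: "w = i # v" "i < r" "v \<in> words m" using Suc.prems(1) by (rule words_SucE)
  obtain j v' where v': "w' = j # v'" "j < r" "v' \<in> words m" using Suc.prems(2) by (rule words_SucE)
  have l: "(\<lambda>s. \<Oplus>\<^bsub>regular_module K\<^esub>k\<in>{..<n}. pq i j (b k) \<odot>\<^bsub>regular_module K\<^esub> pw v v' (dd k s)) \<in> linear_maps K H (regular_module K)"
    using v v' by (intro linear_sum regular_vs linear_scale linear_comp[OF dd_linear Suc.IH]) auto
  have "pw w w' = (\<lambda>s. \<Oplus>\<^bsub>regular_module K\<^esub>k\<in>{..<n}. pq i j (b k) \<odot>\<^bsub>regular_module K\<^esub> pw v v' (dd k s))"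
    by (simp add: v(1) v'(1) finsum_regular fun_eq_iff)
  with l show ?case by simp
qed

lemma pw_closed [simp, intro]:
  "\<lbrakk>w \<in> words m; w' \<in> words m; s \<in> carrier H\<rbrakk> \<Longrightarrow> pw w w' s \<in> carrier K"
  by (rule form_closed[OF pw_linear])

end

section \<open>Coordinates and generators for H tensored over R with a left H-module\<close>

context hopf_quot
begin

sublocale HT: tensor_tower K H R "carrier H" "carrier H"
  by unfold_locales
    (auto simp: H_vs mult_bilinear R_closed H.m_assoc)

declare HT.T_simps [simp del]

lemma finsum_H_closed: "(\<And>i. i \<in> A \<Longrightarrow> f i \<in> carrier H) \<Longrightarrow> finsum H f A \<in> carrier H"
  by (rule H.M.finsum_closed) auto

text \<open>The i-th component of h -> h_(1) \<otimes> [h_(2)] in H \<otimes> Q, that is h_(1)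
  \<open>\<psi> i\<close> (h_(2)). Together the x G_i(h) are the H-coordinates of x \<otimes> h in H
  tensored with H over R.\<close>

definition G where "G i h = (\<Oplus>\<^bsub>H\<^esub>k\<in>{..<n}. \<psi> i (dd k h) \<odot>\<^bsub>H\<^esub> b k)"

lemma G_linear: "i < r \<Longrightarrow> G i \<in> linear_maps K H H"
  unfolding G_def[abs_def]
proof (rule linear_sum[OF H_vs])
  fix k assume i: "i < r" and k: "k \<in> {..<n}"
  then have l: "(\<lambda>h. \<psi> i (dd k h)) \<in> linear_maps K H (regular_module K)"
    by (intro linear_comp[OF dd_linear \<psi>_linear]) auto
  show "(\<lambda>h. \<psi> i (dd k h) \<odot>\<^bsub>H\<^esub> b k) \<in> linear_maps K H H"
    using k form_closed[OF l] form_add[OF l] form_smult[OF l]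
    by (intro linear_mapsI) (auto simp: H.smult_l_distr H.smult_assoc1)
qed

lemma G_closed [simp, intro]: "\<lbrakk>i < r; h \<in> carrier H\<rbrakk> \<Longrightarrow> G i h \<in> carrier H"
  by (rule linear_closed[OF G_linear])

lemma G_product:
  assumes i: "i < r" and x: "x \<in> carrier H" and y: "y \<in> carrier H"
  shows "G i (x \<otimes>\<^bsub>H\<^esub> y) =
    (\<Oplus>\<^bsub>H\<^esub>k\<in>{..<n}. \<Oplus>\<^bsub>H\<^esub>l\<in>{..<n}. \<psi> i (dd k x \<otimes>\<^bsub>H\<^esub> dd l y) \<odot>\<^bsub>H\<^esub> (b k \<otimes>\<^bsub>H\<^esub> b l))"
proof -
  have "bilinear H H H (\<lambda>u v. \<psi> i v \<odot>\<^bsub>H\<^esub> u)"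
    using i by (intro bilinearI') (auto simp: \<psi>_add \<psi>_smult H.smult_l_distr H.smult_r_distr H.smult_assoc1[symmetric] m_comm)
  from sweedler_mult[OF H_vs this x y] show ?thesis by (simp add: G_def)
qed

text \<open>For x in R the second leg x_(2) is in R, so \<open>\<psi> i\<close> (x_(2) h_(2)) =
  eps(x_(2)) \<open>\<psi> i\<close> (h_(2)), and the counit absorbs x_(2). This makes the
  coordinates x G_i(h) balanced over R.\<close>

lemma G_R:
  assumes i: "i < r" and x: "x \<in> R" and h: "h \<in> carrier H"
  shows "G i (x \<otimes>\<^bsub>H\<^esub> h) = x \<otimes>\<^bsub>H\<^esub> G i h"
proof -
  have xc: "x \<in> carrier H" by (rule R_closed[OF x])
  have "G i (x \<otimes>\<^bsub>H\<^esub> h) = (\<Oplus>\<^bsub>H\<^esub>k\<in>{..<n}. (eps (dd k x) \<odot>\<^bsub>H\<^esub> b k) \<otimes>\<^bsub>H\<^esub> G i h)"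
    unfolding G_product[OF i xc h]
  proof (intro H.finsum_cong' refl)
    fix k assume k: "k \<in> {..<n}"
    have "(\<Oplus>\<^bsub>H\<^esub>l\<in>{..<n}. \<psi> i (dd k x \<otimes>\<^bsub>H\<^esub> dd l h) \<odot>\<^bsub>H\<^esub> (b k \<otimes>\<^bsub>H\<^esub> b l)) =
        (\<Oplus>\<^bsub>H\<^esub>l\<in>{..<n}. (eps (dd k x) \<odot>\<^bsub>H\<^esub> b k) \<otimes>\<^bsub>H\<^esub> (\<psi> i (dd l h) \<odot>\<^bsub>H\<^esub> b l))"
      using k i xc h x
      by (intro H.finsum_cong') (auto simp: \<psi>_R dd_R H.smult_mult_left H.smult_mult_right H.smult_assoc1[symmetric] m_comm)
    also have "\<dots> = (eps (dd k x) \<odot>\<^bsub>H\<^esub> b k) \<otimes>\<^bsub>H\<^esub> G i h"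
      unfolding G_def using k i xc h by (intro H.finsum_rdistr[symmetric]) auto
    finally show "(\<Oplus>\<^bsub>H\<^esub>l\<in>{..<n}. \<psi> i (dd k x \<otimes>\<^bsub>H\<^esub> dd l h) \<odot>\<^bsub>H\<^esub> (b k \<otimes>\<^bsub>H\<^esub> b l)) = \<dots>" .
  qed (use i xc h in auto)
  also have "\<dots> = (\<Oplus>\<^bsub>H\<^esub>k\<in>{..<n}. eps (dd k x) \<odot>\<^bsub>H\<^esub> b k) \<otimes>\<^bsub>H\<^esub> G i h"
    using i xc h by (intro H.finsum_ldistr[symmetric]) auto
  finally show ?thesis using sweedler_counit_right[OF xc] by simp
qed

text \<open>The matrix s_(1) p(s_(2)) of the right action on coordinates: \<open>b k\<close> is
  s_(1) and \<open>dd k s\<close> is s_(2).\<close>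

definition PL where "PL w w' s = (\<Oplus>\<^bsub>H\<^esub>k\<in>{..<n}. pw w w' (dd k s) \<odot>\<^bsub>H\<^esub> b k)"

lemma PL_closed [simp, intro]: "\<lbrakk>w \<in> words m; w' \<in> words m; s \<in> carrier H\<rbrakk> \<Longrightarrow> PL w w' s \<in> carrier H"
  unfolding PL_def by (rule finsum_H_closed) auto

lemma eps_PL:
  assumes w: "w \<in> words m" "w' \<in> words m" and s: "s \<in> carrier H"
  shows "eps (PL w w' s) = pw w w' s"
proof -
  have "eps (PL w w' s) = (\<Oplus>k\<in>{..<n}. eps (pw w w' (dd k s) \<odot>\<^bsub>H\<^esub> b k))"
    unfolding PL_def using w s by (intro form_finsum[OF H_vs eps_linear]) auto
  also have "\<dots> = (\<Oplus>k\<in>{..<n}. pw w w' (eps (b k) \<odot>\<^bsub>H\<^esub> dd k s))"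
    using w s by (intro finsum_cong') (auto simp: eps_smult form_smult[OF pw_linear[OF w]] m_comm)
  also have "\<dots> = pw w w' (\<Oplus>\<^bsub>H\<^esub>k\<in>{..<n}. eps (b k) \<odot>\<^bsub>H\<^esub> dd k s)"
    using s by (intro form_finsum[OF H_vs pw_linear[OF w], symmetric]) auto
  finally show ?thesis using sweedler_counit_left[OF s] by simp
qed

lemma PL_Nil: "s \<in> carrier H \<Longrightarrow> PL [] [] s = s"
  by (simp add: PL_def sweedler_counit_right)

text \<open>Expand \<open>\<psi> i\<close> (x_(2) y_(2)) by \<open>\<psi>_mult\<close>; the terms
  then factor into G_j(x) and y_(1) p_(ji)(y_(2)).\<close>

lemma G_mult:
  assumes i: "i < r" and x: "x \<in> carrier H" and y: "y \<in> carrier H"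
  shows "G i (x \<otimes>\<^bsub>H\<^esub> y) = (\<Oplus>\<^bsub>H\<^esub>j\<in>{..<r}. G j x \<otimes>\<^bsub>H\<^esub> (\<Oplus>\<^bsub>H\<^esub>l\<in>{..<n}. pq j i (dd l y) \<odot>\<^bsub>H\<^esub> b l))"
proof -
  let ?g = "\<lambda>j k l. (\<psi> j (dd k x) \<odot>\<^bsub>H\<^esub> b k) \<otimes>\<^bsub>H\<^esub> (pq j i (dd l y) \<odot>\<^bsub>H\<^esub> b l)"
  have gc: "?g j k l \<in> carrier H" if "j < r" "k < n" "l < n" for j k l using that i x y by auto
  have "G i (x \<otimes>\<^bsub>H\<^esub> y) = (\<Oplus>\<^bsub>H\<^esub>k\<in>{..<n}. \<Oplus>\<^bsub>H\<^esub>l\<in>{..<n}. \<Oplus>\<^bsub>H\<^esub>j\<in>{..<r}. ?g j k l)"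
    unfolding G_product[OF i x y]
  proof (intro H.finsum_cong' refl)
    fix k l assume k: "k \<in> {..<n}" and l: "l \<in> {..<n}"
    have "\<psi> i (dd k x \<otimes>\<^bsub>H\<^esub> dd l y) \<odot>\<^bsub>H\<^esub> (b k \<otimes>\<^bsub>H\<^esub> b l) =
        (\<Oplus>j\<in>{..<r}. \<psi> j (dd k x) \<otimes> pq j i (dd l y)) \<odot>\<^bsub>H\<^esub> (b k \<otimes>\<^bsub>H\<^esub> b l)"
      using k l i x y by (simp add: \<psi>_mult)
    also have "\<dots> = (\<Oplus>\<^bsub>H\<^esub>j\<in>{..<r}. (\<psi> j (dd k x) \<otimes> pq j i (dd l y)) \<odot>\<^bsub>H\<^esub> (b k \<otimes>\<^bsub>H\<^esub> b l))"
      using k l i x y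
      by (intro additive_finsum[OF abelian_group_axioms H.M.abelian_group_axioms, where f="\<lambda>c. c \<odot>\<^bsub>H\<^esub> (b k \<otimes>\<^bsub>H\<^esub> b l)"])
        (auto simp: H.smult_l_distr)
    also have "\<dots> = (\<Oplus>\<^bsub>H\<^esub>j\<in>{..<r}. ?g j k l)"
      using k l i x y by (intro H.finsum_cong') (auto simp: H.smult_mult_left H.smult_mult_right H.smult_assoc1[symmetric] m_comm)
    finally show "\<psi> i (dd k x \<otimes>\<^bsub>H\<^esub> dd l y) \<odot>\<^bsub>H\<^esub> (b k \<otimes>\<^bsub>H\<^esub> b l) = (\<Oplus>\<^bsub>H\<^esub>j\<in>{..<r}. ?g j k l)" .
  qed (use gc in \<open>auto intro!: finsum_H_closed\<close>)
  also have "\<dots> = (\<Oplus>\<^bsub>H\<^esub>k\<in>{..<n}. \<Oplus>\<^bsub>H\<^esub>j\<in>{..<r}. \<Oplus>\<^bsub>H\<^esub>l\<in>{..<n}. ?g j k l)"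
    using gc by (intro H.finsum_cong' refl H.finsum_swap) (auto intro!: finsum_H_closed)
  also have "\<dots> = (\<Oplus>\<^bsub>H\<^esub>j\<in>{..<r}. \<Oplus>\<^bsub>H\<^esub>k\<in>{..<n}. \<Oplus>\<^bsub>H\<^esub>l\<in>{..<n}. ?g j k l)"
    using gc by (intro H.finsum_swap) (auto intro!: finsum_H_closed)
  also have "\<dots> = (\<Oplus>\<^bsub>H\<^esub>j\<in>{..<r}. G j x \<otimes>\<^bsub>H\<^esub> (\<Oplus>\<^bsub>H\<^esub>l\<in>{..<n}. pq j i (dd l y) \<odot>\<^bsub>H\<^esub> b l))"
  proof (intro H.finsum_cong' refl)
    fix j assume j: "j \<in> {..<r}"
    have "(\<Oplus>\<^bsub>H\<^esub>k\<in>{..<n}. \<Oplus>\<^bsub>H\<^esub>l\<in>{..<n}. ?g j k l) =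
        (\<Oplus>\<^bsub>H\<^esub>k\<in>{..<n}. (\<psi> j (dd k x) \<odot>\<^bsub>H\<^esub> b k) \<otimes>\<^bsub>H\<^esub> (\<Oplus>\<^bsub>H\<^esub>l\<in>{..<n}. pq j i (dd l y) \<odot>\<^bsub>H\<^esub> b l))"
      using j i x y by (intro H.finsum_cong' refl H.finsum_rdistr[symmetric]) (auto intro!: finsum_H_closed)
    also have "\<dots> = G j x \<otimes>\<^bsub>H\<^esub> (\<Oplus>\<^bsub>H\<^esub>l\<in>{..<n}. pq j i (dd l y) \<odot>\<^bsub>H\<^esub> b l)"
      unfolding G_def using j i x y by (intro H.finsum_ldistr[symmetric]) (auto intro!: finsum_H_closed)
    finally show "(\<Oplus>\<^bsub>H\<^esub>k\<in>{..<n}. \<Oplus>\<^bsub>H\<^esub>l\<in>{..<n}. ?g j k l) = \<dots>" .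
  qed (use i x y in \<open>auto intro!: finsum_H_closed\<close>)
  finally show ?thesis .
qed

text \<open>Coassociativity: both sides are s_(1) p_(ji)(s_(2)) times the entry of the shorter words
  at s_(3), the left one splitting the first leg of s and the right one the second.\<close>

lemma PL_Cons:
  assumes i: "i < r" and j: "j < r" and w: "w \<in> words m" "w' \<in> words m" and s: "s \<in> carrier H"
  shows "(\<Oplus>\<^bsub>H\<^esub>k\<in>{..<n}. pw w w' (dd k s) \<odot>\<^bsub>H\<^esub> (\<Oplus>\<^bsub>H\<^esub>l\<in>{..<n}. pq j i (dd l (b k)) \<odot>\<^bsub>H\<^esub> b l)) = PL (j # w) (i # w') s"
proof -
  note pl = pw_linear[OF w] and ql = pq_linear[OF j i]
  let ?f = "\<lambda>x y z. (pq j i y \<otimes> pw w w' z) \<odot>\<^bsub>H\<^esub> x"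
  have tri: "trilinear H H H H ?f"
  proof (rule trilinearI)
    fix x assume "x \<in> carrier H"
    then show "bilinear H H H (?f x)" using i j w
      by (intro bilinearI')
        (auto simp: form_add[OF pl] form_smult[OF pl] form_add[OF ql] form_smult[OF ql] l_distr r_distr
          H.smult_l_distr H.smult_assoc1[symmetric] m_ac)
  next
    fix y z assume "y \<in> carrier H" "z \<in> carrier H"
    then show "(\<lambda>x. ?f x y z) \<in> linear_maps K H H" using i j w
      by (intro linear_mapsI) (auto simp: H.smult_r_distr H.smult_assoc1[symmetric] m_ac)
  qed
  have "(\<Oplus>\<^bsub>H\<^esub>k\<in>{..<n}. pw w w' (dd k s) \<odot>\<^bsub>H\<^esub> (\<Oplus>\<^bsub>H\<^esub>l\<in>{..<n}. pq j i (dd l (b k)) \<odot>\<^bsub>H\<^esub> b l)) =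
      (\<Oplus>\<^bsub>H\<^esub>k\<in>{..<n}. \<Oplus>\<^bsub>H\<^esub>l\<in>{..<n}. ?f (b l) (dd l (b k)) (dd k s))"
  proof (intro H.finsum_cong' refl)
    fix k assume k: "k \<in> {..<n}"
    have "pw w w' (dd k s) \<odot>\<^bsub>H\<^esub> (\<Oplus>\<^bsub>H\<^esub>l\<in>{..<n}. pq j i (dd l (b k)) \<odot>\<^bsub>H\<^esub> b l) =
       (\<Oplus>\<^bsub>H\<^esub>l\<in>{..<n}. pw w w' (dd k s) \<odot>\<^bsub>H\<^esub> (pq j i (dd l (b k)) \<odot>\<^bsub>H\<^esub> b l))"
      using k i j w s by (intro H.finsum_smult_ldistr) auto
    also have "\<dots> = (\<Oplus>\<^bsub>H\<^esub>l\<in>{..<n}. ?f (b l) (dd l (b k)) (dd k s))"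
      using k i j w s by (intro H.finsum_cong') (auto simp: H.smult_assoc1[symmetric] m_comm)
    finally show "pw w w' (dd k s) \<odot>\<^bsub>H\<^esub> (\<Oplus>\<^bsub>H\<^esub>l\<in>{..<n}. pq j i (dd l (b k)) \<odot>\<^bsub>H\<^esub> b l) = \<dots>" .
  qed (use i j w s in \<open>auto intro!: finsum_H_closed\<close>)
  also have "\<dots> = (\<Oplus>\<^bsub>H\<^esub>k\<in>{..<n}. \<Oplus>\<^bsub>H\<^esub>l\<in>{..<n}. ?f (b k) (b l) (dd l (dd k s)))"
    by (rule sweedler_coassoc[OF H_vs tri s])
  also have "\<dots> = PL (j # w) (i # w') s"
    unfolding PL_def
  proof (intro H.finsum_cong' refl)
    fix k assume k: "k \<in> {..<n}"
    show "(\<Oplus>\<^bsub>H\<^esub>l\<in>{..<n}. ?f (b k) (b l) (dd l (dd k s))) = pw (j # w) (i # w') (dd k s) \<odot>\<^bsub>H\<^esub> b k"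
      using k i j w s
      by (simp, intro additive_finsum[OF abelian_group_axioms H.M.abelian_group_axioms, where f="\<lambda>c. c \<odot>\<^bsub>H\<^esub> b k", symmetric])
        (auto simp: H.smult_l_distr)
  qed (use i j w s pw_closed[of "j # w" "Suc m" "i # w'"] in \<open>auto simp del: pw.simps\<close>)
  finally show ?thesis .
qed

text \<open>The computation behind the induction on the right action: applying \<open>G i\<close> to
  a coordinate already multiplied by the matrix for words of length m produces the matrix for words
  one letter longer.\<close>

lemma G_PL:
  assumes i: "i < r" and w: "w \<in> words m" "w' \<in> words m" and h: "h \<in> carrier H" and s: "s \<in> carrier H"
  shows "G i (h \<otimes>\<^bsub>H\<^esub> PL w' w s) = (\<Oplus>\<^bsub>H\<^esub>j\<in>{..<r}. G j h \<otimes>\<^bsub>H\<^esub> PL (j # w') (i # w) s)"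
proof -
  let ?E = "\<lambda>j y. \<Oplus>\<^bsub>H\<^esub>l\<in>{..<n}. pq j i (dd l y) \<odot>\<^bsub>H\<^esub> b l"
  have Ec: "?E j y \<in> carrier H" if "j < r" "y \<in> carrier H" for j y
    using that i by (intro finsum_H_closed) auto
  have "G i (h \<otimes>\<^bsub>H\<^esub> PL w' w s) = G i (\<Oplus>\<^bsub>H\<^esub>k\<in>{..<n}. pw w' w (dd k s) \<odot>\<^bsub>H\<^esub> (h \<otimes>\<^bsub>H\<^esub> b k))"
  proof -
    have "h \<otimes>\<^bsub>H\<^esub> PL w' w s = (\<Oplus>\<^bsub>H\<^esub>k\<in>{..<n}. h \<otimes>\<^bsub>H\<^esub> (pw w' w (dd k s) \<odot>\<^bsub>H\<^esub> b k))"
      unfolding PL_def using h w s by (intro H.finsum_rdistr) auto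
    also have "\<dots> = (\<Oplus>\<^bsub>H\<^esub>k\<in>{..<n}. pw w' w (dd k s) \<odot>\<^bsub>H\<^esub> (h \<otimes>\<^bsub>H\<^esub> b k))"
      using h w s by (intro H.finsum_cong') (auto simp: H.smult_mult_right)
    finally show ?thesis by simp
  qed
  also have "\<dots> = (\<Oplus>\<^bsub>H\<^esub>k\<in>{..<n}. G i (pw w' w (dd k s) \<odot>\<^bsub>H\<^esub> (h \<otimes>\<^bsub>H\<^esub> b k)))"
    using h w s by (intro linear_finsum[OF H_vs H_vs G_linear[OF i]]) auto
  also have "\<dots> = (\<Oplus>\<^bsub>H\<^esub>k\<in>{..<n}. \<Oplus>\<^bsub>H\<^esub>j\<in>{..<r}. G j h \<otimes>\<^bsub>H\<^esub> (pw w' w (dd k s) \<odot>\<^bsub>H\<^esub> ?E j (b k)))"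
  proof (intro H.finsum_cong' refl)
    fix k assume k: "k \<in> {..<n}"
    have "G i (pw w' w (dd k s) \<odot>\<^bsub>H\<^esub> (h \<otimes>\<^bsub>H\<^esub> b k)) = pw w' w (dd k s) \<odot>\<^bsub>H\<^esub> (\<Oplus>\<^bsub>H\<^esub>j\<in>{..<r}. G j h \<otimes>\<^bsub>H\<^esub> ?E j (b k))"
      using k h w s i by (simp add: linear_smult[OF G_linear] G_mult)
    also have "\<dots> = (\<Oplus>\<^bsub>H\<^esub>j\<in>{..<r}. pw w' w (dd k s) \<odot>\<^bsub>H\<^esub> (G j h \<otimes>\<^bsub>H\<^esub> ?E j (b k)))"
      using k h w s Ec by (intro H.finsum_smult_ldistr) auto
    also have "\<dots> = (\<Oplus>\<^bsub>H\<^esub>j\<in>{..<r}. G j h \<otimes>\<^bsub>H\<^esub> (pw w' w (dd k s) \<odot>\<^bsub>H\<^esub> ?E j (b k)))"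
      using k h w s Ec by (intro H.finsum_cong') (auto simp: H.smult_mult_right)
    finally show "G i (pw w' w (dd k s) \<odot>\<^bsub>H\<^esub> (h \<otimes>\<^bsub>H\<^esub> b k)) = \<dots>" .
  qed (use h w s Ec in \<open>auto intro!: finsum_H_closed\<close>)
  also have "\<dots> = (\<Oplus>\<^bsub>H\<^esub>j\<in>{..<r}. \<Oplus>\<^bsub>H\<^esub>k\<in>{..<n}. G j h \<otimes>\<^bsub>H\<^esub> (pw w' w (dd k s) \<odot>\<^bsub>H\<^esub> ?E j (b k)))"
    using h w s Ec by (intro H.finsum_swap) auto
  also have "\<dots> = (\<Oplus>\<^bsub>H\<^esub>j\<in>{..<r}. G j h \<otimes>\<^bsub>H\<^esub> PL (j # w') (i # w) s)"
  proof (intro H.finsum_cong' refl)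
    fix j assume j: "j \<in> {..<r}"
    have "(\<Oplus>\<^bsub>H\<^esub>k\<in>{..<n}. G j h \<otimes>\<^bsub>H\<^esub> (pw w' w (dd k s) \<odot>\<^bsub>H\<^esub> ?E j (b k))) =
        G j h \<otimes>\<^bsub>H\<^esub> (\<Oplus>\<^bsub>H\<^esub>k\<in>{..<n}. pw w' w (dd k s) \<odot>\<^bsub>H\<^esub> ?E j (b k))"
      using j h w s Ec by (intro H.finsum_rdistr[symmetric]) auto
    then show "(\<Oplus>\<^bsub>H\<^esub>k\<in>{..<n}. G j h \<otimes>\<^bsub>H\<^esub> (pw w' w (dd k s) \<odot>\<^bsub>H\<^esub> ?E j (b k))) = G j h \<otimes>\<^bsub>H\<^esub> PL (j # w') (i # w) s"
      using j PL_Cons[OF i _ w(2,1) s, of j] by simp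
  qed (use i h w s PL_closed[of "_ # w'" "Suc m" "i # w"] in auto)
  finally show ?thesis .
qed

text \<open>\<open>BB m t a h = a \<otimes> h t\<close> and \<open>UU m t h = S(h\<^sub>1) \<otimes> h\<^sub>2 t\<close>; the latter depends only on the class of \<open>h\<close>
  in \<open>Q\<close>.\<close>

abbreviation TT where "TT m \<equiv> HT.T (Suc m)"
definition BB where "BB m t a h = HT.cons (Suc m) a (lact (TT m) h t)"
definition UU where "UU m t h = (\<Oplus>\<^bsub>TT (Suc m)\<^esub>k\<in>{..<n}. BB m t (antip (b k)) (dd k h))"

lemma lact_bilinear: "bilinear H (TT m) (TT m) (lact (TT m))"
  using linear_add[OF HT.lact_linear] linear_smult[OF HT.lact_linear]
  by (intro bilinearI' HT.lact_closed HT.lact_add_left HT.lact_smult_left) auto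

lemma lact_mult:
  "\<lbrakk>x \<in> carrier H; y \<in> carrier H; t \<in> carrier (TT m)\<rbrakk> \<Longrightarrow> lact (TT m) x (lact (TT m) y t) = lact (TT m) (x \<otimes>\<^bsub>H\<^esub> y) t"
  by (rule HT.lact_lact) (auto simp: H.m_assoc)

lemma lact_one: "t \<in> carrier (TT m) \<Longrightarrow> lact (TT m) \<one>\<^bsub>H\<^esub> t = t"
  by (rule HT.lact_id) auto

context
  fixes m and t
  assumes t: "t \<in> carrier (TT m)"
begin

lemma BB_bilinear: "bilinear H H (TT (Suc m)) (BB m t)"
  unfolding BB_def[abs_def]
  by (rule bilinear_comp2[OF HT.cons_bilinear linear_id bilinear_left[OF lact_bilinear t]])

lemma BB_closed: "\<lbrakk>a \<in> carrier H; h \<in> carrier H\<rbrakk> \<Longrightarrow> BB m t a h \<in> carrier (TT (Suc m))"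
  by (rule bilinear_closed[OF BB_bilinear])

lemma BB_R: "\<lbrakk>a \<in> carrier H; x \<in> R; h \<in> carrier H\<rbrakk> \<Longrightarrow> BB m t a (x \<otimes>\<^bsub>H\<^esub> h) = BB m t (a \<otimes>\<^bsub>H\<^esub> x) h"
  unfolding BB_def using t R_closed
  by (simp add: HT.cons_balanced HT.lact_closed lact_mult)

lemma lact_BB: "\<lbrakk>x \<in> carrier H; a \<in> carrier H; h \<in> carrier H\<rbrakk> \<Longrightarrow> lact (TT (Suc m)) x (BB m t a h) = BB m t (x \<otimes>\<^bsub>H\<^esub> a) h"
  unfolding BB_def using t by (simp add: HT.lact_cons HT.lact_closed)

lemma UU_linear: "UU m t \<in> linear_maps K H (TT (Suc m))"
  unfolding UU_def[abs_def]
  by (intro linear_sum HT.T_vs linear_comp[OF dd_linear bilinear_right[OF BB_bilinear]]) auto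

lemma UU_closed: "h \<in> carrier H \<Longrightarrow> UU m t h \<in> carrier (TT (Suc m))"
  by (rule linear_closed[OF UU_linear])

lemma lact_UU:
  assumes x: "x \<in> carrier H" and h: "h \<in> carrier H"
  shows "lact (TT (Suc m)) x (UU m t h) = (\<Oplus>\<^bsub>TT (Suc m)\<^esub>k\<in>{..<n}. BB m t (x \<otimes>\<^bsub>H\<^esub> antip (b k)) (dd k h))"
proof -
  interpret T: Module.module K "TT (Suc m)" by (rule HT.T_vs)
  have "lact (TT (Suc m)) x (UU m t h) = (\<Oplus>\<^bsub>TT (Suc m)\<^esub>k\<in>{..<n}. lact (TT (Suc m)) x (BB m t (antip (b k)) (dd k h)))"
    unfolding UU_def using x h by (intro linear_finsum[OF HT.T_vs HT.T_vs HT.lact_linear] BB_closed) auto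
  also have "\<dots> = (\<Oplus>\<^bsub>TT (Suc m)\<^esub>k\<in>{..<n}. BB m t (x \<otimes>\<^bsub>H\<^esub> antip (b k)) (dd k h))"
  proof (intro T.M.finsum_cong' refl)
    fix k assume "k \<in> {..<n}"
    then show "lact (TT (Suc m)) x (BB m t (antip (b k)) (dd k h)) = BB m t (x \<otimes>\<^bsub>H\<^esub> antip (b k)) (dd k h)"
      using x h by (intro lact_BB) auto
  next
    show "(\<lambda>k. BB m t (x \<otimes>\<^bsub>H\<^esub> antip (b k)) (dd k h)) \<in> {..<n} \<rightarrow> carrier (TT (Suc m))"
      using x h by (intro funcsetI BB_closed) auto
  qed
  finally show ?thesis .
qed

text \<open>The right-hand side is a h_(1) S(h_(2)) \<otimes> h_(3) t, and h_(1) S(h_(2)) collapses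
  by the antipode axiom. So the elements \<open>UU m t h\<close> generate the pure tensors over
  H.\<close>

lemma BB_expand:
  assumes a: "a \<in> carrier H" and h: "h \<in> carrier H"
  shows "BB m t a h = (\<Oplus>\<^bsub>TT (Suc m)\<^esub>i\<in>{..<n}. lact (TT (Suc m)) (a \<otimes>\<^bsub>H\<^esub> b i) (UU m t (dd i h)))"
proof -
  interpret T: Module.module K "TT (Suc m)" by (rule HT.T_vs)
  let ?f = "\<lambda>x y z. BB m t (a \<otimes>\<^bsub>H\<^esub> x \<otimes>\<^bsub>H\<^esub> antip y) z"
  note lin = bilinear_add[OF BB_bilinear] H.r_distr H.l_distr H.smult_mult_left H.smult_mult_right
    linear_add[OF antip_linear] linear_smult[OF antip_linear]
  have tri: "trilinear H H H (TT (Suc m)) ?f"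
    using a by (intro trilinearI bilinearI' linear_mapsI BB_closed) (simp_all add: lin)
  have "(\<Oplus>\<^bsub>TT (Suc m)\<^esub>i\<in>{..<n}. lact (TT (Suc m)) (a \<otimes>\<^bsub>H\<^esub> b i) (UU m t (dd i h))) =
      (\<Oplus>\<^bsub>TT (Suc m)\<^esub>i\<in>{..<n}. \<Oplus>\<^bsub>TT (Suc m)\<^esub>k\<in>{..<n}. ?f (b i) (b k) (dd k (dd i h)))"
    using a h by (intro T.M.finsum_cong' refl lact_UU funcsetI T.M.finsum_closed BB_closed) auto
  also have "\<dots> = (\<Oplus>\<^bsub>TT (Suc m)\<^esub>i\<in>{..<n}. \<Oplus>\<^bsub>TT (Suc m)\<^esub>j\<in>{..<n}. ?f (b j) (dd j (b i)) (dd i h))"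
    by (rule sweedler_coassoc[OF HT.T_vs tri h, symmetric])
  also have "\<dots> = (\<Oplus>\<^bsub>TT (Suc m)\<^esub>i\<in>{..<n}. BB m t a (eps (b i) \<odot>\<^bsub>H\<^esub> dd i h))"
  proof (intro T.M.finsum_cong' refl funcsetI BB_closed)
    fix i assume i: "i \<in> {..<n}"
    then have bi: "b i \<in> carrier H" by simp
    have "(\<Oplus>\<^bsub>TT (Suc m)\<^esub>j\<in>{..<n}. ?f (b j) (dd j (b i)) (dd i h)) =
        BB m t (\<Oplus>\<^bsub>H\<^esub>j\<in>{..<n}. a \<otimes>\<^bsub>H\<^esub> b j \<otimes>\<^bsub>H\<^esub> antip (dd j (b i))) (dd i h)"
      using a h i by (intro bilinear_finsum_left[OF H_vs HT.T_vs BB_bilinear, symmetric]) auto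
    also have "(\<Oplus>\<^bsub>H\<^esub>j\<in>{..<n}. a \<otimes>\<^bsub>H\<^esub> b j \<otimes>\<^bsub>H\<^esub> antip (dd j (b i))) = (\<Oplus>\<^bsub>H\<^esub>j\<in>{..<n}. a \<otimes>\<^bsub>H\<^esub> (b j \<otimes>\<^bsub>H\<^esub> antip (dd j (b i))))"
      using a i by (intro H.finsum_cong') (auto simp: H.m_assoc)
    also have "\<dots> = a \<otimes>\<^bsub>H\<^esub> (\<Oplus>\<^bsub>H\<^esub>j\<in>{..<n}. b j \<otimes>\<^bsub>H\<^esub> antip (dd j (b i)))"
      using a i by (intro H.finsum_rdistr[symmetric]) auto
    also have "\<dots> = eps (b i) \<odot>\<^bsub>H\<^esub> a"
      using a bi by (simp add: sweedler_antip_right H.smult_mult_right)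
    also have "BB m t (eps (b i) \<odot>\<^bsub>H\<^esub> a) (dd i h) = BB m t a (eps (b i) \<odot>\<^bsub>H\<^esub> dd i h)"
      using a h i by (simp add: bilinear_add[OF BB_bilinear])
    finally show "(\<Oplus>\<^bsub>TT (Suc m)\<^esub>j\<in>{..<n}. ?f (b j) (dd j (b i)) (dd i h)) = BB m t a (eps (b i) \<odot>\<^bsub>H\<^esub> dd i h)" .
  qed (use a h in auto)
  also have "\<dots> = BB m t a (\<Oplus>\<^bsub>H\<^esub>i\<in>{..<n}. eps (b i) \<odot>\<^bsub>H\<^esub> dd i h)"
    using a h by (intro bilinear_finsum_right[OF H_vs HT.T_vs BB_bilinear, symmetric]) auto
  also have "\<dots> = BB m t a h" by (simp add: sweedler_counit_left h)
  finally show ?thesis by simp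
qed

text \<open>Moving x_(2) across the tensor sign gives S(x_(1) h_(1)) x_(2) \<otimes> h_(2) t.
  Inserting \<open>BB_expand\<close> then brings a factor h_(2) next to x_(2), so that the antipode
  axiom applies to the product of x with the first leg of h and leaves eps(x).\<close>

lemma UU_R:
  assumes x: "x \<in> R" and h: "h \<in> carrier H"
  shows "UU m t (x \<otimes>\<^bsub>H\<^esub> h) = eps x \<odot>\<^bsub>TT (Suc m)\<^esub> UU m t h"
proof -
  interpret T: Module.module K "TT (Suc m)" by (rule HT.T_vs)
  have xc: "x \<in> carrier H" by (rule R_closed[OF x])
  note lin = bilinear_add[OF BB_bilinear] H.r_distr H.l_distr H.smult_mult_left H.smult_mult_right
    linear_add[OF antip_linear] linear_smult[OF antip_linear]
  let ?LU = "\<lambda>a z. lact (TT (Suc m)) a (UU m t z)"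
  have LU: "bilinear H H (TT (Suc m)) ?LU"
    by (rule bilinear_comp2[OF lact_bilinear linear_id UU_linear])
  note LUc = bilinear_closed[OF LU]
  let ?f = "\<lambda>y z u. \<Oplus>\<^bsub>TT (Suc m)\<^esub>i\<in>{..<n}. ?LU (antip (b i \<otimes>\<^bsub>H\<^esub> y) \<otimes>\<^bsub>H\<^esub> dd i x \<otimes>\<^bsub>H\<^esub> z) u"
  have tri1: "trilinear H H H (TT (Suc m)) (\<lambda>y z u. ?LU (antip (b i \<otimes>\<^bsub>H\<^esub> y) \<otimes>\<^bsub>H\<^esub> dd i x \<otimes>\<^bsub>H\<^esub> z) u)"
    if i: "i \<in> {..<n}" for i
    using i xc by (intro trilinearI bilinearI' linear_mapsI LUc) (simp_all add: lin bilinear_add[OF LU])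
  have b1: "(\<lambda>y. ?f y z u) \<in> linear_maps K H (TT (Suc m))" if "z \<in> carrier H" "u \<in> carrier H" for z u
    using that by (intro linear_sum HT.T_vs trilinearD(2)[OF tri1])
  have b2: "(\<lambda>z. ?f y z u) \<in> linear_maps K H (TT (Suc m))" if "y \<in> carrier H" "u \<in> carrier H" for y u
    using that by (intro linear_sum HT.T_vs bilinear_left[OF trilinearD(1)[OF tri1]])
  have b3: "(\<lambda>u. ?f y z u) \<in> linear_maps K H (TT (Suc m))" if "y \<in> carrier H" "z \<in> carrier H" for y z
    using that by (intro linear_sum HT.T_vs bilinear_right[OF trilinearD(1)[OF tri1]])
  have tri: "trilinear H H H (TT (Suc m)) ?f"
    by (intro trilinearI bilinearI b1 b2 b3)
  have "UU m t (x \<otimes>\<^bsub>H\<^esub> h) = (\<Oplus>\<^bsub>TT (Suc m)\<^esub>i\<in>{..<n}. \<Oplus>\<^bsub>TT (Suc m)\<^esub>j\<in>{..<n}. BB m t (antip (b i \<otimes>\<^bsub>H\<^esub> b j)) (dd i x \<otimes>\<^bsub>H\<^esub> dd j h))"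
    unfolding UU_def by (rule sweedler_mult[OF HT.T_vs bilinear_comp2[OF BB_bilinear antip_linear linear_id] xc h])
  also have "\<dots> = (\<Oplus>\<^bsub>TT (Suc m)\<^esub>i\<in>{..<n}. \<Oplus>\<^bsub>TT (Suc m)\<^esub>j\<in>{..<n}. \<Oplus>\<^bsub>TT (Suc m)\<^esub>l\<in>{..<n}.
      ?LU (antip (b i \<otimes>\<^bsub>H\<^esub> b j) \<otimes>\<^bsub>H\<^esub> dd i x \<otimes>\<^bsub>H\<^esub> b l) (dd l (dd j h)))"
  proof (intro T.M.finsum_cong' refl funcsetI T.M.finsum_closed LUc)
    fix i j assume i: "i \<in> {..<n}" and j: "j \<in> {..<n}"
    \<comment> \<open>Here \<open>dd i x\<close> lies in R by \<open>dd_R\<close>, which is what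
      allows it to cross the tensor sign.\<close>
    have "BB m t (antip (b i \<otimes>\<^bsub>H\<^esub> b j)) (dd i x \<otimes>\<^bsub>H\<^esub> dd j h) = BB m t (antip (b i \<otimes>\<^bsub>H\<^esub> b j) \<otimes>\<^bsub>H\<^esub> dd i x) (dd j h)"
      using i j x h by (intro BB_R dd_R) auto
    also have "\<dots> = (\<Oplus>\<^bsub>TT (Suc m)\<^esub>l\<in>{..<n}. ?LU (antip (b i \<otimes>\<^bsub>H\<^esub> b j) \<otimes>\<^bsub>H\<^esub> dd i x \<otimes>\<^bsub>H\<^esub> b l) (dd l (dd j h)))"
      using i j xc h by (intro BB_expand) auto
    finally show "BB m t (antip (b i \<otimes>\<^bsub>H\<^esub> b j)) (dd i x \<otimes>\<^bsub>H\<^esub> dd j h) = \<dots>" .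
  qed (use xc h in auto)
  also have "\<dots> = (\<Oplus>\<^bsub>TT (Suc m)\<^esub>j\<in>{..<n}. \<Oplus>\<^bsub>TT (Suc m)\<^esub>i\<in>{..<n}. \<Oplus>\<^bsub>TT (Suc m)\<^esub>l\<in>{..<n}.
      ?LU (antip (b i \<otimes>\<^bsub>H\<^esub> b j) \<otimes>\<^bsub>H\<^esub> dd i x \<otimes>\<^bsub>H\<^esub> b l) (dd l (dd j h)))"
    using xc h by (intro T.M.finsum_swap T.M.finsum_closed funcsetI LUc) auto
  also have "\<dots> = (\<Oplus>\<^bsub>TT (Suc m)\<^esub>j\<in>{..<n}. \<Oplus>\<^bsub>TT (Suc m)\<^esub>l\<in>{..<n}. ?f (b j) (b l) (dd l (dd j h)))"
    using xc h by (intro T.M.finsum_cong' refl T.M.finsum_swap T.M.finsum_closed funcsetI LUc) auto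
  \<comment> \<open>Split the first leg of h instead of the second: S(x_(1) h_(1)) x_(2) h_(2)
    becomes the antipode sum for the product of \<open>x\<close> with \<open>b j\<close>.\<close>
  also have "\<dots> = (\<Oplus>\<^bsub>TT (Suc m)\<^esub>j\<in>{..<n}. \<Oplus>\<^bsub>TT (Suc m)\<^esub>l\<in>{..<n}. ?f (b l) (dd l (b j)) (dd j h))"
    by (rule sweedler_coassoc[OF HT.T_vs tri h, symmetric])
  also have "\<dots> = (\<Oplus>\<^bsub>TT (Suc m)\<^esub>j\<in>{..<n}. eps x \<odot>\<^bsub>TT (Suc m)\<^esub> UU m t (eps (b j) \<odot>\<^bsub>H\<^esub> dd j h))"
  proof (intro T.M.finsum_cong' refl funcsetI T.smult_closed UU_closed)
    fix j assume j: "j \<in> {..<n}"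
    then have bj: "b j \<in> carrier H" by simp
    let ?s = "\<lambda>l i. antip (b i \<otimes>\<^bsub>H\<^esub> b l) \<otimes>\<^bsub>H\<^esub> dd i x \<otimes>\<^bsub>H\<^esub> dd l (b j)"
    have "(\<Oplus>\<^bsub>TT (Suc m)\<^esub>l\<in>{..<n}. ?f (b l) (dd l (b j)) (dd j h)) =
        (\<Oplus>\<^bsub>TT (Suc m)\<^esub>l\<in>{..<n}. ?LU (\<Oplus>\<^bsub>H\<^esub>i\<in>{..<n}. ?s l i) (dd j h))"
      using xc h j bj
      by (intro T.M.finsum_cong' refl bilinear_finsum_left[OF H_vs HT.T_vs LU, symmetric] funcsetI LUc finsum_H_closed) auto
    also have "\<dots> = ?LU (\<Oplus>\<^bsub>H\<^esub>l\<in>{..<n}. \<Oplus>\<^bsub>H\<^esub>i\<in>{..<n}. ?s l i) (dd j h)"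
      using xc h j bj by (intro bilinear_finsum_left[OF H_vs HT.T_vs LU, symmetric] finsum_H_closed) auto
    also have "(\<Oplus>\<^bsub>H\<^esub>l\<in>{..<n}. \<Oplus>\<^bsub>H\<^esub>i\<in>{..<n}. ?s l i) = (\<Oplus>\<^bsub>H\<^esub>i\<in>{..<n}. \<Oplus>\<^bsub>H\<^esub>l\<in>{..<n}. ?s l i)"
      using xc bj by (intro H.finsum_swap) auto
    also have "\<dots> = (\<Oplus>\<^bsub>H\<^esub>i\<in>{..<n}. \<Oplus>\<^bsub>H\<^esub>l\<in>{..<n}. antip (b i \<otimes>\<^bsub>H\<^esub> b l) \<otimes>\<^bsub>H\<^esub> (dd i x \<otimes>\<^bsub>H\<^esub> dd l (b j)))"
      using xc bj by (intro H.finsum_cong' refl funcsetI finsum_H_closed) (auto simp: H.m_assoc)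
    also have "\<dots> = (\<Oplus>\<^bsub>H\<^esub>i\<in>{..<n}. antip (b i) \<otimes>\<^bsub>H\<^esub> dd i (x \<otimes>\<^bsub>H\<^esub> b j))"
      by (rule sweedler_mult[OF H_vs bilinear_comp2[OF mult_bilinear antip_linear linear_id] xc bj, symmetric])
    also have "\<dots> = (eps x \<otimes> eps (b j)) \<odot>\<^bsub>H\<^esub> \<one>\<^bsub>H\<^esub>"
      using xc bj by (simp add: sweedler_antip_left eps_mult)
    also have "?LU ((eps x \<otimes> eps (b j)) \<odot>\<^bsub>H\<^esub> \<one>\<^bsub>H\<^esub>) (dd j h) = eps x \<odot>\<^bsub>TT (Suc m)\<^esub> UU m t (eps (b j) \<odot>\<^bsub>H\<^esub> dd j h)"
    proof -
      have dj: "dd j h \<in> carrier H" using j h by auto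
      have "?LU ((eps x \<otimes> eps (b j)) \<odot>\<^bsub>H\<^esub> \<one>\<^bsub>H\<^esub>) (dd j h) = (eps x \<otimes> eps (b j)) \<odot>\<^bsub>TT (Suc m)\<^esub> UU m t (dd j h)"
        using xc bj dj UU_closed by (simp add: bilinear_add(2)[OF LU] lact_one)
      then show ?thesis using xc bj dj UU_closed[OF dj]
        by (simp add: linear_smult[OF UU_linear] T.smult_assoc1)
    qed
    finally show "(\<Oplus>\<^bsub>TT (Suc m)\<^esub>l\<in>{..<n}. ?f (b l) (dd l (b j)) (dd j h)) = eps x \<odot>\<^bsub>TT (Suc m)\<^esub> UU m t (eps (b j) \<odot>\<^bsub>H\<^esub> dd j h)" .
  qed (use xc h in auto)
  also have "\<dots> = eps x \<odot>\<^bsub>TT (Suc m)\<^esub> (\<Oplus>\<^bsub>TT (Suc m)\<^esub>j\<in>{..<n}. UU m t (eps (b j) \<odot>\<^bsub>H\<^esub> dd j h))"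
    using xc h by (intro T.finsum_smult_ldistr[symmetric] funcsetI UU_closed) auto
  also have "(\<Oplus>\<^bsub>TT (Suc m)\<^esub>j\<in>{..<n}. UU m t (eps (b j) \<odot>\<^bsub>H\<^esub> dd j h)) = UU m t (\<Oplus>\<^bsub>H\<^esub>j\<in>{..<n}. eps (b j) \<odot>\<^bsub>H\<^esub> dd j h)"
    using h by (intro linear_finsum[OF H_vs HT.T_vs UU_linear, symmetric]) auto
  also have "\<dots> = UU m t h" by (simp add: sweedler_counit_left h)
  finally show ?thesis .
qed

lemma UU_expand:
  assumes h: "h \<in> carrier H"
  shows "UU m t h = (\<Oplus>\<^bsub>TT (Suc m)\<^esub>j\<in>{..<r}. \<psi> j h \<odot>\<^bsub>TT (Suc m)\<^esub> UU m t (q j))"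
proof (rule kills_I_expand[OF HT.T_vs UU_linear _ h])
  interpret T: Module.module K "TT (Suc m)" by (rule HT.T_vs)
  have sz: "submodule {\<zero>\<^bsub>TT (Suc m)\<^esub>} K (TT (Suc m))"
    by (rule T.submoduleI) (auto simp: group_minus_zero[OF T.M.abelian_group_axioms])
  fix y assume y: "y \<in> I"
  have "UU m t y \<in> {\<zero>\<^bsub>TT (Suc m)\<^esub>}"
  proof (rule I_linear[OF HT.T_vs UU_linear sz _ y])
    fix x g assume "x \<in> R" "eps x = \<zero>" "g \<in> carrier H"
    then show "UU m t (x \<otimes>\<^bsub>H\<^esub> g) \<in> {\<zero>\<^bsub>TT (Suc m)\<^esub>}"
      using UU_closed[of g] by (simp add: UU_R T.smult_l_null)
  qed
  then show "UU m t y = \<zero>\<^bsub>TT (Suc m)\<^esub>" by simp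
qed

text \<open>Combining \<open>BB_expand\<close> with \<open>UU_expand\<close> leaves only the
  finitely many generators \<open>UU m t (q j)\<close>; the scalars \<open>\<psi> j\<close> (h_(2))
  collected with h_(1) form \<open>G j h\<close>.\<close>

lemma BB_basis:
  assumes a: "a \<in> carrier H" and h: "h \<in> carrier H"
  shows "BB m t a h = (\<Oplus>\<^bsub>TT (Suc m)\<^esub>j\<in>{..<r}. lact (TT (Suc m)) (a \<otimes>\<^bsub>H\<^esub> G j h) (UU m t (q j)))"
proof -
  interpret T: Module.module K "TT (Suc m)" by (rule HT.T_vs)
  let ?LU = "\<lambda>a z. lact (TT (Suc m)) a (UU m t z)"
  have LU: "bilinear H H (TT (Suc m)) ?LU"
    by (rule bilinear_comp2[OF lact_bilinear linear_id UU_linear])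
  note LUc = bilinear_closed[OF LU]
  let ?f = "\<lambda>i j. ?LU (\<psi> j (dd i h) \<odot>\<^bsub>H\<^esub> (a \<otimes>\<^bsub>H\<^esub> b i)) (q j)"
  have "BB m t a h = (\<Oplus>\<^bsub>TT (Suc m)\<^esub>i\<in>{..<n}. \<Oplus>\<^bsub>TT (Suc m)\<^esub>j\<in>{..<r}. ?f i j)"
    unfolding BB_expand[OF a h]
  proof (intro T.M.finsum_cong' refl funcsetI T.M.finsum_closed LUc)
    fix i assume i: "i \<in> {..<n}"
    then have di: "dd i h \<in> carrier H" and abi: "a \<otimes>\<^bsub>H\<^esub> b i \<in> carrier H" using h a by auto
    have "?LU (a \<otimes>\<^bsub>H\<^esub> b i) (dd i h) = lact (TT (Suc m)) (a \<otimes>\<^bsub>H\<^esub> b i) (\<Oplus>\<^bsub>TT (Suc m)\<^esub>j\<in>{..<r}. \<psi> j (dd i h) \<odot>\<^bsub>TT (Suc m)\<^esub> UU m t (q j))"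
      using UU_expand[OF di] by simp
    also have "\<dots> = (\<Oplus>\<^bsub>TT (Suc m)\<^esub>j\<in>{..<r}. lact (TT (Suc m)) (a \<otimes>\<^bsub>H\<^esub> b i) (\<psi> j (dd i h) \<odot>\<^bsub>TT (Suc m)\<^esub> UU m t (q j)))"
      using abi di by (intro linear_finsum[OF HT.T_vs HT.T_vs HT.lact_linear] T.smult_closed UU_closed) auto
    also have "\<dots> = (\<Oplus>\<^bsub>TT (Suc m)\<^esub>j\<in>{..<r}. ?f i j)"
      using abi di UU_closed
      by (intro T.M.finsum_cong' refl funcsetI LUc)
        (auto simp: bilinear_add(2)[OF LU] linear_smult[OF HT.lact_linear])
    finally show "?LU (a \<otimes>\<^bsub>H\<^esub> b i) (dd i h) = (\<Oplus>\<^bsub>TT (Suc m)\<^esub>j\<in>{..<r}. ?f i j)" .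
  qed (use a h in auto)
  also have "\<dots> = (\<Oplus>\<^bsub>TT (Suc m)\<^esub>j\<in>{..<r}. \<Oplus>\<^bsub>TT (Suc m)\<^esub>i\<in>{..<n}. ?f i j)"
    using a h by (intro T.M.finsum_swap LUc) auto
  also have "\<dots> = (\<Oplus>\<^bsub>TT (Suc m)\<^esub>j\<in>{..<r}. lact (TT (Suc m)) (a \<otimes>\<^bsub>H\<^esub> G j h) (UU m t (q j)))"
  proof (intro T.M.finsum_cong' refl funcsetI LUc)
    fix j assume j: "j \<in> {..<r}"
    have "(\<Oplus>\<^bsub>TT (Suc m)\<^esub>i\<in>{..<n}. ?f i j) = ?LU (\<Oplus>\<^bsub>H\<^esub>i\<in>{..<n}. \<psi> j (dd i h) \<odot>\<^bsub>H\<^esub> (a \<otimes>\<^bsub>H\<^esub> b i)) (q j)"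
      using a h j by (intro bilinear_finsum_left[OF H_vs HT.T_vs LU, symmetric]) auto
    also have "(\<Oplus>\<^bsub>H\<^esub>i\<in>{..<n}. \<psi> j (dd i h) \<odot>\<^bsub>H\<^esub> (a \<otimes>\<^bsub>H\<^esub> b i)) = (\<Oplus>\<^bsub>H\<^esub>i\<in>{..<n}. a \<otimes>\<^bsub>H\<^esub> (\<psi> j (dd i h) \<odot>\<^bsub>H\<^esub> b i))"
      using a h j by (intro H.finsum_cong') (auto simp: H.smult_mult_right)
    also have "\<dots> = a \<otimes>\<^bsub>H\<^esub> G j h"
      unfolding G_def using a h j by (intro H.finsum_rdistr[symmetric]) auto
    finally show "(\<Oplus>\<^bsub>TT (Suc m)\<^esub>i\<in>{..<n}. ?f i j) = ?LU (a \<otimes>\<^bsub>H\<^esub> G j h) (q j)" .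
  qed (use a h in auto)
  finally show ?thesis .
qed

end

end

section \<open>Freeness of the tensor powers over H, by induction on the number of factors\<close>

context hopf_quot
begin

text \<open>Mind the shift: \<open>TT m\<close> has m+1 tensor factors but is indexed by words of
  length m. A single factor is H itself, of rank one with the empty word as index.\<close>

lemma powers_free_0:
  assumes S: "S \<subseteq> carrier H"
  shows "\<exists>\<theta>. (\<forall>w\<in>words 0. \<theta> w \<in> linear_maps K (TT 0) H) \<and>
    free_over H S (TT 0) (lact (TT 0)) (\<lambda>s t. ract (TT 0) t s) (words 0) \<theta> PL"
proof -
  obtain g where g: "g \<in> linear_maps K (TT 0) H" "\<And>x. x \<in> carrier H \<Longrightarrow> g (HT.gen1 x) = x"
    using HT.gen1_lift[OF H_vs linear_id] by blast
  note gl = HT.gen1_linear and gc = linear_closed[OF HT.gen1_linear]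
  have inv: "HT.gen1 (g t) = t" if "t \<in> carrier (TT 0)" for t
    by (rule HT.gen1_linear_eq[OF HT.T_vs linear_comp[OF g(1) gl] linear_id _ that]) (simp add: g)
  have lam: "g (lact (TT 0) a t) = a \<otimes>\<^bsub>H\<^esub> g t" if "a \<in> carrier H" "t \<in> carrier (TT 0)" for a t
    by (rule HT.gen1_linear_eq[OF H_vs linear_comp[OF HT.lact_linear g(1)] linear_comp[OF g(1) bilinear_right[OF mult_bilinear]] _ that(2)])
      (use that in \<open>auto simp: HT.lact_gen1 g\<close>)
  have rho: "g (ract (TT 0) t s) = g t \<otimes>\<^bsub>H\<^esub> s" if "s \<in> carrier H" "t \<in> carrier (TT 0)" for s t
    by (rule HT.gen1_linear_eq[OF H_vs linear_comp[OF HT.ract_linear g(1)] linear_comp[OF g(1) bilinear_left[OF mult_bilinear]] _ that(2)])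
      (use that in \<open>auto simp: HT.ract_gen1 g\<close>)
  have "free_over H S (TT 0) (lact (TT 0)) (\<lambda>s t. ract (TT 0) t s) (words 0) (\<lambda>_. g) PL"
    unfolding free_over_def words_0
  proof (intro conjI ballI impI)
    fix f assume "f \<in> {[]} \<rightarrow> carrier H"
    then show "\<exists>x\<in>carrier (TT 0). \<forall>w\<in>{[]}. g x = f w"
      using gc g(2) by (intro bexI[of _ "HT.gen1 (f [])"]) auto
  next
    fix x y assume x: "x \<in> carrier (TT 0)" and y: "y \<in> carrier (TT 0)" and "\<forall>w\<in>{[]::nat list}. g x = g y"
    then have "HT.gen1 (g x) = HT.gen1 (g y)" by simp
    then show "x = y" by (simp only: inv[OF x] inv[OF y])
  next
    fix s t assume "s \<in> S" "t \<in> carrier (TT 0)"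
    then show "ract (TT 0) t s \<in> carrier (TT 0)" using S by (intro HT.ract_closed) auto
  next
    fix s t w assume s: "s \<in> S" and t: "t \<in> carrier (TT 0)" and w: "w \<in> {[]::nat list}"
    show "g (ract (TT 0) t s) = (\<Oplus>\<^bsub>H\<^esub>i\<in>{[]}. g t \<otimes>\<^bsub>H\<^esub> PL i w s)"
      using s t w S linear_closed[OF g(1) t] by (auto simp: rho PL_Nil)
  qed (use S in \<open>auto simp: HT.lact_closed lam linear_closed[OF g(1)] linear_add[OF g(1)] vs_abelian[OF HT.T_vs] PL_Nil\<close>)
  then show ?thesis using g(1) by auto
qed

text \<open>The value is S(h_(1)) G_j(h_(2) c) = c S(h_(1)) h_(2) \<open>\<psi> j\<close> (h_(3)),
  which collapses by the antipode and the counit. For unit vectors \<open>t\<close> this is the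
  duality between the candidate basis and the candidate coordinates.\<close>

lemma UU_coordinate:
  assumes \<theta>: "\<theta> \<in> linear_maps K (TT m) H" "\<And>a t. \<lbrakk>a \<in> carrier H; t \<in> carrier (TT m)\<rbrakk> \<Longrightarrow> \<theta> (lact (TT m) a t) = a \<otimes>\<^bsub>H\<^esub> \<theta> t"
    and g: "g \<in> linear_maps K (TT (Suc m)) H"
      "\<And>x t. \<lbrakk>x \<in> carrier H; t \<in> carrier (TT m)\<rbrakk> \<Longrightarrow> g (HT.cons (Suc m) x t) = x \<otimes>\<^bsub>H\<^esub> G j (\<theta> t)"
    and j: "j < r" and t: "t \<in> carrier (TT m)" and h: "h \<in> carrier H" and c: "c \<in> carrier K" "\<theta> t = c \<odot>\<^bsub>H\<^esub> \<one>\<^bsub>H\<^esub>"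
  shows "g (UU m t h) = (c \<otimes> \<psi> j h) \<odot>\<^bsub>H\<^esub> \<one>\<^bsub>H\<^esub>"
proof -
  let ?f = "\<lambda>x y z. \<psi> j z \<odot>\<^bsub>H\<^esub> (antip x \<otimes>\<^bsub>H\<^esub> y)"
  have tri: "trilinear H H H H ?f"
    using j by (intro trilinearI bilinearI' linear_mapsI)
      (auto simp: \<psi>_add \<psi>_smult linear_add[OF antip_linear] linear_smult[OF antip_linear] H.l_distr H.r_distr
        H.smult_mult_left H.smult_mult_right H.smult_l_distr H.smult_r_distr H.smult_assoc1[symmetric] m_comm)
  have 1: "(\<Oplus>\<^bsub>H\<^esub>k\<in>{..<n}. antip (b k) \<otimes>\<^bsub>H\<^esub> G j (dd k h)) = \<psi> j h \<odot>\<^bsub>H\<^esub> \<one>\<^bsub>H\<^esub>"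
  proof -
    have "(\<Oplus>\<^bsub>H\<^esub>k\<in>{..<n}. antip (b k) \<otimes>\<^bsub>H\<^esub> G j (dd k h)) = (\<Oplus>\<^bsub>H\<^esub>k\<in>{..<n}. \<Oplus>\<^bsub>H\<^esub>l\<in>{..<n}. ?f (b k) (b l) (dd l (dd k h)))"
    proof (intro H.finsum_cong' refl)
      fix k assume k: "k \<in> {..<n}"
      have "antip (b k) \<otimes>\<^bsub>H\<^esub> G j (dd k h) = (\<Oplus>\<^bsub>H\<^esub>l\<in>{..<n}. antip (b k) \<otimes>\<^bsub>H\<^esub> (\<psi> j (dd l (dd k h)) \<odot>\<^bsub>H\<^esub> b l))"
        unfolding G_def using k j h by (intro H.finsum_rdistr) auto
      also have "\<dots> = (\<Oplus>\<^bsub>H\<^esub>l\<in>{..<n}. ?f (b k) (b l) (dd l (dd k h)))"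
        using k j h by (intro H.finsum_cong') (auto simp: H.smult_mult_right)
      finally show "antip (b k) \<otimes>\<^bsub>H\<^esub> G j (dd k h) = \<dots>" .
    qed (use j h in \<open>auto intro!: finsum_H_closed\<close>)
    also have "\<dots> = (\<Oplus>\<^bsub>H\<^esub>k\<in>{..<n}. \<Oplus>\<^bsub>H\<^esub>l\<in>{..<n}. ?f (b l) (dd l (b k)) (dd k h))"
      by (rule sweedler_coassoc[OF H_vs tri h, symmetric])
    also have "\<dots> = (\<Oplus>\<^bsub>H\<^esub>k\<in>{..<n}. \<psi> j (eps (b k) \<odot>\<^bsub>H\<^esub> dd k h) \<odot>\<^bsub>H\<^esub> \<one>\<^bsub>H\<^esub>)"
    proof (intro H.finsum_cong' refl)
      fix k assume k: "k \<in> {..<n}"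
      then have bk: "b k \<in> carrier H" by simp
      have "(\<Oplus>\<^bsub>H\<^esub>l\<in>{..<n}. ?f (b l) (dd l (b k)) (dd k h)) = \<psi> j (dd k h) \<odot>\<^bsub>H\<^esub> (\<Oplus>\<^bsub>H\<^esub>l\<in>{..<n}. antip (b l) \<otimes>\<^bsub>H\<^esub> dd l (b k))"
        using k j h by (intro H.finsum_smult_ldistr[symmetric]) auto
      then show "(\<Oplus>\<^bsub>H\<^esub>l\<in>{..<n}. ?f (b l) (dd l (b k)) (dd k h)) = \<psi> j (eps (b k) \<odot>\<^bsub>H\<^esub> dd k h) \<odot>\<^bsub>H\<^esub> \<one>\<^bsub>H\<^esub>"
        using k j h bk by (simp add: sweedler_antip_left \<psi>_smult H.smult_assoc1[symmetric] m_comm)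
    qed (use j h in auto)
    also have "\<dots> = (\<Oplus>k\<in>{..<n}. \<psi> j (eps (b k) \<odot>\<^bsub>H\<^esub> dd k h)) \<odot>\<^bsub>H\<^esub> \<one>\<^bsub>H\<^esub>"
      using j h by (intro additive_finsum[OF abelian_group_axioms H.M.abelian_group_axioms, where f="\<lambda>c. c \<odot>\<^bsub>H\<^esub> \<one>\<^bsub>H\<^esub>", symmetric])
        (auto simp: H.smult_l_distr)
    also have "(\<Oplus>k\<in>{..<n}. \<psi> j (eps (b k) \<odot>\<^bsub>H\<^esub> dd k h)) = \<psi> j (\<Oplus>\<^bsub>H\<^esub>k\<in>{..<n}. eps (b k) \<odot>\<^bsub>H\<^esub> dd k h)"
      using h by (intro form_finsum[OF H_vs \<psi>_linear[OF j], symmetric]) auto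
    finally show ?thesis by (simp add: sweedler_counit_left h)
  qed
  have "g (UU m t h) = (\<Oplus>\<^bsub>H\<^esub>k\<in>{..<n}. g (BB m t (antip (b k)) (dd k h)))"
    unfolding UU_def using h by (intro linear_finsum[OF HT.T_vs H_vs g(1)] BB_closed[OF t]) auto
  also have "\<dots> = (\<Oplus>\<^bsub>H\<^esub>k\<in>{..<n}. c \<odot>\<^bsub>H\<^esub> (antip (b k) \<otimes>\<^bsub>H\<^esub> G j (dd k h)))"
  proof (intro H.finsum_cong' refl)
    fix k assume k: "k \<in> {..<n}"
    have "g (BB m t (antip (b k)) (dd k h)) = antip (b k) \<otimes>\<^bsub>H\<^esub> G j (dd k h \<otimes>\<^bsub>H\<^esub> (c \<odot>\<^bsub>H\<^esub> \<one>\<^bsub>H\<^esub>))"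
      unfolding BB_def using k h t by (simp add: g(2) HT.lact_closed \<theta>(2) c(2))
    then show "g (BB m t (antip (b k)) (dd k h)) = c \<odot>\<^bsub>H\<^esub> (antip (b k) \<otimes>\<^bsub>H\<^esub> G j (dd k h))"
      using k h j c by (simp add: H.smult_mult_right linear_smult[OF G_linear[OF j]])
  qed (use h j c in auto)
  also have "\<dots> = c \<odot>\<^bsub>H\<^esub> (\<Oplus>\<^bsub>H\<^esub>k\<in>{..<n}. antip (b k) \<otimes>\<^bsub>H\<^esub> G j (dd k h))"
    using h j c by (intro H.finsum_smult_ldistr[symmetric]) auto
  finally show ?thesis using 1 c j h by (simp add: H.smult_assoc1)
qed

text \<open>Coordinates and generators are built independently from those one level below and then
  shown dual to each other (\<open>\<Theta>e\<close>) and complete (\<open>exp\<close>); bijectivity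
  of the coordinates follows from these two facts.\<close>

lemma powers_free_Suc:
  assumes S: "S \<subseteq> carrier H" and \<theta>l: "\<forall>w\<in>words m. \<theta> w \<in> linear_maps K (TT m) H"
    and F: "free_over H S (TT m) (lact (TT m)) (\<lambda>s t. ract (TT m) t s) (words m) \<theta> PL"
  shows "\<exists>\<theta>. (\<forall>w\<in>words (Suc m). \<theta> w \<in> linear_maps K (TT (Suc m)) H) \<and>
    free_over H S (TT (Suc m)) (lact (TT (Suc m))) (\<lambda>s t. ract (TT (Suc m)) t s) (words (Suc m)) \<theta> PL"
proof -
  note FD = free_overD[OF F]
  interpret T: Module.module K "TT m" by (rule HT.T_vs)
  interpret T': Module.module K "TT (Suc m)" by (rule HT.T_vs)
  have \<theta>: "\<theta> w \<in> linear_maps K (TT m) H" if "w \<in> words m" for w using \<theta>l that by blast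
  note \<theta>c = linear_closed[OF \<theta>]
  \<comment> \<open>The coordinate at \<open>i # w\<close> sends x \<otimes> t to x
    G_i(\<theta>_w(t)). It is balanced over R since \<theta>_w is left linear and G_i commutes with
    left multiplication by R.\<close>
  have "\<forall>v. \<exists>g. v \<in> words (Suc m) \<longrightarrow> g \<in> linear_maps K (TT (Suc m)) H \<and>
      (\<forall>x\<in>carrier H. \<forall>t\<in>carrier (TT m). g (HT.cons (Suc m) x t) = x \<otimes>\<^bsub>H\<^esub> G (hd v) (\<theta> (tl v) t))"
    (is "\<forall>v. \<exists>g. ?P v g")
  proof
    fix v
    show "\<exists>g. ?P v g"
    proof (cases "v \<in> words (Suc m)")
      case True
      then obtain i w where v: "v = i # w" "i < r" "w \<in> words m" by (rule words_SucE)
      have bil: "bilinear H (TT m) H (\<lambda>x t. x \<otimes>\<^bsub>H\<^esub> G i (\<theta> w t))"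
        by (rule bilinear_comp2[OF mult_bilinear linear_id linear_comp[OF \<theta>[OF v(3)] G_linear[OF v(2)]]])
      have bal: "x \<otimes>\<^bsub>H\<^esub> y \<otimes>\<^bsub>H\<^esub> G i (\<theta> w t) = x \<otimes>\<^bsub>H\<^esub> G i (\<theta> w (lact (TT m) y t))"
        if "x \<in> carrier H" "y \<in> R" "t \<in> carrier (TT m)" for x y t
        using that v R_closed[OF that(2)] \<theta>c[OF v(3) that(3)] by (simp add: FD(8) G_R H.m_assoc)
      obtain g where "g \<in> linear_maps K (TT (Suc m)) H"
        "\<And>x t. \<lbrakk>x \<in> carrier H; t \<in> carrier (TT m)\<rbrakk> \<Longrightarrow> g (HT.cons (Suc m) x t) = x \<otimes>\<^bsub>H\<^esub> G i (\<theta> w t)"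
        using HT.cons_lift[OF H_vs bil bal] by blast
      then show ?thesis unfolding v(1) list.sel by blast
    qed simp
  qed
  from choice[OF this] obtain \<Theta> where \<Theta>0: "\<forall>v. ?P v (\<Theta> v)" ..
  have \<Theta>: "\<Theta> v \<in> linear_maps K (TT (Suc m)) H" if "v \<in> words (Suc m)" for v using \<Theta>0 that by blast
  note \<Theta>c = linear_closed[OF \<Theta>]
  have \<Theta>cons: "\<Theta> (i # w) (HT.cons (Suc m) x t) = x \<otimes>\<^bsub>H\<^esub> G i (\<theta> w t)"
    if "i < r" "w \<in> words m" "x \<in> carrier H" "t \<in> carrier (TT m)" for i w x t
    using \<Theta>0[rule_format, of "i # w"] that by simp
  have lam: "\<Theta> v (lact (TT (Suc m)) a y) = a \<otimes>\<^bsub>H\<^esub> \<Theta> v y"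
    if a: "a \<in> carrier H" and y: "y \<in> carrier (TT (Suc m))" and v: "v \<in> words (Suc m)" for a y v
  proof (rule HT.cons_linear_eq[OF H_vs linear_comp[OF HT.lact_linear[OF a] \<Theta>[OF v]] linear_comp[OF \<Theta>[OF v] bilinear_right[OF mult_bilinear a]] _ y])
    fix x t assume x: "x \<in> carrier H" and t: "t \<in> carrier (TT m)"
    obtain i w where "v = i # w" "i < r" "w \<in> words m" using v by (rule words_SucE)
    then show "\<Theta> v (lact (TT (Suc m)) a (HT.cons (Suc m) x t)) = a \<otimes>\<^bsub>H\<^esub> \<Theta> v (HT.cons (Suc m) x t)"
      using x t a \<theta>c by (simp add: HT.lact_cons \<Theta>cons H.m_assoc)
  qed
  have \<Theta>P: "\<Theta> u y \<otimes>\<^bsub>H\<^esub> PL u v s \<in> carrier H"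
    if "u \<in> words (Suc m)" "v \<in> words (Suc m)" "y \<in> carrier (TT (Suc m))" "s \<in> carrier H" for u v y s
    using that \<Theta>c PL_closed[OF that(1,2,4)] by auto
  have rho: "\<Theta> v (ract (TT (Suc m)) y s) = (\<Oplus>\<^bsub>H\<^esub>u\<in>words (Suc m). \<Theta> u y \<otimes>\<^bsub>H\<^esub> PL u v s)"
    if sS: "s \<in> S" and y: "y \<in> carrier (TT (Suc m))" and v: "v \<in> words (Suc m)" for s y v
  proof -
    have s: "s \<in> carrier H" using sS S by auto
    have l: "(\<lambda>y. \<Oplus>\<^bsub>H\<^esub>u\<in>words (Suc m). \<Theta> u y \<otimes>\<^bsub>H\<^esub> PL u v s) \<in> linear_maps K (TT (Suc m)) H"
      by (intro linear_sum H_vs linear_comp[OF \<Theta> bilinear_left[OF mult_bilinear PL_closed[OF _ v s]]])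
    show ?thesis
    proof (rule HT.cons_linear_eq[OF H_vs linear_comp[OF HT.ract_linear[OF s] \<Theta>[OF v]] l _ y])
      fix x t assume x: "x \<in> carrier H" and t: "t \<in> carrier (TT m)"
      obtain i w where iw: "v = i # w" "i < r" "w \<in> words m" using v by (rule words_SucE)
      have "\<Theta> v (ract (TT (Suc m)) (HT.cons (Suc m) x t) s) = x \<otimes>\<^bsub>H\<^esub> G i (\<Oplus>\<^bsub>H\<^esub>u\<in>words m. \<theta> u t \<otimes>\<^bsub>H\<^esub> PL u w s)"
        unfolding iw(1) using x t s sS iw by (simp add: HT.ract_cons \<Theta>cons HT.ract_closed FD(10))
      also have "\<dots> = x \<otimes>\<^bsub>H\<^esub> (\<Oplus>\<^bsub>H\<^esub>u\<in>words m. G i (\<theta> u t \<otimes>\<^bsub>H\<^esub> PL u w s))"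
        using t s iw \<theta>c by (subst linear_finsum[OF H_vs H_vs G_linear[OF iw(2)]]) auto
      also have "\<dots> = x \<otimes>\<^bsub>H\<^esub> (\<Oplus>\<^bsub>H\<^esub>u\<in>words m. \<Oplus>\<^bsub>H\<^esub>j\<in>{..<r}. G j (\<theta> u t) \<otimes>\<^bsub>H\<^esub> PL (j # u) v s)"
        unfolding iw(1) using t s iw \<theta>c PL_closed[of "_ # _" "Suc m" "i # w"]
        by (intro arg_cong[where f="\<lambda>z. x \<otimes>\<^bsub>H\<^esub> z"] H.finsum_cong' refl G_PL funcsetI finsum_H_closed) auto
      also have "\<dots> = x \<otimes>\<^bsub>H\<^esub> (\<Oplus>\<^bsub>H\<^esub>j\<in>{..<r}. \<Oplus>\<^bsub>H\<^esub>u\<in>words m. G j (\<theta> u t) \<otimes>\<^bsub>H\<^esub> PL (j # u) v s)"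
        using t s v \<theta>c PL_closed[of "_ # _" "Suc m" v]
        by (intro arg_cong[where f="\<lambda>z. x \<otimes>\<^bsub>H\<^esub> z"] H.finsum_swap) auto
      also have "\<dots> = x \<otimes>\<^bsub>H\<^esub> (\<Oplus>\<^bsub>H\<^esub>u\<in>words (Suc m). G (hd u) (\<theta> (tl u) t) \<otimes>\<^bsub>H\<^esub> PL u v s)"
        using t s v \<theta>c PL_closed[of "_ # _" "Suc m" v]
        by (intro arg_cong[where f="\<lambda>z. x \<otimes>\<^bsub>H\<^esub> z"], subst finsum_words_Suc[OF H.M.abelian_monoid_axioms]) auto
      also have "\<dots> = (\<Oplus>\<^bsub>H\<^esub>u\<in>words (Suc m). x \<otimes>\<^bsub>H\<^esub> (G (hd u) (\<theta> (tl u) t) \<otimes>\<^bsub>H\<^esub> PL u v s))"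
        using t by (intro H.finsum_rdistr funcsetI H.m_closed PL_closed[OF _ v s] G_closed \<theta>c x) (auto elim!: words_SucE)
      also have "\<dots> = (\<Oplus>\<^bsub>H\<^esub>u\<in>words (Suc m). \<Theta> u (HT.cons (Suc m) x t) \<otimes>\<^bsub>H\<^esub> PL u v s)"
      proof (intro H.finsum_cong' refl funcsetI \<Theta>P)
        fix u assume u: "u \<in> words (Suc m)"
        obtain j u' where "u = j # u'" "j < r" "u' \<in> words m" using u by (rule words_SucE)
        then show "x \<otimes>\<^bsub>H\<^esub> (G (hd u) (\<theta> (tl u) t) \<otimes>\<^bsub>H\<^esub> PL u v s) = \<Theta> u (HT.cons (Suc m) x t) \<otimes>\<^bsub>H\<^esub> PL u v s"
          using x t \<theta>c PL_closed[OF u v s] by (simp add: \<Theta>cons H.m_assoc)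
      qed (use x t v s HT.cons_closed in auto)
      finally show "\<Theta> v (ract (TT (Suc m)) (HT.cons (Suc m) x t) s) =
          (\<Oplus>\<^bsub>H\<^esub>u\<in>words (Suc m). \<Theta> u (HT.cons (Suc m) x t) \<otimes>\<^bsub>H\<^esub> PL u v s)" .
    qed
  qed
  obtain c where c: "\<And>w. c w \<in> carrier (TT m)" "\<And>w v. v \<in> words m \<Longrightarrow> \<theta> v (c w) = (if v = w then \<one>\<^bsub>H\<^esub> else \<zero>\<^bsub>H\<^esub>)"
    using augmented_algebra.unit_vectors[OF eps_augmented F] by blast
  \<comment> \<open>For v = i # w this is S(h_(1)) \<otimes> h_(2) c_w at h = \<open>q i\<close>,
    with c_w the unit vector one level below.\<close>
  define e where "e v = UU m (c (tl v)) (q (hd v))" for v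
  have ec: "e v \<in> carrier (TT (Suc m))" if v: "v \<in> words (Suc m)" for v
    unfolding e_def by (rule UU_closed[OF c(1)]) (use v in \<open>auto elim!: words_SucE\<close>)
  have \<Theta>e: "\<Theta> u (e v) = (if v = u then \<one>\<^bsub>H\<^esub> else \<zero>\<^bsub>H\<^esub>)" if u: "u \<in> words (Suc m)" and v: "v \<in> words (Suc m)" for u v
  proof -
    obtain j u' where u': "u = j # u'" "j < r" "u' \<in> words m" using u by (rule words_SucE)
    obtain i w where w: "v = i # w" "i < r" "w \<in> words m" using v by (rule words_SucE)
    have "\<Theta> u (e v) = ((if u' = w then \<one> else \<zero>) \<otimes> \<psi> j (q i)) \<odot>\<^bsub>H\<^esub> \<one>\<^bsub>H\<^esub>"
      unfolding e_def w(1) list.sel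
      by (rule UU_coordinate[OF \<theta>[OF u'(3)] _ \<Theta>[OF u] _ u'(2) c(1) q_closed[OF w(2)]])
        (use u' in \<open>auto simp: FD(8) \<Theta>cons c\<close>)
    then show ?thesis using u' w by (auto simp: \<psi>_q)
  qed
  \<comment> \<open>Write t as the sum of the \<theta>_w(t) c_w; then \<open>BB_basis\<close>
    expands each x \<otimes> \<theta>_w(t) c_w with coefficients x G_j(\<theta>_w(t)), the
    coordinates at \<open>j # w\<close>.\<close>
  have exp: "y = (\<Oplus>\<^bsub>TT (Suc m)\<^esub>v\<in>words (Suc m). lact (TT (Suc m)) (\<Theta> v y) (e v))" if y: "y \<in> carrier (TT (Suc m))" for y
  proof -
    have l: "(\<lambda>y. \<Oplus>\<^bsub>TT (Suc m)\<^esub>v\<in>words (Suc m). lact (TT (Suc m)) (\<Theta> v y) (e v)) \<in> linear_maps K (TT (Suc m)) (TT (Suc m))"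
      by (intro linear_sum HT.T_vs linear_comp[OF \<Theta> bilinear_left[OF lact_bilinear ec]])
    show ?thesis
    proof (rule HT.cons_linear_eq[OF HT.T_vs linear_id l _ y])
      fix x t assume x: "x \<in> carrier H" and t: "t \<in> carrier (TT m)"
      let ?g = "\<lambda>w j. lact (TT (Suc m)) (x \<otimes>\<^bsub>H\<^esub> G j (\<theta> w t)) (e (j # w))"
      have gc: "?g w j \<in> carrier (TT (Suc m))" if "w \<in> words m" "j < r" for w j
        using that x t \<theta>c by (intro HT.lact_closed ec) auto
      have "HT.cons (Suc m) x t = HT.cons (Suc m) x (\<Oplus>\<^bsub>TT m\<^esub>w\<in>words m. lact (TT m) (\<theta> w t) (c w))"
        using augmented_algebra.coordinates_expand[OF eps_augmented F c t] by simp
      also have "\<dots> = (\<Oplus>\<^bsub>TT (Suc m)\<^esub>w\<in>words m. HT.cons (Suc m) x (lact (TT m) (\<theta> w t) (c w)))"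
        using t c(1) \<theta>c by (intro linear_finsum[OF HT.T_vs HT.T_vs HT.cons_linear[OF x]] HT.lact_closed) auto
      also have "\<dots> = (\<Oplus>\<^bsub>TT (Suc m)\<^esub>w\<in>words m. \<Oplus>\<^bsub>TT (Suc m)\<^esub>j\<in>{..<r}. ?g w j)"
      proof (intro T'.M.finsum_cong' refl funcsetI T'.M.finsum_closed)
        fix w assume w: "w \<in> words m"
        show "HT.cons (Suc m) x (lact (TT m) (\<theta> w t) (c w)) = (\<Oplus>\<^bsub>TT (Suc m)\<^esub>j\<in>{..<r}. ?g w j)"
          using BB_basis[OF c(1) x \<theta>c[OF w t], of w] by (simp add: BB_def e_def)
      qed (use gc in auto)
      also have "\<dots> = (\<Oplus>\<^bsub>TT (Suc m)\<^esub>j\<in>{..<r}. \<Oplus>\<^bsub>TT (Suc m)\<^esub>w\<in>words m. ?g w j)"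
        using gc by (intro T'.M.finsum_swap) auto
      also have "\<dots> = (\<Oplus>\<^bsub>TT (Suc m)\<^esub>v\<in>words (Suc m). ?g (tl v) (hd v))"
        using gc by (subst finsum_words_Suc[OF T'.M.abelian_monoid_axioms]) auto
      also have "\<dots> = (\<Oplus>\<^bsub>TT (Suc m)\<^esub>v\<in>words (Suc m). lact (TT (Suc m)) (\<Theta> v (HT.cons (Suc m) x t)) (e v))"
      proof (intro T'.M.finsum_cong' refl funcsetI)
        fix v assume v: "v \<in> words (Suc m)"
        obtain i w where iw: "v = i # w" "i < r" "w \<in> words m" using v by (rule words_SucE)
        show "?g (tl v) (hd v) = lact (TT (Suc m)) (\<Theta> v (HT.cons (Suc m) x t)) (e v)"
          using iw x t by (simp add: \<Theta>cons)
        show "lact (TT (Suc m)) (\<Theta> v (HT.cons (Suc m) x t)) (e v) \<in> carrier (TT (Suc m))"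
          using v x t by (intro HT.lact_closed ec \<Theta>c HT.cons_closed)
      qed
      finally show "HT.cons (Suc m) x t = (\<Oplus>\<^bsub>TT (Suc m)\<^esub>v\<in>words (Suc m). lact (TT (Suc m)) (\<Theta> v (HT.cons (Suc m) x t)) (e v))" .
    qed
  qed
  have "free_over H S (TT (Suc m)) (lact (TT (Suc m))) (\<lambda>s t. ract (TT (Suc m)) t s) (words (Suc m)) \<Theta> PL"
    unfolding free_over_def
  proof (intro conjI ballI impI)
    fix f assume f: "f \<in> words (Suc m) \<rightarrow> carrier H"
    let ?y = "\<Oplus>\<^bsub>TT (Suc m)\<^esub>v\<in>words (Suc m). lact (TT (Suc m)) (f v) (e v)"
    have lc: "lact (TT (Suc m)) (f v) (e v) \<in> carrier (TT (Suc m))" if "v \<in> words (Suc m)" for v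
      using that f by (intro HT.lact_closed ec) auto
    show "\<exists>y\<in>carrier (TT (Suc m)). \<forall>w\<in>words (Suc m). \<Theta> w y = f w"
    proof (intro bexI[of _ ?y] ballI)
      show "?y \<in> carrier (TT (Suc m))" using lc by (intro T'.M.finsum_closed) auto
      fix u assume u: "u \<in> words (Suc m)"
      have "\<Theta> u ?y = (\<Oplus>\<^bsub>H\<^esub>v\<in>words (Suc m). \<Theta> u (lact (TT (Suc m)) (f v) (e v)))"
        using lc by (intro linear_finsum[OF HT.T_vs H_vs \<Theta>[OF u]])
      also have "\<dots> = (\<Oplus>\<^bsub>H\<^esub>v\<in>words (Suc m). f v \<otimes>\<^bsub>H\<^esub> (if v = u then \<one>\<^bsub>H\<^esub> else \<zero>\<^bsub>H\<^esub>))"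
        using u f funcset_mem[OF f] by (intro H.finsum_cong') (auto simp: lam ec \<Theta>e)
      also have "\<dots> = f u" using u f funcset_mem[OF f] by (intro H.finsum_delta_right) auto
      finally show "\<Theta> u ?y = f u" .
    qed
  next
    fix x y assume x: "x \<in> carrier (TT (Suc m))" and y: "y \<in> carrier (TT (Suc m))"
      and eq: "\<forall>w\<in>words (Suc m). \<Theta> w x = \<Theta> w y"
    have "x = (\<Oplus>\<^bsub>TT (Suc m)\<^esub>v\<in>words (Suc m). lact (TT (Suc m)) (\<Theta> v x) (e v))" by (rule exp[OF x])
    also have "\<dots> = (\<Oplus>\<^bsub>TT (Suc m)\<^esub>v\<in>words (Suc m). lact (TT (Suc m)) (\<Theta> v y) (e v))"
      using eq y by (intro T'.M.finsum_cong' refl funcsetI HT.lact_closed ec \<Theta>c) auto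
    also have "\<dots> = y" by (rule exp[OF y, symmetric])
    finally show "x = y" .
  next
    fix s t assume "s \<in> S" "t \<in> carrier (TT (Suc m))"
    then show "ract (TT (Suc m)) t s \<in> carrier (TT (Suc m))" using S by (intro HT.ract_closed) auto
  next
    fix s i j assume "s \<in> S" "i \<in> words (Suc m)" "j \<in> words (Suc m)"
    then show "PL i j s \<in> carrier H" using S by blast
  qed (use S in \<open>auto simp: HT.lact_closed lam rho linear_closed[OF \<Theta>] linear_add[OF \<Theta>] vs_abelian[OF HT.T_vs]\<close>)
  then show ?thesis using \<Theta> by blast
qed

lemma powers_free:
  assumes "S \<subseteq> carrier H"
  obtains \<theta> where "free_over H S (TT m) (lact (TT m)) (\<lambda>s t. ract (TT m) t s) (words m) \<theta> PL"
proof -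
  \<comment> \<open>Linearity of the coordinates over the field is carried along because
    \<open>free_over\<close> records only additivity, while the lifts in the induction step need
    linear maps.\<close>
  have "\<exists>\<theta>. (\<forall>w\<in>words m. \<theta> w \<in> linear_maps K (TT m) H) \<and>
    free_over H S (TT m) (lact (TT m)) (\<lambda>s t. ract (TT m) t s) (words m) \<theta> PL"
  proof (induction m)
    case 0
    show ?case by (rule powers_free_0[OF assms])
  next
    case (Suc m)
    then show ?case using powers_free_Suc[OF assms] by blast
  qed
  then show thesis using that by blast
qed

theorem power_retract_iff:
  assumes S: "S \<subseteq> carrier H" and dS: "\<And>i s. \<lbrakk>i < n; s \<in> S\<rbrakk> \<Longrightarrow> dd i s \<in> S"
  shows "retract_of_power (carrier H) S (TT m) (lact (TT m)) (\<lambda>s t. ract (TT m) t s)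
      (TT m') (lact (TT m')) (\<lambda>s t. ract (TT m') t s) \<longleftrightarrow> mat_retract K S (words m) pw (words m') pw"
proof -
  obtain \<theta> where F: "free_over H S (TT m) (lact (TT m)) (\<lambda>s t. ract (TT m) t s) (words m) \<theta> PL"
    by (rule powers_free[OF S])
  obtain \<theta>' where F': "free_over H S (TT m') (lact (TT m')) (\<lambda>s t. ract (TT m') t s) (words m') \<theta>' PL"
    by (rule powers_free[OF S])
  show ?thesis
  proof
    assume r: "retract_of_power (carrier H) S (TT m) (lact (TT m)) (\<lambda>s t. ract (TT m) t s)
      (TT m') (lact (TT m')) (\<lambda>s t. ract (TT m') t s)"
    show "mat_retract K S (words m) pw (words m') pw"
      by (rule augmented_algebra.retract_imp_mat[OF eps_augmented F F' _ _ r]) (use S in \<open>blast intro: eps_PL\<close>)+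
  next
    assume r: "mat_retract K S (words m) pw (words m') pw"
    show "retract_of_power (carrier H) S (TT m) (lact (TT m)) (\<lambda>s t. ract (TT m) t s)
      (TT m') (lact (TT m')) (\<lambda>s t. ract (TT m') t s)"
      \<comment> \<open>The form of the matrix is s_(1) p(s_(2)): the scalar part is evaluated at
        \<open>dd l s\<close>, which stays in \<open>S\<close>, and the weight is
        \<open>b l\<close>.\<close>
      by (rule augmented_algebra.mat_imp_retract[OF eps_augmented F F', of "{..<n}" dd "\<lambda>l s. b l" pw pw, OF _ _ _ _ _ _ _ r])
        (use S dS in \<open>auto simp: PL_def\<close>)
  qed
qed

end

section \<open>Tensor powers of a smash product\<close>

lemma intertwines_transpose:
  fixes K :: "('k, 'm) ring_scheme"
  assumes K: "cring K"
    and p: "\<And>s i j. \<lbrakk>s \<in> S; i \<in> W; j \<in> W\<rbrakk> \<Longrightarrow> p i j s \<in> carrier K"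
    and p': "\<And>s i j. \<lbrakk>s \<in> S; i \<in> W'; j \<in> W'\<rbrakk> \<Longrightarrow> p' i j s \<in> carrier K"
    and I: "intertwines K S W p W' p' a"
  shows "intertwines K S W' (\<lambda>i j. p' j i) W (\<lambda>i j. p j i) (\<lambda>i j. a j i)"
  unfolding intertwines_def
proof (intro conjI ballI)
  interpret K: cring K by fact
  have a: "a i j \<in> carrier K" if "i \<in> W" "j \<in> W'" for i j
    using I that unfolding intertwines_def by blast
  fix s i k assume s: "s \<in> S" and i: "i \<in> W'" and k: "k \<in> W"
  have "(\<Oplus>\<^bsub>K\<^esub>j\<in>W'. p' j i s \<otimes>\<^bsub>K\<^esub> a k j) = (\<Oplus>\<^bsub>K\<^esub>j\<in>W'. a k j \<otimes>\<^bsub>K\<^esub> p' j i s)"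
    using s i k by (intro K.finsum_cong') (auto simp: a p' K.m_comm)
  also have "\<dots> = (\<Oplus>\<^bsub>K\<^esub>j\<in>W. p k j s \<otimes>\<^bsub>K\<^esub> a j i)" using I s i k unfolding intertwines_def by simp
  also have "\<dots> = (\<Oplus>\<^bsub>K\<^esub>j\<in>W. a j i \<otimes>\<^bsub>K\<^esub> p k j s)"
    using s i k by (intro K.finsum_cong') (auto simp: a p K.m_comm)
  finally show "(\<Oplus>\<^bsub>K\<^esub>j\<in>W'. p' j i s \<otimes>\<^bsub>K\<^esub> a k j) = (\<Oplus>\<^bsub>K\<^esub>j\<in>W. a j i \<otimes>\<^bsub>K\<^esub> p k j s)" .
qed (use I in \<open>auto simp: intertwines_def\<close>)

text \<open>Transposition reverses products, so the two families exchange their roles: the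
  transposed \<open>b t\<close> now lead out of W and the transposed \<open>a t\<close> lead back.
  This converts between the matrices of the right module Q and those of the left action on its
  dual.\<close>

lemma mat_retract_transpose:
  fixes K :: "('k, 'm) ring_scheme"
  assumes K: "cring K"
    and p: "\<And>s i j. \<lbrakk>s \<in> S; i \<in> W; j \<in> W\<rbrakk> \<Longrightarrow> p i j s \<in> carrier K"
    and p': "\<And>s i j. \<lbrakk>s \<in> S; i \<in> W'; j \<in> W'\<rbrakk> \<Longrightarrow> p' i j s \<in> carrier K"
    and r: "mat_retract K S W p W' p'"
  shows "mat_retract K S W (\<lambda>i j. p j i) W' (\<lambda>i j. p' j i)"
proof -
  interpret K: cring K by fact
  from r obtain m a b where I: "t < m \<Longrightarrow> intertwines K S W p W' p' (a t)" "t < m \<Longrightarrow> intertwines K S W' p' W p (b t)"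
    and ab: "\<lbrakk>i \<in> W; k \<in> W\<rbrakk> \<Longrightarrow> (\<Oplus>\<^bsub>K\<^esub>t\<in>{..<m::nat}. \<Oplus>\<^bsub>K\<^esub>j\<in>W'. a t i j \<otimes>\<^bsub>K\<^esub> b t j k) = (if i = k then \<one>\<^bsub>K\<^esub> else \<zero>\<^bsub>K\<^esub>)"
    for t i k
    unfolding mat_retract_def by blast
  have c: "a t i j \<in> carrier K" "b t j i \<in> carrier K" if "t < m" "i \<in> W" "j \<in> W'" for t i j
    using I that unfolding intertwines_def by simp_all
  have "(\<Oplus>\<^bsub>K\<^esub>t\<in>{..<m}. \<Oplus>\<^bsub>K\<^esub>j\<in>W'. b t j i \<otimes>\<^bsub>K\<^esub> a t k j) = (if i = k then \<one>\<^bsub>K\<^esub> else \<zero>\<^bsub>K\<^esub>)"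
    if "i \<in> W" "k \<in> W" for i k
  proof -
    have "(\<Oplus>\<^bsub>K\<^esub>t\<in>{..<m}. \<Oplus>\<^bsub>K\<^esub>j\<in>W'. b t j i \<otimes>\<^bsub>K\<^esub> a t k j) = (\<Oplus>\<^bsub>K\<^esub>t\<in>{..<m}. \<Oplus>\<^bsub>K\<^esub>j\<in>W'. a t k j \<otimes>\<^bsub>K\<^esub> b t j i)"
      using that by (intro K.finsum_cong' refl funcsetI K.finsum_closed) (auto simp: c K.m_comm)
    then show ?thesis using ab that by auto
  qed
  then show ?thesis unfolding mat_retract_def
    using intertwines_transpose[OF K p' p I(2)] intertwines_transpose[OF K p p' I(1)]
    by (intro exI[of _ m] exI[of _ "\<lambda>t i j. b t j i"] exI[of _ "\<lambda>t j i. a t i j"]) simp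
qed

text \<open>The \<open>e i\<close> are the images of the \<open>b i\<close> under a linear retraction of \<open>H\<close> onto \<open>S\<close>.\<close>

locale hopf_part = hopf_quot K H n b \<phi> R r q \<psi> for K :: "('k, 'm) ring_scheme" (structure)
    and H :: "('k, 'h, 'x) hopf_scheme" and n b \<phi> R r q \<psi> +
  fixes S :: "'h set" and e :: "nat \<Rightarrow> 'h"
  assumes S_sub: "unital_subalgebra K S H"
    and e_S: "i < n \<Longrightarrow> e i \<in> S"
    and dd_S: "\<lbrakk>i < n; s \<in> S\<rbrakk> \<Longrightarrow> dd i s \<in> S"
    and comult_S: "s \<in> S \<Longrightarrow> comult H s = (\<Oplus>\<^bsub>HH\<^esub>i\<in>{..<n}. pure_tensor K H H (e i) (dd i s))"
begin

lemma S_submodule: "submodule S K H"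
  and S_one: "\<one>\<^bsub>H\<^esub> \<in> S"
  and S_mult: "\<lbrakk>x \<in> S; y \<in> S\<rbrakk> \<Longrightarrow> x \<otimes>\<^bsub>H\<^esub> y \<in> S"
  using S_sub by (auto simp: unital_subalgebra_def)

lemmas S_subE = H.submoduleE[OF S_submodule]

lemma S_closed: "x \<in> S \<Longrightarrow> x \<in> carrier H"
  using S_subE(1) by blast

text \<open>For s in \<open>S\<close> the first legs \<open>b i\<close> may be replaced by the
  elements \<open>e i\<close> of \<open>S\<close>. The former suit computations in H, the latter are
  needed where the legs must act within \<open>S\<close>.\<close>

lemma sweedler_S:
  assumes M: "Module.module K M" and f: "bilinear H H M f" and s: "s \<in> S"
  shows "(\<Oplus>\<^bsub>M\<^esub>i\<in>{..<n}. f (e i) (dd i s)) = (\<Oplus>\<^bsub>M\<^esub>i\<in>{..<n}. f (b i) (dd i s))"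
proof -
  have "tensor_lift K M f (comult H s) = (\<Oplus>\<^bsub>M\<^esub>i\<in>{..<n}. f (e i) (dd i s))"
    unfolding comult_S[OF s] using s by (intro lift_pure_sum[OF M f]) (auto simp: e_S dd_S S_closed)
  then show ?thesis using sweedler[OF M f S_closed[OF s]] by simp
qed

end

text \<open>The algebra \<open>C\<close> plays the role of \<open>Q\<^sup>* # S\<close>, with \<open>j s = 1 # s\<close>, \<open>d i\<close> the dual basis vectors of \<open>Q\<^sup>*\<close>
  and \<open>\<zeta> i (a # s) = a (q i) s\<close>.\<close>

locale free_smash = hopf_part K H n b \<phi> R r q \<psi> S e for K :: "('k, 'm) ring_scheme" (structure)
    and H :: "('k, 'h, 'x) hopf_scheme" and n b \<phi> R r q \<psi> and S :: "'h set" and e +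
  fixes C :: "('k, 'c, 'y) module_scheme" and j :: "'h \<Rightarrow> 'c"
    and d :: "nat \<Rightarrow> 'c" and \<zeta> :: "nat \<Rightarrow> 'c \<Rightarrow> 'h"
  assumes C_vs: "Module.module K C"
    and C_mult: "bilinear C C C (mult C)"
    and j_closed: "s \<in> S \<Longrightarrow> j s \<in> carrier C"
    and j_add: "\<lbrakk>s \<in> S; s' \<in> S\<rbrakk> \<Longrightarrow> j (s \<oplus>\<^bsub>H\<^esub> s') = j s \<oplus>\<^bsub>C\<^esub> j s'"
    and j_smult: "\<lbrakk>c \<in> carrier K; s \<in> S\<rbrakk> \<Longrightarrow> j (c \<odot>\<^bsub>H\<^esub> s) = c \<odot>\<^bsub>C\<^esub> j s"
    and j_mult: "\<lbrakk>s \<in> S; s' \<in> S\<rbrakk> \<Longrightarrow> j (s \<otimes>\<^bsub>H\<^esub> s') = j s \<otimes>\<^bsub>C\<^esub> j s'"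
    and j_inj: "\<lbrakk>s \<in> S; s' \<in> S; j s = j s'\<rbrakk> \<Longrightarrow> s = s'"
    and d_closed: "i < r \<Longrightarrow> d i \<in> carrier C"
    and \<zeta>_linear: "i < r \<Longrightarrow> \<zeta> i \<in> linear_maps K C H"
    and \<zeta>_S: "\<lbrakk>i < r; x \<in> carrier C\<rbrakk> \<Longrightarrow> \<zeta> i x \<in> S"
    and \<zeta>_right: "\<lbrakk>i < r; x \<in> carrier C; s \<in> S\<rbrakk> \<Longrightarrow> \<zeta> i (x \<otimes>\<^bsub>C\<^esub> j s) = \<zeta> i x \<otimes>\<^bsub>H\<^esub> s"
    and \<zeta>_left: "\<lbrakk>i < r; x \<in> carrier C; s \<in> S\<rbrakk> \<Longrightarrow> \<zeta> i (j s \<otimes>\<^bsub>C\<^esub> x) =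
      (\<Oplus>\<^bsub>H\<^esub>k\<in>{..<n}. \<Oplus>\<^bsub>H\<^esub>l\<in>{..<r}. pq i l (b k) \<odot>\<^bsub>H\<^esub> (dd k s \<otimes>\<^bsub>H\<^esub> \<zeta> l x))"
    and \<zeta>_expand: "x \<in> carrier C \<Longrightarrow> x = (\<Oplus>\<^bsub>C\<^esub>i\<in>{..<r}. d i \<otimes>\<^bsub>C\<^esub> j (\<zeta> i x))"
    and \<zeta>_d: "\<lbrakk>i < r; l < r\<rbrakk> \<Longrightarrow> \<zeta> i (d l) = (if i = l then \<one>\<^bsub>H\<^esub> else \<zero>\<^bsub>H\<^esub>)"
begin

lemmas S_zero = submodule_zero[OF S_submodule]

lemma finsum_S: "(\<And>i. i \<in> A \<Longrightarrow> f i \<in> S) \<Longrightarrow> finsum H f A \<in> S"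
  by (rule submodule_finsum[OF H_vs S_submodule])

text \<open>Right modules over \<open>S\<close> are treated as left modules over the opposite algebra.\<close>

definition opS where "opS = H\<lparr>carrier := S, mult := (\<lambda>x y. y \<otimes>\<^bsub>H\<^esub> x)\<rparr>"

lemma opS_simps [simp]:
  "carrier opS = S" "mult opS = (\<lambda>x y. y \<otimes>\<^bsub>H\<^esub> x)" "one opS = \<one>\<^bsub>H\<^esub>" "zero opS = \<zero>\<^bsub>H\<^esub>"
  "add opS = add H" "smult opS = smult H"
  by (simp_all add: opS_def)

lemma opS_vs: "Module.module K opS"
  by (rule module_cong[OF submodule.submodule_is_module[OF S_submodule H_vs]]) simp_all

lemma opS_group: "abelian_group opS"
  by (rule vs_abelian[OF opS_vs])

lemma opS_algebra: "algebra_over K opS"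
proof (intro algebra_over.intro algebra_over_axioms.intro opS_vs ringI opS_group)
  show "monoid opS"
    by (rule monoidI) (auto simp: S_mult S_one S_closed H.m_assoc)
qed (auto simp: S_closed H.l_distr H.r_distr H.smult_mult_left H.smult_mult_right)

lemma opS_augmented: "augmented_algebra K opS eps"
proof (intro augmented_algebra.intro augmented_algebra_axioms.intro opS_algebra base_field_axioms)
  show "eps \<in> ring_hom opS K"
    by (auto simp: ring_hom_def S_closed eps_mult eps_add m_comm)
qed (auto simp: S_closed eps_smult)

lemma finsum_opS:
  assumes "finite A" "\<And>i. i \<in> A \<Longrightarrow> f i \<in> S"
  shows "finsum opS f A = finsum H f A"
  by (rule additive_finsum[OF opS_group H.M.abelian_group_axioms, where f="\<lambda>x. x"]) (use assms S_closed in auto)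

text \<open>The matrix of p(s_(1)) s_(2), with the two indices exchanged: \<open>free_over\<close>
  lets rho act by multiplying a row by a matrix, whereas here s acts from the left on a
  column.\<close>

definition PR where "PR w w' s = (\<Oplus>\<^bsub>H\<^esub>k\<in>{..<n}. pw w' w (b k) \<odot>\<^bsub>H\<^esub> dd k s)"

lemma PR_S: "\<lbrakk>w \<in> words m; w' \<in> words m; s \<in> S\<rbrakk> \<Longrightarrow> PR w w' s \<in> S"
  unfolding PR_def by (rule finsum_S) (auto intro!: S_subE(4) dd_S)

text \<open>\<open>mat_imp_retract\<close> evaluates the intertwining identity only at elements of
  \<open>S\<close>, so the first legs have to be the \<open>e k\<close>.\<close>

lemma PR_e:
  assumes w: "w \<in> words m" "w' \<in> words m" and s: "s \<in> S"
  shows "PR w w' s = (\<Oplus>\<^bsub>opS\<^esub>k\<in>{..<n}. pw w' w (e k) \<odot>\<^bsub>opS\<^esub> dd k s)"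
proof -
  note pl = pw_linear[OF w(2,1)]
  have bil: "bilinear H H H (\<lambda>x y. pw w' w x \<odot>\<^bsub>H\<^esub> y)"
    using w by (intro bilinearI')
      (auto simp: form_add[OF pl] form_smult[OF pl] H.smult_l_distr H.smult_r_distr H.smult_assoc1[symmetric] m_comm)
  have "PR w w' s = tensor_lift K H (\<lambda>x y. pw w' w x \<odot>\<^bsub>H\<^esub> y) (comult H s)"
    unfolding PR_def by (rule sweedler[OF H_vs bil S_closed[OF s], symmetric])
  also have "\<dots> = (\<Oplus>\<^bsub>H\<^esub>k\<in>{..<n}. pw w' w (e k) \<odot>\<^bsub>H\<^esub> dd k s)"
    unfolding comult_S[OF s] using s by (intro lift_pure_sum[OF H_vs bil]) (auto intro: S_closed e_S)
  also have "\<dots> = (\<Oplus>\<^bsub>opS\<^esub>k\<in>{..<n}. pw w' w (e k) \<odot>\<^bsub>opS\<^esub> dd k s)"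
    using w s by (subst finsum_opS) (auto intro!: S_subE(4) dd_S S_closed[OF e_S])
  finally show ?thesis .
qed

lemma eps_PR:
  assumes w: "w \<in> words m" "w' \<in> words m" and s: "s \<in> S"
  shows "eps (PR w w' s) = pw w' w s"
proof -
  have sc: "s \<in> carrier H" by (rule S_closed[OF s])
  have "eps (PR w w' s) = (\<Oplus>k\<in>{..<n}. eps (pw w' w (b k) \<odot>\<^bsub>H\<^esub> dd k s))"
    unfolding PR_def using w sc by (intro form_finsum[OF H_vs eps_linear]) auto
  also have "\<dots> = (\<Oplus>k\<in>{..<n}. pw w' w (eps (dd k s) \<odot>\<^bsub>H\<^esub> b k))"
    using w sc by (intro finsum_cong') (auto simp: eps_smult form_smult[OF pw_linear[OF w(2,1)]] m_comm)
  also have "\<dots> = pw w' w (\<Oplus>\<^bsub>H\<^esub>k\<in>{..<n}. eps (dd k s) \<odot>\<^bsub>H\<^esub> b k)"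
    using sc by (intro form_finsum[OF H_vs pw_linear[OF w(2,1)], symmetric]) auto
  finally show ?thesis using sweedler_counit_right[OF sc] by simp
qed

lemma PR_Nil: "s \<in> carrier H \<Longrightarrow> PR [] [] s = s"
  by (simp add: PR_def sweedler_counit_left)

text \<open>Coassociativity in the form p_(il)(s_(1)) times the entry of the shorter words at s_(2)
  times s_(3).\<close>

lemma PR_Cons:
  assumes i: "i < r" and l: "l < r" and w: "w \<in> words m" "w' \<in> words m" and s: "s \<in> carrier H"
  shows "PR (l # w') (i # w) s = (\<Oplus>\<^bsub>H\<^esub>k\<in>{..<n}. pq i l (b k) \<odot>\<^bsub>H\<^esub> PR w' w (dd k s))"
proof -
  note pl = pw_linear[OF w] and ql = pq_linear[OF i l]
  let ?f = "\<lambda>x y z. (pq i l x \<otimes> pw w w' y) \<odot>\<^bsub>H\<^esub> z"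
  have tri: "trilinear H H H H ?f"
  proof (rule trilinearI)
    fix x assume "x \<in> carrier H"
    then show "bilinear H H H (?f x)" using i l w
      by (intro bilinearI')
        (auto simp: form_add[OF pl] form_smult[OF pl] l_distr r_distr
          H.smult_l_distr H.smult_r_distr H.smult_assoc1[symmetric] m_ac)
  next
    fix y z assume "y \<in> carrier H" "z \<in> carrier H"
    then show "(\<lambda>x. ?f x y z) \<in> linear_maps K H H" using i l w
      by (intro linear_mapsI) (auto simp: form_add[OF ql] form_smult[OF ql] l_distr r_distr H.smult_l_distr H.smult_assoc1[symmetric] m_ac)
  qed
  have "PR (l # w') (i # w) s = (\<Oplus>\<^bsub>H\<^esub>k\<in>{..<n}. \<Oplus>\<^bsub>H\<^esub>c\<in>{..<n}. ?f (b c) (dd c (b k)) (dd k s))"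
    unfolding PR_def
  proof (intro H.finsum_cong' refl funcsetI finsum_H_closed)
    fix k assume k: "k \<in> {..<n}"
    show "pw (i # w) (l # w') (b k) \<odot>\<^bsub>H\<^esub> dd k s = (\<Oplus>\<^bsub>H\<^esub>c\<in>{..<n}. ?f (b c) (dd c (b k)) (dd k s))"
      using k i l w s
      by (simp, intro additive_finsum[OF abelian_group_axioms H.M.abelian_group_axioms, where f="\<lambda>z. z \<odot>\<^bsub>H\<^esub> dd k s"])
        (auto simp: H.smult_l_distr)
  qed (use i l w s in auto)
  also have "\<dots> = (\<Oplus>\<^bsub>H\<^esub>k\<in>{..<n}. \<Oplus>\<^bsub>H\<^esub>c\<in>{..<n}. ?f (b k) (b c) (dd c (dd k s)))"
    by (rule sweedler_coassoc[OF H_vs tri s])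
  also have "\<dots> = (\<Oplus>\<^bsub>H\<^esub>k\<in>{..<n}. pq i l (b k) \<odot>\<^bsub>H\<^esub> PR w' w (dd k s))"
  proof (intro H.finsum_cong' refl funcsetI)
    fix k assume k: "k \<in> {..<n}"
    have "pq i l (b k) \<odot>\<^bsub>H\<^esub> PR w' w (dd k s) = (\<Oplus>\<^bsub>H\<^esub>c\<in>{..<n}. pq i l (b k) \<odot>\<^bsub>H\<^esub> (pw w w' (b c) \<odot>\<^bsub>H\<^esub> dd c (dd k s)))"
      unfolding PR_def using k i l w s by (intro H.finsum_smult_ldistr) auto
    also have "\<dots> = (\<Oplus>\<^bsub>H\<^esub>c\<in>{..<n}. ?f (b k) (b c) (dd c (dd k s)))"
      using k i l w s by (intro H.finsum_cong') (auto simp: H.smult_assoc1)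
    finally show "(\<Oplus>\<^bsub>H\<^esub>c\<in>{..<n}. ?f (b k) (b c) (dd c (dd k s))) = pq i l (b k) \<odot>\<^bsub>H\<^esub> PR w' w (dd k s)" by simp
    show "pq i l (b k) \<odot>\<^bsub>H\<^esub> PR w' w (dd k s) \<in> carrier H"
      unfolding PR_def using k i l w s by (intro H.smult_closed finsum_H_closed) auto
  qed
  finally show ?thesis .
qed

text \<open>Abstracts the passage from M to the dual of Q tensored with M: \<open>\<tau> i\<close>
  are the components along the dual basis, and s acts by p(s_(1)) on the new letter and by s_(2) on
  M. It is used with S as M for a single copy of the smash product, and between successive
  powers.\<close>

lemma free_over_step:
  assumes F: "free_over opS S M lam rho (words m) \<theta> PR" and M: "Module.module K M" and M': "Module.module K M'"
    and \<theta>: "\<And>w. w \<in> words m \<Longrightarrow> \<theta> w \<in> linear_maps K M H"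
    and \<tau>: "\<And>i. i < r \<Longrightarrow> \<tau> i \<in> linear_maps K M' M"
    and \<tau>_lam: "\<And>i a y. \<lbrakk>i < r; a \<in> S; y \<in> carrier M'\<rbrakk> \<Longrightarrow> lam' a y \<in> carrier M' \<and> \<tau> i (lam' a y) = lam a (\<tau> i y)"
    and lam'_closed: "\<And>a y. \<lbrakk>a \<in> S; y \<in> carrier M'\<rbrakk> \<Longrightarrow> lam' a y \<in> carrier M'"
    and rho'_closed: "\<And>a y. \<lbrakk>a \<in> S; y \<in> carrier M'\<rbrakk> \<Longrightarrow> rho' a y \<in> carrier M'"
    and \<tau>_rho: "\<And>i s y. \<lbrakk>i < r; s \<in> S; y \<in> carrier M'\<rbrakk> \<Longrightarrow>
      \<tau> i (rho' s y) = (\<Oplus>\<^bsub>M\<^esub>k\<in>{..<n}. \<Oplus>\<^bsub>M\<^esub>l\<in>{..<r}. pq i l (b k) \<odot>\<^bsub>M\<^esub> rho (dd k s) (\<tau> l y))"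
    and inj: "\<And>y y'. \<lbrakk>y \<in> carrier M'; y' \<in> carrier M'; \<And>i. i < r \<Longrightarrow> \<tau> i y = \<tau> i y'\<rbrakk> \<Longrightarrow> y = y'"
    and surj: "\<And>f. (\<And>i. i < r \<Longrightarrow> f i \<in> carrier M) \<Longrightarrow> \<exists>y\<in>carrier M'. \<forall>i<r. \<tau> i y = f i"
  shows "free_over opS S M' lam' rho' (words (Suc m)) (\<lambda>v y. \<theta> (tl v) (\<tau> (hd v) y)) PR"
proof -
  note FD = free_overD[OF F, unfolded opS_simps]
  interpret M: Module.module K M by fact
  interpret M': Module.module K M' by fact
  note \<tau>c = linear_closed[OF \<tau>]
  have \<Theta>: "(\<lambda>y. \<theta> (tl v) (\<tau> (hd v) y)) \<in> linear_maps K M' H" if "v \<in> words (Suc m)" for v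
    using that by (elim words_SucE) (simp add: linear_comp[OF \<tau> \<theta>])
  have \<Theta>S: "\<theta> (tl v) (\<tau> (hd v) y) \<in> S" if "v \<in> words (Suc m)" "y \<in> carrier M'" for v y
    using that by (elim words_SucE) (simp add: FD(3) \<tau>c)
  have rho_formula: "\<theta> w (\<tau> i (rho' s y)) = (\<Oplus>\<^bsub>H\<^esub>u\<in>words (Suc m). PR u (i # w) s \<otimes>\<^bsub>H\<^esub> \<theta> (tl u) (\<tau> (hd u) y))"
    if i: "i < r" and w: "w \<in> words m" and sS: "s \<in> S" and y: "y \<in> carrier M'" for i w s y
  proof -
    have s: "s \<in> carrier H" by (rule S_closed[OF sS])
    have tc: "\<theta> w' (\<tau> l y) \<in> S" "\<theta> w' (\<tau> l y) \<in> carrier H" if "l < r" "w' \<in> words m" for l w'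
      using that y FD(3) \<tau>c S_closed by blast+
    have dk: "dd k s \<in> S" if "k < n" for k using that sS by (rule dd_S)
    have PRc: "PR w' w (dd k s) \<in> carrier H" if "k < n" "w' \<in> words m" for k w'
      using S_closed[OF PR_S[OF that(2) w dk[OF that(1)]]] .
    have rc: "rho (dd k s) (\<tau> l y) \<in> carrier M" if "k < n" "l < r" for k l
      using that y by (intro FD(9) dk \<tau>c)
    have PRtc: "PR (l # w') (i # w) s \<otimes>\<^bsub>H\<^esub> \<theta> w' (\<tau> l y) \<in> carrier H" if "l < r" "w' \<in> words m" for l w'
    proof -
      have "PR (l # w') (i # w) s \<in> S" using that i w sS by (intro PR_S[of _ "Suc m"]) auto
      then show ?thesis using tc that by (intro H.m_closed S_closed)
    qed
    let ?g = "\<lambda>k l w'. (pq i l (b k) \<odot>\<^bsub>H\<^esub> PR w' w (dd k s)) \<otimes>\<^bsub>H\<^esub> \<theta> w' (\<tau> l y)"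
    have gc: "?g k l w' \<in> carrier H" if "k < n" "l < r" "w' \<in> words m" for k l w'
      using that i PRc tc by auto
    have "\<theta> w (\<tau> i (rho' s y)) = (\<Oplus>\<^bsub>H\<^esub>k\<in>{..<n}. \<theta> w (\<Oplus>\<^bsub>M\<^esub>l\<in>{..<r}. pq i l (b k) \<odot>\<^bsub>M\<^esub> rho (dd k s) (\<tau> l y)))"
      unfolding \<tau>_rho[OF i sS y] using i rc
      by (intro linear_finsum[OF M H_vs \<theta>[OF w]] M.M.finsum_closed) auto
    also have "\<dots> = (\<Oplus>\<^bsub>H\<^esub>k\<in>{..<n}. \<Oplus>\<^bsub>H\<^esub>l\<in>{..<r}. \<Oplus>\<^bsub>H\<^esub>w'\<in>words m. ?g k l w')"
    proof (intro H.finsum_cong' refl funcsetI finsum_H_closed)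
      fix k assume k: "k \<in> {..<n}"
      have "\<theta> w (\<Oplus>\<^bsub>M\<^esub>l\<in>{..<r}. pq i l (b k) \<odot>\<^bsub>M\<^esub> rho (dd k s) (\<tau> l y)) =
          (\<Oplus>\<^bsub>H\<^esub>l\<in>{..<r}. \<theta> w (pq i l (b k) \<odot>\<^bsub>M\<^esub> rho (dd k s) (\<tau> l y)))"
        using k i rc by (intro linear_finsum[OF M H_vs \<theta>[OF w]]) auto
      also have "\<dots> = (\<Oplus>\<^bsub>H\<^esub>l\<in>{..<r}. \<Oplus>\<^bsub>H\<^esub>w'\<in>words m. ?g k l w')"
      proof (intro H.finsum_cong' refl funcsetI finsum_H_closed)
        fix l assume l: "l \<in> {..<r}"
        have "\<theta> w (pq i l (b k) \<odot>\<^bsub>M\<^esub> rho (dd k s) (\<tau> l y)) = pq i l (b k) \<odot>\<^bsub>H\<^esub> \<theta> w (rho (dd k s) (\<tau> l y))"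
          using k l i rc by (intro linear_smult[OF \<theta>[OF w]]) auto
        also have "\<theta> w (rho (dd k s) (\<tau> l y)) = (\<Oplus>\<^bsub>opS\<^esub>w'\<in>words m. PR w' w (dd k s) \<otimes>\<^bsub>H\<^esub> \<theta> w' (\<tau> l y))"
          using FD(10)[OF dk \<tau>c[OF _ y] w, of k l] k l by simp
        also have "\<dots> = (\<Oplus>\<^bsub>H\<^esub>w'\<in>words m. PR w' w (dd k s) \<otimes>\<^bsub>H\<^esub> \<theta> w' (\<tau> l y))"
          using k l tc by (intro finsum_opS finite_words S_mult PR_S[OF _ w dk]) auto
        also have "pq i l (b k) \<odot>\<^bsub>H\<^esub> \<dots> = (\<Oplus>\<^bsub>H\<^esub>w'\<in>words m. pq i l (b k) \<odot>\<^bsub>H\<^esub> (PR w' w (dd k s) \<otimes>\<^bsub>H\<^esub> \<theta> w' (\<tau> l y)))"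
          using k l i tc PRc by (intro H.finsum_smult_ldistr) auto
        also have "\<dots> = (\<Oplus>\<^bsub>H\<^esub>w'\<in>words m. ?g k l w')"
          using k l i tc PRc by (intro H.finsum_cong') (auto simp: H.smult_mult_left)
        finally show "\<theta> w (pq i l (b k) \<odot>\<^bsub>M\<^esub> rho (dd k s) (\<tau> l y)) = (\<Oplus>\<^bsub>H\<^esub>w'\<in>words m. ?g k l w')" .
      qed (use k gc in auto)
      finally show "\<theta> w (\<Oplus>\<^bsub>M\<^esub>l\<in>{..<r}. pq i l (b k) \<odot>\<^bsub>M\<^esub> rho (dd k s) (\<tau> l y)) =
          (\<Oplus>\<^bsub>H\<^esub>l\<in>{..<r}. \<Oplus>\<^bsub>H\<^esub>w'\<in>words m. ?g k l w')" .
    qed (use gc in auto)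
    also have "\<dots> = (\<Oplus>\<^bsub>H\<^esub>l\<in>{..<r}. \<Oplus>\<^bsub>H\<^esub>k\<in>{..<n}. \<Oplus>\<^bsub>H\<^esub>w'\<in>words m. ?g k l w')"
      using gc by (intro H.finsum_swap finsum_H_closed) auto
    also have "\<dots> = (\<Oplus>\<^bsub>H\<^esub>l\<in>{..<r}. \<Oplus>\<^bsub>H\<^esub>w'\<in>words m. \<Oplus>\<^bsub>H\<^esub>k\<in>{..<n}. ?g k l w')"
      using gc by (intro H.finsum_cong' refl funcsetI H.finsum_swap finsum_H_closed) auto
    also have "\<dots> = (\<Oplus>\<^bsub>H\<^esub>l\<in>{..<r}. \<Oplus>\<^bsub>H\<^esub>w'\<in>words m. PR (l # w') (i # w) s \<otimes>\<^bsub>H\<^esub> \<theta> w' (\<tau> l y))"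
    proof (intro H.finsum_cong' refl funcsetI finsum_H_closed)
      fix l w' assume l: "l \<in> {..<r}" and w': "w' \<in> words m"
      show "(\<Oplus>\<^bsub>H\<^esub>k\<in>{..<n}. ?g k l w') = PR (l # w') (i # w) s \<otimes>\<^bsub>H\<^esub> \<theta> w' (\<tau> l y)"
        unfolding PR_Cons[OF i _ w w' s, of l, OF l[unfolded lessThan_iff]]
        using l w' i tc PRc by (intro H.finsum_ldistr[symmetric]) auto
    qed (use PRtc in auto)
    also have "\<dots> = (\<Oplus>\<^bsub>H\<^esub>u\<in>words (Suc m). PR u (i # w) s \<otimes>\<^bsub>H\<^esub> \<theta> (tl u) (\<tau> (hd u) y))"
      using PRtc by (subst finsum_words_Suc[OF H.M.abelian_monoid_axioms]) auto
    finally show ?thesis .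
  qed
  show ?thesis
    unfolding free_over_def opS_simps
  proof (intro conjI ballI impI)
    fix f assume f: "f \<in> words (Suc m) \<rightarrow> S"
    have "\<forall>i. \<exists>t. i < r \<longrightarrow> t \<in> carrier M \<and> (\<forall>w\<in>words m. \<theta> w t = f (i # w))"
    proof
      fix i show "\<exists>t. i < r \<longrightarrow> t \<in> carrier M \<and> (\<forall>w\<in>words m. \<theta> w t = f (i # w))"
        using FD(5)[of "\<lambda>w. f (i # w)"] funcset_mem[OF f] by (cases "i < r") auto
    qed
    from choice[OF this] obtain t where t: "\<forall>i. i < r \<longrightarrow> t i \<in> carrier M \<and> (\<forall>w\<in>words m. \<theta> w (t i) = f (i # w))" ..
    then obtain y where y: "y \<in> carrier M'" "\<forall>i<r. \<tau> i y = t i" using surj[of t] by blast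
    show "\<exists>x\<in>carrier M'. \<forall>w\<in>words (Suc m). \<theta> (tl w) (\<tau> (hd w) x) = f w"
      by (rule bexI[OF _ y(1)]) (use y(2) t in \<open>auto elim!: words_SucE\<close>)
  next
    fix x y assume x: "x \<in> carrier M'" and y: "y \<in> carrier M'"
      and eq: "\<forall>w\<in>words (Suc m). \<theta> (tl w) (\<tau> (hd w) x) = \<theta> (tl w) (\<tau> (hd w) y)"
    show "x = y"
    proof (rule inj[OF x y], rule FD(6))
      fix i w assume "i < r" "w \<in> words m"
      then show "\<theta> w (\<tau> i x) = \<theta> w (\<tau> i y)" using eq[rule_format, of "i # w"] by simp
    qed (use x y \<tau>c in auto)
  next
    fix a y w assume a: "a \<in> S" and y: "y \<in> carrier M'" and w: "w \<in> words (Suc m)"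
    obtain i u where "w = i # u" "i < r" "u \<in> words m" using w by (rule words_SucE)
    then show "\<theta> (tl w) (\<tau> (hd w) (lam' a y)) = \<theta> (tl w) (\<tau> (hd w) y) \<otimes>\<^bsub>H\<^esub> a"
      using a y \<tau>_lam FD(8)[OF a \<tau>c] by simp
  next
    fix s y w assume s: "s \<in> S" and y: "y \<in> carrier M'" and w: "w \<in> words (Suc m)"
    obtain i u where iu: "w = i # u" "i < r" "u \<in> words m" using w by (rule words_SucE)
    have "(\<Oplus>\<^bsub>opS\<^esub>u\<in>words (Suc m). PR u w s \<otimes>\<^bsub>H\<^esub> \<theta> (tl u) (\<tau> (hd u) y)) =
        (\<Oplus>\<^bsub>H\<^esub>u\<in>words (Suc m). PR u w s \<otimes>\<^bsub>H\<^esub> \<theta> (tl u) (\<tau> (hd u) y))"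
      using w s y by (intro finsum_opS finite_words S_mult PR_S[OF _ w] \<Theta>S)
    then show "\<theta> (tl w) (\<tau> (hd w) (rho' s y)) = (\<Oplus>\<^bsub>opS\<^esub>u\<in>words (Suc m). PR u w s \<otimes>\<^bsub>H\<^esub> \<theta> (tl u) (\<tau> (hd u) y))"
      using rho_formula[OF iu(2,3) s y] iu(1) by simp
  next
    fix s i l assume "s \<in> S" "i \<in> words (Suc m)" "l \<in> words (Suc m)"
    then show "PR i l s \<in> S" using PR_S by blast
  qed (use \<Theta>S linear_add[OF \<Theta>] lam'_closed rho'_closed vs_abelian[OF M'] in auto)
qed

end

section \<open>Similarity in terms of component maps, and the exchange of left and right
  actions\<close>

lemma similar_iff:
  fixes M :: "('k, 'c, 'a) bimodule" and N :: "('k, 'c, 'b) bimodule"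
  assumes "abelian_group M" "abelian_group N"
    "acts_on L (lact M) M" "acts_on R (\<lambda>c x. ract M x c) M"
    "acts_on L (lact N) N" "acts_on R (\<lambda>c x. ract N x c) N"
  shows "similar L R M N \<longleftrightarrow>
    retract_of_power L R M (lact M) (\<lambda>c x. ract M x c) N (lact N) (\<lambda>c x. ract N x c) \<and>
    retract_of_power L R N (lact N) (\<lambda>c x. ract N x c) M (lact M) (\<lambda>c x. ract M x c)"
  unfolding similar_def
  using summand_iff_retract[OF assms] summand_iff_retract[OF assms(2,1,5,6,3,4)] by simp

text \<open>The right action takes the place of the module action \<open>lam\<close> in
  \<open>free_over\<close> and the left action that of \<open>rho\<close>. The acting elements are
  indexed by \<open>S\<close> itself instead of its image under \<open>j\<close>.\<close>

lemma bihom_swap_image: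
  "bihom (j ` S) (j ` S) M l r N l' r' = bihom S S M (\<lambda>a. r (j a)) (\<lambda>s. l (j s)) N (\<lambda>a. r' (j a)) (\<lambda>s. l' (j s))"
  by (auto simp: bihom_def)

lemma retract_swap_image:
  "retract_of_power (j ` S) (j ` S) M l r N l' r' \<longleftrightarrow>
    retract_of_power S S M (\<lambda>a. r (j a)) (\<lambda>s. l (j s)) N (\<lambda>a. r' (j a)) (\<lambda>s. l' (j s))"
  by (simp add: retract_of_power_def bihom_swap_image)

context tensor_tower
begin

lemma acts_lact: "acts_on L (lact (T (Suc m))) (T (Suc m))"
  unfolding acts_on_def using linear_closed[OF lact_linear] linear_add[OF lact_linear] by blast

lemma acts_ract: "acts_on N (\<lambda>c x. ract (T (Suc m)) x c) (T (Suc m))"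
  unfolding acts_on_def using linear_closed[OF ract_linear] linear_add[OF ract_linear] by blast

text \<open>With several factors the two actions touch different factors; only for a single factor
  does the associativity hypothesis enter.\<close>

lemma lact_ract:
  assumes c: "c \<in> L" and c': "c' \<in> N" and t: "t \<in> carrier (T (Suc m))"
    and assoc: "\<And>x. x \<in> carrier C \<Longrightarrow> c \<otimes>\<^bsub>C\<^esub> (x \<otimes>\<^bsub>C\<^esub> c') = (c \<otimes>\<^bsub>C\<^esub> x) \<otimes>\<^bsub>C\<^esub> c'"
  shows "lact (T (Suc m)) c (ract (T (Suc m)) t c') = ract (T (Suc m)) (lact (T (Suc m)) c t) c'"
proof (cases m)
  case 0
  show ?thesis
    by (rule gen1_linear_eq[OF T_vs linear_comp[OF ract_linear[OF c'] lact_linear[OF c]]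
          linear_comp[OF lact_linear[OF c] ract_linear[OF c']] _ t[unfolded 0], folded 0])
      (simp only: 0 lact_gen1 ract_gen1 c c' C_closed L_closed N_closed assoc)
next
  case (Suc k)
  show ?thesis
    unfolding Suc
  proof (rule cons_linear_eq[OF T_vs linear_comp[OF ract_linear[OF c'] lact_linear[OF c]]
          linear_comp[OF lact_linear[OF c] ract_linear[OF c']] _ t[unfolded Suc]])
    fix x t assume x: "x \<in> carrier C" and t: "t \<in> carrier (T (Suc k))"
    show "lact (T (Suc (Suc k))) c (ract (T (Suc (Suc k))) (cons (Suc k) x t) c') =
        ract (T (Suc (Suc k))) (lact (T (Suc (Suc k))) c (cons (Suc k) x t)) c'"
      using x t c c' L_closed[OF c] ract_closed[OF c' t] by (simp only: ract_cons lact_cons C_closed)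
  qed
qed

end

section \<open>Freeness of the tensor powers of a smash product over its base\<close>

context free_smash
begin

lemma \<zeta>_inj:
  assumes x: "x \<in> carrier C" and y: "y \<in> carrier C" and eq: "\<And>i. i < r \<Longrightarrow> \<zeta> i x = \<zeta> i y"
  shows "x = y"
proof -
  interpret C: Module.module K C by (rule C_vs)
  have "x = (\<Oplus>\<^bsub>C\<^esub>i\<in>{..<r}. d i \<otimes>\<^bsub>C\<^esub> j (\<zeta> i x))" by (rule \<zeta>_expand[OF x])
  also have "\<dots> = (\<Oplus>\<^bsub>C\<^esub>i\<in>{..<r}. d i \<otimes>\<^bsub>C\<^esub> j (\<zeta> i y))"
    using y by (intro C.M.finsum_cong' refl funcsetI bilinear_closed[OF C_mult] d_closed j_closed \<zeta>_S) (auto simp: eq)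
  also have "\<dots> = y" by (rule \<zeta>_expand[OF y, symmetric])
  finally show ?thesis .
qed

lemma C_closed: "\<lbrakk>x \<in> carrier C; y \<in> carrier C\<rbrakk> \<Longrightarrow> x \<otimes>\<^bsub>C\<^esub> y \<in> carrier C"
  by (rule bilinear_closed[OF C_mult])

text \<open>In coordinates, right multiplication by \<open>j t\<close> is right multiplication by t
  in H, while left multiplication by \<open>j s\<close> combines the coordinates through left
  multiplications in H. This supplies the associativity that \<open>tensor_tower\<close> asks
  for.\<close>

lemma j_assoc:
  assumes s: "s \<in> S" and t: "t \<in> S" and x: "x \<in> carrier C"
  shows "j s \<otimes>\<^bsub>C\<^esub> (x \<otimes>\<^bsub>C\<^esub> j t) = (j s \<otimes>\<^bsub>C\<^esub> x) \<otimes>\<^bsub>C\<^esub> j t"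
proof (rule \<zeta>_inj)
  fix i assume i: "i < r"
  have sc: "s \<in> carrier H" "t \<in> carrier H" using s t S_closed by auto
  have \<zeta>c: "\<zeta> l x \<in> carrier H" if "l < r" for l using S_closed[OF \<zeta>_S[OF that x]] .
  let ?g = "\<lambda>k l. pq i l (b k) \<odot>\<^bsub>H\<^esub> (dd k s \<otimes>\<^bsub>H\<^esub> \<zeta> l x)"
  have "\<zeta> i (j s \<otimes>\<^bsub>C\<^esub> (x \<otimes>\<^bsub>C\<^esub> j t)) = (\<Oplus>\<^bsub>H\<^esub>k\<in>{..<n}. \<Oplus>\<^bsub>H\<^esub>l\<in>{..<r}. ?g k l \<otimes>\<^bsub>H\<^esub> t)"
    unfolding \<zeta>_left[OF i C_closed[OF x j_closed[OF t]] s]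
    using i sc \<zeta>c x t
    by (intro H.finsum_cong' refl funcsetI finsum_H_closed) (auto simp: \<zeta>_right H.m_assoc H.smult_mult_left)
  also have "\<dots> = (\<Oplus>\<^bsub>H\<^esub>k\<in>{..<n}. (\<Oplus>\<^bsub>H\<^esub>l\<in>{..<r}. ?g k l) \<otimes>\<^bsub>H\<^esub> t)"
    using i sc \<zeta>c by (intro H.finsum_cong' refl funcsetI H.finsum_ldistr[symmetric] H.m_closed finsum_H_closed) auto
  also have "\<dots> = (\<Oplus>\<^bsub>H\<^esub>k\<in>{..<n}. \<Oplus>\<^bsub>H\<^esub>l\<in>{..<r}. ?g k l) \<otimes>\<^bsub>H\<^esub> t"
    using i sc \<zeta>c by (intro H.finsum_ldistr[symmetric] funcsetI finsum_H_closed) auto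
  also have "\<dots> = \<zeta> i ((j s \<otimes>\<^bsub>C\<^esub> x) \<otimes>\<^bsub>C\<^esub> j t)"
    using i x s t by (simp add: \<zeta>_right \<zeta>_left C_closed j_closed)
  finally show "\<zeta> i (j s \<otimes>\<^bsub>C\<^esub> (x \<otimes>\<^bsub>C\<^esub> j t)) = \<zeta> i ((j s \<otimes>\<^bsub>C\<^esub> x) \<otimes>\<^bsub>C\<^esub> j t)" .
qed (use s t x in \<open>auto intro!: C_closed j_closed\<close>)

lemma pq_mult:
  assumes "i < r" "l < r" "x \<in> carrier H" "y \<in> carrier H"
  shows "pq i l (x \<otimes>\<^bsub>H\<^esub> y) = (\<Oplus>m\<in>{..<r}. pq i m x \<otimes> pq m l y)"
  using \<psi>_mult[of l "q i \<otimes>\<^bsub>H\<^esub> x" y] assms by (simp add: pq_def H.m_assoc)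

lemma \<zeta>_bilinear:
  assumes i: "i < r" and x: "x \<in> carrier C"
  shows "bilinear H H H (\<lambda>u v. \<Oplus>\<^bsub>H\<^esub>l\<in>{..<r}. pq i l u \<odot>\<^bsub>H\<^esub> (v \<otimes>\<^bsub>H\<^esub> \<zeta> l x))"
proof (intro bilinear_sum H_vs)
  fix l assume l: "l \<in> {..<r}"
  then have "\<zeta> l x \<in> carrier H" using S_closed[OF \<zeta>_S[OF _ x]] by simp
  then show "bilinear H H H (\<lambda>u v. pq i l u \<odot>\<^bsub>H\<^esub> (v \<otimes>\<^bsub>H\<^esub> \<zeta> l x))"
    using i l form_add[OF pq_linear] form_smult[OF pq_linear]
    by (intro bilinearI')
      (auto simp: H.l_distr H.smult_mult_left H.smult_l_distr H.smult_r_distr H.smult_assoc1[symmetric] m_comm)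
qed

lemma j_one_left:
  assumes x: "x \<in> carrier C"
  shows "j \<one>\<^bsub>H\<^esub> \<otimes>\<^bsub>C\<^esub> x = x"
proof (rule \<zeta>_inj)
  fix i assume i: "i < r"
  have \<zeta>c: "\<zeta> l x \<in> carrier H" if "l < r" for l using S_closed[OF \<zeta>_S[OF that x]] .
  note bil = \<zeta>_bilinear[OF i x]
  have "\<zeta> i (j \<one>\<^bsub>H\<^esub> \<otimes>\<^bsub>C\<^esub> x) = (\<Oplus>\<^bsub>H\<^esub>l\<in>{..<r}. pq i l \<one>\<^bsub>H\<^esub> \<odot>\<^bsub>H\<^esub> (\<one>\<^bsub>H\<^esub> \<otimes>\<^bsub>H\<^esub> \<zeta> l x))"
    unfolding \<zeta>_left[OF i x S_one] by (rule sweedler_one[OF H_vs bil])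
  also have "\<dots> = (\<Oplus>\<^bsub>H\<^esub>l\<in>{..<r}. if i = l then \<zeta> l x else \<zero>\<^bsub>H\<^esub>)"
    using i \<zeta>c by (intro H.finsum_cong') (auto simp: pq_def \<psi>_q)
  also have "\<dots> = \<zeta> i x" using i \<zeta>c by (intro H.M.finsum_singleton) auto
  finally show "\<zeta> i (j \<one>\<^bsub>H\<^esub> \<otimes>\<^bsub>C\<^esub> x) = \<zeta> i x" .
qed (use x in \<open>auto intro!: C_closed j_closed S_one\<close>)

text \<open>In coordinates this is multiplicativity of \<Delta> (\<open>sweedler_mult\<close>)
  together with multiplicativity of the matrix p (\<open>pq_mult\<close>).\<close>

lemma j_left_assoc:
  assumes s: "s \<in> S" and t: "t \<in> S" and x: "x \<in> carrier C"
  shows "j s \<otimes>\<^bsub>C\<^esub> (j t \<otimes>\<^bsub>C\<^esub> x) = j (s \<otimes>\<^bsub>H\<^esub> t) \<otimes>\<^bsub>C\<^esub> x"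
proof (rule \<zeta>_inj)
  fix i assume i: "i < r"
  have sc: "s \<in> carrier H" and tc: "t \<in> carrier H" using s t S_closed by auto
  have \<zeta>c: "\<zeta> l x \<in> carrier H" if "l < r" for l using S_closed[OF \<zeta>_S[OF that x]] .
  let ?f = "\<lambda>u v. \<Oplus>\<^bsub>H\<^esub>l\<in>{..<r}. pq i l u \<odot>\<^bsub>H\<^esub> (v \<otimes>\<^bsub>H\<^esub> \<zeta> l x)"
  note bil = \<zeta>_bilinear[OF i x]
  let ?g = "\<lambda>k c m l. (pq i m (b k) \<otimes> pq m l (b c)) \<odot>\<^bsub>H\<^esub> (dd k s \<otimes>\<^bsub>H\<^esub> dd c t \<otimes>\<^bsub>H\<^esub> \<zeta> l x)"
  have gc: "?g k c m l \<in> carrier H" if "k < n" "c < n" "m < r" "l < r" for k c m l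
    using that i sc tc \<zeta>c by auto
  have hc: "pq i m (b k) \<odot>\<^bsub>H\<^esub> (dd k s \<otimes>\<^bsub>H\<^esub> \<zeta> m (j t \<otimes>\<^bsub>C\<^esub> x)) \<in> carrier H" if "k < n" "m < r" for k m
    using that i sc x t by (auto intro!: S_closed[OF \<zeta>_S] C_closed j_closed)
  have "\<zeta> i (j (s \<otimes>\<^bsub>H\<^esub> t) \<otimes>\<^bsub>C\<^esub> x) = (\<Oplus>\<^bsub>H\<^esub>k\<in>{..<n}. ?f (b k) (dd k (s \<otimes>\<^bsub>H\<^esub> t)))"
    by (rule \<zeta>_left[OF i x S_mult[OF s t]])
  also have "\<dots> = (\<Oplus>\<^bsub>H\<^esub>k\<in>{..<n}. \<Oplus>\<^bsub>H\<^esub>c\<in>{..<n}. ?f (b k \<otimes>\<^bsub>H\<^esub> b c) (dd k s \<otimes>\<^bsub>H\<^esub> dd c t))"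
    by (rule sweedler_mult[OF H_vs bil sc tc])
  also have "\<dots> = (\<Oplus>\<^bsub>H\<^esub>k\<in>{..<n}. \<Oplus>\<^bsub>H\<^esub>c\<in>{..<n}. \<Oplus>\<^bsub>H\<^esub>l\<in>{..<r}. \<Oplus>\<^bsub>H\<^esub>m\<in>{..<r}. ?g k c m l)"
  proof (intro H.finsum_cong' refl funcsetI finsum_H_closed)
    fix k c l assume k: "k \<in> {..<n}" and c: "c \<in> {..<n}" and l: "l \<in> {..<r}"
    show "pq i l (b k \<otimes>\<^bsub>H\<^esub> b c) \<odot>\<^bsub>H\<^esub> (dd k s \<otimes>\<^bsub>H\<^esub> dd c t \<otimes>\<^bsub>H\<^esub> \<zeta> l x) = (\<Oplus>\<^bsub>H\<^esub>m\<in>{..<r}. ?g k c m l)"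
      using k c l i sc tc \<zeta>c
      by (simp add: pq_mult, intro additive_finsum[OF abelian_group_axioms H.M.abelian_group_axioms, where f="\<lambda>z. z \<odot>\<^bsub>H\<^esub> (dd k s \<otimes>\<^bsub>H\<^esub> dd c t \<otimes>\<^bsub>H\<^esub> \<zeta> l x)"])
        (auto simp: H.smult_l_distr)
  qed (use gc in auto)
  also have "\<dots> = (\<Oplus>\<^bsub>H\<^esub>k\<in>{..<n}. \<Oplus>\<^bsub>H\<^esub>c\<in>{..<n}. \<Oplus>\<^bsub>H\<^esub>m\<in>{..<r}. \<Oplus>\<^bsub>H\<^esub>l\<in>{..<r}. ?g k c m l)"
    using gc by (intro H.finsum_cong' refl funcsetI finsum_H_closed H.finsum_swap) auto
  also have "\<dots> = (\<Oplus>\<^bsub>H\<^esub>k\<in>{..<n}. \<Oplus>\<^bsub>H\<^esub>m\<in>{..<r}. \<Oplus>\<^bsub>H\<^esub>c\<in>{..<n}. \<Oplus>\<^bsub>H\<^esub>l\<in>{..<r}. ?g k c m l)"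
    using gc by (intro H.finsum_cong' refl funcsetI finsum_H_closed H.finsum_swap) auto
  also have "\<dots> = (\<Oplus>\<^bsub>H\<^esub>k\<in>{..<n}. \<Oplus>\<^bsub>H\<^esub>m\<in>{..<r}. pq i m (b k) \<odot>\<^bsub>H\<^esub> (dd k s \<otimes>\<^bsub>H\<^esub> \<zeta> m (j t \<otimes>\<^bsub>C\<^esub> x)))"
  proof (intro H.finsum_cong' refl funcsetI finsum_H_closed)
    fix k m assume k: "k \<in> {..<n}" and m: "m \<in> {..<r}"
    let ?L = "\<lambda>z. pq i m (b k) \<odot>\<^bsub>H\<^esub> (dd k s \<otimes>\<^bsub>H\<^esub> z)"
    have L: "?L \<in> linear_maps K H H"
      using k m i sc by (intro linear_scale H_vs bilinear_right[OF mult_bilinear]) auto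
    have mc: "pq m l (b c) \<odot>\<^bsub>H\<^esub> (dd c t \<otimes>\<^bsub>H\<^esub> \<zeta> l x) \<in> carrier H" if "c \<in> {..<n}" "l \<in> {..<r}" for c l
      using that m tc \<zeta>c by auto
    have "?L (\<zeta> m (j t \<otimes>\<^bsub>C\<^esub> x)) = ?L (\<Oplus>\<^bsub>H\<^esub>c\<in>{..<n}. \<Oplus>\<^bsub>H\<^esub>l\<in>{..<r}. pq m l (b c) \<odot>\<^bsub>H\<^esub> (dd c t \<otimes>\<^bsub>H\<^esub> \<zeta> l x))"
      using m by (simp add: \<zeta>_left x t)
    also have "\<dots> = (\<Oplus>\<^bsub>H\<^esub>c\<in>{..<n}. ?L (\<Oplus>\<^bsub>H\<^esub>l\<in>{..<r}. pq m l (b c) \<odot>\<^bsub>H\<^esub> (dd c t \<otimes>\<^bsub>H\<^esub> \<zeta> l x)))"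
      using mc by (intro linear_finsum[OF H_vs H_vs L] finsum_H_closed) auto
    also have "\<dots> = (\<Oplus>\<^bsub>H\<^esub>c\<in>{..<n}. \<Oplus>\<^bsub>H\<^esub>l\<in>{..<r}. ?g k c m l)"
    proof (intro H.finsum_cong' refl funcsetI finsum_H_closed)
      fix c assume c: "c \<in> {..<n}"
      have "?L (\<Oplus>\<^bsub>H\<^esub>l\<in>{..<r}. pq m l (b c) \<odot>\<^bsub>H\<^esub> (dd c t \<otimes>\<^bsub>H\<^esub> \<zeta> l x)) =
          (\<Oplus>\<^bsub>H\<^esub>l\<in>{..<r}. ?L (pq m l (b c) \<odot>\<^bsub>H\<^esub> (dd c t \<otimes>\<^bsub>H\<^esub> \<zeta> l x)))"
        by (rule linear_finsum[OF H_vs H_vs L mc[OF c]])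
      also have "\<dots> = (\<Oplus>\<^bsub>H\<^esub>l\<in>{..<r}. ?g k c m l)"
        using k m i c sc tc \<zeta>c by (intro H.finsum_cong') (auto simp: H.smult_mult_right H.smult_assoc1 H.m_assoc)
      finally show "?L (\<Oplus>\<^bsub>H\<^esub>l\<in>{..<r}. pq m l (b c) \<odot>\<^bsub>H\<^esub> (dd c t \<otimes>\<^bsub>H\<^esub> \<zeta> l x)) = (\<Oplus>\<^bsub>H\<^esub>l\<in>{..<r}. ?g k c m l)" .
    qed (use gc k m in auto)
    finally show "(\<Oplus>\<^bsub>H\<^esub>c\<in>{..<n}. \<Oplus>\<^bsub>H\<^esub>l\<in>{..<r}. ?g k c m l) = ?L (\<zeta> m (j t \<otimes>\<^bsub>C\<^esub> x))" by simp
  qed (use hc in auto)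
  also have "\<dots> = \<zeta> i (j s \<otimes>\<^bsub>C\<^esub> (j t \<otimes>\<^bsub>C\<^esub> x))"
    by (rule \<zeta>_left[OF i C_closed[OF j_closed[OF t] x] s, symmetric])
  finally show "\<zeta> i (j s \<otimes>\<^bsub>C\<^esub> (j t \<otimes>\<^bsub>C\<^esub> x)) = \<zeta> i (j (s \<otimes>\<^bsub>H\<^esub> t) \<otimes>\<^bsub>C\<^esub> x)" by simp
qed (use s t x in \<open>auto intro!: C_closed j_closed S_mult\<close>)

sublocale CT: tensor_tower K C "j ` S" "j ` S" "j ` S"
proof (intro tensor_tower.intro tensor_tower_axioms.intro base_field_axioms C_vs C_mult order_refl image_subsetI j_closed)
  fix c x b assume "c \<in> j ` S" "x \<in> carrier C" "b \<in> j ` S"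
  then obtain s t where "s \<in> S" "t \<in> S" "c = j s" "b = j t" by blast
  then show "c \<otimes>\<^bsub>C\<^esub> (x \<otimes>\<^bsub>C\<^esub> b) = c \<otimes>\<^bsub>C\<^esub> x \<otimes>\<^bsub>C\<^esub> b" "b \<otimes>\<^bsub>C\<^esub> (x \<otimes>\<^bsub>C\<^esub> c) = b \<otimes>\<^bsub>C\<^esub> x \<otimes>\<^bsub>C\<^esub> c"
    using j_assoc \<open>x \<in> carrier C\<close> by simp_all
qed

declare CT.T_simps [simp del]

abbreviation U where "U m \<equiv> CT.T (Suc m)"
abbreviation lamU where "lamU m a y \<equiv> ract (U m) y (j a)"
abbreviation rhoU where "rhoU m s y \<equiv> lact (U m) (j s) y"

lemma \<zeta>_linear_S: "i < r \<Longrightarrow> \<zeta> i \<in> linear_maps K C opS"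
  using \<zeta>_linear[of i] \<zeta>_S[of i] by (auto simp: linear_maps_def)

text \<open>The rank one case indexed by the empty word. It covers both \<open>S\<close> as the
  starting point of \<open>free_over_step\<close> and the zeroth tensor power that occurs in depth
  1.\<close>

lemma base_free:
  assumes M: "abelian_group M" and \<theta>: "\<And>x. x \<in> carrier M \<Longrightarrow> \<theta> x \<in> S"
    and add: "\<And>x y. \<lbrakk>x \<in> carrier M; y \<in> carrier M\<rbrakk> \<Longrightarrow> \<theta> (x \<oplus>\<^bsub>M\<^esub> y) = \<theta> x \<oplus>\<^bsub>H\<^esub> \<theta> y"
    and surj: "\<And>s. s \<in> S \<Longrightarrow> \<exists>x\<in>carrier M. \<theta> x = s"
    and inj: "\<And>x y. \<lbrakk>x \<in> carrier M; y \<in> carrier M; \<theta> x = \<theta> y\<rbrakk> \<Longrightarrow> x = y"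
    and lam: "\<And>a x. \<lbrakk>a \<in> S; x \<in> carrier M\<rbrakk> \<Longrightarrow> lam a x \<in> carrier M"
      "\<And>a x. \<lbrakk>a \<in> S; x \<in> carrier M\<rbrakk> \<Longrightarrow> \<theta> (lam a x) = \<theta> x \<otimes>\<^bsub>H\<^esub> a"
    and rho: "\<And>s x. \<lbrakk>s \<in> S; x \<in> carrier M\<rbrakk> \<Longrightarrow> rho s x \<in> carrier M"
      "\<And>s x. \<lbrakk>s \<in> S; x \<in> carrier M\<rbrakk> \<Longrightarrow> \<theta> (rho s x) = s \<otimes>\<^bsub>H\<^esub> \<theta> x"
  shows "free_over opS S M lam rho (words 0) (\<lambda>_. \<theta>) PR"
  unfolding free_over_def words_0 opS_simps
proof (intro conjI ballI impI)
  fix f assume "f \<in> {[]} \<rightarrow> S"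
  then have "f [] \<in> S" by auto
  then show "\<exists>x\<in>carrier M. \<forall>w\<in>{[]}. \<theta> x = f w" using surj by auto
next
  fix x y assume x: "x \<in> carrier M" and y: "y \<in> carrier M" and "\<forall>w\<in>{[]::nat list}. \<theta> x = \<theta> y"
  then show "x = y" using inj by simp
next
  fix s x w assume s: "s \<in> S" and x: "x \<in> carrier M" and w: "w \<in> {[]::nat list}"
  interpret op: Module.module K opS by (rule opS_vs)
  have "PR [] [] s \<otimes>\<^bsub>H\<^esub> \<theta> x \<in> carrier opS" using s x \<theta> by (simp add: PR_Nil S_closed S_mult)
  then show "\<theta> (rho s x) = (\<Oplus>\<^bsub>opS\<^esub>i\<in>{[]}. PR i w s \<otimes>\<^bsub>H\<^esub> \<theta> x)"
    using s x w by (simp add: rho PR_Nil S_closed)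
qed (use assms S_closed in \<open>auto simp: PR_Nil\<close>)

lemma opS_free: "free_over opS S opS (\<lambda>a x. x \<otimes>\<^bsub>H\<^esub> a) (\<lambda>s x. s \<otimes>\<^bsub>H\<^esub> x) (words 0) (\<lambda>_ x. x) PR"
  by (rule base_free) (auto simp: opS_group S_mult)

lemma base_bimodule_free:
  obtains \<theta> where "free_over opS S (base_bimodule (j ` S) C) (\<lambda>a y. y \<otimes>\<^bsub>C\<^esub> j a) (\<lambda>s y. j s \<otimes>\<^bsub>C\<^esub> y) (words 0) \<theta> PR"
proof -
  let ?M = "base_bimodule (j ` S) C"
  define \<theta> where "\<theta> = inv_into S j"
  have inj: "inj_on j S" using j_inj by (auto simp: inj_on_def)
  have \<theta>j: "\<theta> (j s) = s" if "s \<in> S" for s unfolding \<theta>_def by (rule inv_into_f_f[OF inj that])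
  have M: "abelian_group ?M"
  proof (rule abelian_groupI)
    show "\<zero>\<^bsub>?M\<^esub> \<in> carrier ?M"
    proof -
      have "j (\<zero> \<odot>\<^bsub>H\<^esub> \<zero>\<^bsub>H\<^esub>) = \<zero> \<odot>\<^bsub>C\<^esub> j \<zero>\<^bsub>H\<^esub>" by (rule j_smult) (auto simp: S_zero)
      then have "j \<zero>\<^bsub>H\<^esub> = \<zero>\<^bsub>C\<^esub>" using j_closed[OF S_zero] by simp
      then show ?thesis using imageI[OF S_zero, of j] by (simp add: base_bimodule_def)
    qed
    fix x assume "x \<in> carrier ?M"
    then obtain s where s: "s \<in> S" "x = j s" by (auto simp: base_bimodule_def)
    have "j ((\<ominus> \<one>) \<odot>\<^bsub>H\<^esub> s) = (\<ominus> \<one>) \<odot>\<^bsub>C\<^esub> j s" using s by (intro j_smult) auto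
    then have "j ((\<ominus> \<one>) \<odot>\<^bsub>H\<^esub> s) \<oplus>\<^bsub>?M\<^esub> x = \<zero>\<^bsub>?M\<^esub>"
      using s j_closed[OF s(1)] by (simp add: base_bimodule_def CT.C.smult_l_minus CT.C.M.l_neg)
    moreover have "j ((\<ominus> \<one>) \<odot>\<^bsub>H\<^esub> s) \<in> carrier ?M"
      unfolding base_bimodule_def using s by (simp, intro imageI S_subE(4)) auto
    ultimately show "\<exists>y\<in>carrier ?M. y \<oplus>\<^bsub>?M\<^esub> x = \<zero>\<^bsub>?M\<^esub>" by blast
  qed (auto simp: base_bimodule_def j_add[symmetric] S_subE(5) S_closed H.M.a_ac j_closed CT.C.M.a_ac CT.C.M.l_zero)
  have "free_over opS S ?M (\<lambda>a y. y \<otimes>\<^bsub>C\<^esub> j a) (\<lambda>s y. j s \<otimes>\<^bsub>C\<^esub> y) (words 0) (\<lambda>_. \<theta>) PR"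
    by (rule base_free[OF M])
      (auto simp: base_bimodule_def \<theta>j j_add[symmetric] j_mult[symmetric] S_subE(5) S_mult intro!: bexI[of _ "j _"])
  then show thesis using that by blast
qed

lemma finsum_H_opS2:
  assumes "finite A" "finite B" "\<And>k l. \<lbrakk>k \<in> A; l \<in> B\<rbrakk> \<Longrightarrow> f k l \<in> S"
  shows "(\<Oplus>\<^bsub>H\<^esub>k\<in>A. \<Oplus>\<^bsub>H\<^esub>l\<in>B. f k l) = (\<Oplus>\<^bsub>opS\<^esub>k\<in>A. \<Oplus>\<^bsub>opS\<^esub>l\<in>B. f k l)"
proof -
  interpret op: Module.module K opS by (rule opS_vs)
  have "(\<Oplus>\<^bsub>opS\<^esub>k\<in>A. \<Oplus>\<^bsub>opS\<^esub>l\<in>B. f k l) = (\<Oplus>\<^bsub>opS\<^esub>k\<in>A. \<Oplus>\<^bsub>H\<^esub>l\<in>B. f k l)"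
    using assms by (intro op.M.finsum_cong' refl finsum_opS funcsetI) (auto intro: finsum_S)
  also have "\<dots> = (\<Oplus>\<^bsub>H\<^esub>k\<in>A. \<Oplus>\<^bsub>H\<^esub>l\<in>B. f k l)"
    using assms by (intro finsum_opS finsum_S) auto
  finally show ?thesis by simp
qed

lemma \<zeta>_left_opS:
  assumes i: "i < r" and x: "x \<in> carrier C" and s: "s \<in> S"
  shows "\<zeta> i (j s \<otimes>\<^bsub>C\<^esub> x) = (\<Oplus>\<^bsub>opS\<^esub>k\<in>{..<n}. \<Oplus>\<^bsub>opS\<^esub>l\<in>{..<r}. pq i l (b k) \<odot>\<^bsub>opS\<^esub> (dd k s \<otimes>\<^bsub>H\<^esub> \<zeta> l x))"
  unfolding \<zeta>_left[OF assms] opS_simps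
  using assms by (intro finsum_H_opS2) (auto intro!: S_subE(4) S_mult dd_S \<zeta>_S)

lemma d_sum_closed:
  assumes "\<And>i. i < r \<Longrightarrow> f i \<in> S"
  shows "(\<Oplus>\<^bsub>C\<^esub>i\<in>{..<r}. d i \<otimes>\<^bsub>C\<^esub> j (f i)) \<in> carrier C"
  using assms by (intro CT.C.M.finsum_closed funcsetI C_closed d_closed j_closed) auto

lemma \<zeta>_d_sum:
  assumes f: "\<And>i. i < r \<Longrightarrow> f i \<in> S" and l: "l < r"
  shows "\<zeta> l (\<Oplus>\<^bsub>C\<^esub>i\<in>{..<r}. d i \<otimes>\<^bsub>C\<^esub> j (f i)) = f l"
proof -
  have "\<zeta> l (\<Oplus>\<^bsub>C\<^esub>i\<in>{..<r}. d i \<otimes>\<^bsub>C\<^esub> j (f i)) = (\<Oplus>\<^bsub>H\<^esub>i\<in>{..<r}. \<zeta> l (d i \<otimes>\<^bsub>C\<^esub> j (f i)))"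
    using f by (intro linear_finsum[OF C_vs H_vs \<zeta>_linear[OF l]] C_closed d_closed j_closed) auto
  also have "\<dots> = (\<Oplus>\<^bsub>H\<^esub>i\<in>{..<r}. if l = i then f i else \<zero>\<^bsub>H\<^esub>)"
    using l f S_closed[OF f] by (intro H.finsum_cong') (auto simp: \<zeta>_right d_closed \<zeta>_d)
  also have "\<dots> = f l" using l S_closed[OF f] by (intro H.M.finsum_singleton) auto
  finally show ?thesis .
qed

text \<open>One copy of the smash product already contributes one letter, so \<open>U m\<close>,
  with m+1 factors, is indexed by words of length m+1. This differs by one from the powers of H over
  R.\<close>

lemma right_powers_free_0:
  "\<exists>\<theta>. (\<forall>w\<in>words (Suc 0). \<theta> w \<in> linear_maps K (U 0) H) \<and>
    free_over opS S (U 0) (lamU 0) (rhoU 0) (words (Suc 0)) \<theta> PR"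
proof -
  obtain g where g: "g \<in> linear_maps K (U 0) C" "\<And>x. x \<in> carrier C \<Longrightarrow> g (CT.gen1 x) = x"
    using CT.gen1_lift[OF C_vs linear_id] by blast
  note gl = CT.gen1_linear and gc = linear_closed[OF CT.gen1_linear] and g_closed = linear_closed[OF g(1)]
  have inv: "CT.gen1 (g t) = t" if "t \<in> carrier (U 0)" for t
    by (rule CT.gen1_linear_eq[OF CT.T_vs linear_comp[OF g(1) gl] linear_id _ that]) (simp add: g)
  have lam: "g (lamU 0 a t) = g t \<otimes>\<^bsub>C\<^esub> j a" if "a \<in> S" "t \<in> carrier (U 0)" for a t
  proof -
    have "lamU 0 a (CT.gen1 (g t)) = CT.gen1 (g t \<otimes>\<^bsub>C\<^esub> j a)" using that g_closed by (intro CT.ract_gen1) auto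
    then show ?thesis using that by (simp add: inv g C_closed g_closed j_closed)
  qed
  have rho: "g (rhoU 0 s t) = j s \<otimes>\<^bsub>C\<^esub> g t" if "s \<in> S" "t \<in> carrier (U 0)" for s t
  proof -
    have "rhoU 0 s (CT.gen1 (g t)) = CT.gen1 (j s \<otimes>\<^bsub>C\<^esub> g t)" using that g_closed by (intro CT.lact_gen1) auto
    then show ?thesis using that by (simp add: inv g C_closed g_closed j_closed)
  qed
  have "free_over opS S (U 0) (lamU 0) (rhoU 0) (words (Suc 0)) (\<lambda>v y. \<zeta> (hd v) (g y)) PR"
  proof (rule free_over_step[OF opS_free opS_vs CT.T_vs])
    show "(\<lambda>x. x) \<in> linear_maps K opS H" by (rule linear_mapsI) (auto simp: S_closed)
    show "(\<lambda>y. \<zeta> i (g y)) \<in> linear_maps K (U 0) opS" if "i < r" for i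
      by (rule linear_comp[OF g(1) \<zeta>_linear_S[OF that]])
    show "lamU 0 a y \<in> carrier (U 0)" if "a \<in> S" "y \<in> carrier (U 0)" for a y
      using that by (intro CT.ract_closed) auto
    then show "lamU 0 a y \<in> carrier (U 0) \<and> \<zeta> i (g (lamU 0 a y)) = \<zeta> i (g y) \<otimes>\<^bsub>H\<^esub> a"
      if "i < r" "a \<in> S" "y \<in> carrier (U 0)" for i a y
      using that by (simp add: lam \<zeta>_right g_closed)
    show "rhoU 0 a y \<in> carrier (U 0)" if "a \<in> S" "y \<in> carrier (U 0)" for a y
      using that by (intro CT.lact_closed) auto
    show "\<zeta> i (g (rhoU 0 s y)) =
        (\<Oplus>\<^bsub>opS\<^esub>k\<in>{..<n}. \<Oplus>\<^bsub>opS\<^esub>l\<in>{..<r}. pq i l (b k) \<odot>\<^bsub>opS\<^esub> (dd k s \<otimes>\<^bsub>H\<^esub> \<zeta> l (g y)))"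
      if "i < r" "s \<in> S" "y \<in> carrier (U 0)" for i s y
      unfolding rho[OF that(2,3)] using that by (intro \<zeta>_left_opS g_closed)
    show "y = y'" if "y \<in> carrier (U 0)" "y' \<in> carrier (U 0)" "\<And>i. i < r \<Longrightarrow> \<zeta> i (g y) = \<zeta> i (g y')" for y y'
    proof -
      have "g y = g y'" using that by (intro \<zeta>_inj g_closed)
      then have "CT.gen1 (g y) = CT.gen1 (g y')" by simp
      then show ?thesis by (simp only: inv that(1,2))
    qed
    show "\<exists>y\<in>carrier (U 0). \<forall>i<r. \<zeta> i (g y) = f i" if f: "\<And>i. i < r \<Longrightarrow> f i \<in> carrier opS" for f
    proof -
      have f: "f i \<in> S" if "i < r" for i using f[OF that] by simp
      show ?thesis
        by (intro bexI[of _ "CT.gen1 (\<Oplus>\<^bsub>C\<^esub>i\<in>{..<r}. d i \<otimes>\<^bsub>C\<^esub> j (f i))"] gc d_sum_closed f)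
          (auto simp: g d_sum_closed f \<zeta>_d_sum)
    qed
  qed
  moreover have "(\<lambda>y. \<zeta> (hd v) (g y)) \<in> linear_maps K (U 0) H" if "v \<in> words (Suc 0)" for v
    using that by (elim words_SucE) (simp add: linear_comp[OF g(1) \<zeta>_linear])
  ultimately show ?thesis by (intro exI[of _ "\<lambda>v y. \<zeta> (hd v) (g y)"] conjI ballI)
qed

lemma lact_j_linear:
  assumes t: "t \<in> carrier (U m)"
  shows "(\<lambda>z. rhoU m z t) \<in> linear_maps K opS (U m)"
proof (rule linear_mapsI, unfold opS_simps)
  fix s s' c assume s: "s \<in> S" and s': "s' \<in> S"
  show "rhoU m s t \<in> carrier (U m)" using s t by (intro CT.lact_closed) auto
  have js: "j s \<oplus>\<^bsub>C\<^esub> j s' \<in> j ` S" using s s' S_subE(5) by (simp flip: j_add)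
  show "rhoU m (s \<oplus>\<^bsub>H\<^esub> s') t = rhoU m s t \<oplus>\<^bsub>U m\<^esub> rhoU m s' t"
    unfolding j_add[OF s s'] using s s' t js by (intro CT.lact_add_left) auto
  assume c: "c \<in> carrier K"
  have "c \<odot>\<^bsub>C\<^esub> j s \<in> j ` S" using s c S_subE(4) by (simp flip: j_smult)
  then show "rhoU m (c \<odot>\<^bsub>H\<^esub> s) t = c \<odot>\<^bsub>U m\<^esub> rhoU m s t"
    unfolding j_smult[OF c s] using s c t by (intro CT.lact_smult_left) auto
qed

text \<open>The components are \<tau>_i(x \<otimes> t) = \<zeta>_i(x) t, balanced because \<zeta>_i
  is right linear over S. They identify the next power with r copies of the previous one, the i-th
  copy embedded by \<open>d i\<close> \<otimes> t.\<close>

lemma right_powers_free_Suc: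
  assumes \<theta>l: "\<forall>w\<in>words (Suc m). \<theta> w \<in> linear_maps K (U m) H"
    and F: "free_over opS S (U m) (lamU m) (rhoU m) (words (Suc m)) \<theta> PR"
  shows "\<exists>\<theta>. (\<forall>w\<in>words (Suc (Suc m)). \<theta> w \<in> linear_maps K (U (Suc m)) H) \<and>
    free_over opS S (U (Suc m)) (lamU (Suc m)) (rhoU (Suc m)) (words (Suc (Suc m))) \<theta> PR"
proof -
  interpret T: Module.module K "U m" by (rule CT.T_vs)
  interpret T': Module.module K "U (Suc m)" by (rule CT.T_vs)
  have jS: "j s \<in> j ` S" if "s \<in> S" for s using that by blast
  have lact_j: "rhoU m s (rhoU m s' t) = rhoU m (s \<otimes>\<^bsub>H\<^esub> s') t" if "s \<in> S" "s' \<in> S" "t \<in> carrier (U m)" for s s' t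
    using CT.lact_lact[of "j s" "j s'" t m] that S_mult by (auto simp: j_mult[symmetric] j_left_assoc)
  have rc: "rhoU m s t \<in> carrier (U m)" if "s \<in> S" "t \<in> carrier (U m)" for s t
    using that by (intro CT.lact_closed) auto
  have bil: "bilinear C (U m) (U m) (\<lambda>x t. rhoU m (\<zeta> i x) t)" if i: "i < r" for i
  proof (rule bilinearI)
    show "x \<in> carrier C \<Longrightarrow> (\<lambda>t. rhoU m (\<zeta> i x) t) \<in> linear_maps K (U m) (U m)" for x
      using i by (intro CT.lact_linear jS \<zeta>_S)
    show "t \<in> carrier (U m) \<Longrightarrow> (\<lambda>x. rhoU m (\<zeta> i x) t) \<in> linear_maps K C (U m)" for t
      by (rule linear_comp[OF \<zeta>_linear_S[OF i] lact_j_linear])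
  qed
  have bal: "rhoU m (\<zeta> i (x \<otimes>\<^bsub>C\<^esub> y)) t = rhoU m (\<zeta> i x) (lact (U m) y t)"
    if i: "i < r" and x: "x \<in> carrier C" and y: "y \<in> j ` S" and t: "t \<in> carrier (U m)" for i x y t
    using y i x t by (auto simp: \<zeta>_right lact_j \<zeta>_S)
  have "\<forall>i. \<exists>g. i < r \<longrightarrow> g \<in> linear_maps K (U (Suc m)) (U m) \<and>
      (\<forall>x\<in>carrier C. \<forall>t\<in>carrier (U m). g (CT.cons (Suc m) x t) = rhoU m (\<zeta> i x) t)"
    (is "\<forall>i. \<exists>g. ?P i g")
  proof
    fix i
    show "\<exists>g. ?P i g"
    proof (cases "i < r")
      case True
      obtain g where "g \<in> linear_maps K (U (Suc m)) (U m)"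
        "\<And>x t. \<lbrakk>x \<in> carrier C; t \<in> carrier (U m)\<rbrakk> \<Longrightarrow> g (CT.cons (Suc m) x t) = rhoU m (\<zeta> i x) t"
        using CT.cons_lift[OF CT.T_vs bil[OF True] bal[OF True]] by blast
      then show ?thesis by blast
    qed simp
  qed
  from choice[OF this] obtain \<tau> where \<tau>0: "\<forall>i. ?P i (\<tau> i)" ..
  have \<tau>: "\<tau> i \<in> linear_maps K (U (Suc m)) (U m)" if "i < r" for i using \<tau>0 that by blast
  have \<tau>cons: "\<tau> i (CT.cons (Suc m) x t) = rhoU m (\<zeta> i x) t"
    if "i < r" "x \<in> carrier C" "t \<in> carrier (U m)" for i x t using \<tau>0 that by blast
  note \<tau>c = linear_closed[OF \<tau>]
  note cc = bilinear_closed[OF CT.cons_bilinear]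
  \<comment> \<open>In x \<otimes> t expand x as the sum of \<open>d i\<close> times j(\<zeta>_i(x))
    and move the second factor across the tensor sign.\<close>
  have exp: "y = (\<Oplus>\<^bsub>U (Suc m)\<^esub>i\<in>{..<r}. CT.cons (Suc m) (d i) (\<tau> i y))" if y: "y \<in> carrier (U (Suc m))" for y
  proof (rule CT.cons_linear_eq[OF CT.T_vs linear_id _ _ y])
    show "(\<lambda>y. \<Oplus>\<^bsub>U (Suc m)\<^esub>i\<in>{..<r}. CT.cons (Suc m) (d i) (\<tau> i y)) \<in> linear_maps K (U (Suc m)) (U (Suc m))"
      by (intro linear_sum CT.T_vs linear_comp[OF \<tau> CT.cons_linear] d_closed) auto
    fix x t assume x: "x \<in> carrier C" and t: "t \<in> carrier (U m)"
    have "CT.cons (Suc m) x t = CT.cons (Suc m) (\<Oplus>\<^bsub>C\<^esub>i\<in>{..<r}. d i \<otimes>\<^bsub>C\<^esub> j (\<zeta> i x)) t"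
      using \<zeta>_expand[OF x] by simp
    also have "\<dots> = (\<Oplus>\<^bsub>U (Suc m)\<^esub>i\<in>{..<r}. CT.cons (Suc m) (d i \<otimes>\<^bsub>C\<^esub> j (\<zeta> i x)) t)"
      using x t by (intro bilinear_finsum_left[OF C_vs CT.T_vs CT.cons_bilinear] C_closed d_closed j_closed \<zeta>_S) auto
    also have "\<dots> = (\<Oplus>\<^bsub>U (Suc m)\<^esub>i\<in>{..<r}. CT.cons (Suc m) (d i) (\<tau> i (CT.cons (Suc m) x t)))"
    proof (intro T'.M.finsum_cong' refl funcsetI cc)
      fix i assume "i \<in> {..<r}"
      then show "CT.cons (Suc m) (d i \<otimes>\<^bsub>C\<^esub> j (\<zeta> i x)) t = CT.cons (Suc m) (d i) (\<tau> i (CT.cons (Suc m) x t))"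
        using x t by (simp add: \<tau>cons CT.cons_balanced d_closed \<zeta>_S)
    qed (use x t d_closed \<tau>c cc in auto)
    finally show "CT.cons (Suc m) x t = (\<Oplus>\<^bsub>U (Suc m)\<^esub>i\<in>{..<r}. CT.cons (Suc m) (d i) (\<tau> i (CT.cons (Suc m) x t)))" .
  qed
  have \<tau>_d: "\<tau> l (CT.cons (Suc m) (d i) t) = (if l = i then t else \<zero>\<^bsub>U m\<^esub>)" if "i < r" "l < r" "t \<in> carrier (U m)" for i l t
  proof -
    have "rhoU m \<one>\<^bsub>H\<^esub> t = t" using that S_one by (intro CT.lact_id) (auto simp: j_one_left)
    moreover have "rhoU m \<zero>\<^bsub>H\<^esub> t = \<zero>\<^bsub>U m\<^esub>" using linear_zero[OF opS_vs CT.T_vs lact_j_linear[OF that(3)]] by simp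
    ultimately show ?thesis using that by (simp add: \<tau>cons d_closed \<zeta>_d)
  qed
  have "free_over opS S (U (Suc m)) (lamU (Suc m)) (rhoU (Suc m)) (words (Suc (Suc m))) (\<lambda>v y. \<theta> (tl v) (\<tau> (hd v) y)) PR"
  proof (rule free_over_step[OF F CT.T_vs CT.T_vs])
    show "w \<in> words (Suc m) \<Longrightarrow> \<theta> w \<in> linear_maps K (U m) H" for w using \<theta>l by blast
    show "i < r \<Longrightarrow> \<tau> i \<in> linear_maps K (U (Suc m)) (U m)" for i by (rule \<tau>)
    show lc: "lamU (Suc m) a y \<in> carrier (U (Suc m))" if "a \<in> S" "y \<in> carrier (U (Suc m))" for a y
      using that by (intro CT.ract_closed) auto
    show "rhoU (Suc m) a y \<in> carrier (U (Suc m))" if "a \<in> S" "y \<in> carrier (U (Suc m))" for a y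
      using that by (intro CT.lact_closed) auto
    show "lamU (Suc m) a y \<in> carrier (U (Suc m)) \<and> \<tau> i (lamU (Suc m) a y) = lamU m a (\<tau> i y)"
      if i: "i < r" and a: "a \<in> S" and y: "y \<in> carrier (U (Suc m))" for i a y
    proof (rule conjI[OF lc[OF a y]])
      show "\<tau> i (lamU (Suc m) a y) = lamU m a (\<tau> i y)"
      proof (rule CT.cons_linear_eq[OF CT.T_vs linear_comp[OF CT.ract_linear[OF jS[OF a]] \<tau>[OF i]]
            linear_comp[OF \<tau>[OF i] CT.ract_linear[OF jS[OF a]]] _ y])
        fix x t assume x: "x \<in> carrier C" and t: "t \<in> carrier (U m)"
        have "\<tau> i (lamU (Suc m) a (CT.cons (Suc m) x t)) = rhoU m (\<zeta> i x) (lamU m a t)"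
          using i x t a by (simp add: CT.ract_cons \<tau>cons CT.ract_closed)
        also have "\<dots> = lamU m a (rhoU m (\<zeta> i x) t)"
          using i x t a by (intro CT.lact_ract) (auto simp: \<zeta>_S j_assoc)
        finally show "\<tau> i (lamU (Suc m) a (CT.cons (Suc m) x t)) = lamU m a (\<tau> i (CT.cons (Suc m) x t))"
          using i x t by (simp add: \<tau>cons)
      qed
    qed
    show "\<tau> i (rhoU (Suc m) s y) = (\<Oplus>\<^bsub>U m\<^esub>k\<in>{..<n}. \<Oplus>\<^bsub>U m\<^esub>l\<in>{..<r}. pq i l (b k) \<odot>\<^bsub>U m\<^esub> rhoU m (dd k s) (\<tau> l y))"
      if i: "i < r" and s: "s \<in> S" and y: "y \<in> carrier (U (Suc m))" for i s y
    proof (rule CT.cons_linear_eq[OF CT.T_vs linear_comp[OF CT.lact_linear[OF jS[OF s]] \<tau>[OF i]] _ _ y])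
      show "(\<lambda>y. \<Oplus>\<^bsub>U m\<^esub>k\<in>{..<n}. \<Oplus>\<^bsub>U m\<^esub>l\<in>{..<r}. pq i l (b k) \<odot>\<^bsub>U m\<^esub> rhoU m (dd k s) (\<tau> l y))
          \<in> linear_maps K (U (Suc m)) (U m)"
        using i s by (intro linear_sum CT.T_vs linear_scale linear_comp[OF \<tau> CT.lact_linear] jS dd_S) auto
      fix x t assume x: "x \<in> carrier C" and t: "t \<in> carrier (U m)"
      interpret op: Module.module K opS by (rule opS_vs)
      note rl = lact_j_linear[OF t]
      let ?g = "\<lambda>k l. pq i l (b k) \<odot>\<^bsub>opS\<^esub> (dd k s \<otimes>\<^bsub>H\<^esub> \<zeta> l x)"
      have gc: "?g k l \<in> carrier opS" if "k < n" "l < r" for k l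
        using that i s x by (auto intro!: S_subE(4) S_mult dd_S \<zeta>_S)
      have pc: "pq i l (b k) \<odot>\<^bsub>U m\<^esub> rhoU m (dd k s) (\<tau> l (CT.cons (Suc m) x t)) \<in> carrier (U m)" if "k < n" "l < r" for k l
        using that i s x t by (intro T.smult_closed rc \<tau>c cc dd_S) auto
      have "\<tau> i (rhoU (Suc m) s (CT.cons (Suc m) x t)) = rhoU m (\<zeta> i (j s \<otimes>\<^bsub>C\<^esub> x)) t"
        using i s x t by (simp add: CT.lact_cons \<tau>cons C_closed j_closed)
      also have "\<dots> = rhoU m (\<Oplus>\<^bsub>opS\<^esub>k\<in>{..<n}. \<Oplus>\<^bsub>opS\<^esub>l\<in>{..<r}. ?g k l) t"
        by (simp only: \<zeta>_left_opS[OF i x s])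
      also have "\<dots> = (\<Oplus>\<^bsub>U m\<^esub>k\<in>{..<n}. rhoU m (\<Oplus>\<^bsub>opS\<^esub>l\<in>{..<r}. ?g k l) t)"
        using gc by (intro linear_finsum[OF opS_vs CT.T_vs rl] op.M.finsum_closed funcsetI) auto
      also have "\<dots> = (\<Oplus>\<^bsub>U m\<^esub>k\<in>{..<n}. \<Oplus>\<^bsub>U m\<^esub>l\<in>{..<r}. rhoU m (?g k l) t)"
        using gc linear_closed[OF rl]
        by (intro T.M.finsum_cong' refl funcsetI linear_finsum[OF opS_vs CT.T_vs rl] T.M.finsum_closed) auto
      also have "\<dots> = (\<Oplus>\<^bsub>U m\<^esub>k\<in>{..<n}. \<Oplus>\<^bsub>U m\<^esub>l\<in>{..<r}. pq i l (b k) \<odot>\<^bsub>U m\<^esub> rhoU m (dd k s) (\<tau> l (CT.cons (Suc m) x t)))"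
      proof (intro T.M.finsum_cong' refl funcsetI T.M.finsum_closed)
        fix k l assume k: "k \<in> {..<n}" and l: "l \<in> {..<r}"
        have "rhoU m (?g k l) t = pq i l (b k) \<odot>\<^bsub>U m\<^esub> rhoU m (dd k s \<otimes>\<^bsub>H\<^esub> \<zeta> l x) t"
          using k l i s x by (intro linear_smult[OF rl]) (auto intro!: S_mult dd_S \<zeta>_S)
        then show "rhoU m (?g k l) t = pq i l (b k) \<odot>\<^bsub>U m\<^esub> rhoU m (dd k s) (\<tau> l (CT.cons (Suc m) x t))"
          using k l s x t by (simp add: \<tau>cons lact_j dd_S \<zeta>_S)
      qed (use pc in auto)
      finally show "\<tau> i (rhoU (Suc m) s (CT.cons (Suc m) x t)) =
          (\<Oplus>\<^bsub>U m\<^esub>k\<in>{..<n}. \<Oplus>\<^bsub>U m\<^esub>l\<in>{..<r}. pq i l (b k) \<odot>\<^bsub>U m\<^esub> rhoU m (dd k s) (\<tau> l (CT.cons (Suc m) x t)))" .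
    qed
    show "y = y'" if y: "y \<in> carrier (U (Suc m))" and y': "y' \<in> carrier (U (Suc m))" and eq: "\<And>i. i < r \<Longrightarrow> \<tau> i y = \<tau> i y'" for y y'
    proof -
      have "y = (\<Oplus>\<^bsub>U (Suc m)\<^esub>i\<in>{..<r}. CT.cons (Suc m) (d i) (\<tau> i y))" by (rule exp[OF y])
      also have "\<dots> = (\<Oplus>\<^bsub>U (Suc m)\<^esub>i\<in>{..<r}. CT.cons (Suc m) (d i) (\<tau> i y'))"
        using y' by (intro T'.M.finsum_cong' refl funcsetI cc d_closed \<tau>c) (auto simp: eq)
      also have "\<dots> = y'" by (rule exp[OF y', symmetric])
      finally show ?thesis .
    qed
    show "\<exists>y\<in>carrier (U (Suc m)). \<forall>i<r. \<tau> i y = f i" if f: "\<And>i. i < r \<Longrightarrow> f i \<in> carrier (U m)" for f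
    proof (intro bexI[of _ "\<Oplus>\<^bsub>U (Suc m)\<^esub>i\<in>{..<r}. CT.cons (Suc m) (d i) (f i)"] allI impI)
      show "(\<Oplus>\<^bsub>U (Suc m)\<^esub>i\<in>{..<r}. CT.cons (Suc m) (d i) (f i)) \<in> carrier (U (Suc m))"
        using f by (intro T'.M.finsum_closed funcsetI cc d_closed) auto
      fix l assume l: "l < r"
      have "\<tau> l (\<Oplus>\<^bsub>U (Suc m)\<^esub>i\<in>{..<r}. CT.cons (Suc m) (d i) (f i)) = (\<Oplus>\<^bsub>U m\<^esub>i\<in>{..<r}. \<tau> l (CT.cons (Suc m) (d i) (f i)))"
        using f by (intro linear_finsum[OF CT.T_vs CT.T_vs \<tau>[OF l]] cc d_closed) auto
      also have "\<dots> = (\<Oplus>\<^bsub>U m\<^esub>i\<in>{..<r}. if l = i then f i else \<zero>\<^bsub>U m\<^esub>)"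
        using l f by (intro T.M.finsum_cong' refl funcsetI) (auto simp: \<tau>_d)
      also have "\<dots> = f l" using l f by (intro T.M.finsum_singleton) auto
      finally show "\<tau> l (\<Oplus>\<^bsub>U (Suc m)\<^esub>i\<in>{..<r}. CT.cons (Suc m) (d i) (f i)) = f l" .
    qed
  qed
  moreover have "(\<lambda>y. \<theta> (tl v) (\<tau> (hd v) y)) \<in> linear_maps K (U (Suc m)) H" if "v \<in> words (Suc (Suc m))" for v
    using that \<theta>l by (elim words_SucE) (simp add: linear_comp[OF \<tau>])
  ultimately show ?thesis by (intro exI[of _ "\<lambda>v y. \<theta> (tl v) (\<tau> (hd v) y)"] conjI ballI)
qed

lemma right_powers_free:
  obtains \<theta> where "free_over opS S (U m) (lamU m) (rhoU m) (words (Suc m)) \<theta> PR"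
proof -
  have "\<exists>\<theta>. (\<forall>w\<in>words (Suc m). \<theta> w \<in> linear_maps K (U m) H) \<and>
    free_over opS S (U m) (lamU m) (rhoU m) (words (Suc m)) \<theta> PR"
  proof (induction m)
    case 0
    show ?case by (rule right_powers_free_0)
  next
    case (Suc m)
    then show ?case using right_powers_free_Suc by blast
  qed
  then show thesis using that by blast
qed

text \<open>The counit turns \<open>PR\<close> into the transpose of \<open>pw\<close>, so the
  matrix argument over the opposite algebra gives the transposed statement;
  \<open>mat_retract_transpose\<close> undoes this in both directions.\<close>

lemma right_retract_iff:
  assumes F: "free_over opS S M lam rho (words m) \<theta> PR" and F': "free_over opS S M' lam' rho' (words m') \<theta>' PR"
  shows "retract_of_power S S M lam rho M' lam' rho' \<longleftrightarrow> mat_retract K S (words m) pw (words m') pw"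
proof
  have pc: "pw i l s \<in> carrier K" if "s \<in> S" "i \<in> words k" "l \<in> words k" for s i l k
    using that S_closed by blast
  note tr = mat_retract_transpose[where S=S and W="words m" and W'="words m'", OF is_cring]
  {
    assume "retract_of_power S S M lam rho M' lam' rho'"
    then have r: "retract_of_power (carrier opS) S M lam rho M' lam' rho'" by simp
    have "mat_retract K S (words m) (\<lambda>i l. pw l i) (words m') (\<lambda>i l. pw l i)"
      by (rule augmented_algebra.retract_imp_mat[OF opS_augmented F F' _ _ r]) (rule eps_PR; assumption)+
    from tr[OF _ _ this] show "mat_retract K S (words m) pw (words m') pw"
      using pc by blast
  next
    assume "mat_retract K S (words m) pw (words m') pw"
    from tr[OF _ _ this]
    have r: "mat_retract K S (words m) (\<lambda>i l. pw l i) (words m') (\<lambda>i l. pw l i)" using pc by blast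
    have "retract_of_power (carrier opS) S M lam rho M' lam' rho'"
    proof (rule augmented_algebra.mat_imp_retract[OF opS_augmented F F' _ _ _ _ _ _ _ r])
      show "finite {..<n}" by simp
      show "\<And>l s. \<lbrakk>l \<in> {..<n}; s \<in> S\<rbrakk> \<Longrightarrow> e l \<in> S" by (simp add: e_S)
      show "\<And>l s. \<lbrakk>l \<in> {..<n}; s \<in> S\<rbrakk> \<Longrightarrow> dd l s \<in> carrier opS" by (simp add: dd_S)
    next
      fix s i l assume "s \<in> S" "i \<in> words m" "l \<in> words m"
      then show "pw l i s \<in> carrier K" by (intro pc)
    next
      fix s i l assume "s \<in> S" "i \<in> words m'" "l \<in> words m'"
      then show "pw l i s \<in> carrier K" by (intro pc)
    qed (rule PR_e; assumption)+
    then show "retract_of_power S S M lam rho M' lam' rho'" by simp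
  }
qed

theorem power_similar_iff:
  "similar (j ` S) (j ` S) (U m) (U m') \<longleftrightarrow>
    mat_retract K S (words (Suc m)) pw (words (Suc m')) pw \<and> mat_retract K S (words (Suc m')) pw (words (Suc m)) pw"
proof -
  obtain \<theta> \<theta>' where F: "free_over opS S (U m) (lamU m) (rhoU m) (words (Suc m)) \<theta> PR"
    and F': "free_over opS S (U m') (lamU m') (rhoU m') (words (Suc m')) \<theta>' PR"
    using right_powers_free[of m] right_powers_free[of m'] by metis
  show ?thesis
    by (simp add: similar_iff CT.acts_lact CT.acts_ract vs_abelian[OF CT.T_vs] retract_swap_image
        right_retract_iff[OF F F'] right_retract_iff[OF F' F])
qed

theorem base_similar_iff:
  "similar (j ` S) (j ` S) (U 0) (base_bimodule (j ` S) C) \<longleftrightarrow>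
    mat_retract K S (words (Suc 0)) pw (words 0) pw \<and> mat_retract K S (words 0) pw (words (Suc 0)) pw"
proof -
  let ?B = "base_bimodule (j ` S) C"
  obtain \<theta> where F: "free_over opS S (U 0) (lamU 0) (rhoU 0) (words (Suc 0)) \<theta> PR"
    by (rule right_powers_free)
  obtain \<theta>' where F': "free_over opS S ?B (\<lambda>a y. y \<otimes>\<^bsub>C\<^esub> j a) (\<lambda>s y. j s \<otimes>\<^bsub>C\<^esub> y) (words 0) \<theta>' PR"
    by (rule base_bimodule_free)
  have a: "acts_on (j ` S) (lact ?B) ?B" "acts_on (j ` S) (\<lambda>c x. ract ?B x c) ?B"
    by (auto simp: acts_on_def base_bimodule_def j_mult[symmetric] S_mult bilinear_add[OF C_mult] j_closed)
  have s: "lact ?B = (\<otimes>\<^bsub>C\<^esub>)" "ract ?B = (\<otimes>\<^bsub>C\<^esub>)" by (simp_all add: base_bimodule_def)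
  show ?thesis
    using right_retract_iff[OF F F'] right_retract_iff[OF F' F]
    by (simp add: similar_iff[OF vs_abelian[OF CT.T_vs] free_overD(1)[OF F'] CT.acts_lact CT.acts_ract a] retract_swap_image s)
qed

end

section \<open>The smash products of the dual of the quotient coalgebra\<close>

context hopf_quot
begin

abbreviation cls where "cls x \<equiv> I +>\<^bsub>H\<^esub> x"
abbreviation Qm where "Qm \<equiv> quot_module H I"
abbreviation A where "A \<equiv> quot_dual K R H"

lemma carrier_quot_coalg: "carrier (quot_coalg K R H) = cls ` carrier H"
  by (simp add: quot_coalg_def Let_def quot_carrier[OF H_vs I_submodule])

lemma linear_quot_coalg: "linear_maps K (quot_coalg K R H) M = linear_maps K Qm M"
  by (simp add: linear_maps_def quot_coalg_def Let_def)

lemma cls_linear: "cls \<in> linear_maps K H Qm"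
  by (rule quot_proj_linear[OF H_vs I_submodule])

lemma A_form: "a \<in> carrier A \<Longrightarrow> (\<lambda>x. a (cls x)) \<in> linear_maps K H (regular_module K)"
  using linear_comp[OF cls_linear, of a "regular_module K"]
  by (simp add: quot_dual_def dual_algebra_def linear_quot_coalg)

lemma A_val [simp, intro]: "\<lbrakk>a \<in> carrier A; x \<in> carrier H\<rbrakk> \<Longrightarrow> a (cls x) \<in> carrier K"
  by (rule form_closed[OF A_form])

lemma cls_I: "x \<in> I \<Longrightarrow> cls x = cls \<zero>\<^bsub>H\<^esub>"
  using coset_eq_iff[OF H_vs I_submodule I_closed, of x "\<zero>\<^bsub>H\<^esub>"]
  by (simp add: I_closed a_minus_def)

lemma A_kills_I: "\<lbrakk>a \<in> carrier A; x \<in> I\<rbrakk> \<Longrightarrow> a (cls x) = \<zero>"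
  using linear_zero[OF H_vs regular_vs A_form, of a] by (simp add: cls_I)

lemma A_ext:
  assumes "a \<in> carrier A" "a' \<in> carrier A" "\<And>x. x \<in> carrier H \<Longrightarrow> a (cls x) = a' (cls x)"
  shows "a = a'"
proof (rule extensionalityI)
  show "a \<in> extensional (cls ` carrier H)" "a' \<in> extensional (cls ` carrier H)"
    using assms(1,2) by (auto simp: quot_dual_def dual_algebra_def carrier_quot_coalg)
qed (use assms(3) in auto)

lemma A_add [simp]: "x \<in> carrier H \<Longrightarrow> (a \<oplus>\<^bsub>A\<^esub> a') (cls x) = a (cls x) \<oplus> a' (cls x)"
  and A_smult [simp]: "x \<in> carrier H \<Longrightarrow> (c \<odot>\<^bsub>A\<^esub> a) (cls x) = c \<otimes> a (cls x)"
  and A_zero [simp]: "x \<in> carrier H \<Longrightarrow> \<zero>\<^bsub>A\<^esub> (cls x) = \<zero>"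
  by (simp_all add: quot_dual_def dual_algebra_def carrier_quot_coalg)

lemma A_carrierI:
  assumes "f \<in> linear_maps K H (regular_module K)" "\<And>x. x \<in> I \<Longrightarrow> f x = \<zero>"
    and "\<And>x. x \<in> carrier H \<Longrightarrow> a (cls x) = f x" "a \<in> extensional (cls ` carrier H)"
  shows "a \<in> carrier A"
proof -
  have "a \<in> linear_maps K Qm (regular_module K)"
    by (rule linear_mapsI)
      (auto simp: quot_carrier[OF H_vs I_submodule] quot_add[OF H_vs I_submodule] quot_smult[OF H_vs I_submodule]
        assms(3) form_closed[OF assms(1)] form_add[OF assms(1)] form_smult[OF assms(1)])
  then show ?thesis using assms(4)
    by (simp add: quot_dual_def dual_algebra_def linear_quot_coalg carrier_quot_coalg)
qed

definition mkA where "mkA f = (\<lambda>X\<in>cls ` carrier H. f (SOME h. h \<in> X))"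

lemma some_cls:
  assumes f: "f \<in> linear_maps K H (regular_module K)" "\<And>x. x \<in> I \<Longrightarrow> f x = \<zero>" and x: "x \<in> carrier H"
  shows "f (SOME h. h \<in> cls x) = f x"
proof -
  have m: "(SOME h. h \<in> cls x) \<in> cls x"
    by (rule someI[of "\<lambda>h. h \<in> cls x"], rule coset_self[OF H_vs I_submodule x])
  note c = coset_closed[OF H_vs I_submodule x m]
  have "(SOME h. h \<in> cls x) \<ominus>\<^bsub>H\<^esub> x \<in> I"
    using coset_memD[OF H_vs I_submodule x m] coset_eq_iff[OF H_vs I_submodule c x] by simp
  then show ?thesis using form_diff_eq[OF H_vs f(1) c x] f(2) by blast
qed

lemma mkA:
  assumes f: "f \<in> linear_maps K H (regular_module K)" "\<And>x. x \<in> I \<Longrightarrow> f x = \<zero>"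
  shows "mkA f \<in> carrier A" and "x \<in> carrier H \<Longrightarrow> mkA f (cls x) = f x"
proof -
  show *: "mkA f (cls x) = f x" if "x \<in> carrier H" for x
    using that some_cls[OF f that] by (simp add: mkA_def)
  show "mkA f \<in> carrier A"
    by (rule A_carrierI[OF f *]) (simp_all add: mkA_def[abs_def] del: restrict_apply)
qed

text \<open>The operations of the dual algebra are extensional functions on classes. Each pulls back
  to a functional on H vanishing on \<open>I\<close>, which is how membership and values are
  established.\<close>

lemma A_op_carrier:
  assumes f: "f \<in> linear_maps K H (regular_module K)" "\<And>x. x \<in> I \<Longrightarrow> f x = \<zero>"
    and e: "a = (\<lambda>X\<in>cls ` carrier H. g X)" "\<And>x. x \<in> carrier H \<Longrightarrow> g (cls x) = f x"
  shows "a \<in> carrier A" "x \<in> carrier H \<Longrightarrow> a (cls x) = f x"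
proof -
  show *: "a (cls x) = f x" if "x \<in> carrier H" for x using that e by simp
  show "a \<in> carrier A" by (rule A_carrierI[OF f *]) (simp_all add: e(1) del: restrict_apply)
qed

lemma A_zero_closed: "\<zero>\<^bsub>A\<^esub> \<in> carrier A"
  by (rule A_op_carrier[OF linear_zero_map[OF regular_vs]])
    (auto simp: quot_dual_def dual_algebra_def carrier_quot_coalg)

lemma A_add_closed: "\<lbrakk>a \<in> carrier A; a' \<in> carrier A\<rbrakk> \<Longrightarrow> a \<oplus>\<^bsub>A\<^esub> a' \<in> carrier A"
  by (rule A_op_carrier[OF linear_plus[OF regular_vs A_form A_form]])
    (auto simp: quot_dual_def dual_algebra_def carrier_quot_coalg A_kills_I[unfolded quot_dual_def dual_algebra_def])

lemma A_smult_closed: "\<lbrakk>c \<in> carrier K; a \<in> carrier A\<rbrakk> \<Longrightarrow> c \<odot>\<^bsub>A\<^esub> a \<in> carrier A"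
  by (rule A_op_carrier[OF linear_scale[OF regular_vs A_form]])
    (auto simp: quot_dual_def dual_algebra_def carrier_quot_coalg A_kills_I[unfolded quot_dual_def dual_algebra_def])

lemma A_vs: "Module.module K A"
proof (rule moduleI)
  show "cring K" by (rule is_cring)
  show "abelian_group A"
  proof (rule abelian_groupI)
    fix a assume a: "a \<in> carrier A"
    show "\<exists>y\<in>carrier A. y \<oplus>\<^bsub>A\<^esub> a = \<zero>\<^bsub>A\<^esub>"
      using a by (intro bexI[of _ "(\<ominus> \<one>) \<odot>\<^bsub>A\<^esub> a"] A_ext A_add_closed A_smult_closed A_zero_closed)
        (auto simp: l_minus l_neg)
  next
    fix a a' a'' assume "a \<in> carrier A" "a' \<in> carrier A" "a'' \<in> carrier A"
    then show "a \<oplus>\<^bsub>A\<^esub> a' \<oplus>\<^bsub>A\<^esub> a'' = a \<oplus>\<^bsub>A\<^esub> (a' \<oplus>\<^bsub>A\<^esub> a'')"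
      by (intro A_ext A_add_closed) (auto simp: a_assoc)
  next
    fix a a' assume "a \<in> carrier A" "a' \<in> carrier A"
    then show "a \<oplus>\<^bsub>A\<^esub> a' = a' \<oplus>\<^bsub>A\<^esub> a"
      by (intro A_ext A_add_closed) (auto simp: a_comm)
  next
    fix a assume "a \<in> carrier A"
    then show "\<zero>\<^bsub>A\<^esub> \<oplus>\<^bsub>A\<^esub> a = a"
      by (intro A_ext A_add_closed A_zero_closed) auto
  qed (auto simp: A_zero_closed A_add_closed)
next
  fix c c' a assume "c \<in> carrier K" "c' \<in> carrier K" "a \<in> carrier A"
  then show "(c \<oplus> c') \<odot>\<^bsub>A\<^esub> a = c \<odot>\<^bsub>A\<^esub> a \<oplus>\<^bsub>A\<^esub> c' \<odot>\<^bsub>A\<^esub> a"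
    and "(c \<otimes> c') \<odot>\<^bsub>A\<^esub> a = c \<odot>\<^bsub>A\<^esub> (c' \<odot>\<^bsub>A\<^esub> a)"
    by (intro A_ext A_add_closed A_smult_closed; auto simp: l_distr m_assoc)+
next
  fix c a a' assume "c \<in> carrier K" "a \<in> carrier A" "a' \<in> carrier A"
  then show "c \<odot>\<^bsub>A\<^esub> (a \<oplus>\<^bsub>A\<^esub> a') = c \<odot>\<^bsub>A\<^esub> a \<oplus>\<^bsub>A\<^esub> c \<odot>\<^bsub>A\<^esub> a'"
    by (intro A_ext A_add_closed A_smult_closed; auto simp: r_distr)+
next
  fix a assume "a \<in> carrier A"
  then show "\<one> \<odot>\<^bsub>A\<^esub> a = a"
    by (intro A_ext A_smult_closed; auto)+
qed (auto simp: A_smult_closed)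

lemma A_eval: "x \<in> carrier H \<Longrightarrow> (\<lambda>a. a (cls x)) \<in> linear_maps K A (regular_module K)"
  by (rule linear_mapsI) auto

lemma A_R: "\<lbrakk>a \<in> carrier A; x \<in> R; h \<in> carrier H\<rbrakk> \<Longrightarrow> a (cls (x \<otimes>\<^bsub>H\<^esub> h)) = eps x \<otimes> a (cls h)"
  by (rule form_R[OF A_form]) (simp_all add: A_kills_I)

lemma form_product_bilinear:
  assumes "f \<in> linear_maps K V (regular_module K)" "g \<in> linear_maps K W (regular_module K)"
  shows "bilinear V W (regular_module K) (\<lambda>x y. f x \<otimes> g y)"
  using form_closed[OF assms(1)] form_closed[OF assms(2)]
  by (intro bilinearI') (auto simp: form_add[OF assms(1)] form_add[OF assms(2)] form_smult[OF assms(1)]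
      form_smult[OF assms(2)] l_distr r_distr m_ac)

text \<open>The convolution product pulled back along H -> Q: x -> a([x_(1)]) a'([x_(2)]).\<close>

definition conv where "conv a a' x = (\<Oplus>i\<in>{..<n}. a (cls (b i)) \<otimes> a' (cls (dd i x)))"

lemma conv_linear:
  assumes a: "a \<in> carrier A" "a' \<in> carrier A"
  shows "conv a a' \<in> linear_maps K H (regular_module K)"
proof -
  have "(\<lambda>x. \<Oplus>\<^bsub>regular_module K\<^esub>i\<in>{..<n}. a (cls (b i)) \<odot>\<^bsub>regular_module K\<^esub> a' (cls (dd i x))) \<in> linear_maps K H (regular_module K)"
    using a by (intro linear_sum regular_vs linear_scale linear_comp[OF dd_linear A_form]) auto
  then show ?thesis by (simp add: conv_def[abs_def] finsum_regular)
qed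

text \<open>On y h with y in R^+, the second leg y_(2) is in R and acts by eps(y_(2)); summing over
  the first leg gives a([y h_(1)]) a'([h_(2)]), and the first factor vanishes.\<close>

lemma conv_I:
  assumes a: "a \<in> carrier A" "a' \<in> carrier A" and x: "x \<in> I"
  shows "conv a a' x = \<zero>"
proof -
  note sz = zero_submodule[OF regular_vs, simplified]
  have "conv a a' x \<in> {\<zero>}"
  proof (rule I_linear[OF regular_vs conv_linear[OF a] sz _ x])
    fix y h assume y: "y \<in> R" "eps y = \<zero>" and h: "h \<in> carrier H"
    have yc: "y \<in> carrier H" by (rule R_closed[OF y(1)])
    note bil = form_product_bilinear[OF A_form[OF a(1)] A_form[OF a(2)]]
    have "conv a a' (y \<otimes>\<^bsub>H\<^esub> h) = (\<Oplus>i\<in>{..<n}. \<Oplus>j\<in>{..<n}. a (cls (b i \<otimes>\<^bsub>H\<^esub> b j)) \<otimes> a' (cls (dd i y \<otimes>\<^bsub>H\<^esub> dd j h)))"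
      using sweedler_mult[OF regular_vs bil yc h] by (simp add: conv_def finsum_regular)
    also have "\<dots> = (\<Oplus>j\<in>{..<n}. \<Oplus>i\<in>{..<n}. a (cls (b i \<otimes>\<^bsub>H\<^esub> b j)) \<otimes> a' (cls (dd i y \<otimes>\<^bsub>H\<^esub> dd j h)))"
      using a yc h by (intro finsum_swap) auto
    also have "\<dots> = (\<Oplus>j\<in>{..<n}. \<zero>)"
    proof (intro finsum_cong' refl)
      fix j assume j: "j \<in> {..<n}"
      have l: "(\<lambda>x. a (cls (x \<otimes>\<^bsub>H\<^esub> b j))) \<in> linear_maps K H (regular_module K)"
        using j by (intro linear_comp[OF bilinear_left[OF mult_bilinear] A_form[OF a(1)]]) auto
      have "(\<Oplus>i\<in>{..<n}. a (cls (b i \<otimes>\<^bsub>H\<^esub> b j)) \<otimes> a' (cls (dd i y \<otimes>\<^bsub>H\<^esub> dd j h))) =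
          (\<Oplus>i\<in>{..<n}. a (cls ((eps (dd i y) \<odot>\<^bsub>H\<^esub> b i) \<otimes>\<^bsub>H\<^esub> b j)) \<otimes> a' (cls (dd j h)))"
        using a yc h j y(1)
        by (intro finsum_cong') (auto simp: A_R dd_R form_smult[OF l] m_ac)
      also have "\<dots> = (\<Oplus>i\<in>{..<n}. a (cls ((eps (dd i y) \<odot>\<^bsub>H\<^esub> b i) \<otimes>\<^bsub>H\<^esub> b j))) \<otimes> a' (cls (dd j h))"
        using a yc h j by (intro finsum_ldistr[symmetric]) auto
      also have "(\<Oplus>i\<in>{..<n}. a (cls ((eps (dd i y) \<odot>\<^bsub>H\<^esub> b i) \<otimes>\<^bsub>H\<^esub> b j))) = a (cls (y \<otimes>\<^bsub>H\<^esub> b j))"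
        using form_finsum[OF H_vs l, of "{..<n}" "\<lambda>i. eps (dd i y) \<odot>\<^bsub>H\<^esub> b i"] yc sweedler_counit_right[OF yc] by simp
      also have "\<dots> = \<zero>" using a y j A_R[OF a(1) y(1)] by simp
      finally show "(\<Oplus>i\<in>{..<n}. a (cls (b i \<otimes>\<^bsub>H\<^esub> b j)) \<otimes> a' (cls (dd i y \<otimes>\<^bsub>H\<^esub> dd j h))) = \<zero>"
        using a h j by simp
    qed auto
    finally show "conv a a' (y \<otimes>\<^bsub>H\<^esub> h) \<in> {\<zero>}" by (simp add: finsum_zero)
  qed
  then show ?thesis by simp
qed

text \<open>The comultiplication of the quotient is the image of \<Delta>(h) in Q \<otimes> Q for a
  chosen representative h; contracting it with the two functionals recovers the convolution on
  H.\<close>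

lemma A_mult_raw:
  assumes a: "a \<in> carrier A" "a' \<in> carrier A" and h: "h \<in> carrier H"
  shows "tensor_lift K (regular_module K) (\<lambda>x y. a x \<otimes> a' y)
      (tensor_lift K (tensor K Qm Qm) (\<lambda>x y. pure_tensor K Qm Qm (cls x) (cls y)) (comult H h)) = conv a a' h"
proof -
  have Q: "Module.module K Qm" by (rule quot_vs[OF H_vs I_submodule])
  note QQ = tensor_vs[OF Q Q]
  have bil1: "bilinear H H (tensor K Qm Qm) (\<lambda>x y. pure_tensor K Qm Qm (cls x) (cls y))"
    by (rule bilinear_comp2[OF pure_bilinear[OF Q Q] cls_linear cls_linear])
  have aQ: "a \<in> linear_maps K Qm (regular_module K)" "a' \<in> linear_maps K Qm (regular_module K)"
    using a by (simp_all add: quot_dual_def dual_algebra_def linear_quot_coalg)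
  note bil2 = form_product_bilinear[OF aQ]
  note cc = linear_closed[OF cls_linear]
  have "tensor_lift K (regular_module K) (\<lambda>x y. a x \<otimes> a' y)
      (tensor_lift K (tensor K Qm Qm) (\<lambda>x y. pure_tensor K Qm Qm (cls x) (cls y)) (comult H h)) =
    tensor_lift K (regular_module K) (\<lambda>x y. a x \<otimes> a' y)
      (\<Oplus>\<^bsub>tensor K Qm Qm\<^esub>i\<in>{..<n}. pure_tensor K Qm Qm (cls (b i)) (cls (dd i h)))"
    by (simp only: sweedler[OF QQ bil1 h])
  also have "\<dots> = (\<Oplus>i\<in>{..<n}. tensor_lift K (regular_module K) (\<lambda>x y. a x \<otimes> a' y) (pure_tensor K Qm Qm (cls (b i)) (cls (dd i h))))"
    using h by (intro form_finsum[OF QQ tensor_lift_linear[OF Q Q regular_vs bil2]] pure_closed Q cc) auto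
  also have "\<dots> = conv a a' h"
    unfolding conv_def using h a
    by (intro finsum_cong') (auto simp: tensor_lift_pure[OF Q Q regular_vs bil2] cc)
  finally show ?thesis .
qed

lemma A_mult:
  assumes a: "a \<in> carrier A" "a' \<in> carrier A"
  shows "a \<otimes>\<^bsub>A\<^esub> a' \<in> carrier A" and "x \<in> carrier H \<Longrightarrow> (a \<otimes>\<^bsub>A\<^esub> a') (cls x) = conv a a' x"
proof -
  let ?g = "\<lambda>X. tensor_lift K (regular_module K) (\<lambda>x y. a x \<otimes> a' y) (comult (quot_coalg K R H) X)"
  have e: "a \<otimes>\<^bsub>A\<^esub> a' = (\<lambda>X\<in>cls ` carrier H. ?g X)"
    by (simp add: quot_dual_def dual_algebra_def carrier_quot_coalg)
  have g: "?g (cls x) = conv a a' x" if x: "x \<in> carrier H" for x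
  proof -
    have "(SOME h. h \<in> cls x) \<in> carrier H"
      by (rule coset_closed[OF H_vs I_submodule x], rule someI[of "\<lambda>h. h \<in> cls x"], rule coset_self[OF H_vs I_submodule x])
    from A_mult_raw[OF a this] show ?thesis
      using some_cls[OF conv_linear[OF a] conv_I[OF a] x] by (simp add: quot_coalg_def Let_def)
  qed
  show "a \<otimes>\<^bsub>A\<^esub> a' \<in> carrier A" by (rule A_op_carrier(1)[OF conv_linear[OF a] conv_I[OF a] e g])
  show "x \<in> carrier H \<Longrightarrow> (a \<otimes>\<^bsub>A\<^esub> a') (cls x) = conv a a' x"
    by (rule A_op_carrier(2)[OF conv_linear[OF a] conv_I[OF a] e g])
qed

lemma eps_I: "x \<in> I \<Longrightarrow> eps x = \<zero>"
proof -
  assume x: "x \<in> I"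
  note sz = zero_submodule[OF regular_vs, simplified]
  have "eps x \<in> {\<zero>}"
    by (rule I_linear[OF regular_vs eps_linear sz _ x]) (simp add: eps_mult R_closed)
  then show "eps x = \<zero>" by simp
qed

lemma A_one: "\<one>\<^bsub>A\<^esub> \<in> carrier A" "x \<in> carrier H \<Longrightarrow> \<one>\<^bsub>A\<^esub> (cls x) = eps x"
proof -
  have e: "\<one>\<^bsub>A\<^esub> = (\<lambda>X\<in>cls ` carrier H. eps (SOME h. h \<in> X))"
    by (simp add: quot_dual_def dual_algebra_def carrier_quot_coalg)
      (simp add: quot_coalg_def Let_def)
  note g = some_cls[OF eps_linear eps_I]
  show "\<one>\<^bsub>A\<^esub> \<in> carrier A" "x \<in> carrier H \<Longrightarrow> \<one>\<^bsub>A\<^esub> (cls x) = eps x"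
    by (rule A_op_carrier[OF eps_linear eps_I e g]; assumption)+
qed

abbreviation act where "act \<equiv> quot_dual_lact K R H"

lemma quot_ract_cls:
  assumes x: "x \<in> carrier H" and g: "g \<in> carrier H"
  shows "quot_ract K R H (cls x) g = cls (x \<otimes>\<^bsub>H\<^esub> g)"
  unfolding quot_ract_def
proof (rule quot_UN[OF H_vs I_submodule x])
  fix y assume y: "y \<in> carrier H" "y \<ominus>\<^bsub>H\<^esub> x \<in> I"
  have "y \<otimes>\<^bsub>H\<^esub> g \<ominus>\<^bsub>H\<^esub> x \<otimes>\<^bsub>H\<^esub> g = (y \<ominus>\<^bsub>H\<^esub> x) \<otimes>\<^bsub>H\<^esub> g"
    using x y g by (simp add: a_minus_def H.l_distr H.l_minus)
  then show "y \<otimes>\<^bsub>H\<^esub> g \<ominus>\<^bsub>H\<^esub> x \<otimes>\<^bsub>H\<^esub> g \<in> I" using I_right_ideal[OF y(2) g] by simp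
qed (use g in auto)

lemma A_act:
  assumes h: "h \<in> carrier H" and a: "a \<in> carrier A"
  shows "act h a \<in> carrier A" and "x \<in> carrier H \<Longrightarrow> act h a (cls x) = a (cls (x \<otimes>\<^bsub>H\<^esub> h))"
proof -
  have e: "act h a = (\<lambda>X\<in>cls ` carrier H. a (quot_ract K R H X h))"
    by (simp add: quot_dual_lact_def carrier_quot_coalg)
  have l: "(\<lambda>x. a (cls (x \<otimes>\<^bsub>H\<^esub> h))) \<in> linear_maps K H (regular_module K)"
    by (rule linear_comp[OF bilinear_left[OF mult_bilinear h] A_form[OF a]])
  note t = A_op_carrier[OF l _ e]
  show "act h a \<in> carrier A" by (rule t) (simp_all add: A_kills_I a h I_right_ideal quot_ract_cls)
  show "x \<in> carrier H \<Longrightarrow> act h a (cls x) = a (cls (x \<otimes>\<^bsub>H\<^esub> h))"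
    by (rule t) (simp_all add: A_kills_I a h I_right_ideal quot_ract_cls)
qed

lemma conv_bilinear: "x \<in> carrier H \<Longrightarrow> bilinear A A (regular_module K) (\<lambda>a a'. conv a a' x)"
proof -
  assume x: "x \<in> carrier H"
  have l1: "(\<lambda>a. \<Oplus>\<^bsub>regular_module K\<^esub>i\<in>{..<n}. a (cls (b i)) \<otimes> a' (cls (dd i x))) \<in> linear_maps K A (regular_module K)"
    if "a' \<in> carrier A" for a'
    using that x by (intro linear_sum regular_vs bilinear_left[OF form_product_bilinear[OF A_eval A_eval]]) auto
  have l2: "(\<lambda>a'. \<Oplus>\<^bsub>regular_module K\<^esub>i\<in>{..<n}. a (cls (b i)) \<otimes> a' (cls (dd i x))) \<in> linear_maps K A (regular_module K)"
    if "a \<in> carrier A" for a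
    using that x by (intro linear_sum regular_vs bilinear_right[OF form_product_bilinear[OF A_eval A_eval]]) auto
  show ?thesis unfolding conv_def using l1 l2 by (intro bilinearI) (simp_all add: finsum_regular)
qed

lemma A_mult_bilinear: "bilinear A A A (mult A)"
proof (rule bilinearI')
  note cb = bilinear_add[OF conv_bilinear]
  fix a a' a'' assume a: "a \<in> carrier A" "a' \<in> carrier A"
  show "a \<otimes>\<^bsub>A\<^esub> a' \<in> carrier A" by (rule A_mult[OF a])
  assume a'': "a'' \<in> carrier A"
  show "(a \<oplus>\<^bsub>A\<^esub> a') \<otimes>\<^bsub>A\<^esub> a'' = a \<otimes>\<^bsub>A\<^esub> a'' \<oplus>\<^bsub>A\<^esub> a' \<otimes>\<^bsub>A\<^esub> a''"
    using a a'' by (intro A_ext A_mult A_add_closed) (simp_all add: A_mult A_add_closed cb)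
  show "a \<otimes>\<^bsub>A\<^esub> (a' \<oplus>\<^bsub>A\<^esub> a'') = a \<otimes>\<^bsub>A\<^esub> a' \<oplus>\<^bsub>A\<^esub> a \<otimes>\<^bsub>A\<^esub> a''"
    using a a'' by (intro A_ext A_mult A_add_closed) (simp_all add: A_mult A_add_closed cb)
next
  note cb = bilinear_add[OF conv_bilinear]
  fix c a a' assume a: "c \<in> carrier K" "a \<in> carrier A" "a' \<in> carrier A"
  show "(c \<odot>\<^bsub>A\<^esub> a) \<otimes>\<^bsub>A\<^esub> a' = c \<odot>\<^bsub>A\<^esub> (a \<otimes>\<^bsub>A\<^esub> a')" "a \<otimes>\<^bsub>A\<^esub> (c \<odot>\<^bsub>A\<^esub> a') = c \<odot>\<^bsub>A\<^esub> (a \<otimes>\<^bsub>A\<^esub> a')"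
    using a by (intro A_ext A_mult A_smult_closed; simp add: A_mult A_smult_closed cb)+
qed

lemma A_act_bilinear: "bilinear H A A act"
proof (rule bilinearI')
  fix x y a assume x: "x \<in> carrier H" "y \<in> carrier H" and a: "a \<in> carrier A"
  show "act (x \<oplus>\<^bsub>H\<^esub> y) a = act x a \<oplus>\<^bsub>A\<^esub> act y a"
    using x a by (intro A_ext A_act A_add_closed) (simp_all add: A_act H.r_distr form_add[OF A_form])
next
  fix c x a assume "c \<in> carrier K" "x \<in> carrier H" "a \<in> carrier A"
  then show "act (c \<odot>\<^bsub>H\<^esub> x) a = c \<odot>\<^bsub>A\<^esub> act x a" "act x (c \<odot>\<^bsub>A\<^esub> a) = c \<odot>\<^bsub>A\<^esub> act x a"
    by (intro A_ext A_act A_smult_closed H.smult_closed; simp add: A_act A_smult_closed H.smult_mult_right form_smult[OF A_form])+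
next
  fix x a a' assume "x \<in> carrier H" "a \<in> carrier A" "a' \<in> carrier A"
  then show "act x (a \<oplus>\<^bsub>A\<^esub> a') = act x a \<oplus>\<^bsub>A\<^esub> act x a'"
    by (intro A_ext A_act A_add_closed) (simp_all add: A_act A_add_closed)
qed (simp add: A_act)

lemma A_one_left: "a \<in> carrier A \<Longrightarrow> \<one>\<^bsub>A\<^esub> \<otimes>\<^bsub>A\<^esub> a = a"
proof (rule A_ext)
  fix x assume a: "a \<in> carrier A" and x: "x \<in> carrier H"
  have "conv \<one>\<^bsub>A\<^esub> a x = (\<Oplus>i\<in>{..<n}. a (cls (eps (b i) \<odot>\<^bsub>H\<^esub> dd i x)))"
    unfolding conv_def using a x by (intro finsum_cong') (auto simp: A_one form_smult[OF A_form])
  also have "\<dots> = a (cls (\<Oplus>\<^bsub>H\<^esub>i\<in>{..<n}. eps (b i) \<odot>\<^bsub>H\<^esub> dd i x))"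
    using x by (intro form_finsum[OF H_vs A_form[OF a], symmetric]) auto
  finally show "(\<one>\<^bsub>A\<^esub> \<otimes>\<^bsub>A\<^esub> a) (cls x) = a (cls x)"
    using a x by (simp add: A_mult A_one sweedler_counit_left)
qed (simp_all add: A_mult A_one)

lemma A_one_right: "a \<in> carrier A \<Longrightarrow> a \<otimes>\<^bsub>A\<^esub> \<one>\<^bsub>A\<^esub> = a"
proof (rule A_ext)
  fix x assume a: "a \<in> carrier A" and x: "x \<in> carrier H"
  have "conv a \<one>\<^bsub>A\<^esub> x = (\<Oplus>i\<in>{..<n}. a (cls (eps (dd i x) \<odot>\<^bsub>H\<^esub> b i)))"
    unfolding conv_def using a x by (intro finsum_cong') (auto simp: A_one form_smult[OF A_form] m_comm)
  also have "\<dots> = a (cls (\<Oplus>\<^bsub>H\<^esub>i\<in>{..<n}. eps (dd i x) \<odot>\<^bsub>H\<^esub> b i))"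
    using x by (intro form_finsum[OF H_vs A_form[OF a], symmetric]) auto
  finally show "(a \<otimes>\<^bsub>A\<^esub> \<one>\<^bsub>A\<^esub>) (cls x) = a (cls x)"
    using a x by (simp add: A_mult A_one sweedler_counit_right)
qed (simp_all add: A_mult A_one)

lemma A_act_one: "h \<in> carrier H \<Longrightarrow> act h \<one>\<^bsub>A\<^esub> = eps h \<odot>\<^bsub>A\<^esub> \<one>\<^bsub>A\<^esub>"
  by (rule A_ext) (simp_all add: A_act A_one A_smult_closed eps_mult m_comm)

text \<open>The basis of the dual of Q that is dual to the classes of the
  \<open>q i\<close>.\<close>

definition \<delta> where "\<delta> i = mkA (\<psi> i)"

lemma \<delta>_closed: "i < r \<Longrightarrow> \<delta> i \<in> carrier A"
  and \<delta>_cls: "\<lbrakk>i < r; x \<in> carrier H\<rbrakk> \<Longrightarrow> \<delta> i (cls x) = \<psi> i x"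
  unfolding \<delta>_def by (intro mkA \<psi>_linear \<psi>_I; assumption)+

lemma A_q_expand: "\<lbrakk>a \<in> carrier A; x \<in> carrier H\<rbrakk> \<Longrightarrow> a (cls x) = (\<Oplus>i\<in>{..<r}. \<psi> i x \<otimes> a (cls (q i)))"
  using kills_I_expand[OF regular_vs A_form, of a x] by (simp add: A_kills_I finsum_regular)

lemma A_expand:
  assumes a: "a \<in> carrier A"
  shows "a = (\<Oplus>\<^bsub>A\<^esub>i\<in>{..<r}. a (cls (q i)) \<odot>\<^bsub>A\<^esub> \<delta> i)"
proof (rule A_ext[OF a])
  interpret AM: Module.module K A by (rule A_vs)
  show "(\<Oplus>\<^bsub>A\<^esub>i\<in>{..<r}. a (cls (q i)) \<odot>\<^bsub>A\<^esub> \<delta> i) \<in> carrier A"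
    using a by (intro AM.M.finsum_closed) (auto intro!: A_smult_closed \<delta>_closed)
  fix x assume x: "x \<in> carrier H"
  have "(\<Oplus>\<^bsub>A\<^esub>i\<in>{..<r}. a (cls (q i)) \<odot>\<^bsub>A\<^esub> \<delta> i) (cls x) = (\<Oplus>i\<in>{..<r}. (a (cls (q i)) \<odot>\<^bsub>A\<^esub> \<delta> i) (cls x))"
    using a by (intro form_finsum[OF A_vs A_eval[OF x]]) (auto intro!: A_smult_closed \<delta>_closed)
  also have "\<dots> = (\<Oplus>i\<in>{..<r}. \<psi> i x \<otimes> a (cls (q i)))"
    using a x by (intro finsum_cong') (auto simp: \<delta>_cls m_comm)
  finally show "a (cls x) = (\<Oplus>\<^bsub>A\<^esub>i\<in>{..<r}. a (cls (q i)) \<odot>\<^bsub>A\<^esub> \<delta> i) (cls x)"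
    using A_q_expand[OF a x] by simp
qed

end

context base_field
begin

lemma bilinear_cong:
  assumes "bilinear V W M g" "Module.module K V" "Module.module K W"
    and e: "\<And>v w. \<lbrakk>v \<in> carrier V; w \<in> carrier W\<rbrakk> \<Longrightarrow> f v w = g v w"
  shows "bilinear V W M f"
proof -
  interpret V: Module.module K V by fact
  interpret W: Module.module K W by fact
  show ?thesis
    by (intro bilinearI') (simp_all add: e bilinear_closed[OF assms(1)] bilinear_add[OF assms(1)])
qed

text \<open>The smash multiplication is a lift in one argument of a lift in the other. A map that is
  bilinear in each of two pairs of variables induces in this way a bilinear map on the two tensor
  products, determined on pure tensors.\<close>

lemma lift_lift_bilinear:
  assumes V: "Module.module K V" and W: "Module.module K W" and X: "Module.module K X" and Y: "Module.module K Y"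
    and M: "Module.module K M"
    and F: "\<And>v w. \<lbrakk>v \<in> carrier V; w \<in> carrier W\<rbrakk> \<Longrightarrow> bilinear X Y M (F v w)"
    and F': "\<And>x y. \<lbrakk>x \<in> carrier X; y \<in> carrier Y\<rbrakk> \<Longrightarrow> bilinear V W M (\<lambda>v w. F v w x y)"
  shows "bilinear (tensor K V W) (tensor K X Y) M (\<lambda>P P'. tensor_lift K M (\<lambda>v w. tensor_lift K M (F v w) P') P)"
    and "\<lbrakk>v \<in> carrier V; w \<in> carrier W; x \<in> carrier X; y \<in> carrier Y\<rbrakk> \<Longrightarrow>
      tensor_lift K M (\<lambda>v w. tensor_lift K M (F v w) (pure_tensor K X Y x y)) (pure_tensor K V W v w) = F v w x y"
proof -
  note l = tensor_lift_linear[OF X Y M F]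
  note p = tensor_lift_pure[OF X Y M F]
  have b: "bilinear V W M (\<lambda>v w. tensor_lift K M (F v w) P')" if "P' \<in> carrier (tensor K X Y)" for P'
    using that by (intro lift_bilinear[OF X Y V W M] F F')
  note L = tensor_lift_linear[OF V W M b]
  note pp = tensor_lift_pure[OF V W M b]
  interpret T: Module.module K "tensor K X Y" by (rule tensor_vs[OF X Y])
  show "bilinear (tensor K V W) (tensor K X Y) M (\<lambda>P P'. tensor_lift K M (\<lambda>v w. tensor_lift K M (F v w) P') P)"
  proof (rule bilinearI)
    show "(\<lambda>P. tensor_lift K M (\<lambda>v w. tensor_lift K M (F v w) P') P) \<in> linear_maps K (tensor K V W) M"
      if "P' \<in> carrier (tensor K X Y)" for P' using L[OF that] by simp
    fix P assume P: "P \<in> carrier (tensor K V W)"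
    show "(\<lambda>P'. tensor_lift K M (\<lambda>v w. tensor_lift K M (F v w) P') P) \<in> linear_maps K (tensor K X Y) M"
    proof (rule linear_mapsI)
      fix x y assume 1: "x \<in> carrier (tensor K X Y)" "y \<in> carrier (tensor K X Y)"
      note xy = T.M.a_closed[OF 1]
      show "tensor_lift K M (\<lambda>v w. tensor_lift K M (F v w) (x \<oplus>\<^bsub>tensor K X Y\<^esub> y)) P =
        tensor_lift K M (\<lambda>v w. tensor_lift K M (F v w) x) P \<oplus>\<^bsub>M\<^esub> tensor_lift K M (\<lambda>v w. tensor_lift K M (F v w) y) P"
        by (rule tensor_linear_eq[OF V W M L[OF xy] linear_plus[OF M L[OF 1(1)] L[OF 1(2)]] _ P])
          (simp add: pp[OF xy] pp[OF 1(1)] pp[OF 1(2)] linear_add[OF l 1] 1)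
    next
      fix c x assume 1: "c \<in> carrier K" "x \<in> carrier (tensor K X Y)"
      note cx = T.smult_closed[OF 1]
      show "tensor_lift K M (\<lambda>v w. tensor_lift K M (F v w) (c \<odot>\<^bsub>tensor K X Y\<^esub> x)) P =
        c \<odot>\<^bsub>M\<^esub> tensor_lift K M (\<lambda>v w. tensor_lift K M (F v w) x) P"
        by (rule tensor_linear_eq[OF V W M L[OF cx] linear_scale[OF M L[OF 1(2)] 1(1)] _ P])
          (simp add: pp[OF cx] pp[OF 1(2)] linear_smult[OF l 1] 1)
    qed (rule linear_closed[OF L P])
  qed
  show "\<lbrakk>v \<in> carrier V; w \<in> carrier W; x \<in> carrier X; y \<in> carrier Y\<rbrakk> \<Longrightarrow>
      tensor_lift K M (\<lambda>v w. tensor_lift K M (F v w) (pure_tensor K X Y x y)) (pure_tensor K V W v w) = F v w x y"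
    by (simp add: pp[OF pure_closed[OF X Y]] p)
qed

end

text \<open>\<open>sS\<close> is the Hopf algebra that enters \<open>smash\<close>: H itself or
  \<open>sub_hopf K R H\<close>. Its comultiplication takes values in its own tensor square, whose
  elements are cosets in another free module than those of H \<otimes> H, hence the separate
  assumption \<open>comult_sS\<close>.\<close>

locale smash_data = hopf_part K H n b \<phi> R r q \<psi> S e for K :: "('k, 'm) ring_scheme" (structure)
    and H :: "('k, 'h, 'x) hopf_scheme" and n b \<phi> R r q \<psi> and S :: "'h set" and e +
  fixes sS :: "('k, 'h, 'y) hopf_scheme"
  assumes sS_simps [simp]: "carrier sS = S" "mult sS = mult H" "one sS = one H" "zero sS = zero H"
      "add sS = add H" "smult sS = smult H"
    and comult_sS: "s \<in> S \<Longrightarrow> comult sS s = (\<Oplus>\<^bsub>tensor K sS sS\<^esub>i\<in>{..<n}. pure_tensor K sS sS (e i) (dd i s))"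
begin

lemma sS_vs: "Module.module K sS"
  by (rule module_cong[OF submodule.submodule_is_module[OF S_submodule H_vs]]) simp_all

lemma linear_sS: "f \<in> linear_maps K H M \<Longrightarrow> f \<in> linear_maps K sS M"
  by (rule linear_mapsI) (simp_all add: S_closed linear_closed linear_add linear_smult)

lemma linear_into_sS: "\<lbrakk>f \<in> linear_maps K V H; \<And>x. x \<in> carrier V \<Longrightarrow> f x \<in> S\<rbrakk> \<Longrightarrow> f \<in> linear_maps K V sS"
  by (rule linear_mapsI) (simp_all add: linear_add linear_smult)

lemma dd_sS: "i < n \<Longrightarrow> dd i \<in> linear_maps K sS sS"
  by (rule linear_into_sS[OF linear_sS[OF dd_linear]]) (simp_all add: dd_S)

lemma mult_sS: "bilinear sS sS sS (mult H)"
  by (rule bilinearI') (simp_all add: S_closed S_mult bilinear_add[OF mult_bilinear])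

abbreviation T where "T \<equiv> tensor K A sS"
abbreviation t where "t \<equiv> pure_tensor K A sS"
abbreviation C where "C \<equiv> smash K A act sS"

lemma C_simps [simp]:
  "carrier C = carrier T" "add C = add T" "zero C = zero T" "smult C = smult T"
  by (simp_all add: smash_def Let_def)

lemma linear_C: "linear_maps K C M = linear_maps K T M" "linear_maps K M C = linear_maps K M T"
  by (simp_all add: linear_maps_def)

lemma finsum_C: "finsum C f I' = finsum T f I'"
  by (simp add: finsum_def finprod_def)

lemma T_vs: "Module.module K T"
  by (rule tensor_vs[OF A_vs sS_vs])

lemma C_vs: "Module.module K C"
  by (rule module_cong[OF T_vs]) simp_all

lemma t_closed [simp, intro]: "\<lbrakk>a \<in> carrier A; s \<in> S\<rbrakk> \<Longrightarrow> t a s \<in> carrier T"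
  using pure_closed[OF A_vs sS_vs, of a s] by simp

lemmas t_bilinear = pure_bilinear[OF A_vs sS_vs]
lemmas t_add = bilinear_add[OF t_bilinear, simplified]

definition mterm where "mterm a h b' g = (\<Oplus>\<^bsub>T\<^esub>i\<in>{..<n}. t (a \<otimes>\<^bsub>A\<^esub> act (e i) b') (dd i h \<otimes>\<^bsub>H\<^esub> g))"

lemma lift_comult_sS:
  assumes M: "Module.module K M" and f: "bilinear sS sS M f" and s: "s \<in> S"
  shows "tensor_lift K M f (comult sS s) = (\<Oplus>\<^bsub>M\<^esub>i\<in>{..<n}. f (e i) (dd i s))"
proof -
  interpret M: Module.module K M by fact
  have "tensor_lift K M f (comult sS s) = (\<Oplus>\<^bsub>M\<^esub>i\<in>{..<n}. tensor_lift K M f (pure_tensor K sS sS (e i) (dd i s)))"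
    unfolding comult_sS[OF s] using s
    by (intro linear_finsum[OF tensor_vs[OF sS_vs sS_vs] M tensor_lift_linear[OF sS_vs sS_vs M f]] pure_closed sS_vs)
      (auto simp: e_S dd_S)
  also have "\<dots> = (\<Oplus>\<^bsub>M\<^esub>i\<in>{..<n}. f (e i) (dd i s))"
    using s by (intro M.M.finsum_cong')
      (auto simp: tensor_lift_pure[OF sS_vs sS_vs M f] e_S dd_S intro!: bilinear_closed[OF f])
  finally show ?thesis .
qed

lemma act_closed: "\<lbrakk>s \<in> S; a \<in> carrier A\<rbrakk> \<Longrightarrow> act s a \<in> carrier A"
  by (rule A_act(1)[OF S_closed])

lemma smash_integrand:
  assumes a: "a \<in> carrier A" "b' \<in> carrier A" and s: "h \<in> S" "g \<in> S"
  shows "tensor_lift K T (\<lambda>h\<^sub>1 h\<^sub>2. t (a \<otimes>\<^bsub>A\<^esub> act h\<^sub>1 b') (h\<^sub>2 \<otimes>\<^bsub>H\<^esub> g)) (comult sS h) = mterm a h b' g"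
  unfolding mterm_def
proof (rule lift_comult_sS[OF T_vs _ s(1)])
  show "bilinear sS sS T (\<lambda>h\<^sub>1 h\<^sub>2. t (a \<otimes>\<^bsub>A\<^esub> act h\<^sub>1 b') (h\<^sub>2 \<otimes>\<^bsub>H\<^esub> g))"
    by (rule bilinear_comp2[OF t_bilinear linear_comp[OF linear_sS[OF bilinear_left[OF A_act_bilinear a(2)]]
          bilinear_right[OF A_mult_bilinear a(1)]] bilinear_left[OF mult_sS]]) (simp add: s)
qed

lemma mterm_bilinear_left:
  "\<lbrakk>a \<in> carrier A; g \<in> S\<rbrakk> \<Longrightarrow> bilinear A sS T (\<lambda>x h. mterm x h a g)"
  unfolding mterm_def
  by (intro bilinear_sum T_vs bilinear_comp2[OF t_bilinear] bilinear_left[OF A_mult_bilinear]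
      linear_comp[OF dd_sS bilinear_left[OF mult_sS]]) (simp_all add: e_S act_closed)

lemma mterm_bilinear_right:
  "\<lbrakk>a \<in> carrier A; h \<in> S\<rbrakk> \<Longrightarrow> bilinear A sS T (mterm a h)"
  unfolding mterm_def
  by (intro bilinear_sum T_vs bilinear_comp2[OF t_bilinear]
      linear_comp[OF bilinear_right[OF A_act_bilinear] bilinear_right[OF A_mult_bilinear]]
      bilinear_right[OF mult_sS]) (simp_all add: e_S dd_S S_closed)

text \<open>The integrand contains a lift over the comultiplication; its bilinearity in either pair
  of arguments is inherited from the explicit sum \<open>mterm\<close> to which it
  evaluates.\<close>

lemma C_mult: "bilinear C C C (mult C)"
  and C_mult_pure: "\<lbrakk>a \<in> carrier A; h \<in> S; b' \<in> carrier A; g \<in> S\<rbrakk> \<Longrightarrow> t a h \<otimes>\<^bsub>C\<^esub> t b' g = mterm a h b' g"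
proof -
  let ?F = "\<lambda>a h b' g. tensor_lift K T (\<lambda>h\<^sub>1 h\<^sub>2. t (a \<otimes>\<^bsub>A\<^esub> act h\<^sub>1 b') (h\<^sub>2 \<otimes>\<^bsub>H\<^esub> g)) (comult sS h)"
  have F: "bilinear A sS T (?F a h)" if "a \<in> carrier A" "h \<in> carrier sS" for a h
    using that by (intro bilinear_cong[OF mterm_bilinear_right _ _ smash_integrand] A_vs sS_vs) simp_all
  have F': "bilinear A sS T (\<lambda>a h. ?F a h b' g)" if "b' \<in> carrier A" "g \<in> carrier sS" for b' g
    using that by (intro bilinear_cong[OF mterm_bilinear_left _ _ smash_integrand] A_vs sS_vs) simp_all
  note L = lift_lift_bilinear[where F="?F", OF A_vs sS_vs A_vs sS_vs T_vs F F']
  have m: "mult C = (\<lambda>P P'. tensor_lift K T (\<lambda>a h. tensor_lift K T (?F a h) P') P)"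
    by (simp add: smash_def Let_def)
  show "bilinear C C C (mult C)"
    unfolding m using L(1) by (simp add: bilinear_def linear_C)
  show "\<lbrakk>a \<in> carrier A; h \<in> S; b' \<in> carrier A; g \<in> S\<rbrakk> \<Longrightarrow> t a h \<otimes>\<^bsub>C\<^esub> t b' g = mterm a h b' g"
    unfolding m using L(2) by (simp add: smash_integrand)
qed

text \<open>The first leg acts on the unit of the dual by the counit, h_(1).1 = eps(h_(1)) 1, so the
  sum collapses to \<open>h\<close>.\<close>

lemma C_mult_one_right:
  assumes a: "a \<in> carrier A" and h: "h \<in> S" and g: "g \<in> S"
  shows "t a h \<otimes>\<^bsub>C\<^esub> t \<one>\<^bsub>A\<^esub> g = t a (h \<otimes>\<^bsub>H\<^esub> g)"
proof -
  interpret TM: Module.module K T by (rule T_vs)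
  note tl = linear_comp[OF bilinear_left[OF mult_sS] bilinear_right[OF t_bilinear a], of g]
  have c: "eps (e i) \<odot>\<^bsub>H\<^esub> dd i h \<in> S" if "i < n" for i
    using that h by (simp add: S_subE(4) dd_S e_S S_closed)
  have "mterm a h \<one>\<^bsub>A\<^esub> g = (\<Oplus>\<^bsub>T\<^esub>i\<in>{..<n}. t a ((eps (e i) \<odot>\<^bsub>H\<^esub> dd i h) \<otimes>\<^bsub>H\<^esub> g))"
    unfolding mterm_def using a h g
    by (intro TM.M.finsum_cong')
      (auto simp: A_act_one A_one A_one_right bilinear_add[OF A_mult_bilinear] t_add e_S dd_S S_closed S_mult c
        H.smult_mult_left)
  also have "\<dots> = t a ((\<Oplus>\<^bsub>sS\<^esub>i\<in>{..<n}. eps (e i) \<odot>\<^bsub>H\<^esub> dd i h) \<otimes>\<^bsub>H\<^esub> g)"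
    using g c by (intro linear_finsum[OF sS_vs T_vs tl, symmetric]) auto
  also have "(\<Oplus>\<^bsub>sS\<^esub>i\<in>{..<n}. eps (e i) \<odot>\<^bsub>H\<^esub> dd i h) = (\<Oplus>\<^bsub>H\<^esub>i\<in>{..<n}. eps (e i) \<odot>\<^bsub>H\<^esub> dd i h)"
    using c by (intro linear_finsum[OF sS_vs H_vs linear_sS[OF linear_id]]) auto
  also have "\<dots> = h"
    using sweedler_S[OF H_vs eps_smult_bilinear h] sweedler_counit_left[OF S_closed[OF h]] by simp
  finally show ?thesis using a h g by (simp add: C_mult_pure A_one)
qed

abbreviation j where "j \<equiv> t \<one>\<^bsub>A\<^esub>"

definition \<zeta> where "\<zeta> i = tensor_lift K H (\<lambda>a s. a (cls (q i)) \<odot>\<^bsub>H\<^esub> s)"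

lemma \<zeta>_bilinear: "x \<in> carrier H \<Longrightarrow> bilinear A sS H (\<lambda>a s. a (cls x) \<odot>\<^bsub>H\<^esub> s)"
  by (intro bilinearI')
    (auto simp: S_closed H.smult_l_distr H.smult_r_distr H.smult_assoc1[symmetric] m_comm)

lemma \<zeta>_linear: "i < r \<Longrightarrow> \<zeta> i \<in> linear_maps K T H"
  unfolding \<zeta>_def by (intro tensor_lift_linear A_vs sS_vs H_vs \<zeta>_bilinear) simp

lemma \<zeta>_pure: "\<lbrakk>i < r; a \<in> carrier A; s \<in> S\<rbrakk> \<Longrightarrow> \<zeta> i (t a s) = a (cls (q i)) \<odot>\<^bsub>H\<^esub> s"
  unfolding \<zeta>_def by (intro tensor_lift_pure[OF A_vs sS_vs H_vs \<zeta>_bilinear]) simp_all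

lemma \<zeta>_S: "\<lbrakk>i < r; x \<in> carrier T\<rbrakk> \<Longrightarrow> \<zeta> i x \<in> S"
  by (rule tensor_linear_range[OF A_vs sS_vs H_vs \<zeta>_linear S_submodule]) (simp_all add: \<zeta>_pure S_subE(4))

lemma \<zeta>_into: "i < r \<Longrightarrow> \<zeta> i \<in> linear_maps K T sS"
  by (rule linear_into_sS[OF \<zeta>_linear]) (simp_all add: \<zeta>_S)

lemma CT_mult: "bilinear T T T (mult C)"
  using C_mult by (simp add: bilinear_def linear_C)

lemma \<zeta>_right:
  assumes i: "i < r" and x: "x \<in> carrier T" and s: "s \<in> S"
  shows "\<zeta> i (x \<otimes>\<^bsub>C\<^esub> j s) = \<zeta> i x \<otimes>\<^bsub>H\<^esub> s"
proof (rule tensor_linear_eq[OF A_vs sS_vs H_vs linear_comp[OF bilinear_left[OF CT_mult] \<zeta>_linear[OF i]]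
      linear_comp[OF \<zeta>_linear[OF i] bilinear_left[OF mult_bilinear]] _ x])
  show "j s \<in> carrier T" "s \<in> carrier H" using s by (simp_all add: A_one S_closed)
  fix a h assume "a \<in> carrier A" "h \<in> carrier sS"
  then show "\<zeta> i (t a h \<otimes>\<^bsub>C\<^esub> j s) = \<zeta> i (t a h) \<otimes>\<^bsub>H\<^esub> s"
    using i s by (simp add: C_mult_one_right \<zeta>_pure S_mult H.smult_mult_left S_closed)
qed

text \<open>Evaluating s_(1).a # s_(2) g at \<open>q i\<close> gives a([q_i s_(1)]) s_(2) g. After
  the first legs have been turned from \<open>e k\<close> into \<open>b k\<close>, expanding the
  class of q_i s_(1) in the basis of Q produces the coefficients p_(il)(s_(1)).\<close>

lemma \<zeta>_left:
  assumes i: "i < r" and x: "x \<in> carrier T" and s: "s \<in> S"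
  shows "\<zeta> i (j s \<otimes>\<^bsub>C\<^esub> x) = (\<Oplus>\<^bsub>H\<^esub>k\<in>{..<n}. \<Oplus>\<^bsub>H\<^esub>l\<in>{..<r}. pq i l (b k) \<odot>\<^bsub>H\<^esub> (dd k s \<otimes>\<^bsub>H\<^esub> \<zeta> l x))"
proof (rule tensor_linear_eq[OF A_vs sS_vs H_vs linear_comp[OF bilinear_right[OF CT_mult] \<zeta>_linear[OF i]] _ _ x])
  have sc: "s \<in> carrier H" by (rule S_closed[OF s])
  show "j s \<in> carrier T" using s by (simp add: A_one)
  show "(\<lambda>x. \<Oplus>\<^bsub>H\<^esub>k\<in>{..<n}. \<Oplus>\<^bsub>H\<^esub>l\<in>{..<r}. pq i l (b k) \<odot>\<^bsub>H\<^esub> (dd k s \<otimes>\<^bsub>H\<^esub> \<zeta> l x)) \<in> linear_maps K T H"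
    using i sc by (intro linear_sum H_vs linear_scale linear_comp[OF \<zeta>_linear bilinear_right[OF mult_bilinear]]) auto
  fix a g assume a: "a \<in> carrier A" and "g \<in> carrier sS"
  then have g: "g \<in> S" "g \<in> carrier H" by (simp_all add: S_closed)
  have bil: "bilinear H H H (\<lambda>x y. a (cls (q i \<otimes>\<^bsub>H\<^esub> x)) \<odot>\<^bsub>H\<^esub> (y \<otimes>\<^bsub>H\<^esub> g))"
    using a i g
    by (intro bilinearI')
      (auto simp: H.r_distr H.l_distr H.smult_mult_left H.smult_mult_right form_add[OF A_form[OF a]] form_smult[OF A_form[OF a]]
        H.smult_l_distr H.smult_r_distr H.smult_assoc1[symmetric] m_comm)
  have c: "act (e k) a \<in> carrier A" "dd k s \<otimes>\<^bsub>H\<^esub> g \<in> S" if "k < n" for k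
    using that a g s by (simp_all add: act_closed e_S S_mult dd_S)
  have "\<zeta> i (j s \<otimes>\<^bsub>C\<^esub> t a g) = (\<Oplus>\<^bsub>H\<^esub>k\<in>{..<n}. \<zeta> i (t (\<one>\<^bsub>A\<^esub> \<otimes>\<^bsub>A\<^esub> act (e k) a) (dd k s \<otimes>\<^bsub>H\<^esub> g)))"
    unfolding C_mult_pure[OF A_one(1) s a g(1)] mterm_def
    by (rule linear_finsum[OF T_vs H_vs \<zeta>_linear[OF i]]) (simp add: c A_one_left)
  also have "\<dots> = (\<Oplus>\<^bsub>H\<^esub>k\<in>{..<n}. a (cls (q i \<otimes>\<^bsub>H\<^esub> e k)) \<odot>\<^bsub>H\<^esub> (dd k s \<otimes>\<^bsub>H\<^esub> g))"
    using i a sc g by (intro H.M.finsum_cong') (auto simp: c A_one_left \<zeta>_pure A_act e_S S_closed)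
  also have "\<dots> = (\<Oplus>\<^bsub>H\<^esub>k\<in>{..<n}. a (cls (q i \<otimes>\<^bsub>H\<^esub> b k)) \<odot>\<^bsub>H\<^esub> (dd k s \<otimes>\<^bsub>H\<^esub> g))"
    by (rule sweedler_S[OF H_vs bil s])
  also have "\<dots> = (\<Oplus>\<^bsub>H\<^esub>k\<in>{..<n}. \<Oplus>\<^bsub>H\<^esub>l\<in>{..<r}. pq i l (b k) \<odot>\<^bsub>H\<^esub> (dd k s \<otimes>\<^bsub>H\<^esub> \<zeta> l (t a g)))"
  proof (intro H.M.finsum_cong' refl funcsetI H.M.finsum_closed)
    fix k assume "k \<in> {..<n}"
    then have k: "k < n" by simp
    have sm: "(\<lambda>c. c \<odot>\<^bsub>H\<^esub> (dd k s \<otimes>\<^bsub>H\<^esub> g)) \<in> linear_maps K (regular_module K) H"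
      using k sc g by (intro linear_mapsI) (auto simp: H.smult_l_distr H.smult_assoc1)
    have "a (cls (q i \<otimes>\<^bsub>H\<^esub> b k)) \<odot>\<^bsub>H\<^esub> (dd k s \<otimes>\<^bsub>H\<^esub> g) =
      (\<Oplus>l\<in>{..<r}. pq i l (b k) \<otimes> a (cls (q l))) \<odot>\<^bsub>H\<^esub> (dd k s \<otimes>\<^bsub>H\<^esub> g)"
      using i k a by (subst A_q_expand) (simp_all add: pq_def)
    also have "\<dots> = (\<Oplus>\<^bsub>H\<^esub>l\<in>{..<r}. (pq i l (b k) \<otimes> a (cls (q l))) \<odot>\<^bsub>H\<^esub> (dd k s \<otimes>\<^bsub>H\<^esub> g))"
      using linear_finsum[OF regular_vs H_vs sm, of "{..<r}" "\<lambda>l. pq i l (b k) \<otimes> a (cls (q l))"] i k a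
      by (simp add: finsum_regular)
    also have "\<dots> = (\<Oplus>\<^bsub>H\<^esub>l\<in>{..<r}. pq i l (b k) \<odot>\<^bsub>H\<^esub> (dd k s \<otimes>\<^bsub>H\<^esub> \<zeta> l (t a g)))"
      using i k a sc g by (intro H.M.finsum_cong') (auto simp: \<zeta>_pure H.smult_assoc1 H.smult_mult_right)
    finally show "a (cls (q i \<otimes>\<^bsub>H\<^esub> b k)) \<odot>\<^bsub>H\<^esub> (dd k s \<otimes>\<^bsub>H\<^esub> g) =
      (\<Oplus>\<^bsub>H\<^esub>l\<in>{..<r}. pq i l (b k) \<odot>\<^bsub>H\<^esub> (dd k s \<otimes>\<^bsub>H\<^esub> \<zeta> l (t a g)))" .
  qed (use i a sc g in \<open>auto simp: \<zeta>_pure\<close>)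
  finally show "\<zeta> i (j s \<otimes>\<^bsub>C\<^esub> t a g) =
    (\<Oplus>\<^bsub>H\<^esub>k\<in>{..<n}. \<Oplus>\<^bsub>H\<^esub>l\<in>{..<r}. pq i l (b k) \<odot>\<^bsub>H\<^esub> (dd k s \<otimes>\<^bsub>H\<^esub> \<zeta> l (t a g)))" .
qed

lemma \<zeta>_expand:
  assumes x: "x \<in> carrier T"
  shows "x = (\<Oplus>\<^bsub>T\<^esub>i\<in>{..<r}. t (\<delta> i) \<one>\<^bsub>H\<^esub> \<otimes>\<^bsub>C\<^esub> j (\<zeta> i x))"
proof (rule tensor_linear_eq[OF A_vs sS_vs T_vs linear_id _ _ x])
  interpret TM: Module.module K T by (rule T_vs)
  show "(\<lambda>x. \<Oplus>\<^bsub>T\<^esub>i\<in>{..<r}. t (\<delta> i) \<one>\<^bsub>H\<^esub> \<otimes>\<^bsub>C\<^esub> j (\<zeta> i x)) \<in> linear_maps K T T"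
    by (intro linear_sum T_vs linear_comp[OF linear_comp[OF \<zeta>_into bilinear_right[OF t_bilinear A_one(1)]]
        bilinear_right[OF CT_mult]]) (auto simp: \<delta>_closed S_one)
  fix a s assume a: "a \<in> carrier A" and "s \<in> carrier sS"
  then have s: "s \<in> S" by simp
  have ds: "a (cls (q i)) \<odot>\<^bsub>A\<^esub> \<delta> i \<in> carrier A" if "i < r" for i
    using that a by (simp add: A_smult_closed \<delta>_closed)
  have "t a s = t (\<Oplus>\<^bsub>A\<^esub>i\<in>{..<r}. a (cls (q i)) \<odot>\<^bsub>A\<^esub> \<delta> i) s"
    using A_expand[OF a] by simp
  also have "\<dots> = (\<Oplus>\<^bsub>T\<^esub>i\<in>{..<r}. t (a (cls (q i)) \<odot>\<^bsub>A\<^esub> \<delta> i) s)"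
    using s ds by (intro bilinear_finsum_left[OF A_vs T_vs t_bilinear]) auto
  also have "\<dots> = (\<Oplus>\<^bsub>T\<^esub>i\<in>{..<r}. t (\<delta> i) \<one>\<^bsub>H\<^esub> \<otimes>\<^bsub>C\<^esub> j (\<zeta> i (t a s)))"
    using a s by (intro TM.M.finsum_cong')
      (auto simp: \<zeta>_pure C_mult_one_right \<delta>_closed S_one S_subE(4) S_closed t_add)
  finally show "t a s = (\<Oplus>\<^bsub>T\<^esub>i\<in>{..<r}. t (\<delta> i) \<one>\<^bsub>H\<^esub> \<otimes>\<^bsub>C\<^esub> j (\<zeta> i (t a s)))" .
qed

text \<open>A left inverse is a # s -> a([1]) s: the unit of the dual is the counit, whose value at
  1 is 1.\<close>

lemma j_inj:
  assumes s: "s \<in> S" "s' \<in> S" and eq: "j s = j s'"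
  shows "s = s'"
proof -
  have "tensor_lift K H (\<lambda>a s. a (cls \<one>\<^bsub>H\<^esub>) \<odot>\<^bsub>H\<^esub> s) (j u) = u" if u: "u \<in> S" for u
    using tensor_lift_pure[OF A_vs sS_vs H_vs \<zeta>_bilinear[OF H.one_closed] A_one(1), of u] u
    by (simp add: A_one S_closed)
  then show ?thesis using s eq by metis
qed

lemma smash_free: "free_smash K H n b \<phi> R r q \<psi> S e C j (\<lambda>i. t (\<delta> i) \<one>\<^bsub>H\<^esub>) \<zeta>"
proof (intro free_smash.intro free_smash_axioms.intro hopf_part_axioms C_vs C_mult)
  fix s s' assume s: "s \<in> S" "s' \<in> S"
  show "j (s \<otimes>\<^bsub>H\<^esub> s') = j s \<otimes>\<^bsub>C\<^esub> j s'" using s by (simp add: C_mult_one_right A_one)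
  show "j (s \<oplus>\<^bsub>H\<^esub> s') = j s \<oplus>\<^bsub>C\<^esub> j s'" using s by (simp add: t_add A_one)
next
  fix x assume "x \<in> carrier C"
  then show "x = (\<Oplus>\<^bsub>C\<^esub>i\<in>{..<r}. t (\<delta> i) \<one>\<^bsub>H\<^esub> \<otimes>\<^bsub>C\<^esub> j (\<zeta> i x))" using \<zeta>_expand by (simp add: finsum_C)
next
  fix i l assume i: "i < r" "l < r"
  show "\<zeta> i (t (\<delta> l) \<one>\<^bsub>H\<^esub>) = (if i = l then \<one>\<^bsub>H\<^esub> else \<zero>\<^bsub>H\<^esub>)"
    using i by (auto simp: \<zeta>_pure \<delta>_closed S_one \<delta>_cls \<psi>_q)
qed (auto simp: linear_C \<zeta>_linear \<zeta>_S \<zeta>_right \<zeta>_left A_one \<delta>_closed S_one t_add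
    dest: j_inj)

lemma smash_base_eq: "smash_base K A sS = j ` S"
  by (simp add: smash_base_def)

end

section \<open>Comparison of the depths\<close>

lemma direct_summand_mono:
  assumes "direct_summand L R M N" "L' \<subseteq> L" "R' \<subseteq> R"
  shows "direct_summand L' R' M N"
proof -
  have i: "bimodule_iso L R M (N\<lparr>carrier := S\<rparr>) \<Longrightarrow> bimodule_iso L' R' M (N\<lparr>carrier := S\<rparr>)" for S
    using assms(2,3) unfolding bimodule_iso_def by (blast dest: subsetD)
  have "sub_bimodule L R S N \<Longrightarrow> sub_bimodule L' R' S N" for S
    using assms(2,3) unfolding sub_bimodule_def by blast
  with i show ?thesis using assms(1) unfolding direct_summand_def by (elim exE conjE) (intro exI conjI; blast)
qed

lemma similar_mono:
  assumes "similar L R M N" "L' \<subseteq> L" "R' \<subseteq> R"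
  shows "similar L' R' M N"
  using assms(1) unfolding similar_def
  by (elim conjE exE) (intro conjI exI; rule direct_summand_mono[OF _ assms(2,3)]; assumption)

lemma Inf_enat_eq:
  assumes "P d" "\<And>m. P m \<Longrightarrow> d \<le> m"
  shows "Inf {enat m |m. P m} = enat d"
  using assms by (intro Inf_eqI) auto

text \<open>The right-hand side rounds the least value with \<open>Q\<close> up to an odd number. If
  that value is an even 2k, then 2k+1 also has \<open>Q\<close>, and no smaller odd number does; if
  there is no such value, both sides are infinite.\<close>

lemma min_odd_eq:
  assumes PQ: "\<And>m. odd m \<Longrightarrow> P m \<longleftrightarrow> Q m" and Q: "\<And>k. \<lbrakk>1 \<le> k; Q (2 * k)\<rbrakk> \<Longrightarrow> Q (2 * k + 1)"
  shows "Inf {enat m |m. odd m \<and> P m} =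
    (case Inf {enat m |m. m \<ge> 1 \<and> Q m} of enat d \<Rightarrow> enat (2 * nat \<lceil>(real d - 1) / 2\<rceil> + 1) | \<infinity> \<Rightarrow> \<infinity>)"
proof (cases "\<exists>m\<ge>1. Q m")
  case False
  then have "{enat m |m. m \<ge> 1 \<and> Q m} = {}" by blast
  moreover have "{enat m |m. odd m \<and> P m} = {}" using False PQ by (auto elim!: oddE)
  ultimately show ?thesis unfolding Inf_enat_def by simp
next
  case True
  define d where "d = (LEAST m. m \<ge> 1 \<and> Q m)"
  have d: "d \<ge> 1" "Q d" unfolding d_def using LeastI_ex[of "\<lambda>m. m \<ge> 1 \<and> Q m"] True by auto
  have le: "d \<le> m" if "m \<ge> 1" "Q m" for m unfolding d_def using that by (intro Least_le) simp
  have D: "Inf {enat m |m. m \<ge> 1 \<and> Q m} = enat d" using d le by (intro Inf_enat_eq) auto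
  have odd1: "m \<ge> 1" if "odd m" for m :: nat using that by (auto elim: oddE)
  show ?thesis
  proof (cases "odd d")
    case True
    then obtain k where k: "d = 2 * k + 1" by (elim oddE)
    have "Inf {enat m |m. odd m \<and> P m} = enat d"
      using d le True PQ odd1 by (intro Inf_enat_eq) auto
    then show ?thesis unfolding D by (simp add: k)
  next
    case False
    then obtain k where k: "d = 2 * k" by (auto elim: evenE)
    have k1: "1 \<le> k" using d k by simp
    have "Inf {enat m |m. odd m \<and> P m} = enat (2 * k + 1)"
    proof (rule Inf_enat_eq)
      show "odd (2 * k + 1) \<and> P (2 * k + 1)" using PQ[of "2 * k + 1"] Q[OF k1] d k by simp
      fix m assume m: "odd m \<and> P m"
      then have "2 * k \<le> m" using le[of m] PQ[of m] odd1[of m] k by simp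
      moreover have "m \<noteq> 2 * k" using m by auto
      ultimately show "2 * k + 1 \<le> m" by simp
    qed
    \<comment> \<open>The number (2k - 1)/2 is half an integer, so rounding up gives k and the
      formula returns 2k+1.\<close>
    moreover have "\<lceil>(real (2 * k) - 1) / 2\<rceil> = int k"
      by (rule ceiling_unique) (simp_all add: field_simps)
    ultimately show ?thesis unfolding D by (simp add: k)
  qed
qed

text \<open>A nonempty infimum is attained, so it suffices to move its least element; the empty case
  makes the right-hand side infinite.\<close>

lemma Inf_enat_le_add:
  assumes "\<And>m. Q m \<Longrightarrow> \<exists>m'. P m' \<and> m' \<le> m + c"
  shows "Inf {enat m |m. P m} \<le> Inf {enat m |m. Q m} + enat c"
proof (cases "\<exists>m. Q m")
  case False
  then have "{enat m |m. Q m} = {}" by blast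
  then show ?thesis unfolding Inf_enat_def[of "{enat m |m. Q m}"] by simp
next
  case True
  then have "Q (LEAST m. Q m)" by (auto intro: LeastI_ex)
  then obtain m' where m': "P m'" "m' \<le> (LEAST m. Q m) + c" using assms by blast
  have "Inf {enat m |m. P m} \<le> enat m'" using m' by (intro Inf_lower) auto
  also have "\<dots> \<le> enat (LEAST m. Q m) + enat c" using m' by simp
  also have "enat (LEAST m. Q m) = Inf {enat m |m. Q m}"
    using True by (intro Inf_enat_eq[symmetric]) (auto intro: LeastI_ex Least_le)
  finally show ?thesis .
qed

context hopf_quot
begin

text \<open>Similarity of the tensor powers \<open>Q\<^sup>\<otimes>\<^sup>(\<^sup>k\<^sup>+\<^sup>1\<^sup>)\<close> and \<open>Q\<^sup>\<otimes>\<^sup>k\<close> as right \<open>S\<close>-modules.\<close>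

definition Q_similar where "Q_similar S k \<longleftrightarrow>
  mat_retract K S (words (Suc k)) pw (words k) pw \<and> mat_retract K S (words k) pw (words (Suc k)) pw"

lemma power_similar_Q:
  assumes "S \<subseteq> carrier H" "\<And>i s. \<lbrakk>i < n; s \<in> S\<rbrakk> \<Longrightarrow> dd i s \<in> S"
  shows "similar (carrier H) S (TT (Suc k)) (TT k) \<longleftrightarrow> Q_similar S k"
proof -
  have ar: "acts_on S (\<lambda>c x. ract (TT m) x c) (TT m)" for m
    using HT.acts_ract[of m] assms(1) unfolding acts_on_def by blast
  show ?thesis
    by (simp add: similar_iff vs_abelian[OF HT.T_vs] HT.acts_lact ar power_retract_iff[OF assms] Q_similar_def)
qed

text \<open>h-depth 2k+1 compares k+2 with k+1 factors, that is \<open>TT (Suc k)\<close> with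
  \<open>TT k\<close>, whose index words have lengths k+1 and k.\<close>

lemma h_depth_iff: "has_h_depth K R H (2 * k + 1) \<longleftrightarrow> Q_similar (carrier H) k"
proof -
  have "has_h_depth K R H (2 * k + 1) \<longleftrightarrow> similar (carrier H) (carrier H) (TT (Suc k)) (TT k)"
  proof
    assume "has_h_depth K R H (2 * k + 1)"
    then obtain m where m: "m \<ge> 1" "2 * k + 1 = 2 * m - 1"
      "similar (carrier H) (carrier H) (HT.T (m + 1)) (HT.T m)" unfolding has_h_depth_def by blast
    then have "m = Suc k" by simp
    with m(3) show "similar (carrier H) (carrier H) (TT (Suc k)) (TT k)" by simp
  next
    assume "similar (carrier H) (carrier H) (TT (Suc k)) (TT k)"
    then show "has_h_depth K R H (2 * k + 1)" unfolding has_h_depth_def by (intro exI[of _ "Suc k"]) simp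
  qed
  then show ?thesis using power_similar_Q[OF order_refl] by simp
qed

text \<open>Over R the left coordinates are still taken in H, so the result is a similarity of
  H-R-bimodules with k+2 and k+1 factors, which is depth 2(k+1).\<close>

lemma depth_of_Q_similar:
  assumes "Q_similar R k"
  shows "has_depth K R H (2 * k + 2)"
proof -
  have "similar (carrier H) R (TT (Suc k)) (TT k)"
    using assms power_similar_Q[OF subsetI[OF R_closed] dd_R] by blast
  then show ?thesis unfolding has_depth_def by (intro disjI2 exI[of _ "Suc k"]) simp
qed

end

context free_smash
begin

lemma U_similar_Q: "similar (j ` S) (j ` S) (U (Suc k)) (U k) \<longleftrightarrow> Q_similar S (Suc k)"
  by (simp add: power_similar_iff Q_similar_def)

text \<open>With the unshifted index of the smash tower, depth 2k+1 compares words of lengths k+1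
  and k. For k = 0 the second object is the base algebra itself, matching the empty word.\<close>

lemma depth_iff: "has_depth K (j ` S) C (2 * k + 1) \<longleftrightarrow> Q_similar S k"
proof (cases k)
  case 0
  have "has_depth K (j ` S) C 1 \<longleftrightarrow> similar (j ` S) (j ` S) (U 0) (base_bimodule (j ` S) C)"
    unfolding has_depth_def by auto
  then show ?thesis using 0 by (simp add: base_similar_iff Q_similar_def)
next
  case (Suc k')
  have "has_depth K (j ` S) C (2 * Suc k' + 1) \<longleftrightarrow> similar (j ` S) (j ` S) (U (Suc k')) (U k')"
  proof
    assume "has_depth K (j ` S) C (2 * Suc k' + 1)"
    moreover have "2 * Suc k' + 1 \<noteq> 2 * m" for m by presburger
    ultimately obtain m where m: "2 * Suc k' + 1 = 2 * m + 1" "similar (j ` S) (j ` S) (CT.T (m + 1)) (CT.T m)"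
      unfolding has_depth_def by auto
    from m(1) have "m = Suc k'" by simp
    with m(2) show "similar (j ` S) (j ` S) (U (Suc k')) (U k')" by simp
  next
    assume "similar (j ` S) (j ` S) (U (Suc k')) (U k')"
    then show "has_depth K (j ` S) C (2 * Suc k' + 1)"
      unfolding has_depth_def by (intro disjI2 disjI1 exI[of _ "Suc k'"]) simp
  qed
  then show ?thesis using Suc U_similar_Q by simp
qed

text \<open>Restricting the larger of the two acting algebras to the base turns either one-sided
  version of depth 2k into depth 2k+1.\<close>

lemma even_depth:
  assumes "1 \<le> k" "has_depth K (j ` S) C (2 * k)"
  shows "Q_similar S k"
proof -
  obtain k' where k': "k = Suc k'" using assms(1) by (cases k) auto
  have jC: "j ` S \<subseteq> carrier C" using j_closed by blast
  have "2 * k \<noteq> 1" "2 * k \<noteq> 2 * m + 1" for m by presburger+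
  then obtain m where m: "2 * k = 2 * m" "similar (j ` S) (carrier C) (CT.T (m + 1)) (CT.T m) \<or>
      similar (carrier C) (j ` S) (CT.T (m + 1)) (CT.T m)"
    using assms(2) unfolding has_depth_def by auto
  from m(1) k' have "m = Suc k'" by simp
  then have "similar (j ` S) (j ` S) (U (Suc k')) (U k')"
    using m(2) similar_mono[OF _ order_refl jC] similar_mono[OF _ jC order_refl] by auto
  then show ?thesis using U_similar_Q k' by simp
qed

end

context smash_data
begin

lemma smash_depth_iff: "has_depth K (smash_base K A sS) C (2 * k + 1) \<longleftrightarrow> Q_similar S k"
  unfolding smash_base_eq by (rule free_smash.depth_iff[OF smash_free])

lemma smash_even_depth: "\<lbrakk>1 \<le> k; has_depth K (smash_base K A sS) C (2 * k)\<rbrakk> \<Longrightarrow> Q_similar S k"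
  unfolding smash_base_eq by (rule free_smash.even_depth[OF smash_free])

end

context hopf_quot
begin

lemma smash_H: "smash_data K H n b \<phi> R r q \<psi> (carrier H) b H"
proof (intro smash_data.intro hopf_part.intro hopf_part_axioms.intro smash_data_axioms.intro hopf_quot_axioms)
  show "unital_subalgebra K (carrier H) H"
    using H.carrier_is_submodule by (simp add: unital_subalgebra_def)
qed (simp_all add: comult_expand[symmetric])

context
  fixes m :: nat and c :: "nat \<Rightarrow> 'h" and \<chi> :: "nat \<Rightarrow> 'h \<Rightarrow> 'k"
  assumes rb: "rel_basis H R m c \<chi>"
begin

text \<open>Subtracting the components along the \<open>c i\<close>, a basis of a complement of R,
  gives a linear projection of H onto R.\<close>

definition retr where "retr x = x \<ominus>\<^bsub>H\<^esub> (\<Oplus>\<^bsub>H\<^esub>i\<in>{..<m}. \<chi> i x \<odot>\<^bsub>H\<^esub> c i)"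

lemma retr_R: "x \<in> carrier H \<Longrightarrow> retr x \<in> R"
  and retr_id: "x \<in> R \<Longrightarrow> retr x = x"
  and retr_linear: "retr \<in> linear_maps K H H"
proof -
  have \<chi>: "i < m \<Longrightarrow> \<chi> i \<in> linear_maps K H (regular_module K)" "i < m \<Longrightarrow> c i \<in> carrier H" for i
    using rb by (auto simp: rel_basis_def)
  have l: "(\<lambda>x. \<Oplus>\<^bsub>H\<^esub>i\<in>{..<m}. \<chi> i x \<odot>\<^bsub>H\<^esub> c i) \<in> linear_maps K H H"
  proof (intro linear_sum H_vs)
    fix i assume "i \<in> {..<m}"
    then show "(\<lambda>x. \<chi> i x \<odot>\<^bsub>H\<^esub> c i) \<in> linear_maps K H H"
      using \<chi>[of i] form_closed[OF \<chi>(1)] form_add[OF \<chi>(1)] form_smult[OF \<chi>(1)]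
      by (intro linear_mapsI) (auto simp: H.smult_l_distr H.smult_assoc1)
  qed
  show "retr \<in> linear_maps K H H"
  proof (rule linear_mapsI)
    fix x y assume 1: "x \<in> carrier H" "y \<in> carrier H"
    then show "retr (x \<oplus>\<^bsub>H\<^esub> y) = retr x \<oplus>\<^bsub>H\<^esub> retr y"
      using linear_closed[OF l] by (simp add: retr_def linear_add[OF l] a_minus_def H.M.minus_add H.M.a_ac)
  next
    fix a x assume 1: "a \<in> carrier K" "x \<in> carrier H"
    then show "retr (a \<odot>\<^bsub>H\<^esub> x) = a \<odot>\<^bsub>H\<^esub> retr x"
      using linear_closed[OF l] by (simp add: retr_def linear_smult[OF l] a_minus_def H.smult_r_distr H.smult_r_minus)
  qed (use linear_closed[OF l] in \<open>simp add: retr_def\<close>)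
  show "x \<in> carrier H \<Longrightarrow> retr x \<in> R" using rb by (simp add: rel_basis_def retr_def)
  assume x: "x \<in> R"
  have "(\<Oplus>\<^bsub>H\<^esub>i\<in>{..<m}. \<chi> i x \<odot>\<^bsub>H\<^esub> c i) = (\<Oplus>\<^bsub>H\<^esub>i\<in>{..<m}. \<zero>\<^bsub>H\<^esub>)"
    using rb x \<chi> by (intro H.M.finsum_cong') (auto simp: rel_basis_def)
  then show "retr x = x"
    using R_closed[OF x] by (simp add: retr_def a_minus_def group_minus_zero[OF H.M.abelian_group_axioms])
qed

lemma retr_HR: "retr \<in> linear_maps K H HR"
  by (rule linear_mapsI) (simp_all add: retr_R linear_add[OF retr_linear] linear_smult[OF retr_linear])

text \<open>\<Delta>(x) comes from R \<otimes> R and is therefore fixed by the retraction applied to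
  its first leg.\<close>

lemma comult_retr:
  assumes x: "x \<in> R"
  shows "comult H x = (\<Oplus>\<^bsub>HH\<^esub>i\<in>{..<n}. pure_tensor K H H (retr (b i)) (dd i x))"
proof -
  note pb = bilinear_comp2[OF pure_bilinear[OF H_vs H_vs] retr_linear linear_id]
  obtain P where P: "P \<in> carrier (tensor K HR HR)" "comult H x = tensor_incl K H P"
    using R_comult[OF x] by blast
  have "tensor_lift K HH (\<lambda>x y. pure_tensor K H H (retr x) y) (tensor_incl K H P) = tensor_incl K H P"
    by (rule tensor_linear_eq[OF HR_vs HR_vs HH_vs linear_comp[OF incl_linear tensor_lift_linear[OF H_vs H_vs HH_vs pb]]
          incl_linear _ P(1)])
      (simp add: incl_pure tensor_lift_pure[OF H_vs H_vs HH_vs pb] R_closed retr_id)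
  then show ?thesis
    using sweedler[OF HH_vs pb R_closed[OF x]] P(2) by simp
qed

text \<open>The comultiplication of the Hopf subalgebra is a definite description of a preimage of
  \<Delta>(x). The sum is such a preimage by \<open>comult_retr\<close>, and it is the only one
  because R \<otimes> R -> H \<otimes> H has a left inverse.\<close>

lemma comult_sub_hopf:
  assumes x: "x \<in> R"
  shows "comult (sub_hopf K R H) x = (\<Oplus>\<^bsub>tensor K HR HR\<^esub>i\<in>{..<n}. pure_tensor K HR HR (retr (b i)) (dd i x))"
    (is "_ = ?P")
proof -
  note HHR_vs = tensor_vs[OF HR_vs HR_vs]
  interpret T: Module.module K "tensor K HR HR" by (rule HHR_vs)
  note pb = bilinear_comp2[OF pure_bilinear[OF HR_vs HR_vs] retr_HR retr_HR]
  have c: "pure_tensor K HR HR (retr (b i)) (dd i x) \<in> carrier (tensor K HR HR)" if "i < n" for i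
    using that x by (intro pure_closed HR_vs) (simp_all add: retr_R dd_R)
  have P: "?P \<in> carrier (tensor K HR HR)"
    using c by (intro T.M.finsum_closed) auto
  have "tensor_incl K H ?P = (\<Oplus>\<^bsub>HH\<^esub>i\<in>{..<n}. tensor_incl K H (pure_tensor K HR HR (retr (b i)) (dd i x)))"
    by (rule linear_finsum[OF HHR_vs HH_vs incl_linear]) (simp add: c)
  also have "\<dots> = (\<Oplus>\<^bsub>HH\<^esub>i\<in>{..<n}. pure_tensor K H H (retr (b i)) (dd i x))"
  proof -
    interpret HM: Module.module K HH by (rule HH_vs)
    show ?thesis using x R_closed
      by (intro HM.M.finsum_cong') (auto simp: incl_pure retr_R dd_R intro!: pure_closed H_vs)
  qed
  finally have i: "tensor_incl K H ?P = comult H x" using comult_retr[OF x] by simp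
  \<comment> \<open>The retraction applied to both legs is a left inverse of the inclusion.\<close>
  have inv: "tensor_lift K (tensor K HR HR) (\<lambda>x y. pure_tensor K HR HR (retr x) (retr y)) (tensor_incl K H P') = P'"
    if "P' \<in> carrier (tensor K HR HR)" for P'
    by (rule tensor_linear_eq[OF HR_vs HR_vs HHR_vs
          linear_comp[OF incl_linear tensor_lift_linear[OF H_vs H_vs HHR_vs pb]] linear_id _ that])
      (simp add: incl_pure tensor_lift_pure[OF H_vs H_vs HHR_vs pb] R_closed retr_id)
  have "(THE P. P \<in> carrier (tensor K HR HR) \<and> tensor_incl K H P = comult H x) = ?P"
  proof (rule the_equality)
    fix P' assume P': "P' \<in> carrier (tensor K HR HR) \<and> tensor_incl K H P' = comult H x"
    then show "P' = ?P" using inv[of P'] inv[OF P] i by simp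
  qed (use P i in simp)
  then show ?thesis by (simp add: sub_hopf_def)
qed

text \<open>The construction of the tensor product reads only the module operations, and the new
  comultiplication leaves these unchanged.\<close>

lemma tensor_sub_hopf:
  "tensor K (sub_hopf K R H) (sub_hopf K R H) = tensor K HR HR"
  "pure_tensor K (sub_hopf K R H) (sub_hopf K R H) = pure_tensor K HR HR"
  by (simp_all add: tensor_def tensor_rels_def sub_hopf_def pure_tensor_def fun_eq_iff)

lemma smash_R: "smash_data K H n b \<phi> R r q \<psi> R (\<lambda>i. retr (b i)) (sub_hopf K R H)"
proof (intro smash_data.intro hopf_part.intro hopf_part_axioms.intro smash_data_axioms.intro hopf_quot_axioms)
  show "unital_subalgebra K R H"
    using R_sub by (simp add: hopf_subalgebra_def)
  fix s assume s: "s \<in> R"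
  show "comult (sub_hopf K R H) s = (\<Oplus>\<^bsub>tensor K (sub_hopf K R H) (sub_hopf K R H)\<^esub>i\<in>{..<n}.
      pure_tensor K (sub_hopf K R H) (sub_hopf K R H) (retr (b i)) (dd i s))"
    by (simp only: tensor_sub_hopf comult_sub_hopf[OF s])
qed (simp_all add: retr_R dd_R comult_retr sub_hopf_def)

lemma min_depth_le:
  "min_depth K R H \<le> min_depth K (smash_base K A (sub_hopf K R H)) (smash K A act (sub_hopf K R H)) + 2"
proof -
  have "min_depth K R H \<le> min_depth K (smash_base K A (sub_hopf K R H)) (smash K A act (sub_hopf K R H)) + enat 2"
    unfolding min_depth_def
  proof (rule Inf_enat_le_add)
    fix l assume l: "1 \<le> l \<and> has_depth K (smash_base K A (sub_hopf K R H)) (smash K A act (sub_hopf K R H)) l"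
    \<comment> \<open>For even l = 2k the bound 1 \<le> l gives k \<ge> 1, as
      \<open>smash_even_depth\<close> requires; k = 0 occurs only for l = 1.\<close>
    obtain k where k: "l = 2 * k \<or> l = 2 * k + 1" by (metis oddE evenE)
    then have "Q_similar R k"
      using l smash_data.smash_even_depth[OF smash_R, of k] smash_data.smash_depth_iff[OF smash_R, of k] by auto
    then have "has_depth K R H (2 * k + 2)" by (rule depth_of_Q_similar)
    \<comment> \<open>The witness 2k+2 is l + 2 for even l and l + 1 for odd l, so the constant 2
      comes from the even case.\<close>
    then show "\<exists>l'. (1 \<le> l' \<and> has_depth K R H l') \<and> l' \<le> l + 2" using k by (intro exI[of _ "2 * k + 2"]) auto
  qed
  then show ?thesis by (simp add: numeral_eq_enat)
qed

end

lemma min_h_depth_eq: "min_h_depth K R H = min_odd_depth K (smash_base K A H) (smash K A act H)"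
  unfolding min_h_depth_def min_odd_depth_def min_depth_def
proof (rule min_odd_eq)
  fix l :: nat assume "odd l"
  then obtain k where "l = 2 * k + 1" by (elim oddE)
  then show "has_h_depth K R H l \<longleftrightarrow> has_depth K (smash_base K A H) (smash K A act H) l"
    by (simp only: h_depth_iff smash_data.smash_depth_iff[OF smash_H])
next
  fix k :: nat assume "1 \<le> k" "has_depth K (smash_base K A H) (smash K A act H) (2 * k)"
  then show "has_depth K (smash_base K A H) (smash K A act H) (2 * k + 1)"
    unfolding smash_data.smash_depth_iff[OF smash_H] by (rule smash_data.smash_even_depth[OF smash_H])
qed

end

theorem corollary6p3:
  fixes K :: "('k, 'm) ring_scheme" and H :: "('k, 'h) hopf" and R :: "'h set"
  assumes "field K"
    and "hopf_algebra K H"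
    and "finite_dimensional K H"
    and "hopf_subalgebra K R H"
  shows "min_depth K R H
      \<le> min_depth K
          (smash_base K (quot_dual K R H) (sub_hopf K R H))
          (smash K (quot_dual K R H) (quot_dual_lact K R H) (sub_hopf K R H)) + 2 \<and>
    min_h_depth K R H =
      min_odd_depth K
        (smash_base K (quot_dual K R H) H)
        (smash K (quot_dual K R H) (quot_dual_lact K R H) H)"
proof -
  have F: "base_field K" using assms(1) by (rule base_field.intro)
  have H: "algebra_over K H" using assms(2) by (rule hopf_algebra.axioms(2))
  then have M: "Module.module K H" by (rule algebra_over.axioms(1))
  have R: "submodule R K H" using assms(4) by (simp add: hopf_subalgebra_def unital_subalgebra_def)
  have "{x \<otimes>\<^bsub>H\<^esub> h |x h. x \<in> R \<and> counit H x = \<zero>\<^bsub>K\<^esub> \<and> h \<in> carrier H} \<subseteq> carrier H"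
    using module.submoduleE(1)[OF M R] monoid.m_closed[OF ring.is_monoid[OF algebra_over.axioms(2)[OF H]]] by blast
  then have I: "submodule (augmentation_right_ideal K R H) K H"
    unfolding augmentation_right_ideal_def by (rule base_field.span_submodule[OF F M])
  \<comment> \<open>Three relative bases are chosen: modulo zero for the Sweedler indices, modulo
    R^+ H for a basis of Q, and modulo R for the retraction onto the Hopf subalgebra.\<close>
  obtain n b \<phi> where b: "base_field.rel_basis K H {\<zero>\<^bsub>H\<^esub>} n b \<phi>"
    by (rule base_field.rel_basis_exists[OF F M assms(3) base_field.zero_submodule[OF F M]])
  from F assms(2) b have hb: "hopf_basis K H n b \<phi>"
    by (intro hopf_basis.intro hopf_basis_axioms.intro)
  obtain r q \<psi> where q: "base_field.rel_basis K H (augmentation_right_ideal K R H) r q \<psi>"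
    by (rule base_field.rel_basis_exists[OF F M assms(3) I])
  obtain m c \<chi> where c: "base_field.rel_basis K H R m c \<chi>"
    by (rule base_field.rel_basis_exists[OF F M assms(3) R])
  from hb assms(4) q have hq: "hopf_quot K H n b \<phi> R r q \<psi>"
    by (intro hopf_quot.intro hopf_quot_axioms.intro)
  show ?thesis
    using hopf_quot.min_depth_le[OF hq c] hopf_quot.min_h_depth_eq[OF hq] by (rule conjI)
qed

end
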